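(* Let $l\geq 3$ be an odd integer, let $q\in k$ be a primitive $l$-th root of unity, and let $\mathfrak{u}$ and $D_{\varphi}=D_{\varphi}(\mathfrak{u}^{\geq 0},\mathfrak{u}^{\leq 0})$ be the finite dimensional Hopf algebras defined in the context. Let $\zeta_l\subset k$ be the set of all $l$-th roots of unity. Then the category of left $D_{\varphi}$-modules is equivalent to the direct product of $|\zeta_l\times\zeta_l|$ copies of the category of left $\mathfrak{u}$-modules.
   Context: $k$ is an algebraically closed field of characteristic $0$. $(a_{ij})_{1\leq i,j\leq 2}$ is the Cartan matrix of type $A_2$: $a_{11}=a_{22}=2$, $a_{12}=a_{21}=-1$. The Hopf algebra $U$: the unital $k$-algebra generated by $E_i,F_i,K_i,K_i^{-1}$ ($i=1,2$) with relations (for $i,j\in\{1,2\}$): $K_iK_j=K_jK_i$; $K_iK_i^{-1}=K_i^{-1}K_i=1$; $K_iE_jK_i^{-1}=q^{a_{ji}}E_j$; $K_iF_jK_i^{-1}=q^{-a_{ji}}F_j$; $E_1F_1-F_1E_1=(K_1-K_1^{-1})/(q-q^{-1})$; $E_iF_j-F_jE_i=0$ for $(i,j)\neq(1,1)$ (in particular $E_2F_2=F_2E_2$); and for $i\neq j$, $E_i^2E_j-(q+q^{-1})E_iE_jE_i+E_jE_i^2=0$ and $F_i^2F_j-(q+q^{-1})F_iF_jF_i+F_jF_i^2=0$. The Hopf structure is $\Delta(E_i)=K_i\otimes E_i+E_i\otimes 1$, $\Delta(F_i)=1\otimes F_i+F_i\otimes K_i^{-1}$, $\Delta(K_i^{\pm1})=K_i^{\pm1}\otimes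 K_i^{\pm1}$, $S(E_i)=-K_i^{-1}E_i$, $S(F_i)=-F_iK_i$, $S(K_i)=K_i^{-1}$, $\varepsilon(E_i)=\varepsilon(F_i)=0$, $\varepsilon(K_i)=1$. Put $E_{1,2}=E_1E_2-q^{-1}E_2E_1$ and $F_{1,2}=F_2F_1-qF_1F_2$. Let $I$ be the (Hopf) ideal of $U$ generated by $E_1^l,E_{1,2}^l,E_2^l,F_1^l,F_{1,2}^l,F_2^l,K_1^l-1,K_2^l-1$, and $\mathfrak{u}=U/I$. Let $\mathfrak{u}^{\geq 0}$ (resp. $\mathfrak{u}^{\leq 0}$) be the Hopf subalgebra of $\mathfrak{u}$ generated by the $E_i,K_i$ (resp. the $F_i,K_i$), $i=1,2$. They are graded by $\mathbb{Z}\alpha_1\oplus\mathbb{Z}\alpha_2$ with $\deg E_i=\alpha_i$, $\deg K_i=0$ in $\mathfrak{u}^{\geq 0}$, and $\deg F_i=\alpha_i$, $\deg K_i=0$ in $\mathfrak{u}^{\leq 0}$. A skew pairing of Hopf algebras $A,H$ is a bilinear map $\varphi:A\otimes H\to k$ with $\varphi(ab,x)=\sum\varphi(a,x_{(1)})\varphi(b,x_{(2)})$, $\varphi(a,xy)=\sum\varphi(a_{(1)},y)\varphi(a_{(2)},x)$, $\varphi(a,1)=\varepsilon(a)$, $\varphi(1,x)=\varepsilon(x)$. It is convolution invertible with $\varphi^{-1}(a,x)=\varphi(S_A(a),x)$. Here $\varphi:\mathfrak{u}^{\geq 0}\otimes\mathfrak{u}^{\leq 0}\to k$ is the unique skew pairing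 with $\varphi(1,1)=\varphi(1,K_i)=\varphi(K_i,1)=1$; $\varphi(x,y)=0$ for monomials $x,y$ of different degrees; $\varphi(E_i,F_j)=\delta_{i,j}\delta_{i,1}\frac{1}{q^2-1}$; $\varphi(K_i,K_j)=q^{a_{ij}}$, $\varphi(K_i,K_j^{-1})=q^{-a_{ij}}$ ($1\leq i,j\leq 2$). $D_{\varphi}$ is the double crossproduct $\mathfrak{u}^{\geq 0}\bowtie_{\varphi}\mathfrak{u}^{\leq 0}$: the vector space $\mathfrak{u}^{\geq 0}\otimes\mathfrak{u}^{\leq 0}$ with the tensor product coalgebra structure, identity $1\otimes 1$, and multiplication $(a\otimes x)(b\otimes y)=\sum\varphi(b_{(1)},x_{(1)})\,ab_{(2)}\otimes x_{(2)}y\,\varphi^{-1}(b_{(3)},x_{(3)})$. *)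

theory Defs
  imports
    "HOL-Library.Poly_Mapping"
    "HOL-Computational_Algebra.Polynomial"
    "HOL-Algebra.QuotRing"
    "HOL-Algebra.Module"
begin

section \<open>Categories and equivalence of categories\<close>

text \<open>Morphisms do not carry their source and target, so composition is indexed by the three
  objects involved: \<open>Cmp C X Y Z g f\<close> is the composite of \<open>f : X \<rightarrow> Y\<close> and
  \<open>g : Y \<rightarrow> Z\<close>.\<close>

record ('o, 'm) cat =
  Ob  :: "'o set"
  Hom :: "'o \<Rightarrow> 'o \<Rightarrow> 'm set"
  Cmp :: "'o \<Rightarrow> 'o \<Rightarrow> 'o \<Rightarrow> 'm \<Rightarrow> 'm \<Rightarrow> 'm"
  Idn :: "'o \<Rightarrow> 'm"

definition is_category :: "('o, 'm) cat \<Rightarrow> bool" where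
  "is_category C \<longleftrightarrow>
    (\<forall>X\<in>Ob C. Idn C X \<in> Hom C X X) \<and>
    (\<forall>X\<in>Ob C. \<forall>Y\<in>Ob C. \<forall>Z\<in>Ob C. \<forall>f\<in>Hom C X Y. \<forall>g\<in>Hom C Y Z.
       Cmp C X Y Z g f \<in> Hom C X Z) \<and>
    (\<forall>X\<in>Ob C. \<forall>Y\<in>Ob C. \<forall>f\<in>Hom C X Y.
       Cmp C X X Y f (Idn C X) = f \<and> Cmp C X Y Y (Idn C Y) f = f) \<and>
    (\<forall>W\<in>Ob C. \<forall>X\<in>Ob C. \<forall>Y\<in>Ob C. \<forall>Z\<in>Ob C.
       \<forall>f\<in>Hom C W X. \<forall>g\<in>Hom C X Y. \<forall>h\<in>Hom C Y Z.
       Cmp C W Y Z h (Cmp C W X Y g f) = Cmp C W X Z (Cmp C X Y Z h g) f)"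

text \<open>A functor is a pair of an object map \<open>Fo\<close> and a morphism map \<open>Fm\<close>; the
  latter is again indexed by source and target.\<close>

definition is_functor ::
    "('o, 'm) cat \<Rightarrow> ('p, 'n) cat \<Rightarrow> ('o \<Rightarrow> 'p) \<Rightarrow> ('o \<Rightarrow> 'o \<Rightarrow> 'm \<Rightarrow> 'n) \<Rightarrow> bool" where
  "is_functor C D Fo Fm \<longleftrightarrow>
    (\<forall>X\<in>Ob C. Fo X \<in> Ob D) \<and>
    (\<forall>X\<in>Ob C. \<forall>Y\<in>Ob C. \<forall>f\<in>Hom C X Y. Fm X Y f \<in> Hom D (Fo X) (Fo Y)) \<and>
    (\<forall>X\<in>Ob C. Fm X X (Idn C X) = Idn D (Fo X)) \<and>
    (\<forall>X\<in>Ob C. \<forall>Y\<in>Ob C. \<forall>Z\<in>Ob C. \<forall>f\<in>Hom C X Y. \<forall>g\<in>Hom C Y Z.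
       Fm X Z (Cmp C X Y Z g f) = Cmp D (Fo X) (Fo Y) (Fo Z) (Fm Y Z g) (Fm X Y f))"

definition is_iso :: "('o, 'm) cat \<Rightarrow> 'o \<Rightarrow> 'o \<Rightarrow> 'm \<Rightarrow> bool" where
  "is_iso C X Y f \<longleftrightarrow> f \<in> Hom C X Y \<and>
    (\<exists>g\<in>Hom C Y X. Cmp C X Y X g f = Idn C X \<and> Cmp C Y X Y f g = Idn C Y)"

definition naturally_isomorphic ::
    "('o, 'm) cat \<Rightarrow> ('p, 'n) cat \<Rightarrow> ('o \<Rightarrow> 'p) \<Rightarrow> ('o \<Rightarrow> 'o \<Rightarrow> 'm \<Rightarrow> 'n)
      \<Rightarrow> ('o \<Rightarrow> 'p) \<Rightarrow> ('o \<Rightarrow> 'o \<Rightarrow> 'm \<Rightarrow> 'n) \<Rightarrow> bool" where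
  "naturally_isomorphic C D Fo Fm Go Gm \<longleftrightarrow>
    (\<exists>\<theta>. (\<forall>X\<in>Ob C. is_iso D (Fo X) (Go X) (\<theta> X)) \<and>
      (\<forall>X\<in>Ob C. \<forall>Y\<in>Ob C. \<forall>f\<in>Hom C X Y.
         Cmp D (Fo X) (Fo Y) (Go Y) (\<theta> Y) (Fm X Y f)
         = Cmp D (Fo X) (Go X) (Go Y) (Gm X Y f) (\<theta> X)))"

definition equivalent_categories :: "('o, 'm) cat \<Rightarrow> ('p, 'n) cat \<Rightarrow> bool" where
  "equivalent_categories C D \<longleftrightarrow> is_category C \<and> is_category D \<and>
    (\<exists>Fo Fm Go Gm.
       is_functor C D Fo Fm \<and> is_functor D C Go Gm \<and>
       naturally_isomorphic C C (\<lambda>X. Go (Fo X)) (\<lambda>X Y f. Gm (Fo X) (Fo Y) (Fm X Y f))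
         (\<lambda>X. X) (\<lambda>X Y f. f) \<and>
       naturally_isomorphic D D (\<lambda>X. Fo (Go X)) (\<lambda>X Y f. Fm (Go X) (Go Y) (Gm X Y f))
         (\<lambda>X. X) (\<lambda>X Y f. f))"

definition product_category :: "'i set \<Rightarrow> ('i \<Rightarrow> ('o, 'm) cat) \<Rightarrow> ('i \<Rightarrow> 'o, 'i \<Rightarrow> 'm) cat" where
  "product_category I C =
    \<lparr> Ob = (\<Pi>\<^sub>E i\<in>I. Ob (C i)),
      Hom = (\<lambda>X Y. \<Pi>\<^sub>E i\<in>I. Hom (C i) (X i) (Y i)),
      Cmp = (\<lambda>X Y Z g f. \<lambda>i\<in>I. Cmp (C i) (X i) (Y i) (Z i) (g i) (f i)),
      Idn = (\<lambda>X. \<lambda>i\<in>I. Idn (C i) (X i)) \<rparr>"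


section \<open>The category of left modules over a ring\<close>

text \<open>The locale \<open>Module.module\<close> demands a commutative ring of scalars; this is the same
  notion over an arbitrary ring.  The fields \<open>mult\<close> and \<open>one\<close> of \<open>M\<close>, inherited from the
  record type, play no role.\<close>

locale left_module = R?: ring R + M?: abelian_group M
  for R (structure) and M :: "('r, 'v) module" (structure) +
  assumes smult_closed:
      "\<lbrakk>a \<in> carrier R; x \<in> carrier M\<rbrakk> \<Longrightarrow> a \<odot>\<^bsub>M\<^esub> x \<in> carrier M"
    and smult_l_distr:
      "\<lbrakk>a \<in> carrier R; b \<in> carrier R; x \<in> carrier M\<rbrakk>
        \<Longrightarrow> (a \<oplus>\<^bsub>R\<^esub> b) \<odot>\<^bsub>M\<^esub> x = a \<odot>\<^bsub>M\<^esub> x \<oplus>\<^bsub>M\<^esub> b \<odot>\<^bsub>M\<^esub> x"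
    and smult_r_distr:
      "\<lbrakk>a \<in> carrier R; x \<in> carrier M; y \<in> carrier M\<rbrakk>
        \<Longrightarrow> a \<odot>\<^bsub>M\<^esub> (x \<oplus>\<^bsub>M\<^esub> y) = a \<odot>\<^bsub>M\<^esub> x \<oplus>\<^bsub>M\<^esub> a \<odot>\<^bsub>M\<^esub> y"
    and smult_assoc1:
      "\<lbrakk>a \<in> carrier R; b \<in> carrier R; x \<in> carrier M\<rbrakk>
        \<Longrightarrow> (a \<otimes>\<^bsub>R\<^esub> b) \<odot>\<^bsub>M\<^esub> x = a \<odot>\<^bsub>M\<^esub> (b \<odot>\<^bsub>M\<^esub> x)"
    and smult_one:
      "x \<in> carrier M \<Longrightarrow> \<one>\<^bsub>R\<^esub> \<odot>\<^bsub>M\<^esub> x = x"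

definition left_module_hom ::
    "('r, 'x) ring_scheme \<Rightarrow> ('r, 'v) module \<Rightarrow> ('r, 'v) module \<Rightarrow> ('v \<Rightarrow> 'v) set" where
  "left_module_hom R M N = {f \<in> carrier M \<rightarrow>\<^sub>E carrier N.
     (\<forall>x\<in>carrier M. \<forall>y\<in>carrier M. f (x \<oplus>\<^bsub>M\<^esub> y) = f x \<oplus>\<^bsub>N\<^esub> f y) \<and>
     (\<forall>r\<in>carrier R. \<forall>x\<in>carrier M. f (r \<odot>\<^bsub>M\<^esub> x) = r \<odot>\<^bsub>N\<^esub> f x)}"

text \<open>The type \<open>'v\<close> is the universe: the objects are the left \<open>R\<close>-modules whose underlying
  set is a subset of \<open>'v\<close>.\<close>

definition left_module_category ::
    "'v itself \<Rightarrow> ('r, 'x) ring_scheme \<Rightarrow> (('r, 'v) module, 'v \<Rightarrow> 'v) cat" where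
  "left_module_category _ R =
    \<lparr> Ob = {M. left_module R M},
      Hom = left_module_hom R,
      Cmp = (\<lambda>L M N g f. compose (carrier L) g f),
      Idn = (\<lambda>M. \<lambda>x\<in>carrier M. x) \<rparr>"


section \<open>Algebras and tensor products over a field\<close>

text \<open>The ground field is a type \<open>'k\<close> of class \<open>field\<close>; a \<open>'k\<close>-algebra is given by a record
  of type \<open>('k, 'a) module\<close>, whose multiplication need not be commutative.\<close>

definition type_ring :: "'r::ring_1 ring" where
  "type_ring = \<lparr> carrier = UNIV, monoid.mult = (*), one = 1, ring.zero = 0, add = (+) \<rparr>"

definition ground_field :: "('k::field, 'k) module" where
  "ground_field = ring.extend type_ring (module.fields (*))"

definition op_algebra :: "('k, 'a, 'm) module_scheme \<Rightarrow> ('k, 'a, 'm) module_scheme" where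
  "op_algebra A = A\<lparr>mult := (\<lambda>x y. y \<otimes>\<^bsub>A\<^esub> x)\<rparr>"

definition alg_hom ::
    "('k, 'a, 'm) module_scheme \<Rightarrow> ('k, 'b, 'n) module_scheme \<Rightarrow> ('a \<Rightarrow> 'b) set" where
  "alg_hom A B = {f \<in> ring_hom A B \<inter> extensional (carrier A).
     \<forall>c. \<forall>x\<in>carrier A. f (c \<odot>\<^bsub>A\<^esub> x) = c \<odot>\<^bsub>B\<^esub> f x}"

definition alg_quot :: "('k, 'a, 'm) module_scheme \<Rightarrow> 'a set \<Rightarrow> ('k, 'a set) module" where
  "alg_quot A I = ring.extend (A Quot I)
     (module.fields (\<lambda>c X. \<Union>x\<in>X. I +>\<^bsub>A\<^esub> (c \<odot>\<^bsub>A\<^esub> x)))"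

text \<open>\<open>A \<otimes> B\<close> is the space of formal linear combinations of pairs \<open>(a, b)\<close> modulo the
  bilinearity relations; its elements are cosets, i.e. sets of formal sums.\<close>

definition formal_sums ::
    "('k::field, 'a, 'm) module_scheme \<Rightarrow> ('k, 'b, 'n) module_scheme \<Rightarrow> ('a \<times> 'b \<Rightarrow>\<^sub>0 'k) set" where
  "formal_sums A B = {p. Poly_Mapping.keys p \<subseteq> carrier A \<times> carrier B}"

inductive_set bilinear_relations ::
    "('k::field, 'a, 'm) module_scheme \<Rightarrow> ('k, 'b, 'n) module_scheme \<Rightarrow> ('a \<times> 'b \<Rightarrow>\<^sub>0 'k) set"
  for A :: "('k::field, 'a, 'm) module_scheme" and B :: "('k, 'b, 'n) module_scheme"
where
  zero: "0 \<in> bilinear_relations A B"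
| diff: "\<lbrakk>p \<in> bilinear_relations A B; r \<in> bilinear_relations A B\<rbrakk>
    \<Longrightarrow> p - r \<in> bilinear_relations A B"
| add_left: "\<lbrakk>a \<in> carrier A; a' \<in> carrier A; b \<in> carrier B\<rbrakk> \<Longrightarrow>
    Poly_Mapping.single (a \<oplus>\<^bsub>A\<^esub> a', b) c - Poly_Mapping.single (a, b) c
      - Poly_Mapping.single (a', b) c \<in> bilinear_relations A B"
| add_right: "\<lbrakk>a \<in> carrier A; b \<in> carrier B; b' \<in> carrier B\<rbrakk> \<Longrightarrow>
    Poly_Mapping.single (a, b \<oplus>\<^bsub>B\<^esub> b') c - Poly_Mapping.single (a, b) c
      - Poly_Mapping.single (a, b') c \<in> bilinear_relations A B"
| smult_left: "\<lbrakk>a \<in> carrier A; b \<in> carrier B\<rbrakk> \<Longrightarrow>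
    Poly_Mapping.single (d \<odot>\<^bsub>A\<^esub> a, b) c - Poly_Mapping.single (a, b) (c * d)
      \<in> bilinear_relations A B"
| smult_right: "\<lbrakk>a \<in> carrier A; b \<in> carrier B\<rbrakk> \<Longrightarrow>
    Poly_Mapping.single (a, d \<odot>\<^bsub>B\<^esub> b) c - Poly_Mapping.single (a, b) (c * d)
      \<in> bilinear_relations A B"

definition tensor_class ::
    "('k::field, 'a, 'm) module_scheme \<Rightarrow> ('k, 'b, 'n) module_scheme
      \<Rightarrow> ('a \<times> 'b \<Rightarrow>\<^sub>0 'k) \<Rightarrow> ('a \<times> 'b \<Rightarrow>\<^sub>0 'k) set" where
  "tensor_class A B p = {r \<in> formal_sums A B. r - p \<in> bilinear_relations A B}"

definition pure_tensor ::
    "('k::field, 'a, 'm) module_scheme \<Rightarrow> ('k, 'b, 'n) module_scheme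
      \<Rightarrow> 'a \<Rightarrow> 'b \<Rightarrow> ('a \<times> 'b \<Rightarrow>\<^sub>0 'k) set" where
  "pure_tensor A B a b = tensor_class A B (Poly_Mapping.single (a, b) 1)"

text \<open>The algebra \<open>A \<otimes> B\<close>, with \<open>(a \<otimes> b)(a' \<otimes> b') = aa' \<otimes> bb'\<close>.\<close>

definition tensor ::
    "('k::field, 'a, 'm) module_scheme \<Rightarrow> ('k, 'b, 'n) module_scheme
      \<Rightarrow> ('k, ('a \<times> 'b \<Rightarrow>\<^sub>0 'k) set) module" where
  "tensor A B =
    \<lparr> carrier = tensor_class A B ` formal_sums A B,
      monoid.mult = (\<lambda>s t. \<Union>p\<in>s. \<Union>r\<in>t. tensor_class A B
        (\<Sum>z\<in>Poly_Mapping.keys p. \<Sum>w\<in>Poly_Mapping.keys r.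
           Poly_Mapping.single (fst z \<otimes>\<^bsub>A\<^esub> fst w, snd z \<otimes>\<^bsub>B\<^esub> snd w)
             (Poly_Mapping.lookup p z * Poly_Mapping.lookup r w))),
      one = pure_tensor A B \<one>\<^bsub>A\<^esub> \<one>\<^bsub>B\<^esub>,
      ring.zero = tensor_class A B 0,
      add = (\<lambda>s t. \<Union>p\<in>s. \<Union>r\<in>t. tensor_class A B (p + r)),
      module.smult = (\<lambda>c s. \<Union>p\<in>s. tensor_class A B (Poly_Mapping.map (\<lambda>x. c * x) p)) \<rparr>"

text \<open>\<open>tensor_lift C f\<close> is the linear map to \<open>C\<close> that a bilinear map \<open>f\<close> with values in
  \<open>C\<close> induces on the tensor product: it sends \<open>\<Sum>\<^sub>i a\<^sub>i \<otimes> b\<^sub>i\<close> to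
  \<open>\<Sum>\<^sub>i f a\<^sub>i b\<^sub>i\<close>, whichever formal sum represents the given tensor.\<close>

definition tensor_lift ::
    "('k::field, 'c, 'm) module_scheme \<Rightarrow> ('a \<Rightarrow> 'b \<Rightarrow> 'c) \<Rightarrow> ('a \<times> 'b \<Rightarrow>\<^sub>0 'k) set \<Rightarrow> 'c" where
  "tensor_lift C f t = (let p = (SOME p. p \<in> t) in
     \<Oplus>\<^bsub>C\<^esub>z\<in>Poly_Mapping.keys p. Poly_Mapping.lookup p z \<odot>\<^bsub>C\<^esub> f (fst z) (snd z))"


section \<open>Hopf algebras\<close>

record (overloaded) ('k::zero, 'a) hopf = "('k, 'a) module" +
  comult :: "'a \<Rightarrow> ('a \<times> 'a \<Rightarrow>\<^sub>0 'k) set"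
  counit :: "'a \<Rightarrow> 'k"
  antipode :: "'a \<Rightarrow> 'a"

text \<open>Sweedler sums: \<open>sweedler2 H C f x\<close> is \<open>\<Sum> f x\<^sub>(\<^sub>1\<^sub>) x\<^sub>(\<^sub>2\<^sub>)\<close> and
  \<open>sweedler3 H C f x\<close> is \<open>\<Sum> f x\<^sub>(\<^sub>1\<^sub>) x\<^sub>(\<^sub>2\<^sub>) x\<^sub>(\<^sub>3\<^sub>)\<close>, computed in \<open>C\<close>, for a multilinear \<open>f\<close>.\<close>

definition sweedler2 ::
    "('k::field, 'a) hopf \<Rightarrow> ('k, 'c, 'm) module_scheme \<Rightarrow> ('a \<Rightarrow> 'a \<Rightarrow> 'c) \<Rightarrow> 'a \<Rightarrow> 'c" where
  "sweedler2 H C f x = tensor_lift C f (comult H x)"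

definition sweedler3 ::
    "('k::field, 'a) hopf \<Rightarrow> ('k, 'c, 'm) module_scheme \<Rightarrow> ('a \<Rightarrow> 'a \<Rightarrow> 'a \<Rightarrow> 'c) \<Rightarrow> 'a \<Rightarrow> 'c" where
  "sweedler3 H C f x = sweedler2 H C (\<lambda>x1 x'. sweedler2 H C (\<lambda>x2 x3. f x1 x2 x3) x') x"

text \<open>Intended for a Hopf ideal \<open>I\<close>, when the structure maps do not depend on the chosen
  representatives.\<close>

definition hopf_quot :: "('k::field, 'a) hopf \<Rightarrow> 'a set \<Rightarrow> ('k, 'a set) hopf" where
  "hopf_quot H I = module.extend (alg_quot H I) (hopf.fields
     (\<lambda>X. sweedler2 H (tensor (alg_quot H I) (alg_quot H I))
        (\<lambda>x1 x2. pure_tensor (alg_quot H I) (alg_quot H I) (I +>\<^bsub>H\<^esub> x1) (I +>\<^bsub>H\<^esub> x2))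
        (SOME x. x \<in> X))
     (\<lambda>X. counit H (SOME x. x \<in> X))
     (\<lambda>X. I +>\<^bsub>H\<^esub> antipode H (SOME x. x \<in> X)))"

text \<open>The condition on \<open>comult\<close> says \<open>\<Delta>(B) \<subseteq> B \<otimes> B\<close>: the tensor \<open>\<Delta>(b)\<close> has a
  representative all of whose terms lie in \<open>B\<close>.\<close>

definition hopf_subalgebra :: "('k::field, 'a) hopf \<Rightarrow> 'a set \<Rightarrow> bool" where
  "hopf_subalgebra H B \<longleftrightarrow> B \<subseteq> carrier H \<and> \<one>\<^bsub>H\<^esub> \<in> B \<and>
     (\<forall>x\<in>B. \<forall>y\<in>B. x \<oplus>\<^bsub>H\<^esub> y \<in> B \<and> x \<otimes>\<^bsub>H\<^esub> y \<in> B) \<and>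
     (\<forall>c. \<forall>x\<in>B. c \<odot>\<^bsub>H\<^esub> x \<in> B) \<and>
     (\<forall>x\<in>B. antipode H x \<in> B) \<and>
     (\<forall>x\<in>B. \<exists>p\<in>comult H x. Poly_Mapping.keys p \<subseteq> B \<times> B)"

text \<open>A Hopf subalgebra as a Hopf algebra in its own right.  Since \<open>B \<otimes> B \<rightarrow> H \<otimes> H\<close> is
  injective over a field, the formal sums over \<open>B\<close> inside the coset \<open>\<Delta>(x)\<close> form exactly
  one coset, which is \<open>\<Delta>(x)\<close> regarded as an element of \<open>B \<otimes> B\<close>.\<close>

definition hopf_restrict :: "('k::field, 'a) hopf \<Rightarrow> 'a set \<Rightarrow> ('k, 'a) hopf" where
  "hopf_restrict H B =
     H\<lparr>carrier := B, comult := (\<lambda>x. {p \<in> comult H x. Poly_Mapping.keys p \<subseteq> B \<times> B})\<rparr>"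

definition hopf_generate :: "('k::field, 'a) hopf \<Rightarrow> 'a set \<Rightarrow> ('k, 'a) hopf" where
  "hopf_generate H G = hopf_restrict H (\<Inter>{B. hopf_subalgebra H B \<and> G \<subseteq> B})"

definition skew_pairing ::
    "('k::field, 'a) hopf \<Rightarrow> ('k, 'b) hopf \<Rightarrow> ('a \<Rightarrow> 'b \<Rightarrow> 'k) \<Rightarrow> bool" where
  "skew_pairing A H \<phi> \<longleftrightarrow>
     (\<forall>a\<in>carrier A. \<forall>b\<in>carrier A. \<forall>x\<in>carrier H.
        \<phi> (a \<oplus>\<^bsub>A\<^esub> b) x = \<phi> a x + \<phi> b x) \<and>
     (\<forall>a\<in>carrier A. \<forall>x\<in>carrier H. \<forall>y\<in>carrier H.
        \<phi> a (x \<oplus>\<^bsub>H\<^esub> y) = \<phi> a x + \<phi> a y) \<and>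
     (\<forall>c. \<forall>a\<in>carrier A. \<forall>x\<in>carrier H.
        \<phi> (c \<odot>\<^bsub>A\<^esub> a) x = c * \<phi> a x \<and> \<phi> a (c \<odot>\<^bsub>H\<^esub> x) = c * \<phi> a x) \<and>
     (\<forall>a\<in>carrier A. \<forall>b\<in>carrier A. \<forall>x\<in>carrier H.
        \<phi> (a \<otimes>\<^bsub>A\<^esub> b) x = sweedler2 H ground_field (\<lambda>x1 x2. \<phi> a x1 * \<phi> b x2) x) \<and>
     (\<forall>a\<in>carrier A. \<forall>x\<in>carrier H. \<forall>y\<in>carrier H.
        \<phi> a (x \<otimes>\<^bsub>H\<^esub> y) = sweedler2 A ground_field (\<lambda>a1 a2. \<phi> a1 y * \<phi> a2 x) a) \<and>
     (\<forall>a\<in>carrier A. \<phi> a \<one>\<^bsub>H\<^esub> = counit A a) \<and>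
     (\<forall>x\<in>carrier H. \<phi> \<one>\<^bsub>A\<^esub> x = counit H x)"

text \<open>The algebra underlying the double crossproduct:
  \<open>(a \<otimes> x)(b \<otimes> y) = \<Sum> \<phi>(b\<^sub>(\<^sub>1\<^sub>), x\<^sub>(\<^sub>1\<^sub>)) ab\<^sub>(\<^sub>2\<^sub>) \<otimes> x\<^sub>(\<^sub>2\<^sub>)y \<phi>(S(b\<^sub>(\<^sub>3\<^sub>)), x\<^sub>(\<^sub>3\<^sub>))\<close>,
  the last factor being the convolution inverse of \<open>\<phi>\<close>.  Its modules do not involve the
  coalgebra structure, which is therefore not recorded.\<close>

definition double_crossproduct ::
    "('k::field, 'a) hopf \<Rightarrow> ('k, 'b) hopf \<Rightarrow> ('a \<Rightarrow> 'b \<Rightarrow> 'k)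
      \<Rightarrow> ('k, ('a \<times> 'b \<Rightarrow>\<^sub>0 'k) set) module" where
  "double_crossproduct A H \<phi> = (let T = tensor A H in
     T\<lparr>mult := (\<lambda>s t.
       tensor_lift T (\<lambda>a x. tensor_lift T (\<lambda>b y.
         sweedler3 A T (\<lambda>b1 b2 b3. sweedler3 H T (\<lambda>x1 x2 x3.
           (\<phi> b1 x1 * \<phi> (antipode A b3) x3) \<odot>\<^bsub>T\<^esub>
             pure_tensor A H (a \<otimes>\<^bsub>A\<^esub> b2) (x2 \<otimes>\<^bsub>H\<^esub> y)) x) b) t) s)\<rparr>)"


section \<open>Free algebras\<close>

text \<open>The free monoid on \<open>'g\<close>, written additively because the convolution product on
  \<open>'m \<Rightarrow>\<^sub>0 'k\<close> (the monoid algebra) is defined for additive monoids.\<close>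

datatype 'g word = Word "'g list"

instantiation word :: (type) monoid_add
begin

definition zero_word :: "'a word" where "0 = Word []"

fun plus_word :: "'a word \<Rightarrow> 'a word \<Rightarrow> 'a word" where
  "Word u + Word v = Word (u @ v)"

instance
proof
  fix a b c :: "'a word"
  show "a + b + c = a + (b + c)" by (cases a; cases b; cases c) simp
  show "0 + a = a" by (cases a) (simp add: zero_word_def)
  show "a + 0 = a" by (cases a) (simp add: zero_word_def)
qed

end

type_synonym ('g, 'k) free_algebra = "'g word \<Rightarrow>\<^sub>0 'k"

definition var :: "'g \<Rightarrow> ('g, 'k::field) free_algebra" where
  "var g = Poly_Mapping.single (Word [g]) 1"

definition const :: "'k::field \<Rightarrow> ('g, 'k) free_algebra" where
  "const c = Poly_Mapping.single 0 c"

definition free_alg :: "('k::field, ('g, 'k) free_algebra) module" where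
  "free_alg = ring.extend type_ring (module.fields (\<lambda>c p. const c * p))"


section \<open>The Hopf algebra U\<close>

datatype idx = I1 | I2

definition cartan :: "idx \<Rightarrow> idx \<Rightarrow> int" where
  "cartan i j = (if i = j then 2 else -1)"

text \<open>\<open>gK' i\<close> is the generator \<open>K\<^sub>i\<^sup>-\<^sup>1\<close>.\<close>

datatype gen = gE idx | gF idx | gK idx | gK' idx

definition U_relations :: "'k::field \<Rightarrow> (gen, 'k) free_algebra set" where
  "U_relations q =
     {var (gK i) * var (gK j) - var (gK j) * var (gK i) | i j. True} \<union>
     {var (gK i) * var (gK' i) - 1 | i. True} \<union>
     {var (gK' i) * var (gK i) - 1 | i. True} \<union>
     {var (gK i) * var (gE j) * var (gK' i) - const (q powi cartan j i) * var (gE j) | i j. True} \<union>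
     {var (gK i) * var (gF j) * var (gK' i) - const (q powi (- cartan j i)) * var (gF j) | i j. True} \<union>
     {var (gE I1) * var (gF I1) - var (gF I1) * var (gE I1)
        - const (1 / (q - inverse q)) * (var (gK I1) - var (gK' I1))} \<union>
     {var (gE i) * var (gF j) - var (gF j) * var (gE i) | i j. (i, j) \<noteq> (I1, I1)} \<union>
     {var (gE i) ^ 2 * var (gE j) - const (q + inverse q) * (var (gE i) * var (gE j) * var (gE i))
        + var (gE j) * var (gE i) ^ 2 | i j. i \<noteq> j} \<union>
     {var (gF i) ^ 2 * var (gF j) - const (q + inverse q) * (var (gF i) * var (gF j) * var (gF i))
        + var (gF j) * var (gF i) ^ 2 | i j. i \<noteq> j}"

definition U_ideal :: "'k::field \<Rightarrow> (gen, 'k) free_algebra set" where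
  "U_ideal q = genideal free_alg (U_relations q)"

type_synonym 'k U_elem = "(gen, 'k) free_algebra set"

definition U_alg :: "'k::field \<Rightarrow> ('k, 'k U_elem) module" where
  "U_alg q = alg_quot free_alg (U_ideal q)"

definition U_gen :: "'k::field \<Rightarrow> gen \<Rightarrow> 'k U_elem" where
  "U_gen q g = U_ideal q +>\<^bsub>free_alg\<^esub> var g"

text \<open>The structure maps are the unique (anti)homomorphisms with the prescribed values on
  the generators.\<close>

fun comult_gen :: "'k::field \<Rightarrow> gen \<Rightarrow> ('k U_elem \<times> 'k U_elem \<Rightarrow>\<^sub>0 'k) set" where
  "comult_gen q (gE i) =
     pure_tensor (U_alg q) (U_alg q) (U_gen q (gK i)) (U_gen q (gE i))
     \<oplus>\<^bsub>tensor (U_alg q) (U_alg q)\<^esub> pure_tensor (U_alg q) (U_alg q) (U_gen q (gE i)) \<one>\<^bsub>U_alg q\<^esub>"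
| "comult_gen q (gF i) =
     pure_tensor (U_alg q) (U_alg q) \<one>\<^bsub>U_alg q\<^esub> (U_gen q (gF i))
     \<oplus>\<^bsub>tensor (U_alg q) (U_alg q)\<^esub> pure_tensor (U_alg q) (U_alg q) (U_gen q (gF i)) (U_gen q (gK' i))"
| "comult_gen q (gK i) = pure_tensor (U_alg q) (U_alg q) (U_gen q (gK i)) (U_gen q (gK i))"
| "comult_gen q (gK' i) = pure_tensor (U_alg q) (U_alg q) (U_gen q (gK' i)) (U_gen q (gK' i))"

fun counit_gen :: "gen \<Rightarrow> 'k::field" where
  "counit_gen (gE i) = 0"
| "counit_gen (gF i) = 0"
| "counit_gen (gK i) = 1"
| "counit_gen (gK' i) = 1"

fun antipode_gen :: "'k::field \<Rightarrow> gen \<Rightarrow> 'k U_elem" where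
  "antipode_gen q (gE i) = \<ominus>\<^bsub>U_alg q\<^esub> (U_gen q (gK' i) \<otimes>\<^bsub>U_alg q\<^esub> U_gen q (gE i))"
| "antipode_gen q (gF i) = \<ominus>\<^bsub>U_alg q\<^esub> (U_gen q (gF i) \<otimes>\<^bsub>U_alg q\<^esub> U_gen q (gK i))"
| "antipode_gen q (gK i) = U_gen q (gK' i)"
| "antipode_gen q (gK' i) = U_gen q (gK i)"

definition U_hopf :: "'k::field \<Rightarrow> ('k, 'k U_elem) hopf" where
  "U_hopf q = module.extend (U_alg q) (hopf.fields
     (THE \<Delta>. \<Delta> \<in> alg_hom (U_alg q) (tensor (U_alg q) (U_alg q))
        \<and> (\<forall>g. \<Delta> (U_gen q g) = comult_gen q g))
     (THE \<epsilon>. \<epsilon> \<in> alg_hom (U_alg q) ground_field \<and> (\<forall>g. \<epsilon> (U_gen q g) = counit_gen g))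
     (THE S. S \<in> alg_hom (U_alg q) (op_algebra (U_alg q))
        \<and> (\<forall>g. S (U_gen q g) = antipode_gen q g)))"


section \<open>The finite dimensional quotient and its Borel parts\<close>

definition U_E12 :: "'k::field \<Rightarrow> 'k U_elem" where
  "U_E12 q = (let U = U_hopf q in
     U_gen q (gE I1) \<otimes>\<^bsub>U\<^esub> U_gen q (gE I2)
     \<ominus>\<^bsub>U\<^esub> inverse q \<odot>\<^bsub>U\<^esub> (U_gen q (gE I2) \<otimes>\<^bsub>U\<^esub> U_gen q (gE I1)))"

definition U_F12 :: "'k::field \<Rightarrow> 'k U_elem" where
  "U_F12 q = (let U = U_hopf q in
     U_gen q (gF I2) \<otimes>\<^bsub>U\<^esub> U_gen q (gF I1)
     \<ominus>\<^bsub>U\<^esub> q \<odot>\<^bsub>U\<^esub> (U_gen q (gF I1) \<otimes>\<^bsub>U\<^esub> U_gen q (gF I2)))"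

definition small_ideal :: "nat \<Rightarrow> 'k::field \<Rightarrow> 'k U_elem set" where
  "small_ideal l q = (let U = U_hopf q in genideal U
     ({x [^]\<^bsub>U\<^esub> l | x. x \<in> {U_gen q (gE I1), U_E12 q, U_gen q (gE I2),
                             U_gen q (gF I1), U_F12 q, U_gen q (gF I2)}} \<union>
      {U_gen q (gK i) [^]\<^bsub>U\<^esub> l \<ominus>\<^bsub>U\<^esub> \<one>\<^bsub>U\<^esub> | i. True}))"

type_synonym 'k u_elem = "'k U_elem set"

definition small_u :: "nat \<Rightarrow> 'k::field \<Rightarrow> ('k, 'k u_elem) hopf" where
  "small_u l q = hopf_quot (U_hopf q) (small_ideal l q)"

definition u_gen :: "nat \<Rightarrow> 'k::field \<Rightarrow> gen \<Rightarrow> 'k u_elem" where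
  "u_gen l q g = small_ideal l q +>\<^bsub>U_hopf q\<^esub> U_gen q g"

definition u_ge0 :: "nat \<Rightarrow> 'k::field \<Rightarrow> ('k, 'k u_elem) hopf" where
  "u_ge0 l q = hopf_generate (small_u l q) (u_gen l q ` (range gE \<union> range gK))"

definition u_le0 :: "nat \<Rightarrow> 'k::field \<Rightarrow> ('k, 'k u_elem) hopf" where
  "u_le0 l q = hopf_generate (small_u l q) (u_gen l q ` (range gF \<union> range gK))"

fun u_monomial :: "nat \<Rightarrow> 'k::field \<Rightarrow> gen list \<Rightarrow> 'k u_elem" where
  "u_monomial l q [] = \<one>\<^bsub>small_u l q\<^esub>"
| "u_monomial l q (g # w) = u_gen l q g \<otimes>\<^bsub>small_u l q\<^esub> u_monomial l q w"

text \<open>The degree of a monomial of either Borel part, as its coefficient vector with respect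
  to \<open>\<alpha>\<^sub>1, \<alpha>\<^sub>2\<close>; note that \<open>F\<^sub>i\<close> has degree \<open>\<alpha>\<^sub>i\<close>, not \<open>- \<alpha>\<^sub>i\<close>.\<close>

definition monomial_degree :: "gen list \<Rightarrow> idx \<Rightarrow> int" where
  "monomial_degree w i = int (count_list w (gE i)) + int (count_list w (gF i))"

definition is_borel_pairing ::
    "nat \<Rightarrow> 'k::field \<Rightarrow> ('k u_elem \<Rightarrow> 'k u_elem \<Rightarrow> 'k) \<Rightarrow> bool" where
  "is_borel_pairing l q \<phi> \<longleftrightarrow>
     skew_pairing (u_ge0 l q) (u_le0 l q) \<phi> \<and>
     \<phi> \<one>\<^bsub>u_ge0 l q\<^esub> \<one>\<^bsub>u_le0 l q\<^esub> = 1 \<and>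
     (\<forall>i. \<phi> \<one>\<^bsub>u_ge0 l q\<^esub> (u_gen l q (gK i)) = 1 \<and>
          \<phi> (u_gen l q (gK i)) \<one>\<^bsub>u_le0 l q\<^esub> = 1) \<and>
     (\<forall>v w. set v \<subseteq> range gE \<union> range gK \<union> range gK' \<longrightarrow>
            set w \<subseteq> range gF \<union> range gK \<union> range gK' \<longrightarrow>
            monomial_degree v \<noteq> monomial_degree w \<longrightarrow>
            \<phi> (u_monomial l q v) (u_monomial l q w) = 0) \<and>
     (\<forall>i j. \<phi> (u_gen l q (gE i)) (u_gen l q (gF j))
            = (if i = j \<and> i = I1 then 1 / (q^2 - 1) else 0)) \<and>
     (\<forall>i j. \<phi> (u_gen l q (gK i)) (u_gen l q (gK j)) = q powi cartan i j \<and>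
            \<phi> (u_gen l q (gK i)) (u_gen l q (gK' j)) = q powi (- cartan i j))"

definition primitive_root_of_unity :: "nat \<Rightarrow> 'k::field \<Rightarrow> bool" where
  "primitive_root_of_unity l q \<longleftrightarrow> l > 0 \<and> q ^ l = 1 \<and> (\<forall>m. 0 < m \<and> m < l \<longrightarrow> q ^ m \<noteq> 1)"

definition roots_of_unity :: "nat \<Rightarrow> 'k::field set" where
  "roots_of_unity l = {z. z ^ l = 1}"

end

theory Submission
  imports Defs "HOL-Library.Product_Plus"
begin

text \<open>
  The double crossproduct \<open>D\<close> is a direct product of copies of \<open>\<uu>\<close>, one for each pair
  \<open>\<eta> = (\<eta>\<^sub>1, \<eta>\<^sub>2)\<close> of \<open>l\<close>-th roots of unity, and modules over a finite product of rings are
  families of modules over the factors.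

  The algebra \<open>D\<close> contains two copies of the torus, \<open>K\<^sub>i \<otimes> 1\<close> and \<open>1 \<otimes> K\<^sub>i\<close>.  In \<open>D\<close> all
  commutators of the \<open>E\<^sub>i \<otimes> 1\<close> with the \<open>1 \<otimes> F\<^sub>j\<close> vanish except
  \<open>E\<^sub>1 F\<^sub>1 - F\<^sub>1 E\<^sub>1 = (K\<^sub>1 \<otimes> 1 - 1 \<otimes> K\<^sub>1\<^sup>-\<^sup>1) / (q\<^sup>2 - 1)\<close>, and the elements \<open>z\<^sub>i = K\<^sub>i \<otimes> K\<^sub>i\<^sup>-\<^sup>1\<close> are
  central with \<open>z\<^sub>i\<^sup>l = 1\<close> (\<open>letters_commute\<close>, \<open>central_z\<close>, \<open>zp_l\<close>).  On the part of \<open>D\<close> where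
  \<open>z\<^sub>i\<close> acts as \<open>\<eta>\<^sub>i\<^sup>2\<close> both copies of \<open>K\<^sub>i\<close> are multiples of a single \<open>K\<^sub>i\<close>, and the relations
  become those of \<open>\<uu>\<close>.  This suggests the algebra maps \<open>\<Phi>\<^sub>\<eta> : D \<rightarrow> \<uu>\<close> that are the inclusion on
  \<open>E\<^sub>i\<close> and \<open>F\<^sub>2\<close>, multiply \<open>F\<^sub>1\<close> by \<open>\<eta>\<^sub>1/q\<close>, and send \<open>K\<^sub>i \<otimes> 1\<close> to \<open>\<eta>\<^sub>i K\<^sub>i\<close> and
  \<open>1 \<otimes> K\<^sub>i\<close> to \<open>\<eta>\<^sub>i\<^sup>-\<^sup>1 K\<^sub>i\<close>.

  These maps are jointly bijective.  As \<open>l\<close> is odd and invertible in the field, squaring permutes the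
  \<open>l\<close>-th roots of unity, so the averages of the powers of \<open>z\<^sub>1\<close> and \<open>z\<^sub>2\<close> give central
  idempotents \<open>e\<^sub>\<eta>\<close> with sum \<open>1\<close> and \<open>\<Phi>\<^sub>\<eta>'(e\<^sub>\<eta>) = \<delta>\<^sub>\<eta>\<^sub>\<eta>'\<close> (\<open>sum_ee\<close>, \<open>\<Phi>0_ee\<close>).  On the block
  \<open>D e\<^sub>\<eta>\<close> an inverse \<open>\<theta>\<^sub>\<eta>\<close> of \<open>\<Phi>\<^sub>\<eta>\<close> is obtained by assigning values to the generators of \<open>\<uu>\<close>
  and verifying the relations (\<open>\<theta>_u_ideal\<close>, \<open>\<theta>_\<Phi>0\<close>).

  The delicate point is that \<open>\<Phi>\<^sub>\<eta>\<close> and \<open>\<theta>\<^sub>\<eta>\<close> are well defined.  The Borel parts are given as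
  subalgebras of \<open>\<uu>\<close>, so it has to be shown that rescaling \<open>K\<^sub>i\<close> by roots of unity preserves all
  relations that hold between words in \<open>E\<^sub>i, K\<^sub>i\<close> alone, or in \<open>F\<^sub>i, K\<^sub>i\<close> alone; on all of \<open>\<uu>\<close> it is
  not an automorphism.  A module on which \<open>E\<^sub>2, F\<^sub>2\<close> act as \<open>0\<close>,
  with a highest weight vector \<open>v\<close> of weight \<open>K\<^sub>i v = \<eta>\<^sub>i v\<close>, yields a linear form on
  \<open>\<uu>\<close> that restricts to a character \<open>\<chi>\<close> of each Borel part, and \<open>(id \<otimes> \<chi>) \<Delta>\<close> and
  \<open>(\<chi> \<otimes> id) \<Delta>\<close> are the required rescalings (\<open>\<rho>_u_ideal\<close>, \<open>A_rescale\<close>, \<open>H_rescale\<close>).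

  All computations are done on words.  \<open>U\<close>, \<open>\<uu>\<close>, the Borel parts, tensor products and \<open>D\<close>
  are images of spaces of formal sums under linear surjections with known kernels (locale
  \<open>presented\<close> and its descendants).  The coproduct, counit and antipode of \<open>\<uu>\<close> are shown to be
  induced by explicit maps of the free algebra; the work is that \<open>\<Delta>\<close> respects the quantum Serre relations and the
  \<open>l\<close>-th powers of the root vectors (quantum binomial theorem at a root of unity).  The product of
  \<open>D\<close> then becomes a product \<open>\<star>\<close> of formal sums of pairs of words, associative by coassociativity
  (\<open>mul_assoc\<close>, \<open>D_mult\<close>).
\<close>


section \<open>Modules over a finite product of rings\<close>

text \<open>An infinite set is equipotent to its square, hence to its finite powers.  This lets a finite product of
  subsets of \<open>'v\<close> be realised inside \<open>'v\<close>.\<close>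

lemma inj_power_into_infinite:
  assumes "infinite (UNIV :: 'v set)" and "finite I"
  shows "\<exists>J :: ('i \<Rightarrow> 'v) \<Rightarrow> 'v. inj_on J (I \<rightarrow>\<^sub>E UNIV)"
  using assms(2)
proof (induction I)
  case empty
  show ?case by (rule exI[of _ "\<lambda>_. undefined"]) (simp add: inj_on_def)
next
  case (insert i I)
  then obtain J :: "('i \<Rightarrow> 'v) \<Rightarrow> 'v" where J: "inj_on J (I \<rightarrow>\<^sub>E UNIV)" by blast
  from card_of_Times_same_infinite[OF assms(1)]
  obtain p :: "'v \<times> 'v \<Rightarrow> 'v" where p: "inj p"
    using card_of_ordIso[of "UNIV \<times> UNIV :: ('v \<times> 'v) set" "UNIV :: 'v set"]
    by (auto simp: bij_betw_def)
  have "inj_on (\<lambda>f. p (f i, J (restrict f I))) (insert i I \<rightarrow>\<^sub>E UNIV)"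
  proof (rule inj_onI)
    fix f g :: "'i \<Rightarrow> 'v"
    assume f: "f \<in> insert i I \<rightarrow>\<^sub>E UNIV" and g: "g \<in> insert i I \<rightarrow>\<^sub>E UNIV"
      and eq: "p (f i, J (restrict f I)) = p (g i, J (restrict g I))"
    from eq p have 1: "f i = g i" and "J (restrict f I) = J (restrict g I)"
      by (auto dest: injD)
    with J have "restrict f I = restrict g I"
      by (auto dest: inj_onD)
    with 1 have "f x = g x" if "x \<in> insert i I" for x
      using that by (metis insertE restrict_apply')
    then show "f = g" by (rule PiE_ext[OF f g])
  qed
  then show ?case by blast
qed

lemma naturally_isomorphic_sym:
  assumes D: "is_category D" and F: "is_functor C D Fo Fm" and G: "is_functor C D Go Gm"
    and nat: "naturally_isomorphic C D Fo Fm Go Gm"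
  shows "naturally_isomorphic C D Go Gm Fo Fm"
proof -
  obtain t where t: "\<And>X. X \<in> Ob C \<Longrightarrow> is_iso D (Fo X) (Go X) (t X)"
    and nt: "\<And>X Y f. X \<in> Ob C \<Longrightarrow> Y \<in> Ob C \<Longrightarrow> f \<in> Hom C X Y \<Longrightarrow>
       Cmp D (Fo X) (Fo Y) (Go Y) (t Y) (Fm X Y f) = Cmp D (Fo X) (Go X) (Go Y) (Gm X Y f) (t X)"
    using nat unfolding naturally_isomorphic_def by blast
  have "\<forall>X\<in>Ob C. \<exists>s. s \<in> Hom D (Go X) (Fo X) \<and>
      Cmp D (Fo X) (Go X) (Fo X) s (t X) = Idn D (Fo X) \<and>
      Cmp D (Go X) (Fo X) (Go X) (t X) s = Idn D (Go X)"
    using t unfolding is_iso_def by blast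
  then obtain s where s: "\<And>X. X \<in> Ob C \<Longrightarrow> s X \<in> Hom D (Go X) (Fo X) \<and>
      Cmp D (Fo X) (Go X) (Fo X) (s X) (t X) = Idn D (Fo X) \<and>
      Cmp D (Go X) (Fo X) (Go X) (t X) (s X) = Idn D (Go X)"
    by (auto dest!: bchoice)
  have obF: "Fo X \<in> Ob D" and obG: "Go X \<in> Ob D" if "X \<in> Ob C" for X
    using that F G unfolding is_functor_def by blast+
  have hF: "Fm X Y f \<in> Hom D (Fo X) (Fo Y)" and hG: "Gm X Y f \<in> Hom D (Go X) (Go Y)"
    if "X \<in> Ob C" "Y \<in> Ob C" "f \<in> Hom C X Y" for X Y f
    using that F G unfolding is_functor_def by blast+
  have tH: "t X \<in> Hom D (Fo X) (Go X)" if "X \<in> Ob C" for X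
    using t[OF that] unfolding is_iso_def by blast
  have ass: "Cmp D W Y Z h (Cmp D W X Y g f) = Cmp D W X Z (Cmp D X Y Z h g) f"
    if "W\<in>Ob D" "X\<in>Ob D" "Y\<in>Ob D" "Z\<in>Ob D" "f\<in>Hom D W X" "g\<in>Hom D X Y" "h\<in>Hom D Y Z"
    for W X Y Z f g h
    using D that unfolding is_category_def by blast
  have unit: "Cmp D X X Y f (Idn D X) = f \<and> Cmp D X Y Y (Idn D Y) f = f"
    if "X\<in>Ob D" "Y\<in>Ob D" "f \<in> Hom D X Y" for X Y f
    using D that unfolding is_category_def by blast
  have cl: "Cmp D X Y Z g f \<in> Hom D X Z"
    if "X\<in>Ob D" "Y\<in>Ob D" "Z\<in>Ob D" "f \<in> Hom D X Y" "g \<in> Hom D Y Z" for X Y Z f g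
    using D that unfolding is_category_def by blast
  show ?thesis
    unfolding naturally_isomorphic_def
  proof (intro exI conjI ballI)
    fix X assume X: "X \<in> Ob C"
    show "is_iso D (Go X) (Fo X) (s X)"
      using s[OF X] tH[OF X] unfolding is_iso_def by blast
  next
    fix X Y f assume X: "X \<in> Ob C" and Y: "Y \<in> Ob C" and f: "f \<in> Hom C X Y"
    note o = obF[OF X] obF[OF Y] obG[OF X] obG[OF Y]
    note h = hF[OF X Y f] hG[OF X Y f] tH[OF X] tH[OF Y] s[OF X, THEN conjunct1] s[OF Y, THEN conjunct1]
    let ?f = "Fm X Y f" and ?g = "Gm X Y f"
    have "Cmp D (Go X) (Go Y) (Fo Y) (s Y) ?g
        = Cmp D (Go X) (Go Y) (Fo Y) (s Y) (Cmp D (Go X) (Go X) (Go Y) ?g (Idn D (Go X)))"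
      using unit o h by simp
    also have "\<dots> = Cmp D (Go X) (Go Y) (Fo Y) (s Y)
        (Cmp D (Go X) (Go X) (Go Y) ?g (Cmp D (Go X) (Fo X) (Go X) (t X) (s X)))"
      using s[OF X] by simp
    also have "\<dots> = Cmp D (Go X) (Go Y) (Fo Y) (s Y)
        (Cmp D (Go X) (Fo X) (Go Y) (Cmp D (Fo X) (Go X) (Go Y) ?g (t X)) (s X))"
      using ass o h by simp
    also have "\<dots> = Cmp D (Go X) (Go Y) (Fo Y) (s Y)
        (Cmp D (Go X) (Fo X) (Go Y) (Cmp D (Fo X) (Fo Y) (Go Y) (t Y) ?f) (s X))"
      using nt[OF X Y f] by simp
    also have "\<dots> = Cmp D (Go X) (Fo X) (Fo Y) (Cmp D (Fo X) (Fo Y) (Fo Y)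
        (Cmp D (Fo Y) (Go Y) (Fo Y) (s Y) (t Y)) ?f) (s X)"
      using ass o h cl by (smt (verit, best))
    also have "\<dots> = Cmp D (Go X) (Fo X) (Fo Y) ?f (s X)"
      using s[OF Y] unit o h by simp
    finally show "Cmp D (Go X) (Go Y) (Fo Y) (s Y) ?g = Cmp D (Go X) (Fo X) (Fo Y) ?f (s X)" .
  qed
qed

lemma left_module_hom_compose:
  assumes "left_module R L" "left_module R M" "f \<in> left_module_hom R L M" "g \<in> left_module_hom R M N"
  shows "compose (carrier L) g f \<in> left_module_hom R L N"
proof -
  interpret L: left_module R L by fact
  interpret M: left_module R M by fact
  show ?thesis
    using assms(3,4) unfolding left_module_hom_def
    by (auto simp: compose_def L.smult_closed M.smult_closed Pi_iff PiE_iff)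
qed

lemma left_module_hom_id:
  assumes "left_module R M"
  shows "(\<lambda>x\<in>carrier M. x) \<in> left_module_hom R M M"
proof -
  interpret M: left_module R M by fact
  show ?thesis unfolding left_module_hom_def by (auto simp: M.smult_closed)
qed

lemma left_module_category_is_category: "is_category (left_module_category TYPE('v) R)"
  unfolding is_category_def left_module_category_def
proof (simp, intro conjI ballI allI impI, goal_cases)
  case (1 X) then show ?case by (simp add: left_module_hom_id)
next
  case (2 X Y Z f g) then show ?case by (blast intro: left_module_hom_compose)
next
  case (3 X Y f)
  then show ?case unfolding left_module_hom_def compose_def PiE_def extensional_def by (auto simp: fun_eq_iff)
next
  case (4 X Y f)
  then show ?case unfolding left_module_hom_def compose_def PiE_def extensional_def
    by (auto simp: fun_eq_iff)
next
  case (5 W X Y Z f g h)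
  then show ?case unfolding left_module_hom_def compose_def PiE_def extensional_def
    by (auto simp: fun_eq_iff)
qed

text \<open>The inverse of a bijective homomorphism is linear, so it serves as the inverse morphism.\<close>

lemma left_module_hom_bij_is_iso:
  assumes M: "left_module R M" and N: "left_module R N" and f: "f \<in> left_module_hom R M N"
    and bij: "bij_betw f (carrier M) (carrier N)"
  shows "is_iso (left_module_category TYPE('v) R) M N f"
proof -
  interpret M: left_module R M by fact
  interpret N: left_module R N by fact
  define g where "g = (\<lambda>y\<in>carrier N. inv_into (carrier M) f y)"
  have fim: "f x \<in> carrier N" if "x \<in> carrier M" for x using f that unfolding left_module_hom_def by blast
  have g1: "g y \<in> carrier M" "f (g y) = y" if "y \<in> carrier N" for y
    using that bij unfolding g_def bij_betw_def by (auto intro: inv_into_into f_inv_into_f)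
  have g2: "g (f x) = x" if "x \<in> carrier M" for x
    using that bij fim unfolding g_def bij_betw_def by auto
  have fadd: "f (x \<oplus>\<^bsub>M\<^esub> y) = f x \<oplus>\<^bsub>N\<^esub> f y" if "x \<in> carrier M" "y \<in> carrier M" for x y
    using f that unfolding left_module_hom_def by blast
  have fsm: "f (r \<odot>\<^bsub>M\<^esub> x) = r \<odot>\<^bsub>N\<^esub> f x" if "r \<in> carrier R" "x \<in> carrier M" for x r
    using f that unfolding left_module_hom_def by blast
  have "g \<in> left_module_hom R N M"
    unfolding left_module_hom_def mem_Collect_eq
  proof (intro conjI ballI)
    show "g \<in> carrier N \<rightarrow>\<^sub>E carrier M" using g1 by (auto simp: g_def)
  next
    fix x y assume "x \<in> carrier N" "y \<in> carrier N"
    then show "g (x \<oplus>\<^bsub>N\<^esub> y) = g x \<oplus>\<^bsub>M\<^esub> g y"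
      using fadd[of "g x" "g y"] g1 g2[of "g x \<oplus>\<^bsub>M\<^esub> g y"] by simp
  next
    fix r x assume "r \<in> carrier R" "x \<in> carrier N"
    then show "g (r \<odot>\<^bsub>N\<^esub> x) = r \<odot>\<^bsub>M\<^esub> g x"
      using fsm[of r "g x"] g1 g2[of "r \<odot>\<^bsub>M\<^esub> g x"] by (simp add: M.smult_closed)
  qed
  then show ?thesis
    unfolding is_iso_def left_module_category_def
    using f g1 g2 by (auto simp: compose_def fun_eq_iff intro!: bexI[of _ g])
qed

lemma product_category_is_category:
  assumes "\<And>i. i \<in> I \<Longrightarrow> is_category (C i)"
  shows "is_category (product_category I C)"
proof -
  note a = assms[unfolded is_category_def]
  show ?thesis
    unfolding is_category_def product_category_def
  proof (simp, intro conjI ballI allI impI, goal_cases)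
    case (1 X) then show ?case using a by (auto simp: PiE_iff)
  next
    case (2 X Y Z f g) then show ?case using a by (simp add: PiE_iff)
  next
    case (3 X Y f)
    have "\<And>i. i \<in> I \<Longrightarrow> Cmp (C i) (X i) (X i) (Y i) (f i) (Idn (C i) (X i)) = f i"
      using 3 a by (simp add: PiE_iff)
    then show ?case using 3 by (auto simp: fun_eq_iff PiE_iff extensional_def)
  next
    case (4 X Y f)
    have "\<And>i. i \<in> I \<Longrightarrow> Cmp (C i) (X i) (Y i) (Y i) (Idn (C i) (Y i)) (f i) = f i"
      using 4 a by (simp add: PiE_iff)
    then show ?case using 4 by (auto simp: fun_eq_iff PiE_iff extensional_def)
  next
    case (5 W X Y Z f g h)
    have "\<And>i. i \<in> I \<Longrightarrow> Cmp (C i) (W i) (Y i) (Z i) (h i) (Cmp (C i) (W i) (X i) (Y i) (g i) (f i))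
        = Cmp (C i) (W i) (X i) (Z i) (Cmp (C i) (X i) (Y i) (Z i) (h i) (g i)) (f i)"
    proof -
      fix i assume i: "i \<in> I"
      have "\<forall>W\<in>Ob (C i). \<forall>X\<in>Ob (C i). \<forall>Y\<in>Ob (C i). \<forall>Z\<in>Ob (C i).
       \<forall>f\<in>Hom (C i) W X. \<forall>g\<in>Hom (C i) X Y. \<forall>h\<in>Hom (C i) Y Z.
       Cmp (C i) W Y Z h (Cmp (C i) W X Y g f) = Cmp (C i) W X Z (Cmp (C i) X Y Z h g) f"
        using a[OF i] by blast
      then show "Cmp (C i) (W i) (Y i) (Z i) (h i) (Cmp (C i) (W i) (X i) (Y i) (g i) (f i))
        = Cmp (C i) (W i) (X i) (Z i) (Cmp (C i) (X i) (Y i) (Z i) (h i) (g i)) (f i)"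
        using 5 i by (simp add: PiE_iff)
    qed
    then show ?case by (auto simp: fun_eq_iff)
  qed
qed


context left_module
begin

lemma smult_r_null: "r \<in> carrier R \<Longrightarrow> r \<odot>\<^bsub>M\<^esub> \<zero>\<^bsub>M\<^esub> = \<zero>\<^bsub>M\<^esub>"
  using smult_r_distr[of r "\<zero>\<^bsub>M\<^esub>" "\<zero>\<^bsub>M\<^esub>"] smult_closed[of r "\<zero>\<^bsub>M\<^esub>"]
  by (metis M.add.r_cancel_one' M.l_zero M.zero_closed)

lemma smult_l_null: "x \<in> carrier M \<Longrightarrow> \<zero>\<^bsub>R\<^esub> \<odot>\<^bsub>M\<^esub> x = \<zero>\<^bsub>M\<^esub>"
  using smult_l_distr[of "\<zero>\<^bsub>R\<^esub>" "\<zero>\<^bsub>R\<^esub>" x] smult_closed[of "\<zero>\<^bsub>R\<^esub>" x]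
  by (metis M.add.r_cancel_one' R.l_zero R.zero_closed)

lemma smult_minus: "r \<in> carrier R \<Longrightarrow> x \<in> carrier M \<Longrightarrow> r \<odot>\<^bsub>M\<^esub> (\<ominus>\<^bsub>M\<^esub> x) = \<ominus>\<^bsub>M\<^esub> (r \<odot>\<^bsub>M\<^esub> x)"
  using smult_r_distr[of r "\<ominus>\<^bsub>M\<^esub> x" x] smult_r_null[of r]
  by (metis M.a_inv_closed M.l_neg M.minus_equality smult_closed)

lemma finsum_smult_l:
  assumes "finite A" "f \<in> A \<rightarrow> carrier R" "x \<in> carrier M"
  shows "(\<Oplus>\<^bsub>R\<^esub>i\<in>A. f i) \<odot>\<^bsub>M\<^esub> x = (\<Oplus>\<^bsub>M\<^esub>i\<in>A. f i \<odot>\<^bsub>M\<^esub> x)"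
  using assms
proof (induction A)
  case (insert a A)
  then have "f \<in> A \<rightarrow> carrier R" "f a \<in> carrier R" by auto
  then show ?case using insert by (simp add: smult_l_distr Pi_iff smult_closed)
qed (simp add: smult_l_null)

lemma smult_finsum:
  assumes "finite A" "f \<in> A \<rightarrow> carrier M" "r \<in> carrier R"
  shows "r \<odot>\<^bsub>M\<^esub> (\<Oplus>\<^bsub>M\<^esub>i\<in>A. f i) = (\<Oplus>\<^bsub>M\<^esub>i\<in>A. r \<odot>\<^bsub>M\<^esub> f i)"
  using assms
proof (induction A)
  case (insert a A)
  then have "f \<in> A \<rightarrow> carrier M" "f a \<in> carrier M" by auto
  then show ?case using insert by (simp add: smult_r_distr Pi_iff smult_closed)
qed (simp add: smult_r_null)

end

text \<open>Let \<open>e\<^sub>i \<in> R\<close> be the element that the ring homomorphisms \<open>\<Phi>\<^sub>j\<close> send to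
  \<open>\<delta>\<^sub>i\<^sub>j\<close>.  An \<open>R\<close>-module \<open>M\<close> decomposes into its components \<open>e\<^sub>i M \<subseteq> M\<close>, which are
  \<open>S\<close>-modules.  In the other direction a family of \<open>S\<close>-modules is assembled into the product of the
  underlying sets, on which \<open>R\<close> acts through the \<open>\<Phi>\<^sub>i\<close>.  Since the objects of the category have
  their underlying sets inside the universe \<open>'v\<close>, that product has to be moved into \<open>'v\<close> by an
  injection; this is where the infinitude of \<open>'v\<close> enters.\<close>

locale ring_product =
  fixes R :: "('r, 'x) ring_scheme" and S :: "('s, 'y) ring_scheme"
    and I :: "'i set" and \<Phi> :: "'i \<Rightarrow> 'r \<Rightarrow> 's" and vtype :: "'v itself"
  assumes R: "ring R" and S: "ring S" and finI: "finite I"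
    and \<Phi>: "\<And>i. i \<in> I \<Longrightarrow> \<Phi> i \<in> ring_hom R S"
    and joint_inj: "\<And>r. r \<in> carrier R \<Longrightarrow> (\<And>i. i \<in> I \<Longrightarrow> \<Phi> i r = \<zero>\<^bsub>S\<^esub>) \<Longrightarrow> r = \<zero>\<^bsub>R\<^esub>"
    and joint_surj: "\<And>i s. i \<in> I \<Longrightarrow> s \<in> carrier S \<Longrightarrow>
        \<exists>r\<in>carrier R. \<Phi> i r = s \<and> (\<forall>j\<in>I - {i}. \<Phi> j r = \<zero>\<^bsub>S\<^esub>)"
    and infv: "infinite (UNIV :: 'v set)"
begin

sublocale R: ring R by (rule R)
sublocale S: ring S by (rule S)

text \<open>The preimage of \<open>s\<close> under the \<open>i\<close>-th projection that lies in the
  \<open>i\<close>-th factor of the product.\<close>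

definition lift1 :: "'i \<Rightarrow> 's \<Rightarrow> 'r" where
  "lift1 i s = (SOME r. r \<in> carrier R \<and> \<Phi> i r = s \<and> (\<forall>j\<in>I - {i}. \<Phi> j r = \<zero>\<^bsub>S\<^esub>))"

lemma lift1:
  assumes "i \<in> I" "s \<in> carrier S"
  shows "lift1 i s \<in> carrier R" "\<Phi> i (lift1 i s) = s" "\<And>j. j \<in> I \<Longrightarrow> j \<noteq> i \<Longrightarrow> \<Phi> j (lift1 i s) = \<zero>\<^bsub>S\<^esub>"
proof -
  have "\<exists>r. r \<in> carrier R \<and> \<Phi> i r = s \<and> (\<forall>j\<in>I - {i}. \<Phi> j r = \<zero>\<^bsub>S\<^esub>)"
    using joint_surj[OF assms] by blast
  from someI_ex[OF this, folded lift1_def]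
  show "lift1 i s \<in> carrier R" "\<Phi> i (lift1 i s) = s" "\<And>j. j \<in> I \<Longrightarrow> j \<noteq> i \<Longrightarrow> \<Phi> j (lift1 i s) = \<zero>\<^bsub>S\<^esub>"
    by auto
qed

lemma \<Phi>_simps [simp]:
  assumes "i \<in> I"
  shows "r \<in> carrier R \<Longrightarrow> \<Phi> i r \<in> carrier S"
    "r \<in> carrier R \<Longrightarrow> r' \<in> carrier R \<Longrightarrow> \<Phi> i (r \<oplus>\<^bsub>R\<^esub> r') = \<Phi> i r \<oplus>\<^bsub>S\<^esub> \<Phi> i r'"
    "r \<in> carrier R \<Longrightarrow> r' \<in> carrier R \<Longrightarrow> \<Phi> i (r \<otimes>\<^bsub>R\<^esub> r') = \<Phi> i r \<otimes>\<^bsub>S\<^esub> \<Phi> i r'"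
    "\<Phi> i \<one>\<^bsub>R\<^esub> = \<one>\<^bsub>S\<^esub>" "\<Phi> i \<zero>\<^bsub>R\<^esub> = \<zero>\<^bsub>S\<^esub>"
    "r \<in> carrier R \<Longrightarrow> \<Phi> i (\<ominus>\<^bsub>R\<^esub> r) = \<ominus>\<^bsub>S\<^esub> \<Phi> i r"
proof -
  interpret h: ring_hom_ring R S "\<Phi> i"
    using \<Phi>[OF assms] by (intro ring_hom_ringI2) (auto intro: R S)
  show "r \<in> carrier R \<Longrightarrow> \<Phi> i r \<in> carrier S"
    "r \<in> carrier R \<Longrightarrow> r' \<in> carrier R \<Longrightarrow> \<Phi> i (r \<oplus>\<^bsub>R\<^esub> r') = \<Phi> i r \<oplus>\<^bsub>S\<^esub> \<Phi> i r'"
    "r \<in> carrier R \<Longrightarrow> r' \<in> carrier R \<Longrightarrow> \<Phi> i (r \<otimes>\<^bsub>R\<^esub> r') = \<Phi> i r \<otimes>\<^bsub>S\<^esub> \<Phi> i r'"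
    "\<Phi> i \<one>\<^bsub>R\<^esub> = \<one>\<^bsub>S\<^esub>" "\<Phi> i \<zero>\<^bsub>R\<^esub> = \<zero>\<^bsub>S\<^esub>"
    "r \<in> carrier R \<Longrightarrow> \<Phi> i (\<ominus>\<^bsub>R\<^esub> r) = \<ominus>\<^bsub>S\<^esub> \<Phi> i r" by auto
qed

lemma joint_eqI:
  assumes "r \<in> carrier R" "r' \<in> carrier R" "\<And>i. i \<in> I \<Longrightarrow> \<Phi> i r = \<Phi> i r'"
  shows "r = r'"
proof -
  have "r \<ominus>\<^bsub>R\<^esub> r' = \<zero>\<^bsub>R\<^esub>"
    by (rule joint_inj) (use assms in \<open>auto simp: a_minus_def S.r_neg\<close>)
  moreover have "r = (r \<ominus>\<^bsub>R\<^esub> r') \<oplus>\<^bsub>R\<^esub> r'"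
    using assms by (simp add: a_minus_def R.a_assoc R.l_neg)
  ultimately show ?thesis using assms by simp
qed

lemma lift1_hom:
  assumes i: "i \<in> I" and s: "s \<in> carrier S" "t \<in> carrier S"
  shows "lift1 i (s \<oplus>\<^bsub>S\<^esub> t) = lift1 i s \<oplus>\<^bsub>R\<^esub> lift1 i t"
    and "lift1 i (s \<otimes>\<^bsub>S\<^esub> t) = lift1 i s \<otimes>\<^bsub>R\<^esub> lift1 i t"
proof -
  note l = lift1[OF i s(1)] lift1[OF i s(2)] lift1[OF i S.a_closed[OF s]] lift1[OF i S.m_closed[OF s]]
  show "lift1 i (s \<oplus>\<^bsub>S\<^esub> t) = lift1 i s \<oplus>\<^bsub>R\<^esub> lift1 i t"
    by (rule joint_eqI) (use l i in \<open>auto, (metis S.r_zero S.zero_closed \<Phi>_simps(2) l)?\<close>)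
  show "lift1 i (s \<otimes>\<^bsub>S\<^esub> t) = lift1 i s \<otimes>\<^bsub>R\<^esub> lift1 i t"
    by (rule joint_eqI) (use l i in \<open>auto, (metis S.r_null S.zero_closed \<Phi>_simps(3) l)?\<close>)
qed

text \<open>The \<open>i\<close>-th factor is a two-sided ideal on which \<open>R\<close> acts through \<open>\<Phi>
  i\<close>; all projections agree on both sides.\<close>

lemma lift1_slide:
  assumes i: "i \<in> I" and r: "r \<in> carrier R" and s: "s \<in> carrier S"
  shows "r \<otimes>\<^bsub>R\<^esub> lift1 i s = lift1 i (\<Phi> i r \<otimes>\<^bsub>S\<^esub> s)" "lift1 i s \<otimes>\<^bsub>R\<^esub> r = lift1 i (s \<otimes>\<^bsub>S\<^esub> \<Phi> i r)"
proof -
  have c: "\<Phi> i r \<otimes>\<^bsub>S\<^esub> s \<in> carrier S" "s \<otimes>\<^bsub>S\<^esub> \<Phi> i r \<in> carrier S" using i r s by auto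
  note l = lift1[OF i s] lift1[OF i c(1)] lift1[OF i c(2)]
  show "r \<otimes>\<^bsub>R\<^esub> lift1 i s = lift1 i (\<Phi> i r \<otimes>\<^bsub>S\<^esub> s)"
  proof (rule joint_eqI)
    fix j assume "j \<in> I" then show "\<Phi> j (r \<otimes>\<^bsub>R\<^esub> lift1 i s) = \<Phi> j (lift1 i (\<Phi> i r \<otimes>\<^bsub>S\<^esub> s))"
      using l i r s by (cases "j = i") auto
  qed (use l r in auto)
  show "lift1 i s \<otimes>\<^bsub>R\<^esub> r = lift1 i (s \<otimes>\<^bsub>S\<^esub> \<Phi> i r)"
  proof (rule joint_eqI)
    fix j assume "j \<in> I" then show "\<Phi> j (lift1 i s \<otimes>\<^bsub>R\<^esub> r) = \<Phi> j (lift1 i (s \<otimes>\<^bsub>S\<^esub> \<Phi> i r))"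
      using l i r s by (cases "j = i") auto
  qed (use l r in auto)
qed

abbreviation e :: "'i \<Rightarrow> 'r" where "e i \<equiv> lift1 i \<one>\<^bsub>S\<^esub>"

lemma e_sum: "(\<Oplus>\<^bsub>R\<^esub>i\<in>I. e i) = \<one>\<^bsub>R\<^esub>"
proof (rule joint_eqI)
  have c: "e \<in> I \<rightarrow> carrier R" using lift1 by auto
  show "(\<Oplus>\<^bsub>R\<^esub>i\<in>I. e i) \<in> carrier R" using c by simp
  fix j assume j: "j \<in> I"
  have "\<Phi> j (\<Oplus>\<^bsub>R\<^esub>i\<in>A. e i) = (if j \<in> A then \<one>\<^bsub>S\<^esub> else \<zero>\<^bsub>S\<^esub>)" if "A \<subseteq> I" for A
    using finite_subset[OF that finI] that
  proof (induction A)
    case (insert i A)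
    have "e \<in> A \<rightarrow> carrier R" "e i \<in> carrier R" using c insert by auto
    then show ?case using insert j lift1(2,3)[of i "\<one>\<^bsub>S\<^esub>"] by auto
  qed (simp add: j)
  then show "\<Phi> j (\<Oplus>\<^bsub>R\<^esub>i\<in>I. e i) = \<Phi> j \<one>\<^bsub>R\<^esub>" using j by simp
qed simp

definition component :: "'i \<Rightarrow> ('r, 'v) module \<Rightarrow> ('s, 'v) module" where
  "component i M = \<lparr>carrier = {x \<in> carrier M. e i \<odot>\<^bsub>M\<^esub> x = x}, monoid.mult = undefined,
     one = undefined, ring.zero = \<zero>\<^bsub>M\<^esub>, add = (\<oplus>\<^bsub>M\<^esub>), smult = (\<lambda>s x. lift1 i s \<odot>\<^bsub>M\<^esub> x)\<rparr>"

lemma component_simps: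
  "\<zero>\<^bsub>component i M\<^esub> = \<zero>\<^bsub>M\<^esub>" "x \<oplus>\<^bsub>component i M\<^esub> y = x \<oplus>\<^bsub>M\<^esub> y"
  "s \<odot>\<^bsub>component i M\<^esub> x = lift1 i s \<odot>\<^bsub>M\<^esub> x"
  by (simp_all add: component_def)

lemma component_module:
  assumes i: "i \<in> I" and M: "left_module R M"
  shows "left_module S (component i M)"
proof -
  interpret M: left_module R M by (rule M)
  note l = lift1(1)[OF i] lift1_hom[OF i] lift1(2)[OF i]
  have "abelian_group (component i M)"
  proof (rule abelian_groupI, goal_cases)
    case (6 x)
    then show ?case using l by (intro bexI[of _ "\<ominus>\<^bsub>M\<^esub> x"])
      (auto simp: component_def M.smult_minus M.l_neg)
  qed (use l in \<open>auto simp: component_def M.smult_r_distr M.smult_r_null M.a_ac M.smult_closed\<close>)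
  moreover have "lift1 i s \<odot>\<^bsub>M\<^esub> x \<in> carrier (component i M)" if "s \<in> carrier S" "x \<in> carrier M" for s x
    using that l(1) l(3)[of "\<one>\<^bsub>S\<^esub>" s, symmetric] l(4)
    by (simp add: component_def M.smult_closed M.smult_assoc1[symmetric])
  ultimately show ?thesis
    unfolding left_module_def left_module_axioms_def using l S
    by (auto simp: component_def M.smult_l_distr M.smult_r_distr M.smult_assoc1)
qed

definition pack :: "('i \<Rightarrow> 'v) \<Rightarrow> 'v" where
  "pack = (SOME J. inj_on J (I \<rightarrow>\<^sub>E UNIV))"

definition unpack :: "'v \<Rightarrow> 'i \<Rightarrow> 'v" where
  "unpack = inv_into (I \<rightarrow>\<^sub>E UNIV) pack"

lemma unpack_pack: "f \<in> extensional I \<Longrightarrow> unpack (pack f) = f"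
  using someI_ex[OF inj_power_into_infinite[OF infv finI], folded pack_def]
  unfolding unpack_def by (intro inv_into_f_f) (auto simp: PiE_def)

lemma unpack_pack_restrict [simp]: "unpack (pack (\<lambda>i\<in>I. f i)) = (\<lambda>i\<in>I. f i)"
  by (rule unpack_pack) simp

definition assemble :: "('i \<Rightarrow> ('s, 'v) module) \<Rightarrow> ('r, 'v) module" where
  "assemble N = \<lparr>carrier = pack ` (\<Pi>\<^sub>E i\<in>I. carrier (N i)), monoid.mult = undefined,
     one = undefined, ring.zero = pack (\<lambda>i\<in>I. \<zero>\<^bsub>N i\<^esub>),
     add = (\<lambda>x y. pack (\<lambda>i\<in>I. unpack x i \<oplus>\<^bsub>N i\<^esub> unpack y i)),
     smult = (\<lambda>r x. pack (\<lambda>i\<in>I. \<Phi> i r \<odot>\<^bsub>N i\<^esub> unpack x i))\<rparr>"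

lemma assemble_carrierE:
  assumes "x \<in> carrier (assemble N)"
  shows "x = pack (\<lambda>i\<in>I. unpack x i)" "\<And>i. i \<in> I \<Longrightarrow> unpack x i \<in> carrier (N i)"
    "unpack x \<in> (\<Pi>\<^sub>E i\<in>I. carrier (N i))"
proof -
  obtain f where f: "f \<in> (\<Pi>\<^sub>E i\<in>I. carrier (N i))" "x = pack f"
    using assms by (auto simp: assemble_def)
  then have "unpack x = f" by (simp add: unpack_pack PiE_def)
  moreover have "(\<lambda>i\<in>I. f i) = f" using f(1) by (simp add: PiE_def extensional_restrict)
  ultimately show "x = pack (\<lambda>i\<in>I. unpack x i)" "\<And>i. i \<in> I \<Longrightarrow> unpack x i \<in> carrier (N i)"
    "unpack x \<in> (\<Pi>\<^sub>E i\<in>I. carrier (N i))"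
    using f by auto
qed

lemma assemble_carrierI:
  "(\<And>i. i \<in> I \<Longrightarrow> f i \<in> carrier (N i)) \<Longrightarrow> pack (\<lambda>i\<in>I. f i) \<in> carrier (assemble N)"
  by (auto simp: assemble_def)

lemma assemble_eqI:
  assumes "x \<in> carrier (assemble N)" "y \<in> carrier (assemble N)" "\<And>i. i \<in> I \<Longrightarrow> unpack x i = unpack y i"
  shows "x = y"
proof -
  have "(\<lambda>i\<in>I. unpack x i) = (\<lambda>i\<in>I. unpack y i)" using assms(3) by (auto intro: restrict_ext)
  then show ?thesis using assemble_carrierE(1)[OF assms(1)] assemble_carrierE(1)[OF assms(2)] by simp
qed

lemma assemble_simps:
  "\<zero>\<^bsub>assemble N\<^esub> = pack (\<lambda>i\<in>I. \<zero>\<^bsub>N i\<^esub>)"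
  "x \<oplus>\<^bsub>assemble N\<^esub> y = pack (\<lambda>i\<in>I. unpack x i \<oplus>\<^bsub>N i\<^esub> unpack y i)"
  "r \<odot>\<^bsub>assemble N\<^esub> x = pack (\<lambda>i\<in>I. \<Phi> i r \<odot>\<^bsub>N i\<^esub> unpack x i)"
  by (simp_all add: assemble_def)

lemma assemble_module:
  assumes N: "\<And>i. i \<in> I \<Longrightarrow> left_module S (N i)"
  shows "left_module R (assemble N)"
proof -
  note u = assemble_carrierE(2)
  note g = abelian_groupE[OF left_module.axioms(2)[OF N]]
  note lm = left_module.smult_closed[OF N] left_module.smult_l_distr[OF N]
    left_module.smult_r_distr[OF N] left_module.smult_assoc1[OF N] left_module.smult_one[OF N]
  have ag: "abelian_group (assemble N)"
  proof (rule abelian_groupI, goal_cases)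
    case (1 x y) then show ?case
      unfolding assemble_simps by (intro assemble_carrierI) (auto intro: g u)
  next
    case 2 then show ?case
      unfolding assemble_simps by (intro assemble_carrierI) (auto intro: g)
  next
    case (3 x y z) then show ?case
      unfolding assemble_simps by (auto intro!: arg_cong[of _ _ pack] g dest: u simp: fun_eq_iff)
  next
    case (4 x y) then show ?case
      unfolding assemble_simps by (auto intro!: arg_cong[of _ _ pack] g dest: u simp: fun_eq_iff)
  next
    case (5 x)
    have "pack (\<lambda>i\<in>I. unpack (pack (\<lambda>i\<in>I. \<zero>\<^bsub>N i\<^esub>)) i \<oplus>\<^bsub>N i\<^esub> unpack x i) = pack (\<lambda>i\<in>I. unpack x i)"
      using u[OF 5] by (auto intro!: arg_cong[of _ _ pack] g simp: fun_eq_iff)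
    then show ?case unfolding assemble_simps using assemble_carrierE(1)[OF 5] by simp
  next
    case (6 x)
    show ?case
    proof (rule bexI[of _ "pack (\<lambda>i\<in>I. \<ominus>\<^bsub>N i\<^esub> unpack x i)"])
      have "\<ominus>\<^bsub>N i\<^esub> unpack x i \<in> carrier (N i) \<and> \<ominus>\<^bsub>N i\<^esub> unpack x i \<oplus>\<^bsub>N i\<^esub> unpack x i = \<zero>\<^bsub>N i\<^esub>" if "i \<in> I" for i
        using left_module.axioms(2)[OF N[OF that]] u[OF 6 that]
        by (simp add: abelian_group.l_neg abelian_group.a_inv_closed)
      then show "pack (\<lambda>i\<in>I. \<ominus>\<^bsub>N i\<^esub> unpack x i) \<oplus>\<^bsub>assemble N\<^esub> x = \<zero>\<^bsub>assemble N\<^esub>"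
        "pack (\<lambda>i\<in>I. \<ominus>\<^bsub>N i\<^esub> unpack x i) \<in> carrier (assemble N)"
        unfolding assemble_simps by (auto intro!: arg_cong[of _ _ pack] assemble_carrierI simp: fun_eq_iff)
    qed
  qed
  show ?thesis
  proof (intro left_module.intro left_module_axioms.intro R ag, goal_cases)
    case (1 a x) then show ?case
      unfolding assemble_simps by (intro assemble_carrierI) (auto intro: lm u)
  next
    case (2 a b x) then show ?case
      unfolding assemble_simps by (auto intro!: arg_cong[of _ _ pack] lm dest: u simp: fun_eq_iff)
  next
    case (3 a x y) then show ?case
      unfolding assemble_simps by (auto intro!: arg_cong[of _ _ pack] lm dest: u simp: fun_eq_iff)
  next
    case (4 a b x) then show ?case
      unfolding assemble_simps by (auto intro!: arg_cong[of _ _ pack] lm dest: u simp: fun_eq_iff)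
  next
    case (5 x)
    have "pack (\<lambda>i\<in>I. \<Phi> i \<one>\<^bsub>R\<^esub> \<odot>\<^bsub>N i\<^esub> unpack x i) = pack (\<lambda>i\<in>I. unpack x i)"
      using u[OF 5] by (auto intro!: arg_cong[of _ _ pack] lm simp: fun_eq_iff)
    then show ?case unfolding assemble_simps using assemble_carrierE(1)[OF 5] by simp
  qed
qed

abbreviation CR where "CR \<equiv> left_module_category TYPE('v) R"
abbreviation CS where "CS \<equiv> left_module_category TYPE('v) S"
abbreviation CP where "CP \<equiv> product_category I (\<lambda>_. CS)"

definition Fo where "Fo M = (\<lambda>i\<in>I. component i M)"
definition Fm where "Fm M (N :: ('r, 'v) module) f = (\<lambda>i\<in>I. restrict f (carrier (component i M)))"
definition Gm where
  "Gm N (N' :: 'i \<Rightarrow> ('s, 'v) module) f = (\<lambda>x\<in>carrier (assemble N). pack (\<lambda>i\<in>I. f i (unpack x i)))"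

lemma CP_simps:
  "N \<in> Ob CP \<longleftrightarrow> N \<in> extensional I \<and> (\<forall>i\<in>I. left_module S (N i))"
  "f \<in> Hom CP N N' \<longleftrightarrow> f \<in> extensional I \<and> (\<forall>i\<in>I. f i \<in> left_module_hom S (N i) (N' i))"
  "Cmp CP X Y Z g f = (\<lambda>i\<in>I. compose (carrier (X i)) (g i) (f i))"
  "Idn CP X = (\<lambda>i\<in>I. \<lambda>x\<in>carrier (X i). x)"
  by (auto simp: product_category_def left_module_category_def PiE_iff)

lemma CR_simps:
  "M \<in> Ob CR \<longleftrightarrow> left_module R M"
  "f \<in> Hom CR M N \<longleftrightarrow> f \<in> left_module_hom R M N"
  "Cmp CR X Y Z g f = compose (carrier X) g f"
  "Idn CR X = (\<lambda>x\<in>carrier X. x)"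
  by (auto simp: left_module_category_def)

lemma CS_simps:
  "f \<in> Hom CS M N \<longleftrightarrow> f \<in> left_module_hom S M N"
  "Cmp CS X Y Z g f = compose (carrier X) g f"
  "Idn CS X = (\<lambda>x\<in>carrier X. x)"
  by (auto simp: left_module_category_def)

lemma hom_component:
  assumes i: "i \<in> I" and M: "left_module R M" and N: "left_module R N" and f: "f \<in> left_module_hom R M N"
  shows "restrict f (carrier (component i M)) \<in> left_module_hom S (component i M) (component i N)"
proof -
  interpret M: left_module R M by (rule M)
  interpret C: left_module S "component i M" by (rule component_module[OF i M])
  have f1: "f x \<in> carrier N" if "x \<in> carrier M" for x using f that unfolding left_module_hom_def by blast
  have f2: "f (x \<oplus>\<^bsub>M\<^esub> y) = f x \<oplus>\<^bsub>N\<^esub> f y" if "x \<in> carrier M" "y \<in> carrier M" for x y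
    using f that unfolding left_module_hom_def by blast
  have f3: "f (r \<odot>\<^bsub>M\<^esub> x) = r \<odot>\<^bsub>N\<^esub> f x" if "r \<in> carrier R" "x \<in> carrier M" for x r
    using f that unfolding left_module_hom_def by blast
  have sub: "x \<in> carrier M \<and> e i \<odot>\<^bsub>M\<^esub> x = x" if "x \<in> carrier (component i M)" for x
    using that by (simp add: component_def)
  have e: "e i \<in> carrier R" using lift1(1)[OF i] by simp
  show ?thesis
    unfolding left_module_hom_def mem_Collect_eq
  proof (intro conjI ballI)
    have "f x \<in> carrier (component i N)" if "x \<in> carrier (component i M)" for x
      using sub[OF that] f1 f3[of "e i" x] e by (simp add: component_def)
    then show "restrict f (carrier (component i M)) \<in> carrier (component i M) \<rightarrow>\<^sub>E carrier (component i N)"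
      by auto
  next
    fix x y assume xy: "x \<in> carrier (component i M)" "y \<in> carrier (component i M)"
    have "x \<oplus>\<^bsub>M\<^esub> y \<in> carrier (component i M)" using C.M.a_closed[OF xy] by (simp add: component_def)
    then show "restrict f (carrier (component i M)) (x \<oplus>\<^bsub>component i M\<^esub> y) =
      restrict f (carrier (component i M)) x \<oplus>\<^bsub>component i N\<^esub> restrict f (carrier (component i M)) y"
      using xy f2[of x y] sub[OF xy(1)] sub[OF xy(2)] by (simp add: component_simps)
  next
    fix s x assume s: "s \<in> carrier S" and x: "x \<in> carrier (component i M)"
    have "lift1 i s \<odot>\<^bsub>M\<^esub> x \<in> carrier (component i M)"
      using C.smult_closed[OF s x] by (simp add: component_def)
    then show "restrict f (carrier (component i M)) (s \<odot>\<^bsub>component i M\<^esub> x) =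
      s \<odot>\<^bsub>component i N\<^esub> restrict f (carrier (component i M)) x"
      using x s f3[of "lift1 i s" x] sub[OF x] lift1(1)[OF i s] by (simp add: component_simps)
  qed
qed

lemma functor_F: "is_functor CR CP Fo Fm"
  unfolding is_functor_def
proof (intro conjI ballI, goal_cases)
  case (1 X) then show ?case by (simp add: CR_simps CP_simps Fo_def component_module)
next
  case (2 X Y f) then show ?case by (simp add: CR_simps CP_simps Fo_def Fm_def hom_component)
next
  case (3 X) then show ?case
    by (auto simp: CR_simps CP_simps Fo_def Fm_def fun_eq_iff component_def)
next
  case (4 X Y Z f g)
  have "f x \<in> carrier (component i Y)" if "i \<in> I" "x \<in> carrier (component i X)" for i x
    using hom_component[of i X Y f] 4 that by (auto simp: CR_simps left_module_hom_def)
  moreover have "carrier (component i X) \<subseteq> carrier X" for i by (auto simp: component_def)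
  ultimately show ?case
    by (auto simp: CR_simps CP_simps Fo_def Fm_def compose_def fun_eq_iff)
qed

lemma hom_assemble:
  assumes N: "\<And>i. i \<in> I \<Longrightarrow> left_module S (N i)" "\<And>i. i \<in> I \<Longrightarrow> left_module S (N' i)"
    and f: "\<And>i. i \<in> I \<Longrightarrow> f i \<in> left_module_hom S (N i) (N' i)"
  shows "Gm N N' f \<in> left_module_hom R (assemble N) (assemble N')"
proof -
  interpret A: left_module R "assemble N" by (rule assemble_module[OF N(1)])
  have f1: "f i x \<in> carrier (N' i)" if "i \<in> I" "x \<in> carrier (N i)" for x i
    using f[OF that(1)] that(2) unfolding left_module_hom_def by blast
  have f2: "f i (x \<oplus>\<^bsub>N i\<^esub> y) = f i x \<oplus>\<^bsub>N' i\<^esub> f i y" if "i \<in> I" "x \<in> carrier (N i)" "y \<in> carrier (N i)" for x y i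
    using f[OF that(1)] that(2-) unfolding left_module_hom_def by blast
  have f3: "f i (r \<odot>\<^bsub>N i\<^esub> x) = r \<odot>\<^bsub>N' i\<^esub> f i x" if "i \<in> I" "r \<in> carrier S" "x \<in> carrier (N i)" for x r i
    using f[OF that(1)] that(2-) unfolding left_module_hom_def by blast
  show ?thesis
    unfolding left_module_hom_def mem_Collect_eq
  proof (intro conjI ballI)
    show "Gm N N' f \<in> carrier (assemble N) \<rightarrow>\<^sub>E carrier (assemble N')"
      unfolding Gm_def by (auto intro!: assemble_carrierI f1 assemble_carrierE(2))
  next
    fix x y assume xy: "x \<in> carrier (assemble N)" "y \<in> carrier (assemble N)"
    then show "Gm N N' f (x \<oplus>\<^bsub>assemble N\<^esub> y) = Gm N N' f x \<oplus>\<^bsub>assemble N'\<^esub> Gm N N' f y"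
      using A.M.a_closed[OF xy] unfolding Gm_def assemble_simps
      by (auto intro!: arg_cong[of _ _ pack] f2 dest: assemble_carrierE(2) simp: fun_eq_iff)
  next
    fix r x assume r: "r \<in> carrier R" and x: "x \<in> carrier (assemble N)"
    then show "Gm N N' f (r \<odot>\<^bsub>assemble N\<^esub> x) = r \<odot>\<^bsub>assemble N'\<^esub> Gm N N' f x"
      using A.smult_closed[OF r x] unfolding Gm_def assemble_simps
      by (auto intro!: arg_cong[of _ _ pack] f3 dest: assemble_carrierE(2) simp: fun_eq_iff)
  qed
qed

lemma functor_G: "is_functor CP CR assemble Gm"
  unfolding is_functor_def
proof (intro conjI ballI, goal_cases)
  case (1 X) then show ?case by (simp add: CR_simps CP_simps assemble_module)
next
  case (2 X Y f) then show ?case by (simp add: CR_simps CP_simps hom_assemble)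
next
  case (3 X)
  have "pack (\<lambda>i\<in>I. Idn CP X i (unpack x i)) = x" if "x \<in> carrier (assemble X)" for x
  proof -
    have "(\<lambda>i\<in>I. Idn CP X i (unpack x i)) = (\<lambda>i\<in>I. unpack x i)"
      using assemble_carrierE(2)[OF that] by (auto simp: CP_simps fun_eq_iff)
    then show ?thesis using assemble_carrierE(1)[OF that] by simp
  qed
  then show ?case by (auto simp: CR_simps Gm_def fun_eq_iff)
next
  case (4 X Y Z f g)
  have h: "Gm X Y f \<in> left_module_hom R (assemble X) (assemble Y)"
    using 4 by (simp add: CR_simps CP_simps hom_assemble)
  have "Gm X Y f x \<in> carrier (assemble Y)" if "x \<in> carrier (assemble X)" for x
    using h that by (auto simp: left_module_hom_def)
  then show ?case
    by (auto simp: CR_simps CP_simps Gm_def compose_def fun_eq_iff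
        intro!: arg_cong[of _ _ pack] dest: assemble_carrierE(2))
qed

text \<open>The unit \<open>M \<rightarrow> G (F M)\<close> is \<open>x \<mapsto> (e\<^sub>i x)\<^sub>i\<close>.\<close>

definition unit_map where "unit_map M = (\<lambda>x\<in>carrier M. pack (\<lambda>i\<in>I. e i \<odot>\<^bsub>M\<^esub> x))"

lemma e_component:
  assumes i: "i \<in> I" and M: "left_module R M" and x: "x \<in> carrier M"
  shows "e i \<odot>\<^bsub>M\<^esub> x \<in> carrier (component i M)"
proof -
  interpret M: left_module R M by (rule M)
  show ?thesis
    using lift1(1)[OF i] lift1_hom(2)[OF i, of "\<one>\<^bsub>S\<^esub>" "\<one>\<^bsub>S\<^esub>"] x
    by (simp add: component_def M.smult_closed M.smult_assoc1[symmetric])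
qed

lemma Fo_apply: "i \<in> I \<Longrightarrow> Fo M i = component i M"
  by (simp add: Fo_def)

lemma unit_map_hom:
  assumes M: "left_module R M"
  shows "unit_map M \<in> left_module_hom R M (assemble (Fo M))"
proof -
  interpret M: left_module R M by (rule M)
  have l: "lift1 i s \<in> carrier R" if "i \<in> I" "s \<in> carrier S" for i s using lift1 that by blast
  show ?thesis
    unfolding left_module_hom_def mem_Collect_eq
  proof (intro conjI ballI)
    show "unit_map M \<in> carrier M \<rightarrow>\<^sub>E carrier (assemble (Fo M))"
      unfolding unit_map_def by (auto intro!: assemble_carrierI simp: Fo_apply e_component M)
  next
    fix x y assume "x \<in> carrier M" "y \<in> carrier M"
    then show "unit_map M (x \<oplus>\<^bsub>M\<^esub> y) = unit_map M x \<oplus>\<^bsub>assemble (Fo M)\<^esub> unit_map M y"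
      unfolding unit_map_def assemble_simps
      by (auto intro!: arg_cong[of _ _ pack] M.smult_r_distr l simp: fun_eq_iff Fo_apply component_def)
  next
    fix r x assume r: "r \<in> carrier R" and x: "x \<in> carrier M"
    have "e i \<odot>\<^bsub>M\<^esub> (r \<odot>\<^bsub>M\<^esub> x) = lift1 i (\<Phi> i r) \<odot>\<^bsub>M\<^esub> (e i \<odot>\<^bsub>M\<^esub> x)" if i: "i \<in> I" for i
      using lift1_slide(2)[OF i r, of "\<one>\<^bsub>S\<^esub>"] lift1_hom(2)[OF i, of "\<Phi> i r" "\<one>\<^bsub>S\<^esub>"] l[OF i] i r x
      by (simp add: M.smult_assoc1[symmetric])
    then show "unit_map M (r \<odot>\<^bsub>M\<^esub> x) = r \<odot>\<^bsub>assemble (Fo M)\<^esub> unit_map M x"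
      unfolding unit_map_def assemble_simps using r x
      by (auto intro!: arg_cong[of _ _ pack] simp: fun_eq_iff Fo_apply component_def M.smult_closed)
  qed
qed

text \<open>Injectivity is \<open>x = \<Sum>\<^sub>i e\<^sub>i x\<close>.  A family \<open>(x\<^sub>i)\<close> with
  \<open>x\<^sub>i \<in> e\<^sub>i M\<close> is hit by its sum, because \<open>e\<^sub>j x\<^sub>i = 0\<close> for
  \<open>i \<noteq> j\<close>.\<close>

lemma unit_map_bij:
  assumes M: "left_module R M"
  shows "bij_betw (unit_map M) (carrier M) (carrier (assemble (Fo M)))"
proof -
  interpret M: left_module R M by (rule M)
  have l: "e i \<in> carrier R" if "i \<in> I" for i using lift1 that by blast
  have split: "x = (\<Oplus>\<^bsub>M\<^esub>i\<in>I. e i \<odot>\<^bsub>M\<^esub> x)" if "x \<in> carrier M" for x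
    using M.finsum_smult_l[OF finI, of e x] that l by (simp add: e_sum M.smult_one)
  have un: "unpack (unit_map M x) i = e i \<odot>\<^bsub>M\<^esub> x" if "x \<in> carrier M" "i \<in> I" for x i
    using that by (simp add: unit_map_def)
  have cl: "unit_map M x \<in> carrier (assemble (Fo M))" if "x \<in> carrier M" for x
    using unit_map_hom[OF M] that by (auto simp: left_module_hom_def)
  show ?thesis
    unfolding bij_betw_def
  proof (intro conjI inj_onI equalityI subsetI)
    fix x y assume xy: "x \<in> carrier M" "y \<in> carrier M" "unit_map M x = unit_map M y"
    then have "e i \<odot>\<^bsub>M\<^esub> x = e i \<odot>\<^bsub>M\<^esub> y" if "i \<in> I" for i using un that by metis
    then have "(\<Oplus>\<^bsub>M\<^esub>i\<in>I. e i \<odot>\<^bsub>M\<^esub> x) = (\<Oplus>\<^bsub>M\<^esub>i\<in>I. e i \<odot>\<^bsub>M\<^esub> y)"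
      using l xy by (intro M.finsum_cong') (auto simp: M.smult_closed)
    then show "x = y" using split xy by metis
  next
    fix z assume "z \<in> unit_map M ` carrier M" then show "z \<in> carrier (assemble (Fo M))" using cl by blast
  next
    fix z assume z: "z \<in> carrier (assemble (Fo M))"
    have zi: "unpack z i \<in> carrier M \<and> e i \<odot>\<^bsub>M\<^esub> unpack z i = unpack z i" if "i \<in> I" for i
      using assemble_carrierE(2)[OF z that] that by (simp add: Fo_apply component_def)
    define x where "x = (\<Oplus>\<^bsub>M\<^esub>i\<in>I. unpack z i)"
    have x: "x \<in> carrier M" unfolding x_def using zi by (intro M.finsum_closed) auto
    have ij: "e j \<odot>\<^bsub>M\<^esub> unpack z i = (if i = j then unpack z i else \<zero>\<^bsub>M\<^esub>)" if "i \<in> I" "j \<in> I" for i j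
    proof (cases "i = j")
      case False
      have "e j \<otimes>\<^bsub>R\<^esub> e i = \<zero>\<^bsub>R\<^esub>"
      proof (rule joint_eqI)
        fix k assume k: "k \<in> I"
        then have "k \<noteq> i \<or> k \<noteq> j" using False by blast
        then show "\<Phi> k (e j \<otimes>\<^bsub>R\<^esub> e i) = \<Phi> k \<zero>\<^bsub>R\<^esub>"
          using k that l lift1(3)[of i "\<one>\<^bsub>S\<^esub>" k] lift1(3)[of j "\<one>\<^bsub>S\<^esub>" k] by (elim disjE) simp_all
      qed (use l that in auto)
      then have "e j \<odot>\<^bsub>M\<^esub> (e i \<odot>\<^bsub>M\<^esub> unpack z i) = \<zero>\<^bsub>M\<^esub>"
        using M.smult_assoc1[of "e j" "e i" "unpack z i"] l that zi M.smult_l_null by simp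
      then show ?thesis using False zi that by simp
    qed (use zi that in auto)
    have "unit_map M x = z"
    proof (rule assemble_eqI[OF cl[OF x] z])
      fix j assume j: "j \<in> I"
      have "e j \<odot>\<^bsub>M\<^esub> x = (\<Oplus>\<^bsub>M\<^esub>i\<in>I. e j \<odot>\<^bsub>M\<^esub> unpack z i)"
        unfolding x_def using M.smult_finsum[OF finI] zi l[OF j] by auto
      also have "\<dots> = (\<Oplus>\<^bsub>M\<^esub>i\<in>I. if j = i then unpack z i else \<zero>\<^bsub>M\<^esub>)"
        using ij j zi by (intro M.finsum_cong') auto
      also have "\<dots> = unpack z j"
        using M.finsum_singleton[OF j finI, of "unpack z"] zi by auto
      finally show "unpack (unit_map M x) j = unpack z j" using un[OF x j] by simp
    qed
    then show "z \<in> unit_map M ` carrier M" using x by blast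
  qed
qed

text \<open>The counit \<open>F (G N) \<rightarrow> N\<close> is the projection to the \<open>i\<close>-th factor.\<close>

definition counit_map where
  "counit_map N = (\<lambda>i\<in>I. \<lambda>x\<in>carrier (component i (assemble N)). unpack x i)"

lemma counit_map_iso:
  assumes N: "\<And>i. i \<in> I \<Longrightarrow> left_module S (N i)" and i: "i \<in> I"
  shows "counit_map N i \<in> left_module_hom S (component i (assemble N)) (N i)"
    and "bij_betw (counit_map N i) (carrier (component i (assemble N))) (carrier (N i))"
proof -
  interpret A: left_module R "assemble N" by (rule assemble_module[OF N])
  interpret C: left_module S "component i (assemble N)" by (rule component_module[OF i A.left_module_axioms])
  have sub: "x \<in> carrier (assemble N)" if "x \<in> carrier (component i (assemble N))" for x
    using that by (simp add: component_def)
  have cj: "unpack x j = \<zero>\<^bsub>N j\<^esub>" if x: "x \<in> carrier (component i (assemble N))" and j: "j \<in> I" "j \<noteq> i" for x j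
  proof -
    interpret Nj: left_module S "N j" by (rule N[OF j(1)])
    have "x = e i \<odot>\<^bsub>assemble N\<^esub> x" using x by (simp add: component_def)
    then have "unpack x j = unpack (e i \<odot>\<^bsub>assemble N\<^esub> x) j" by simp
    also have "\<dots> = \<Phi> j (e i) \<odot>\<^bsub>N j\<^esub> unpack x j"
      using j by (simp add: assemble_simps)
    finally show ?thesis
      using lift1(3)[OF i _ j, of "\<one>\<^bsub>S\<^esub>"] assemble_carrierE(2)[OF sub[OF x] j(1)] Nj.smult_l_null by simp
  qed
  interpret Ni: left_module S "N i" by (rule N[OF i])
  show "counit_map N i \<in> left_module_hom S (component i (assemble N)) (N i)"
    unfolding left_module_hom_def mem_Collect_eq
  proof (intro conjI ballI)
    show "counit_map N i \<in> carrier (component i (assemble N)) \<rightarrow>\<^sub>E carrier (N i)"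
      using assemble_carrierE(2)[OF sub i] i by (auto simp: counit_map_def)
  next
    fix x y assume xy: "x \<in> carrier (component i (assemble N))" "y \<in> carrier (component i (assemble N))"
    then show "counit_map N i (x \<oplus>\<^bsub>component i (assemble N)\<^esub> y) = counit_map N i x \<oplus>\<^bsub>N i\<^esub> counit_map N i y"
      using C.M.a_closed[OF xy] i by (simp add: counit_map_def) (simp add: component_def assemble_simps)
  next
    fix s x assume s: "s \<in> carrier S" and x: "x \<in> carrier (component i (assemble N))"
    then show "counit_map N i (s \<odot>\<^bsub>component i (assemble N)\<^esub> x) = s \<odot>\<^bsub>N i\<^esub> counit_map N i x"
      using C.smult_closed[OF s x] i lift1(2)[OF i s]
      by (simp add: counit_map_def) (simp add: component_def assemble_simps)
  qed
  show "bij_betw (counit_map N i) (carrier (component i (assemble N))) (carrier (N i))"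
    unfolding bij_betw_def
  proof (intro conjI inj_onI equalityI subsetI)
    fix x y assume xy: "x \<in> carrier (component i (assemble N))" "y \<in> carrier (component i (assemble N))"
      "counit_map N i x = counit_map N i y"
    then have "unpack x j = unpack y j" if "j \<in> I" for j
      using cj[OF xy(1) that] cj[OF xy(2) that] i by (cases "j = i") (auto simp: counit_map_def)
    then show "x = y" using assemble_eqI[OF sub[OF xy(1)] sub[OF xy(2)]] by blast
  next
    fix z assume "z \<in> counit_map N i ` carrier (component i (assemble N))"
    then show "z \<in> carrier (N i)"
      using assemble_carrierE(2)[OF sub i] i by (auto simp: counit_map_def)
  next
    fix z assume z: "z \<in> carrier (N i)"
    define x where "x = pack (\<lambda>j\<in>I. if j = i then z else \<zero>\<^bsub>N j\<^esub>)"
    have zj: "\<zero>\<^bsub>N j\<^esub> \<in> carrier (N j) \<and> \<Phi> j (e i) \<odot>\<^bsub>N j\<^esub> \<zero>\<^bsub>N j\<^esub> = \<zero>\<^bsub>N j\<^esub>" if "j \<in> I" for j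
    proof -
      interpret Nj: left_module S "N j" by (rule N[OF that])
      show ?thesis using lift1(1)[OF i, of "\<one>\<^bsub>S\<^esub>"] that by (simp add: Nj.smult_r_null)
    qed
    have x1: "x \<in> carrier (assemble N)" unfolding x_def using z zj by (intro assemble_carrierI) auto
    have "e i \<odot>\<^bsub>assemble N\<^esub> x = x"
      unfolding x_def assemble_simps using z zj lift1(2)[OF i, of "\<one>\<^bsub>S\<^esub>"]
      by (auto intro!: arg_cong[of _ _ pack] simp: fun_eq_iff Ni.smult_one)
    then have "x \<in> carrier (component i (assemble N))" using x1 by (simp add: component_def)
    moreover have "counit_map N i x = z" using calculation i by (simp add: counit_map_def x_def)
    ultimately show "z \<in> counit_map N i ` carrier (component i (assemble N))" by blast
  qed
qed

lemma functor_comp: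
  assumes "is_functor A B F1 F2" "is_functor B C G1 G2"
  shows "is_functor A C (\<lambda>X. G1 (F1 X)) (\<lambda>X Y f. G2 (F1 X) (F1 Y) (F2 X Y f))"
  using assms unfolding is_functor_def by simp

lemma functor_id: "is_functor A A (\<lambda>X. X) (\<lambda>X Y f. f)"
  unfolding is_functor_def by simp

text \<open>The functors are \<open>M \<mapsto> (e\<^sub>i M)\<^sub>i\<close> and the product of a family;
  \<open>unit_map\<close> and \<open>counit_map\<close> are the natural isomorphisms.\<close>

theorem equivalent: "equivalent_categories CR CP"
proof -
  have catR: "is_category CR" and catS: "is_category CS" by (rule left_module_category_is_category)+
  have catP: "is_category CP" by (rule product_category_is_category[OF catS])
  have n1: "naturally_isomorphic CR CR (\<lambda>X. X) (\<lambda>X Y f. f)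
      (\<lambda>X. assemble (Fo X)) (\<lambda>X Y f. Gm (Fo X) (Fo Y) (Fm X Y f))"
    unfolding naturally_isomorphic_def
  proof (intro exI[of _ unit_map] conjI ballI)
    fix X assume X: "X \<in> Ob CR"
    then have "left_module R (assemble (Fo X))"
      by (auto intro!: assemble_module simp: Fo_apply component_module CR_simps)
    then show "is_iso CR X (assemble (Fo X)) (unit_map X)"
      using X by (intro left_module_hom_bij_is_iso unit_map_hom unit_map_bij) (auto simp: CR_simps)
  next
    fix X Y f assume X: "X \<in> Ob CR" and Y: "Y \<in> Ob CR" and f: "f \<in> Hom CR X Y"
    have f1: "f x \<in> carrier Y" if "x \<in> carrier X" for x
      using f that unfolding left_module_hom_def CR_simps by blast
    have f3: "f (e i \<odot>\<^bsub>X\<^esub> x) = e i \<odot>\<^bsub>Y\<^esub> f x" if "i \<in> I" "x \<in> carrier X" for x i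
      using f that lift1(1)[of i "\<one>\<^bsub>S\<^esub>"] unfolding left_module_hom_def CR_simps by blast
    have u: "unit_map X x \<in> carrier (assemble (Fo X))" if "x \<in> carrier X" for x
      using unit_map_hom[of X] X that by (auto simp: left_module_hom_def CR_simps)
    show "Cmp CR X Y (assemble (Fo Y)) (unit_map Y) f =
        Cmp CR X (assemble (Fo X)) (assemble (Fo Y)) (Gm (Fo X) (Fo Y) (Fm X Y f)) (unit_map X)"
      unfolding CR_simps
    proof (rule ext)
      fix x
      show "compose (carrier X) (unit_map Y) f x =
          compose (carrier X) (Gm (Fo X) (Fo Y) (Fm X Y f)) (unit_map X) x"
      proof (cases "x \<in> carrier X")
        case True
        have "(\<lambda>i\<in>I. e i \<odot>\<^bsub>Y\<^esub> f x) = (\<lambda>i\<in>I. Fm X Y f i (unpack (unit_map X x) i))"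
          using True e_component[OF _ X[unfolded CR_simps] True]
          by (auto simp: fun_eq_iff Fm_def unit_map_def f3)
        then show ?thesis
          using True f1[OF True] u[OF True] by (simp add: compose_def unit_map_def[of Y] Gm_def)
      qed (simp add: compose_def)
    qed
  qed
  have n2: "naturally_isomorphic CP CP (\<lambda>X. Fo (assemble X))
      (\<lambda>X Y f. Fm (assemble X) (assemble Y) (Gm X Y f)) (\<lambda>X. X) (\<lambda>X Y f. f)"
    unfolding naturally_isomorphic_def
  proof (intro exI[of _ counit_map] conjI ballI)
    fix X assume X: "X \<in> Ob CP"
    then have Xi: "\<And>i. i \<in> I \<Longrightarrow> left_module S (X i)" by (simp add: CP_simps)
    note C = component_module[OF _ assemble_module[OF Xi]]
    have iso: "is_iso CS (component i (assemble X)) (X i) (counit_map X i)" if "i \<in> I" for i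
      by (intro left_module_hom_bij_is_iso counit_map_iso C Xi that)
    then have "\<forall>i\<in>I. \<exists>g. g \<in> Hom CS (X i) (component i (assemble X)) \<and>
       Cmp CS (component i (assemble X)) (X i) (component i (assemble X)) g (counit_map X i)
         = Idn CS (component i (assemble X)) \<and>
       Cmp CS (X i) (component i (assemble X)) (X i) (counit_map X i) g = Idn CS (X i)"
      unfolding is_iso_def by blast
    then obtain g where g: "\<forall>i\<in>I. g i \<in> Hom CS (X i) (component i (assemble X)) \<and>
       Cmp CS (component i (assemble X)) (X i) (component i (assemble X)) (g i) (counit_map X i)
         = Idn CS (component i (assemble X)) \<and>
       Cmp CS (X i) (component i (assemble X)) (X i) (counit_map X i) (g i) = Idn CS (X i)"
      by (auto dest!: bchoice)
    show "is_iso CP (Fo (assemble X)) X (counit_map X)"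
      unfolding is_iso_def
    proof (intro conjI bexI[of _ "restrict g I"])
      have "counit_map X i \<in> left_module_hom S (component i (assemble X)) (X i)" if "i \<in> I" for i
        by (rule counit_map_iso(1)) (use Xi that in auto)
      moreover have "counit_map X \<in> extensional I" by (simp add: counit_map_def)
      ultimately show "counit_map X \<in> Hom CP (Fo (assemble X)) X"
        by (simp add: CP_simps Fo_apply)
      show "restrict g I \<in> Hom CP X (Fo (assemble X))"
        using g by (simp add: CP_simps Fo_apply CS_simps)
      show "Cmp CP (Fo (assemble X)) X (Fo (assemble X)) (restrict g I) (counit_map X) = Idn CP (Fo (assemble X))"
        "Cmp CP X (Fo (assemble X)) X (counit_map X) (restrict g I) = Idn CP X"
        using g by (auto simp: CP_simps Fo_apply CS_simps intro!: restrict_ext)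
    qed
  next
    fix X Y f assume X: "X \<in> Ob CP" and Y: "Y \<in> Ob CP" and f: "f \<in> Hom CP X Y"
    then have Xi: "\<And>i. i \<in> I \<Longrightarrow> left_module S (X i)" and Yi: "\<And>i. i \<in> I \<Longrightarrow> left_module S (Y i)"
      and fi: "\<And>i. i \<in> I \<Longrightarrow> f i \<in> left_module_hom S (X i) (Y i)"
      by (simp_all add: CP_simps)
    have h: "Gm X Y f x \<in> carrier (component i (assemble Y))"
      if "i \<in> I" "x \<in> carrier (component i (assemble X))" for i x
    proof -
      have "Gm X Y f \<in> left_module_hom R (assemble X) (assemble Y)"
        "left_module R (assemble X)" "left_module R (assemble Y)"
        using Xi Yi fi by (auto intro!: hom_assemble assemble_module)
      from hom_component[OF that(1) this(2,3,1)] show ?thesis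
        using that(2) unfolding left_module_hom_def by (auto dest: PiE_mem)
    qed
    have sub: "x \<in> carrier (assemble X)" if "x \<in> carrier (component i (assemble X))" for x i
      using that by (simp add: component_def)
    show "Cmp CP (Fo (assemble X)) (Fo (assemble Y)) Y (counit_map Y) (Fm (assemble X) (assemble Y) (Gm X Y f)) =
       Cmp CP (Fo (assemble X)) X Y f (counit_map X)"
      using h sub by (auto simp: CP_simps Fo_apply counit_map_def Fm_def compose_def fun_eq_iff Gm_def)
  qed
  show ?thesis
    unfolding equivalent_categories_def
    using catR catP functor_F functor_G n2
      naturally_isomorphic_sym[OF catR functor_id functor_comp[OF functor_F functor_G] n1]
    by blast
qed

end

section \<open>Linear algebra of formal sums\<close>

text \<open>Scalar multiplication of formal sums.\<close>

definition psc :: "'k::field \<Rightarrow> ('x \<Rightarrow>\<^sub>0 'k) \<Rightarrow> ('x \<Rightarrow>\<^sub>0 'k)" where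
  "psc c p = Poly_Mapping.map (\<lambda>x. c * x) p"

lemma lookup_psc [simp]: "Poly_Mapping.lookup (psc c p) x = c * Poly_Mapping.lookup p x"
  by (simp add: psc_def Poly_Mapping.map.rep_eq when_def)

lemma psc_single [simp]: "psc c (Poly_Mapping.single x d) = Poly_Mapping.single x (c * d)"
  by (rule poly_mapping_eqI) (simp add: lookup_single when_def)

lemma vector_space_psc: "vector_space psc"
  by unfold_locales (auto intro!: poly_mapping_eqI simp: lookup_add algebra_simps)

interpretation psc: vector_space psc by (rule vector_space_psc)

lemma psc_conv_mult: "psc c p = Poly_Mapping.single 0 c * p"
  by (simp add: psc_def mult_map_scale_conv_mult)

text \<open>The linear extension of \<open>f\<close> from the basis to formal sums.\<close>

definition lin :: "('k::field \<Rightarrow> 'v \<Rightarrow> 'v::ab_group_add) \<Rightarrow> ('x \<Rightarrow> 'v) \<Rightarrow> ('x \<Rightarrow>\<^sub>0 'k) \<Rightarrow> 'v" where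
  "lin sc f p = (\<Sum>x\<in>Poly_Mapping.keys p. sc (Poly_Mapping.lookup p x) (f x))"

context vector_space
begin

lemma lin_superset:
  assumes "finite A" "Poly_Mapping.keys p \<subseteq> A"
  shows "lin scale f p = (\<Sum>x\<in>A. scale (Poly_Mapping.lookup p x) (f x))"
  unfolding lin_def by (rule sum.mono_neutral_left) (use assms in \<open>auto simp: in_keys_iff\<close>)

lemma linear_lin: "Vector_Spaces.linear psc scale (lin scale f)"
proof -
  have 1: "lin scale f (p + r) = lin scale f p + lin scale f r" for p r
  proof -
    let ?A = "Poly_Mapping.keys p \<union> Poly_Mapping.keys r"
    have "Poly_Mapping.keys (p + r) \<subseteq> ?A" by (rule keys_add)
    then show ?thesis
      by (subst (1 2 3) lin_superset[of ?A]) (auto simp: lookup_add scale_left_distrib sum.distrib)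
  qed
  have 2: "lin scale f (psc c p) = scale c (lin scale f p)" for c p
  proof -
    have "Poly_Mapping.keys (psc c p) \<subseteq> Poly_Mapping.keys p" by (auto simp: in_keys_iff)
    then have "lin scale f (psc c p) = (\<Sum>x\<in>Poly_Mapping.keys p. scale (c * Poly_Mapping.lookup p x) (f x))"
      by (subst lin_superset[of "Poly_Mapping.keys p"]) auto
    also have "\<dots> = scale c (lin scale f p)"
      unfolding lin_def scale_sum_right scale_scale ..
    finally show ?thesis .
  qed
  show ?thesis
    unfolding Vector_Spaces.linear_iff using 1 2 vector_space_psc vector_space_axioms by blast
qed

lemma lin_single [simp]: "lin scale f (Poly_Mapping.single x c) = scale c (f x)"
  by (simp add: lin_def)

lemma lin_add: "lin scale f (p + r) = lin scale f p + lin scale f r"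
  and lin_psc: "lin scale f (psc c p) = scale c (lin scale f p)"
  using linear_lin[of f] by (auto simp: Vector_Spaces.linear_iff)

lemma lin_0 [simp]: "lin scale f 0 = 0"
  by (simp add: lin_def)

lemma lin_diff: "lin scale f (p - r) = lin scale f p - lin scale f r"
  using lin_add[of f "p - r" r] by simp

lemma lin_uminus: "lin scale f (- p) = - lin scale f p"
  using lin_diff[of f 0 p] by simp

lemma lin_fun_add: "lin scale (\<lambda>x. f x + g x) p = lin scale f p + lin scale g p"
  by (simp add: lin_def scale_right_distrib sum.distrib)

lemma lin_fun_scale: "lin scale (\<lambda>x. scale c (f x)) p = scale c (lin scale f p)"
  unfolding lin_def scale_sum_right by (rule sum.cong) (simp_all add: mult.commute)

lemma lin_fun_0 [simp]: "lin scale (\<lambda>x. 0) p = 0"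
  by (simp add: lin_def)

end

lemma linear_lin_comp:
  assumes "Vector_Spaces.linear s1 s2 h"
  shows "h (lin s1 f p) = lin s2 (\<lambda>x. h (f x)) p"
proof -
  interpret h: Vector_Spaces.linear s1 s2 h by fact
  show ?thesis by (simp add: lin_def h.sum h.scale)
qed

lemma lin_single_id: "lin psc (\<lambda>x. Poly_Mapping.single x 1) p = (p :: 'x \<Rightarrow>\<^sub>0 'k::field)"
proof (rule poly_mapping_eqI)
  fix y
  have "Poly_Mapping.lookup (lin psc (\<lambda>x. Poly_Mapping.single x 1) p) y
      = (\<Sum>x\<in>Poly_Mapping.keys p. if x = y then Poly_Mapping.lookup p x else 0)"
    unfolding lin_def lookup_sum by (rule sum.cong) (auto simp: lookup_single when_def)
  also have "\<dots> = Poly_Mapping.lookup p y"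
    by (simp add: sum.delta in_keys_iff)
  finally show "Poly_Mapping.lookup (lin psc (\<lambda>x. Poly_Mapping.single x 1) p) y = Poly_Mapping.lookup p y" .
qed

text \<open>A predicate that is compatible with linear combinations only has to be checked on the basis.\<close>

lemma poly_mapping_linear_induct [case_names single add scale zero]:
  fixes p :: "'x \<Rightarrow>\<^sub>0 'k::field"
  assumes "\<And>x. P (Poly_Mapping.single x 1)"
    and "\<And>p r. P p \<Longrightarrow> P r \<Longrightarrow> P (p + r)" and "\<And>c p. P p \<Longrightarrow> P (psc c p)" and "P 0"
  shows "P p"
proof -
  have "P (\<Sum>x\<in>A. psc (Poly_Mapping.lookup p x) (Poly_Mapping.single x 1))" for A
    by (induction A rule: infinite_finite_induct) (simp_all add: assms del: psc_single)
  from this[of "Poly_Mapping.keys p"] show ?thesis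
    using lin_single_id[of p] by (simp only: lin_def)
qed

lemma psc_mult_left: "psc c p * r = psc c (p * r)"
  for p :: "'m::monoid_add \<Rightarrow>\<^sub>0 'k::field"
  by (simp add: psc_conv_mult mult.assoc)

lemma psc_mult_right: "p * psc c r = psc c (p * r)"
  for p :: "'m::monoid_add \<Rightarrow>\<^sub>0 'k::field"
proof (induction p rule: poly_mapping_linear_induct)
  case (single x)
  show ?case by (simp add: psc_conv_mult mult.assoc[symmetric] mult_single)
qed (simp_all add: distrib_right psc.scale_right_distrib psc_mult_left mult.commute)

text \<open>The tensor product of formal sums.\<close>

definition bt :: "('x \<Rightarrow>\<^sub>0 'k::field) \<Rightarrow> ('y \<Rightarrow>\<^sub>0 'k) \<Rightarrow> ('x \<times> 'y \<Rightarrow>\<^sub>0 'k)" where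
  "bt p r = lin psc (\<lambda>x. lin psc (\<lambda>y. Poly_Mapping.single (x, y) 1) r) p"

lemma bt_single [simp]:
  "bt (Poly_Mapping.single x c) (Poly_Mapping.single y d) = Poly_Mapping.single (x, y) (c * d)"
  by (simp add: bt_def psc.lin_single)

lemma bt_linear:
  "bt (p + p') r = bt p r + bt p' r" "bt (psc c p) r = psc c (bt p r)" "bt 0 r = 0"
  "bt (p - p') r = bt p r - bt p' r"
  "bt p (r + r') = bt p r + bt p r'" "bt p (psc c r) = psc c (bt p r)" "bt p 0 = 0"
  "bt p (r - r') = bt p r - bt p r'"
proof -
  show "bt (p + p') r = bt p r + bt p' r" "bt (psc c p) r = psc c (bt p r)" "bt 0 r = 0"
    "bt (p - p') r = bt p r - bt p' r"
    by (simp_all add: bt_def psc.lin_add psc.lin_psc psc.lin_diff)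
  show 1: "bt p (r + r') = bt p r + bt p r'" "bt p (psc c r) = psc c (bt p r)" "bt p 0 = 0" for r r'
    by (simp_all add: bt_def psc.lin_add psc.lin_psc psc.lin_fun_add psc.lin_fun_scale)
  show "bt p (r - r') = bt p r - bt p r'" using 1(1)[of "r - r'" r'] by simp
qed

lemma bt_mult:
  fixes p p' :: "'m::monoid_add \<Rightarrow>\<^sub>0 'k::field" and r r' :: "'n::monoid_add \<Rightarrow>\<^sub>0 'k"
  shows "bt (p * p') (r * r') = bt p r * bt p' r'"
proof (induction p rule: poly_mapping_linear_induct)
  case (single x)
  show ?case
  proof (induction p' rule: poly_mapping_linear_induct)
    case (single x')
    show ?case
    proof (induction r rule: poly_mapping_linear_induct)
      case (single y)
      show ?case
      proof (induction r' rule: poly_mapping_linear_induct)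
        case (single y')
        show ?case by (simp add: mult_single)
      qed (simp_all add: bt_linear distrib_left psc_mult_right)
    qed (simp_all add: bt_linear distrib_right psc_mult_left)
  qed (simp_all add: bt_linear distrib_left psc_mult_right)
qed (simp_all add: bt_linear distrib_right psc_mult_left)

lemma bt_one: "bt 1 1 = (1 :: 'm::monoid_add \<times> 'n::monoid_add \<Rightarrow>\<^sub>0 'k::field)"
  by (simp flip: single_one add: zero_prod_def)

text \<open>A record space \<open>C\<close> is handled through a linear surjection \<open>\<pi>\<close> from a type of class
  \<open>ab_group_add\<close>: computations take place in that type, modulo the kernel of \<open>\<pi>\<close>.\<close>

locale presented = vector_space sc
  for sc :: "'k::field \<Rightarrow> 'y::ab_group_add \<Rightarrow> 'y" +
  fixes C :: "('k, 'c, 'm) module_scheme" and \<pi> :: "'y \<Rightarrow> 'c"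
  assumes \<pi>_add: "\<pi> (x + y) = \<pi> x \<oplus>\<^bsub>C\<^esub> \<pi> y" and \<pi>_scale: "\<pi> (sc c x) = c \<odot>\<^bsub>C\<^esub> \<pi> x"
    and \<pi>_zero: "\<pi> 0 = \<zero>\<^bsub>C\<^esub>" and \<pi>_surj: "carrier C = range \<pi>"
begin

lemma \<pi>_closed [simp]: "\<pi> x \<in> carrier C"
  by (simp add: \<pi>_surj)

lemma \<pi>_E: assumes "z \<in> carrier C" obtains x where "z = \<pi> x"
  using assms \<pi>_surj by auto

lemma abelian_group: "abelian_group C"
proof (rule abelian_groupI)
  fix x assume "x \<in> carrier C"
  then obtain y where "x = \<pi> y" by (rule \<pi>_E)
  then show "\<exists>y\<in>carrier C. y \<oplus>\<^bsub>C\<^esub> x = \<zero>\<^bsub>C\<^esub>"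
    by (intro bexI[of _ "\<pi> (- y)"]) (simp_all flip: \<pi>_add \<pi>_zero)
qed (auto simp: \<pi>_surj add_ac simp flip: \<pi>_add \<pi>_zero)

sublocale C: abelian_group C by (rule abelian_group)

lemma \<pi>_uminus: "\<pi> (- x) = \<ominus>\<^bsub>C\<^esub> \<pi> x"
  by (rule C.minus_equality[symmetric]) (simp_all flip: \<pi>_add \<pi>_zero)

lemma \<pi>_diff: "\<pi> (x - y) = \<pi> x \<ominus>\<^bsub>C\<^esub> \<pi> y"
  using \<pi>_add[of x "- y"] by (simp add: \<pi>_uminus a_minus_def)

lemma \<pi>_eq_iff: "\<pi> x = \<pi> y \<longleftrightarrow> \<pi> (x - y) = \<zero>\<^bsub>C\<^esub>"
proof
  assume "\<pi> (x - y) = \<zero>\<^bsub>C\<^esub>"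
  then have "\<pi> (x - y + y) = \<pi> y" by (simp only: \<pi>_add) simp
  then show "\<pi> x = \<pi> y" by simp
qed (metis \<pi>_zero \<pi>_diff diff_self)

lemma \<pi>_sum: "\<pi> (\<Sum>i\<in>A. f i) = (\<Oplus>\<^bsub>C\<^esub>i\<in>A. \<pi> (f i))" if "finite A"
  using that by (induction A) (auto simp: \<pi>_zero \<pi>_add)

lemma smult_closed: "z \<in> carrier C \<Longrightarrow> c \<odot>\<^bsub>C\<^esub> z \<in> carrier C"
  by (auto simp: \<pi>_surj simp flip: \<pi>_scale)

lemma smult_distrib: "z \<in> carrier C \<Longrightarrow> w \<in> carrier C \<Longrightarrow> c \<odot>\<^bsub>C\<^esub> (z \<oplus>\<^bsub>C\<^esub> w) = c \<odot>\<^bsub>C\<^esub> z \<oplus>\<^bsub>C\<^esub> c \<odot>\<^bsub>C\<^esub> w"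
  by (auto simp: \<pi>_surj scale_right_distrib simp flip: \<pi>_scale \<pi>_add)

lemma smult_smult: "z \<in> carrier C \<Longrightarrow> c \<odot>\<^bsub>C\<^esub> (d \<odot>\<^bsub>C\<^esub> z) = (c * d) \<odot>\<^bsub>C\<^esub> z"
  by (auto simp: \<pi>_surj simp flip: \<pi>_scale)

text \<open>The value of a \<open>C\<close>-valued function on a formal sum.\<close>

definition evaluate :: "('x \<Rightarrow> 'c) \<Rightarrow> ('x \<Rightarrow>\<^sub>0 'k) \<Rightarrow> 'c" where
  "evaluate f p = (\<Oplus>\<^bsub>C\<^esub>x\<in>Poly_Mapping.keys p. Poly_Mapping.lookup p x \<odot>\<^bsub>C\<^esub> f x)"

lemma evaluate_\<pi>:
  assumes "\<And>x. x \<in> Poly_Mapping.keys p \<Longrightarrow> f x = \<pi> (g x)"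
  shows "evaluate f p = \<pi> (lin sc g p)"
proof -
  have "evaluate f p = (\<Oplus>\<^bsub>C\<^esub>x\<in>Poly_Mapping.keys p. \<pi> (sc (Poly_Mapping.lookup p x) (g x)))"
    unfolding evaluate_def by (rule C.finsum_cong') (auto simp: \<pi>_scale assms intro: smult_closed)
  then show ?thesis by (simp add: lin_def \<pi>_sum)
qed

end

text \<open>Linear and bilinear maps between record spaces.\<close>

definition klin :: "('k, 'a, 'm) module_scheme \<Rightarrow> ('k, 'c, 'n) module_scheme \<Rightarrow> ('a \<Rightarrow> 'c) \<Rightarrow> bool" where
  "klin A C f \<longleftrightarrow> (\<forall>x\<in>carrier A. f x \<in> carrier C) \<and>
     (\<forall>x\<in>carrier A. \<forall>y\<in>carrier A. f (x \<oplus>\<^bsub>A\<^esub> y) = f x \<oplus>\<^bsub>C\<^esub> f y) \<and>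
     (\<forall>c. \<forall>x\<in>carrier A. f (c \<odot>\<^bsub>A\<^esub> x) = c \<odot>\<^bsub>C\<^esub> f x)"

definition kbil :: "('k, 'a, 'm) module_scheme \<Rightarrow> ('k, 'b, 'l) module_scheme \<Rightarrow>
    ('k, 'c, 'n) module_scheme \<Rightarrow> ('a \<Rightarrow> 'b \<Rightarrow> 'c) \<Rightarrow> bool" where
  "kbil A B C f \<longleftrightarrow> (\<forall>a\<in>carrier A. klin B C (f a)) \<and> (\<forall>b\<in>carrier B. klin A C (\<lambda>a. f a b))"

lemma klinD:
  assumes "klin A C f"
  shows "x \<in> carrier A \<Longrightarrow> f x \<in> carrier C"
    "x \<in> carrier A \<Longrightarrow> y \<in> carrier A \<Longrightarrow> f (x \<oplus>\<^bsub>A\<^esub> y) = f x \<oplus>\<^bsub>C\<^esub> f y"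
    "x \<in> carrier A \<Longrightarrow> f (c \<odot>\<^bsub>A\<^esub> x) = c \<odot>\<^bsub>C\<^esub> f x"
  using assms by (auto simp: klin_def)

lemma kbilD:
  assumes "kbil A B C f"
  shows "a \<in> carrier A \<Longrightarrow> klin B C (f a)" "b \<in> carrier B \<Longrightarrow> klin A C (\<lambda>a. f a b)"
  using assms by (auto simp: kbil_def)

section \<open>Tensor products of presented spaces\<close>

locale presented_pair = A: presented psc A \<alpha> + B: presented psc B \<beta>
  for A :: "('k::field, 'a, 'm) module_scheme" and \<alpha> :: "('x \<Rightarrow>\<^sub>0 'k) \<Rightarrow> 'a"
    and B :: "('k, 'b, 'n) module_scheme" and \<beta> :: "('y \<Rightarrow>\<^sub>0 'k) \<Rightarrow> 'b"
begin

abbreviation BR where "BR \<equiv> bilinear_relations A B"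

text \<open>A formal sum of pairs of basis indices, read as a formal sum of pairs of elements of \<open>A\<close> and
  \<open>B\<close>.\<close>

definition push :: "('x \<times> 'y \<Rightarrow>\<^sub>0 'k) \<Rightarrow> ('a \<times> 'b \<Rightarrow>\<^sub>0 'k)" where
  "push p = lin psc (\<lambda>(x, y). Poly_Mapping.single (\<alpha> (Poly_Mapping.single x 1), \<beta> (Poly_Mapping.single y 1)) 1) p"

definition \<tau> :: "('x \<times> 'y \<Rightarrow>\<^sub>0 'k) \<Rightarrow> ('a \<times> 'b \<Rightarrow>\<^sub>0 'k) set" where
  "\<tau> p = tensor_class A B (push p)"

lemma push_linear: "push (p + r) = push p + push r" "push (psc c p) = psc c (push p)" "push 0 = 0"
    "push (p - r) = push p - push r"
  by (simp_all add: push_def psc.lin_add psc.lin_psc psc.lin_diff)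

lemma BR_uminus: "p \<in> BR \<Longrightarrow> - p \<in> BR"
  using bilinear_relations.diff[OF bilinear_relations.zero] by force

lemma BR_add: "p \<in> BR \<Longrightarrow> r \<in> BR \<Longrightarrow> p + r \<in> BR"
  using bilinear_relations.diff[OF _ BR_uminus] by force

lemma BR_psc: "p \<in> BR \<Longrightarrow> psc c p \<in> BR"
proof (induction rule: bilinear_relations.induct)
  case (smult_left a b d e)
  then show ?case using bilinear_relations.smult_left[of a A b B d "c * e"]
    by (simp add: psc.scale_right_diff_distrib mult.assoc)
next
  case (smult_right a b d e)
  then show ?case using bilinear_relations.smult_right[of a A b B d "c * e"]
    by (simp add: psc.scale_right_diff_distrib mult.assoc)
qed (auto simp: psc.scale_right_diff_distrib intro: bilinear_relations.intros)

lemma formal_sums_closed: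
  "0 \<in> formal_sums A B" "p \<in> formal_sums A B \<Longrightarrow> r \<in> formal_sums A B \<Longrightarrow> p + r \<in> formal_sums A B"
  "p \<in> formal_sums A B \<Longrightarrow> psc c p \<in> formal_sums A B"
  "p \<in> formal_sums A B \<Longrightarrow> r \<in> formal_sums A B \<Longrightarrow> p - r \<in> formal_sums A B"
  "a \<in> carrier A \<Longrightarrow> b \<in> carrier B \<Longrightarrow> Poly_Mapping.single (a, b) c \<in> formal_sums A B"
proof -
  show "p \<in> formal_sums A B \<Longrightarrow> r \<in> formal_sums A B \<Longrightarrow> p + r \<in> formal_sums A B"
    using keys_add[of p r] by (auto simp: formal_sums_def)
  show "p \<in> formal_sums A B \<Longrightarrow> psc c p \<in> formal_sums A B"
    by (auto simp: formal_sums_def in_keys_iff subset_iff)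
  show "p \<in> formal_sums A B \<Longrightarrow> r \<in> formal_sums A B \<Longrightarrow> p - r \<in> formal_sums A B"
  proof -
    assume a: "p \<in> formal_sums A B" "r \<in> formal_sums A B"
    have "Poly_Mapping.keys (p - r) \<subseteq> Poly_Mapping.keys p \<union> Poly_Mapping.keys r"
      by (auto simp: in_keys_iff lookup_minus)
    then show "p - r \<in> formal_sums A B" using a by (auto simp: formal_sums_def)
  qed
qed (auto simp: formal_sums_def)

lemma formal_sums_induct [consumes 1, case_names single add zero]:
  assumes "p \<in> formal_sums A B"
    and "\<And>a b c. a \<in> carrier A \<Longrightarrow> b \<in> carrier B \<Longrightarrow> P (Poly_Mapping.single (a, b) c)"
    and "\<And>p r. P p \<Longrightarrow> P r \<Longrightarrow> P (p + r)" and "P 0"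
  shows "P p"
proof -
  have "P (\<Sum>x\<in>S. psc (Poly_Mapping.lookup p x) (Poly_Mapping.single x 1))"
    if "S \<subseteq> carrier A \<times> carrier B" for S
    using that
    by (induction S rule: infinite_finite_induct) (use assms in auto)
  from this[of "Poly_Mapping.keys p"] show ?thesis
    using lin_single_id[of p] assms(1) by (simp add: lin_def formal_sums_def)
qed

lemma push_formal_sums: "push p \<in> formal_sums A B"
  by (induction p rule: poly_mapping_linear_induct)
    (auto simp: push_def psc.lin_single psc.lin_add psc.lin_psc intro: formal_sums_closed)

lemma tensor_class_eq_iff:
  assumes "p \<in> formal_sums A B"
  shows "tensor_class A B p = tensor_class A B r \<longleftrightarrow> p - r \<in> BR"
proof
  assume "tensor_class A B p = tensor_class A B r"
  moreover have "p \<in> tensor_class A B p"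
    using assms bilinear_relations.zero by (auto simp: tensor_class_def)
  ultimately show "p - r \<in> BR" by (simp add: tensor_class_def)
next
  assume a: "p - r \<in> BR"
  have "(s - p) \<in> BR \<longleftrightarrow> (s - r) \<in> BR" for s
    using BR_add[of "s - p" "p - r"] bilinear_relations.diff[of "s - r" A B "p - r"] a by auto
  then show "tensor_class A B p = tensor_class A B r" by (simp add: tensor_class_def)
qed

lemma tensor_class_self: "p \<in> formal_sums A B \<Longrightarrow> p \<in> tensor_class A B p"
  using bilinear_relations.zero by (auto simp: tensor_class_def)

text \<open>Modulo the bilinearity relations every pair expands into pairs of images of basis vectors; hence
  \<open>\<tau>\<close> is surjective and maps \<open>bt p r\<close> to \<open>\<alpha> p \<otimes> \<beta>
  r\<close>.\<close>

lemma push_bt: "Poly_Mapping.single (\<alpha> p, \<beta> r) c - psc c (push (bt p r)) \<in> BR"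
proof -
  have add_l: "Poly_Mapping.single (a \<oplus>\<^bsub>A\<^esub> a', b) c - (s + s') \<in> BR"
    if "Poly_Mapping.single (a, b) c - s \<in> BR" "Poly_Mapping.single (a', b) c - s' \<in> BR"
      "a \<in> carrier A" "a' \<in> carrier A" "b \<in> carrier B" for a a' b c s s'
    using BR_add[OF BR_add[OF bilinear_relations.add_left[of a A a' b B c] that(1)] that(2)] that(3-)
    by (simp add: algebra_simps)
  have add_r: "Poly_Mapping.single (a, b \<oplus>\<^bsub>B\<^esub> b') c - (s + s') \<in> BR"
    if "Poly_Mapping.single (a, b) c - s \<in> BR" "Poly_Mapping.single (a, b') c - s' \<in> BR"
      "a \<in> carrier A" "b' \<in> carrier B" "b \<in> carrier B" for a b' b c s s'
    using BR_add[OF BR_add[OF bilinear_relations.add_right[of a A b B b' c] that(1)] that(2)] that(3-)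
    by (simp add: algebra_simps)
  have scale_l: "Poly_Mapping.single (d \<odot>\<^bsub>A\<^esub> a, b) c - psc d s \<in> BR"
    if "Poly_Mapping.single (a, b) c - s \<in> BR" "a \<in> carrier A" "b \<in> carrier B" for a b c d s
    using BR_add[OF bilinear_relations.smult_left[of a A b B d c] BR_psc[OF that(1), of d]] that(2-)
    by (simp add: psc.scale_right_diff_distrib mult.commute)
  have scale_r: "Poly_Mapping.single (a, d \<odot>\<^bsub>B\<^esub> b) c - psc d s \<in> BR"
    if "Poly_Mapping.single (a, b) c - s \<in> BR" "a \<in> carrier A" "b \<in> carrier B" for a b c d s
    using BR_add[OF bilinear_relations.smult_right[of a A b B d c] BR_psc[OF that(1), of d]] that(2-)
    by (simp add: psc.scale_right_diff_distrib mult.commute)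
  have z1: "Poly_Mapping.single (\<zero>\<^bsub>A\<^esub>, b) c \<in> BR" if "b \<in> carrier B" for b c
    using BR_uminus[OF bilinear_relations.add_left[of "\<zero>\<^bsub>A\<^esub>" A "\<zero>\<^bsub>A\<^esub>" b B c]] that by simp
  have z2: "Poly_Mapping.single (a, \<zero>\<^bsub>B\<^esub>) c \<in> BR" if "a \<in> carrier A" for a c
    using BR_uminus[OF bilinear_relations.add_right[of a A "\<zero>\<^bsub>B\<^esub>" B "\<zero>\<^bsub>B\<^esub>" c]] that by simp
  show ?thesis
  proof (induction p rule: poly_mapping_linear_induct)
    case (single x)
    show ?case
    proof (induction r rule: poly_mapping_linear_induct)
      case (single y)
      show ?case using bilinear_relations.zero by (simp add: push_def psc.lin_single)
    next
      case (scale d r) then show ?case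
        using scale_r[OF scale.IH, of d] by (simp add: B.\<pi>_scale bt_linear push_linear mult.commute)
    next
      case (add r r') then show ?case
        using add_r[OF add.IH] by (simp add: B.\<pi>_add bt_linear push_linear psc.scale_right_distrib)
    qed (simp add: B.\<pi>_zero bt_linear push_linear z2)
  next
    case (scale d r) then show ?case
      using scale_l[OF scale.IH, of d] by (simp add: A.\<pi>_scale bt_linear push_linear mult.commute)
  next
    case (add r r') then show ?case
      using add_l[OF add.IH] by (simp add: A.\<pi>_add bt_linear push_linear psc.scale_right_distrib)
  qed (simp add: A.\<pi>_zero bt_linear push_linear z1)
qed

lemma formal_sum_push:
  assumes "p \<in> formal_sums A B"
  shows "\<exists>r. p - push r \<in> BR"
  using assms
proof (induction rule: formal_sums_induct)
  case (single a b c)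
  then obtain p r where "a = \<alpha> p" "b = \<beta> r" by (auto elim!: A.\<pi>_E B.\<pi>_E)
  then show ?case using push_bt[of p r c] by (metis push_linear(2))
next
  case (add p r)
  then obtain p' r' where "p - push p' \<in> BR" "r - push r' \<in> BR" by blast
  then have "p + r - push (p' + r') \<in> BR"
    using BR_add[of "p - push p'" "r - push r'"] by (simp add: push_linear algebra_simps)
  then show ?case by blast
next
  case zero
  show ?case using bilinear_relations.zero by (intro exI[of _ 0]) (simp add: push_linear)
qed

lemma \<tau>_eq_iff: "\<tau> p = \<tau> r \<longleftrightarrow> push (p - r) \<in> BR"
  by (simp add: \<tau>_def tensor_class_eq_iff push_formal_sums push_linear)

lemma mem_\<tau>: "s \<in> \<tau> p \<longleftrightarrow> s \<in> formal_sums A B \<and> s - push p \<in> BR"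
  by (simp add: \<tau>_def tensor_class_def)

lemma push_mem_\<tau>: "push p \<in> \<tau> p"
  by (simp add: \<tau>_def tensor_class_self push_formal_sums)

lemma UN_const: "X \<noteq> {} \<Longrightarrow> (\<And>x. x \<in> X \<Longrightarrow> f x = c) \<Longrightarrow> (\<Union>x\<in>X. f x) = c"
  by auto

lemma \<tau>_add: "\<tau> (p + r) = \<tau> p \<oplus>\<^bsub>tensor A B\<^esub> \<tau> r"
proof -
  have "(\<Union>s\<in>\<tau> p. \<Union>t\<in>\<tau> r. tensor_class A B (s + t)) = \<tau> (p + r)"
  proof (intro UN_const)
    fix s t assume "s \<in> \<tau> p" "t \<in> \<tau> r"
    then show "tensor_class A B (s + t) = \<tau> (p + r)"
      using BR_add[of "s - push p" "t - push r"]
      by (simp add: \<tau>_def tensor_class_eq_iff formal_sums_closed mem_\<tau>[unfolded \<tau>_def] push_linear algebra_simps)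
  qed (use push_mem_\<tau> in blast)+
  then show ?thesis by (simp add: tensor_def)
qed

lemma \<tau>_scale: "\<tau> (psc c p) = c \<odot>\<^bsub>tensor A B\<^esub> \<tau> p"
proof -
  have "(\<Union>s\<in>\<tau> p. tensor_class A B (Poly_Mapping.map (\<lambda>x. c * x) s)) = \<tau> (psc c p)"
    unfolding psc_def[symmetric]
  proof (intro UN_const)
    fix s assume "s \<in> \<tau> p"
    then show "tensor_class A B (psc c s) = \<tau> (psc c p)"
      using BR_psc[of "s - push p" c]
      by (simp add: \<tau>_def tensor_class_eq_iff formal_sums_closed mem_\<tau>[unfolded \<tau>_def] push_linear
          psc.scale_right_diff_distrib)
  qed (use push_mem_\<tau> in blast)+
  then show ?thesis by (simp add: tensor_def)
qed

lemma presented_tensor: "presented psc (tensor A B) \<tau>"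
proof unfold_locales
  show "\<tau> (p + r) = \<tau> p \<oplus>\<^bsub>tensor A B\<^esub> \<tau> r" for p r by (rule \<tau>_add)
  show "\<tau> (psc c p) = c \<odot>\<^bsub>tensor A B\<^esub> \<tau> p" for c p by (rule \<tau>_scale)
  show "\<tau> 0 = \<zero>\<^bsub>tensor A B\<^esub>" by (simp add: \<tau>_def push_linear tensor_def)
  show "carrier (tensor A B) = range \<tau>"
  proof -
    have "tensor_class A B p \<in> range \<tau>" if "p \<in> formal_sums A B" for p
      using formal_sum_push[OF that] that by (auto simp: \<tau>_def tensor_class_eq_iff)
    then show ?thesis using push_formal_sums by (auto simp: tensor_def \<tau>_def)
  qed
qed

sublocale T: presented psc "tensor A B" \<tau> by (rule presented_tensor)

lemma pure_tensor_\<tau>: "pure_tensor A B (\<alpha> p) (\<beta> r) = \<tau> (bt p r)"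
  using push_bt[of p r 1] by (simp add: pure_tensor_def \<tau>_def tensor_class_eq_iff formal_sums_closed)

lemma kbil_pure_tensor: "kbil A B (tensor A B) (pure_tensor A B)"
  unfolding kbil_def klin_def
  by (auto elim!: A.\<pi>_E B.\<pi>_E
      simp: pure_tensor_\<tau> bt_linear T.\<pi>_add T.\<pi>_scale simp flip: A.\<pi>_add A.\<pi>_scale B.\<pi>_add B.\<pi>_scale)

text \<open>The universal property: a bilinear map can be evaluated on any formal sum that represents
  the tensor.\<close>

lemma evaluate_bilinear:
  assumes C: "presented sc C \<gamma>" and f: "kbil A B C f"
    and g: "\<And>x y. f (\<alpha> (Poly_Mapping.single x 1)) (\<beta> (Poly_Mapping.single y 1)) = \<gamma> (g x y)"
    and s: "s \<in> \<tau> p"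
  shows "(\<Oplus>\<^bsub>C\<^esub>z\<in>Poly_Mapping.keys s. Poly_Mapping.lookup s z \<odot>\<^bsub>C\<^esub> f (fst z) (snd z))
    = \<gamma> (lin sc (\<lambda>(x, y). g x y) p)"
proof -
  interpret C: presented sc C \<gamma> by fact
  define h where "h z = (SOME y. \<gamma> y = f (fst z) (snd z))" for z
  have h: "\<gamma> (h (a, b)) = f a b" if "a \<in> carrier A" "b \<in> carrier B" for a b
  proof -
    have "f a b \<in> carrier C" using klinD(1)[OF kbilD(1)[OF f that(1)] that(2)] .
    then obtain y where "\<gamma> y = f a b" by (auto elim: C.\<pi>_E)
    from someI[of "\<lambda>y. \<gamma> y = f a b", OF this] show ?thesis unfolding h_def by simp
  qed
  have c0: "c \<odot>\<^bsub>C\<^esub> \<zero>\<^bsub>C\<^esub> = \<zero>\<^bsub>C\<^esub>" for c using C.\<pi>_scale[of c 0] by (simp add: C.\<pi>_zero)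
  note fl = klinD[OF kbilD(1)[OF f]] and fr = klinD[OF kbilD(2)[OF f]]
  have rel: "\<gamma> (lin sc h r) = \<zero>\<^bsub>C\<^esub>" if "r \<in> BR" for r
    using that
  proof (induction rule: bilinear_relations.induct)
    case (add_left a a' b c)
    have "\<gamma> (sc c (h (a \<oplus>\<^bsub>A\<^esub> a', b)) - sc c (h (a, b)) - sc c (h (a', b)))
      = \<gamma> (sc c (h (a, b) + h (a', b)) - sc c (h (a, b)) - sc c (h (a', b)))"
      using add_left by (simp add: C.\<pi>_diff C.\<pi>_scale C.\<pi>_add h fr)
    then show ?case by (simp add: C.lin_diff C.lin_single C.\<pi>_zero C.scale_right_distrib)
  next
    case (add_right a b b' c)
    have "\<gamma> (sc c (h (a, b \<oplus>\<^bsub>B\<^esub> b')) - sc c (h (a, b)) - sc c (h (a, b')))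
      = \<gamma> (sc c (h (a, b) + h (a, b')) - sc c (h (a, b)) - sc c (h (a, b')))"
      using add_right by (simp add: C.\<pi>_diff C.\<pi>_scale C.\<pi>_add h fl)
    then show ?case by (simp add: C.lin_diff C.lin_single C.\<pi>_zero C.scale_right_distrib)
  next
    case (smult_left a b d c)
    have "\<gamma> (sc c (h (d \<odot>\<^bsub>A\<^esub> a, b)) - sc (c * d) (h (a, b))) = \<gamma> (sc c (sc d (h (a, b))) - sc (c * d) (h (a, b)))"
      using smult_left by (simp only: C.\<pi>_diff C.\<pi>_scale h fr A.smult_closed)
    then show ?case by (simp add: C.lin_diff C.lin_single C.\<pi>_zero)
  next
    case (smult_right a b d c)
    have "\<gamma> (sc c (h (a, d \<odot>\<^bsub>B\<^esub> b)) - sc (c * d) (h (a, b))) = \<gamma> (sc c (sc d (h (a, b))) - sc (c * d) (h (a, b)))"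
      using smult_right by (simp only: C.\<pi>_diff C.\<pi>_scale h fl B.smult_closed)
    then show ?case by (simp add: C.lin_diff C.lin_single C.\<pi>_zero)
  qed (simp_all add: C.lin_diff C.\<pi>_diff C.\<pi>_zero a_minus_def)
  have "C.evaluate (\<lambda>z. f (fst z) (snd z)) s = \<gamma> (lin sc h s)"
    by (rule C.evaluate_\<pi>) (use s h in \<open>auto simp: mem_\<tau> formal_sums_def\<close>)
  also have "\<dots> = \<gamma> (lin sc h (push p))"
    using rel[of "s - push p"] s by (subst C.\<pi>_eq_iff) (simp add: mem_\<tau> C.lin_diff)
  also have "\<dots> = \<gamma> (lin sc (\<lambda>(x, y). h (\<alpha> (Poly_Mapping.single x 1), \<beta> (Poly_Mapping.single y 1))) p)"
    unfolding push_def by (simp add: linear_lin_comp[OF C.linear_lin] case_prod_unfold C.lin_single)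
  also have "\<dots> = \<gamma> (lin sc (\<lambda>(x, y). g x y) p)"
  proof (induction p rule: poly_mapping_linear_induct)
    case (single z)
    show ?case by (cases z) (simp add: C.lin_single C.\<pi>_scale h g)
  qed (simp_all add: C.lin_add C.\<pi>_add C.lin_psc C.\<pi>_scale)
  finally show ?thesis by (simp add: C.evaluate_def)
qed

lemma tensor_lift_\<tau>:
  assumes "presented sc C \<gamma>" "kbil A B C f"
    "\<And>x y. f (\<alpha> (Poly_Mapping.single x 1)) (\<beta> (Poly_Mapping.single y 1)) = \<gamma> (g x y)"
  shows "tensor_lift C f (\<tau> p) = \<gamma> (lin sc (\<lambda>(x, y). g x y) p)"
  unfolding tensor_lift_def Let_def
  by (rule evaluate_bilinear[OF assms]) (rule someI, rule push_mem_\<tau>)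

text \<open>The kernel of \<open>\<tau>\<close> is \<open>ker \<alpha> \<otimes> Y + X \<otimes> ker \<beta>\<close>, in the form of an induction rule.\<close>

lemma kernel_induct:
  assumes "\<tau> p = \<zero>\<^bsub>tensor A B\<^esub>"
    and add: "\<And>p r. P p \<Longrightarrow> P r \<Longrightarrow> P (p + r)" and neg: "\<And>p. P p \<Longrightarrow> P (- p)" and zero: "P 0"
    and left: "\<And>p r. \<alpha> p = \<zero>\<^bsub>A\<^esub> \<Longrightarrow> P (bt p r)" and right: "\<And>p r. \<beta> r = \<zero>\<^bsub>B\<^esub> \<Longrightarrow> P (bt p r)"
  shows "P p"
proof -
  define sA where "sA a = (SOME p. \<alpha> p = a)" for a
  define sB where "sB b = (SOME r. \<beta> r = b)" for b
  have sA: "\<alpha> (sA a) = a" if "a \<in> carrier A" for a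
    unfolding sA_def using that A.\<pi>_surj by (intro someI_ex[of "\<lambda>p. \<alpha> p = a"]) auto
  have sB: "\<beta> (sB b) = b" if "b \<in> carrier B" for b
    unfolding sB_def using that B.\<pi>_surj by (intro someI_ex[of "\<lambda>r. \<beta> r = b"]) auto
  have dif: "P (p - r)" if "P p" "P r" for p r using add[OF that(1) neg[OF that(2)]] by simp
  have L: "P (bt p r)" if "\<alpha> p = \<zero>\<^bsub>A\<^esub>" for p r using left that .
  let ?h = "\<lambda>(a, b). bt (sA a) (sB b)"
  have rel: "P (lin psc ?h r)" if "r \<in> BR" for r
    using that
  proof (induction rule: bilinear_relations.induct)
    case zero show ?case by (simp add: assms(4))
  next
    case (diff p r) then show ?case unfolding psc.lin_diff by (intro dif)
  next
    case (add_left a a' b c)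
    have "P (bt (sA (a \<oplus>\<^bsub>A\<^esub> a') - sA a - sA a') (psc c (sB b)))"
    proof (rule left)
      have "\<alpha> (sA (a \<oplus>\<^bsub>A\<^esub> a')) = \<alpha> (sA a + sA a')" using add_left by (simp add: sA A.\<pi>_add)
      then show "\<alpha> (sA (a \<oplus>\<^bsub>A\<^esub> a') - sA a - sA a') = \<zero>\<^bsub>A\<^esub>"
        by (simp add: A.\<pi>_eq_iff diff_diff_eq)
    qed
    then show ?case by (simp add: psc.lin_diff psc.lin_single bt_linear psc.scale_right_diff_distrib)
  next
    case (add_right a b b' c)
    have "P (bt (psc c (sA a)) (sB (b \<oplus>\<^bsub>B\<^esub> b') - sB b - sB b'))"
    proof (rule right)
      have "\<beta> (sB (b \<oplus>\<^bsub>B\<^esub> b')) = \<beta> (sB b + sB b')" using add_right by (simp add: sB B.\<pi>_add)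
      then show "\<beta> (sB (b \<oplus>\<^bsub>B\<^esub> b') - sB b - sB b') = \<zero>\<^bsub>B\<^esub>"
        by (simp add: B.\<pi>_eq_iff diff_diff_eq)
    qed
    then show ?case by (simp add: psc.lin_diff psc.lin_single bt_linear psc.scale_right_diff_distrib)
  next
    case (smult_left a b d c)
    have "P (bt (sA (d \<odot>\<^bsub>A\<^esub> a) - psc d (sA a)) (psc c (sB b)))"
    proof (rule left)
      have "\<alpha> (sA (d \<odot>\<^bsub>A\<^esub> a)) = \<alpha> (psc d (sA a))" using smult_left by (simp add: sA A.\<pi>_scale A.smult_closed)
      then show "\<alpha> (sA (d \<odot>\<^bsub>A\<^esub> a) - psc d (sA a)) = \<zero>\<^bsub>A\<^esub>" by (simp add: A.\<pi>_eq_iff)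
    qed
    then show ?case by (simp add: psc.lin_diff psc.lin_single bt_linear psc.scale_right_diff_distrib)
  next
    case (smult_right a b d c)
    have "P (bt (psc c (sA a)) (sB (d \<odot>\<^bsub>B\<^esub> b) - psc d (sB b)))"
    proof (rule right)
      have "\<beta> (sB (d \<odot>\<^bsub>B\<^esub> b)) = \<beta> (psc d (sB b))" using smult_right by (simp add: sB B.\<pi>_scale B.smult_closed)
      then show "\<beta> (sB (d \<odot>\<^bsub>B\<^esub> b) - psc d (sB b)) = \<zero>\<^bsub>B\<^esub>" by (simp add: B.\<pi>_eq_iff)
    qed
    then show ?case by (simp add: psc.lin_diff psc.lin_single bt_linear psc.scale_right_diff_distrib mult.commute)
  qed
  have "push p \<in> BR" using assms(1) \<tau>_eq_iff[of p 0] by (simp add: T.\<pi>_zero)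
  from rel[OF this] have 1: "P (lin psc ?h (push p))" .
  have scale: "P (psc c (bt p r))" if "\<alpha> p = \<zero>\<^bsub>A\<^esub>" for c p r
    using left[OF that, of "psc c r"] by (simp add: bt_linear)
  have key: "P (psc c (lin psc ?h (push (Poly_Mapping.single z 1)) - Poly_Mapping.single z 1))" for z c
  proof (cases z)
    case (Pair x y)
    let ?a = "Poly_Mapping.single x (1::'k)" and ?b = "Poly_Mapping.single y (1::'k)"
    have "P (bt (sA (\<alpha> ?a) - ?a) (psc c (sB (\<beta> ?b))))"
      by (rule left) (simp add: A.\<pi>_eq_iff[symmetric] sA)
    moreover have "P (bt (psc c ?a) (sB (\<beta> ?b) - ?b))"
      by (rule right) (simp add: B.\<pi>_eq_iff[symmetric] sB)
    ultimately have "P (bt (sA (\<alpha> ?a) - ?a) (psc c (sB (\<beta> ?b))) + bt (psc c ?a) (sB (\<beta> ?b) - ?b))"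
      by (rule add)
    then show ?thesis
      by (simp add: Pair push_def psc.lin_single bt_linear psc.scale_right_diff_distrib del: psc_single bt_single)
        (simp add: Pair)
  qed
  have "P (psc c (lin psc ?h (push p) - p))" for c
  proof (induction p arbitrary: c rule: poly_mapping_linear_induct)
    case (single z) show ?case by (rule key)
  next
    case (add p r)
    have "P (psc c (lin psc ?h (push p) - p) + psc c (lin psc ?h (push r) - r))"
      by (intro assms(2) add.IH)
    then show ?case by (simp add: push_linear psc.lin_add algebra_simps psc.scale_right_diff_distrib psc.scale_right_distrib)
  next
    case (scale d p)
    then show ?case using scale.IH[of "c * d"]
      by (simp add: push_linear psc.lin_psc psc.scale_right_diff_distrib)
  next
    case zero show ?case by (simp add: push_linear assms(4))
  qed
  from this[of 1] have "P (lin psc ?h (push p) - p)" by simp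
  from dif[OF 1 this] show ?thesis by simp
qed

end

section \<open>Presented algebras and their quotients\<close>

locale presented_alg = presented psc A \<alpha>
  for A :: "('k::field, 'a, 'n) module_scheme" and \<alpha> :: "('m::monoid_add \<Rightarrow>\<^sub>0 'k) \<Rightarrow> 'a" +
  assumes \<alpha>_mult: "\<alpha> (p * r) = \<alpha> p \<otimes>\<^bsub>A\<^esub> \<alpha> r" and \<alpha>_one: "\<alpha> 1 = \<one>\<^bsub>A\<^esub>"
begin

lemma ring: "ring A"
proof (rule ringI[OF abelian_group])
  show "Group.monoid A"
    by (rule Group.monoidI) (auto simp: \<pi>_surj mult.assoc simp flip: \<alpha>_mult \<alpha>_one)
qed (auto simp: \<pi>_surj distrib_left distrib_right simp flip: \<alpha>_mult \<alpha>_one \<pi>_add)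

sublocale R: ring A by (rule ring)

lemma smult_mult: "x \<in> carrier A \<Longrightarrow> c \<odot>\<^bsub>A\<^esub> x = \<alpha> (psc c 1) \<otimes>\<^bsub>A\<^esub> x"
  by (auto simp: \<pi>_surj psc_mult_left simp flip: \<alpha>_mult \<pi>_scale)

lemma \<alpha>_pow: "\<alpha> (p ^ n) = \<alpha> p [^]\<^bsub>A\<^esub> n"
  by (induction n) (simp_all add: \<alpha>_one \<alpha>_mult power_Suc2 del: power_Suc)

lemma presented_quotient:
  assumes I: "ideal I A"
  shows "presented_alg (alg_quot A I) (\<lambda>p. I +>\<^bsub>A\<^esub> \<alpha> p)"
    and "I +>\<^bsub>A\<^esub> \<alpha> p = I +>\<^bsub>A\<^esub> \<alpha> r \<longleftrightarrow> \<alpha> (p - r) \<in> I"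
    and "\<zero>\<^bsub>alg_quot A I\<^esub> = I"
proof -
  interpret I: ideal I A by (rule I)
  have smI: "c \<odot>\<^bsub>A\<^esub> x \<in> I" if "x \<in> I" for c x
    using that I.I_l_closed[OF that, of "\<alpha> (psc c 1)"] smult_mult[of x c] I.Icarr by simp
  show eq: "I +>\<^bsub>A\<^esub> \<alpha> p = I +>\<^bsub>A\<^esub> \<alpha> r \<longleftrightarrow> \<alpha> (p - r) \<in> I" for p r
    using R.quotient_eq_iff_same_a_r_cos[OF I, of "\<alpha> p" "\<alpha> r"] by (simp add: \<pi>_diff)
  show "\<zero>\<^bsub>alg_quot A I\<^esub> = I"
    by (simp add: alg_quot_def ring.defs FactRing_def module.defs)
  have sm: "(\<Union>x\<in>I +>\<^bsub>A\<^esub> \<alpha> p. I +>\<^bsub>A\<^esub> (c \<odot>\<^bsub>A\<^esub> x)) = I +>\<^bsub>A\<^esub> \<alpha> (psc c p)" for c p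
  proof -
    have "I +>\<^bsub>A\<^esub> (c \<odot>\<^bsub>A\<^esub> x) = I +>\<^bsub>A\<^esub> \<alpha> (psc c p)" if x: "x \<in> I +>\<^bsub>A\<^esub> \<alpha> p" for x
    proof -
      obtain r where r: "x = \<alpha> r"
        using x C.a_r_coset_subset_G[OF I.a_subset \<pi>_closed] by (auto simp: \<pi>_surj)
      have "I +>\<^bsub>A\<^esub> \<alpha> r = I +>\<^bsub>A\<^esub> \<alpha> p" using C.a_repr_independence[OF x[unfolded r] \<pi>_closed I.a_subgroup] by simp
      then have "\<alpha> (r - p) \<in> I" by (simp add: eq)
      then have "\<alpha> (psc c r - psc c p) \<in> I"
        using smI[of "\<alpha> (r - p)" c] by (simp flip: \<pi>_scale add: psc.scale_right_diff_distrib)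
      then have "I +>\<^bsub>A\<^esub> \<alpha> (psc c r) = I +>\<^bsub>A\<^esub> \<alpha> (psc c p)" by (simp add: eq)
      then show ?thesis by (simp add: r \<pi>_scale)
    qed
    moreover have "I +>\<^bsub>A\<^esub> \<alpha> p \<noteq> {}" using I.a_rcos_self[OF \<pi>_closed] by blast
    ultimately show ?thesis by auto
  qed
  show "presented_alg (alg_quot A I) (\<lambda>p. I +>\<^bsub>A\<^esub> \<alpha> p)"
  proof unfold_locales
    fix p r c
    note h = I.rcos_ring_hom
    show "I +>\<^bsub>A\<^esub> \<alpha> (p + r) = (I +>\<^bsub>A\<^esub> \<alpha> p) \<oplus>\<^bsub>alg_quot A I\<^esub> (I +>\<^bsub>A\<^esub> \<alpha> r)"
      using ring_hom_add[OF h, of "\<alpha> p" "\<alpha> r"] by (simp add: alg_quot_def ring.defs module.defs FactRing_def \<pi>_add)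
    show "I +>\<^bsub>A\<^esub> \<alpha> (p * r) = (I +>\<^bsub>A\<^esub> \<alpha> p) \<otimes>\<^bsub>alg_quot A I\<^esub> (I +>\<^bsub>A\<^esub> \<alpha> r)"
      using ring_hom_mult[OF h, of "\<alpha> p" "\<alpha> r"] by (simp add: alg_quot_def ring.defs module.defs FactRing_def \<alpha>_mult)
    show "I +>\<^bsub>A\<^esub> \<alpha> 1 = \<one>\<^bsub>alg_quot A I\<^esub>"
      by (simp add: alg_quot_def ring.defs module.defs FactRing_def \<alpha>_one)
    show "I +>\<^bsub>A\<^esub> \<alpha> 0 = \<zero>\<^bsub>alg_quot A I\<^esub>"
      using C.a_coset_join2[OF C.zero_closed I.a_subgroup I.zero_closed] by (simp add: alg_quot_def ring.defs module.defs FactRing_def \<pi>_zero)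
    show "I +>\<^bsub>A\<^esub> \<alpha> (psc c p) = c \<odot>\<^bsub>alg_quot A I\<^esub> (I +>\<^bsub>A\<^esub> \<alpha> p)"
      using sm[of c p] by (simp add: alg_quot_def ring.defs module.defs)
    show "carrier (alg_quot A I) = range (\<lambda>p. I +>\<^bsub>A\<^esub> \<alpha> p)"
      by (auto simp: alg_quot_def ring.defs module.defs FactRing_def A_RCOSETS_def' \<pi>_surj)
  qed
qed

end

text \<open>Adding a coproduct, counit and antipode to the record of an algebra keeps the presentation.\<close>

lemma presented_alg_extend:
  fixes A :: "('k::field, 'a) module"
  assumes "presented_alg A \<alpha>"
  shows "presented_alg (module.extend A x) \<alpha>"
proof -
  interpret presented_alg A \<alpha> by fact
  show ?thesis
    by unfold_locales (simp_all add: module.defs \<pi>_add \<pi>_scale \<pi>_zero \<alpha>_mult \<alpha>_one \<pi>_surj)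
qed

subsection \<open>The tensor product of two algebras\<close>

locale presented_alg_pair = A: presented_alg A \<alpha> + B: presented_alg B \<beta>
  for A :: "('k::field, 'a, 'm) module_scheme" and \<alpha> :: "('x::monoid_add \<Rightarrow>\<^sub>0 'k) \<Rightarrow> 'a"
    and B :: "('k, 'b, 'n) module_scheme" and \<beta> :: "('y::monoid_add \<Rightarrow>\<^sub>0 'k) \<Rightarrow> 'b"
begin

sublocale presented_pair A \<alpha> B \<beta> ..

text \<open>The representative-level product that occurs in the definition of the algebra \<open>A \<otimes>
  B\<close>.\<close>

definition fprod :: "('a \<times> 'b \<Rightarrow>\<^sub>0 'k) \<Rightarrow> ('a \<times> 'b \<Rightarrow>\<^sub>0 'k) \<Rightarrow> ('a \<times> 'b \<Rightarrow>\<^sub>0 'k)" where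
  "fprod p r = lin psc (\<lambda>z. lin psc (\<lambda>w.
      Poly_Mapping.single (fst z \<otimes>\<^bsub>A\<^esub> fst w, snd z \<otimes>\<^bsub>B\<^esub> snd w) 1) r) p"

lemma fprod_linear:
  "fprod (p + p') r = fprod p r + fprod p' r" "fprod (psc c p) r = psc c (fprod p r)" "fprod 0 r = 0"
  "fprod (p - p') r = fprod p r - fprod p' r"
  "fprod p (r + r') = fprod p r + fprod p r'" "fprod p (psc c r) = psc c (fprod p r)" "fprod p 0 = 0"
  "fprod p (r - r') = fprod p r - fprod p r'"
proof -
  show "fprod (p + p') r = fprod p r + fprod p' r" "fprod (psc c p) r = psc c (fprod p r)" "fprod 0 r = 0"
    "fprod (p - p') r = fprod p r - fprod p' r"
    by (simp_all add: fprod_def psc.lin_add psc.lin_psc psc.lin_diff)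
  show 1: "fprod p (r + r') = fprod p r + fprod p r'" "fprod p (psc c r) = psc c (fprod p r)" "fprod p 0 = 0" for r r'
    by (simp_all add: fprod_def psc.lin_add psc.lin_psc psc.lin_fun_add psc.lin_fun_scale)
  show "fprod p (r - r') = fprod p r - fprod p r'" using 1(1)[of "r - r'" r'] by simp
qed

lemma fprod_single [simp]:
  "fprod (Poly_Mapping.single (a, b) c) (Poly_Mapping.single (a', b') d)
    = Poly_Mapping.single (a \<otimes>\<^bsub>A\<^esub> a', b \<otimes>\<^bsub>B\<^esub> b') (c * d)"
  by (simp add: fprod_def psc.lin_single)

lemma fprod_push: "fprod (push p) (push r) = push (p * r)"
proof (induction p rule: poly_mapping_linear_induct)
  case (single x)
  show ?case
  proof (induction r rule: poly_mapping_linear_induct)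
    case (single y)
    show ?case
      by (cases x; cases y) (simp add: push_def psc.lin_single mult_single flip: A.\<alpha>_mult B.\<alpha>_mult)
  qed (simp_all add: push_linear fprod_linear distrib_left psc_mult_right)
qed (simp_all add: push_linear fprod_linear distrib_right psc_mult_left)

lemma fprod_BR_left:
  assumes "n \<in> BR" "r \<in> formal_sums A B"
  shows "fprod n r \<in> BR"
  using assms(2)
proof (induction rule: formal_sums_induct)
  case (single a' b' c')
  show ?case
    using assms(1)
  proof (induction rule: bilinear_relations.induct)
    case (add_left a a2 b c) then show ?case
      using single bilinear_relations.add_left[of "a \<otimes>\<^bsub>A\<^esub> a'" A "a2 \<otimes>\<^bsub>A\<^esub> a'" "b \<otimes>\<^bsub>B\<^esub> b'" B "c * c'"]
      by (simp add: fprod_linear A.R.l_distr)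
  next
    case (add_right a b b2 c) then show ?case
      using single bilinear_relations.add_right[of "a \<otimes>\<^bsub>A\<^esub> a'" A "b \<otimes>\<^bsub>B\<^esub> b'" B "b2 \<otimes>\<^bsub>B\<^esub> b'" "c * c'"]
      by (simp add: fprod_linear B.R.l_distr)
  next
    case (smult_left a b d c) then show ?case
      using single bilinear_relations.smult_left[of "a \<otimes>\<^bsub>A\<^esub> a'" A "b \<otimes>\<^bsub>B\<^esub> b'" B d "c * c'"]
      by (simp add: fprod_linear A.smult_mult A.R.m_assoc mult_ac)
  next
    case (smult_right a b d c) then show ?case
      using single bilinear_relations.smult_right[of "a \<otimes>\<^bsub>A\<^esub> a'" A "b \<otimes>\<^bsub>B\<^esub> b'" B d "c * c'"]
      by (simp add: fprod_linear B.smult_mult B.R.m_assoc mult_ac)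
  qed (auto simp: fprod_linear intro: bilinear_relations.intros)
qed (auto simp: fprod_linear intro: BR_add bilinear_relations.zero)

lemma A_smult_right: "x \<in> carrier A \<Longrightarrow> y \<in> carrier A \<Longrightarrow> x \<otimes>\<^bsub>A\<^esub> (c \<odot>\<^bsub>A\<^esub> y) = c \<odot>\<^bsub>A\<^esub> (x \<otimes>\<^bsub>A\<^esub> y)"
  by (auto simp: A.\<pi>_surj psc_mult_right simp flip: A.\<pi>_scale A.\<alpha>_mult)

lemma B_smult_right: "x \<in> carrier B \<Longrightarrow> y \<in> carrier B \<Longrightarrow> x \<otimes>\<^bsub>B\<^esub> (c \<odot>\<^bsub>B\<^esub> y) = c \<odot>\<^bsub>B\<^esub> (x \<otimes>\<^bsub>B\<^esub> y)"
  by (auto simp: B.\<pi>_surj psc_mult_right simp flip: B.\<pi>_scale B.\<alpha>_mult)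

lemma fprod_BR_right:
  assumes "n \<in> BR" "r \<in> formal_sums A B"
  shows "fprod r n \<in> BR"
  using assms(2)
proof (induction rule: formal_sums_induct)
  case (single a' b' c')
  show ?case
    using assms(1)
  proof (induction rule: bilinear_relations.induct)
    case (add_left a a2 b c) then show ?case
      using single bilinear_relations.add_left[of "a' \<otimes>\<^bsub>A\<^esub> a" A "a' \<otimes>\<^bsub>A\<^esub> a2" "b' \<otimes>\<^bsub>B\<^esub> b" B "c' * c"]
      by (simp add: fprod_linear A.R.r_distr)
  next
    case (add_right a b b2 c) then show ?case
      using single bilinear_relations.add_right[of "a' \<otimes>\<^bsub>A\<^esub> a" A "b' \<otimes>\<^bsub>B\<^esub> b" B "b' \<otimes>\<^bsub>B\<^esub> b2" "c' * c"]
      by (simp add: fprod_linear B.R.r_distr)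
  next
    case (smult_left a b d c) then show ?case
      using single bilinear_relations.smult_left[of "a' \<otimes>\<^bsub>A\<^esub> a" A "b' \<otimes>\<^bsub>B\<^esub> b" B d "c' * c"]
      by (simp add: fprod_linear A_smult_right mult_ac)
  next
    case (smult_right a b d c) then show ?case
      using single bilinear_relations.smult_right[of "a' \<otimes>\<^bsub>A\<^esub> a" A "b' \<otimes>\<^bsub>B\<^esub> b" B d "c' * c"]
      by (simp add: fprod_linear B_smult_right mult_ac)
  qed (auto simp: fprod_linear intro: bilinear_relations.intros)
qed (auto simp: fprod_linear intro: BR_add bilinear_relations.zero)

lemma fprod_formal_sums:
  "p \<in> formal_sums A B \<Longrightarrow> r \<in> formal_sums A B \<Longrightarrow> fprod p r \<in> formal_sums A B"
proof (induction rule: formal_sums_induct)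
  case (single a b c)
  from single(3) show ?case
    by (induction rule: formal_sums_induct) (use single in \<open>auto simp: fprod_linear intro: formal_sums_closed\<close>)
qed (auto simp: fprod_linear intro: formal_sums_closed)

lemma \<tau>_mult: "\<tau> (p * r) = \<tau> p \<otimes>\<^bsub>tensor A B\<^esub> \<tau> r"
proof -
  have conv: "(\<Sum>z\<in>Poly_Mapping.keys s. \<Sum>w\<in>Poly_Mapping.keys t.
           Poly_Mapping.single (fst z \<otimes>\<^bsub>A\<^esub> fst w, snd z \<otimes>\<^bsub>B\<^esub> snd w)
             (Poly_Mapping.lookup s z * Poly_Mapping.lookup t w)) = fprod s t" for s t
    by (simp add: fprod_def lin_def psc.scale_sum_right)
  have "(\<Union>s\<in>\<tau> p. \<Union>t\<in>\<tau> r. tensor_class A B (fprod s t)) = \<tau> (p * r)"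
  proof (intro UN_const)
    fix s t assume s: "s \<in> \<tau> p" and t: "t \<in> \<tau> r"
    then have f: "s \<in> formal_sums A B" "t \<in> formal_sums A B" by (auto simp: mem_\<tau>)
    have "fprod s t - push (p * r) = fprod (s - push p) t + fprod (push p) (t - push r)"
      by (simp add: fprod_linear fprod_push)
    also have "\<dots> \<in> BR"
      by (intro BR_add fprod_BR_left fprod_BR_right) (use s t f in \<open>auto simp: mem_\<tau> push_formal_sums\<close>)
    finally show "tensor_class A B (fprod s t) = \<tau> (p * r)"
      by (simp add: \<tau>_def tensor_class_eq_iff fprod_formal_sums f)
  qed (use push_mem_\<tau> in blast)+
  then show ?thesis by (simp add: tensor_def conv)
qed

lemma presented_alg_tensor: "presented_alg (tensor A B) \<tau>"
proof unfold_locales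
  show "\<tau> (p * r) = \<tau> p \<otimes>\<^bsub>tensor A B\<^esub> \<tau> r" for p r by (rule \<tau>_mult)
  have "\<tau> (bt 1 1) = \<one>\<^bsub>tensor A B\<^esub>"
    using pure_tensor_\<tau>[of 1 1] by (simp add: tensor_def A.\<alpha>_one B.\<alpha>_one)
  then show "\<tau> 1 = \<one>\<^bsub>tensor A B\<^esub>" by (simp add: bt_one)
qed

end

section \<open>Two-sided ideals of a ring type\<close>

locale tideal =
  fixes N :: "'r::ring_1 set"
  assumes zero: "0 \<in> N" and add: "a \<in> N \<Longrightarrow> b \<in> N \<Longrightarrow> a + b \<in> N"
    and left: "a \<in> N \<Longrightarrow> x * a \<in> N" and right: "a \<in> N \<Longrightarrow> a * x \<in> N"
begin

lemma uminus: "a \<in> N \<Longrightarrow> - a \<in> N"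
  using left[of a "-1"] by simp

lemma diff: "a \<in> N \<Longrightarrow> b \<in> N \<Longrightarrow> a - b \<in> N"
  using add[OF _ uminus] by fastforce

lemma sum: "(\<And>i. i \<in> A \<Longrightarrow> f i \<in> N) \<Longrightarrow> (\<Sum>i\<in>A. f i) \<in> N"
  by (induction A rule: infinite_finite_induct) (auto intro: zero add)

definition eqv :: "'r \<Rightarrow> 'r \<Rightarrow> bool" (infix \<open>\<approx>\<close> 50) where
  "a \<approx> b \<longleftrightarrow> a - b \<in> N"

lemma eqv_refl [simp]: "a \<approx> a" by (simp add: eqv_def zero)
lemma eqv_sym: "a \<approx> b \<Longrightarrow> b \<approx> a" using uminus[of "a - b"] by (simp add: eqv_def)
lemma eqv_trans [trans]: "a \<approx> b \<Longrightarrow> b \<approx> c \<Longrightarrow> a \<approx> c"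
  using add[of "a - b" "b - c"] by (simp add: eqv_def)
lemma eqv_eq_trans [trans]: "a \<approx> b \<Longrightarrow> b = c \<Longrightarrow> a \<approx> c" "a = b \<Longrightarrow> b \<approx> c \<Longrightarrow> a \<approx> c" by auto
lemma eqv_add: "a \<approx> b \<Longrightarrow> c \<approx> d \<Longrightarrow> a + c \<approx> b + d"
  using add[of "a - b" "c - d"] by (simp add: eqv_def algebra_simps)
lemma eqv_uminus: "a \<approx> b \<Longrightarrow> - a \<approx> - b"
  using uminus[of "a - b"] by (simp add: eqv_def)
lemma eqv_diff: "a \<approx> b \<Longrightarrow> c \<approx> d \<Longrightarrow> a - c \<approx> b - d"
  using diff[of "a - b" "c - d"] by (simp add: eqv_def algebra_simps)
lemma eqv_mult: "a \<approx> b \<Longrightarrow> c \<approx> d \<Longrightarrow> a * c \<approx> b * d"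
  using add[OF right[of "a - b" c] left[of "c - d" b]] by (simp add: eqv_def algebra_simps)
lemma eqv_left: "a \<approx> b \<Longrightarrow> x * a \<approx> x * b" by (rule eqv_mult) simp_all
lemma eqv_right: "a \<approx> b \<Longrightarrow> a * x \<approx> b * x" by (rule eqv_mult) simp_all
lemma eqv_sum: "(\<And>i. i \<in> A \<Longrightarrow> f i \<approx> g i) \<Longrightarrow> sum f A \<approx> sum g A"
  by (induction A rule: infinite_finite_induct) (auto intro: eqv_add)
lemma eqv_power: "a \<approx> b \<Longrightarrow> a ^ n \<approx> b ^ n"
  by (induction n) (auto intro: eqv_mult)
lemma eqv_0: "a \<approx> 0 \<longleftrightarrow> a \<in> N" by (simp add: eqv_def)

end

lemma tideal_psc:
  fixes N :: "('m::monoid_add \<Rightarrow>\<^sub>0 'k::field) set"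
  assumes "tideal N" "a \<in> N"
  shows "psc c a \<in> N"
  using tideal.left[OF assms, of "Poly_Mapping.single 0 c"] by (simp add: psc_conv_mult)

lemma eqv_psc:
  fixes N :: "('m::monoid_add \<Rightarrow>\<^sub>0 'k::field) set"
  assumes "tideal N" "tideal.eqv N a b"
  shows "tideal.eqv N (psc c a) (psc c b)"
  using assms tideal_psc[OF assms(1), of "a - b" c]
  by (simp add: tideal.eqv_def psc.scale_right_diff_distrib)

lemma (in presented_alg) kernel_tideal: "tideal {p. \<alpha> p = \<zero>\<^bsub>A\<^esub>}"
  by unfold_locales (auto simp: \<pi>_zero \<pi>_add \<alpha>_mult)

lemma (in presented_alg) preimage_tideal: "ideal I A \<Longrightarrow> tideal {p. \<alpha> p \<in> I}"
proof -
  assume "ideal I A"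
  then interpret I: ideal I A .
  show ?thesis by unfold_locales (auto simp: \<pi>_zero \<pi>_add \<alpha>_mult I.I_l_closed I.I_r_closed)
qed

lemma (in presented_alg) image_ideal:
  assumes "tideal N"
  shows "ideal (\<alpha> ` N) A"
proof -
  interpret N: tideal N by fact
  have "subgroup (\<alpha> ` N) (add_monoid A)"
  proof
    show "\<one>\<^bsub>add_monoid A\<^esub> \<in> \<alpha> ` N" using N.zero by (force simp flip: \<pi>_zero)
    show "inv\<^bsub>add_monoid A\<^esub> x \<in> \<alpha> ` N" if "x \<in> \<alpha> ` N" for x
      using that N.uminus by (auto simp flip: \<pi>_uminus a_inv_def)
  qed (auto simp flip: \<pi>_add intro!: imageI N.add)
  then show ?thesis
  proof (rule idealI[OF ring])
    fix a x assume "a \<in> \<alpha> ` N" "x \<in> carrier A"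
    then obtain p r where "a = \<alpha> p" "p \<in> N" "x = \<alpha> r" by (auto elim: \<pi>_E)
    then show "x \<otimes>\<^bsub>A\<^esub> a \<in> \<alpha> ` N" "a \<otimes>\<^bsub>A\<^esub> x \<in> \<alpha> ` N"
      by (auto simp flip: \<alpha>_mult intro!: imageI intro: N.left N.right)
  qed
qed

text \<open>The ideal of a presented algebra generated by the images of some elements, in terms of the
  presentation.\<close>

lemma (in presented_alg) genideal_minimal:
  assumes N: "tideal N" and S: "S \<subseteq> \<alpha> ` N" and ker: "\<And>p. \<alpha> p = \<zero>\<^bsub>A\<^esub> \<Longrightarrow> p \<in> N" and p: "\<alpha> p \<in> genideal A S"
  shows "p \<in> N"
proof -
  interpret N: tideal N by (rule N)
  have "genideal A S \<subseteq> \<alpha> ` N" by (rule R.genideal_minimal[OF image_ideal[OF N] S])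
  then obtain r where r: "r \<in> N" "\<alpha> p = \<alpha> r" using p by blast
  then have "p - r \<in> N" using ker \<pi>_eq_iff by blast
  from N.add[OF this r(1)] show ?thesis by simp
qed

section \<open>Presentations of \<open>U\<close> and of \<open>\<uu>\<close>\<close>

lemma free_alg_simps:
  "carrier free_alg = UNIV" "x \<otimes>\<^bsub>free_alg\<^esub> y = x * y" "\<one>\<^bsub>free_alg\<^esub> = 1" "\<zero>\<^bsub>free_alg\<^esub> = 0"
  "x \<oplus>\<^bsub>free_alg\<^esub> y = x + y" "c \<odot>\<^bsub>free_alg\<^esub> x = psc c x"
  by (simp_all add: free_alg_def type_ring_def ring.defs module.defs const_def psc_conv_mult)

interpretation free_alg: presented_alg "free_alg :: ('k::field, ('g, 'k) free_algebra) module" "\<lambda>p. p"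
  by unfold_locales (simp_all add: free_alg_simps)

lemma ideal_U_ideal: "ideal (U_ideal q) free_alg"
  unfolding U_ideal_def by (rule free_alg.R.genideal_ideal) (simp add: free_alg_simps)

definition piU :: "'k::field \<Rightarrow> (gen, 'k) free_algebra \<Rightarrow> 'k U_elem" where
  "piU q p = U_ideal q +>\<^bsub>free_alg\<^esub> p"

lemma presented_U_alg: "presented_alg (U_alg q) (piU q)"
  using free_alg.presented_quotient(1)[OF ideal_U_ideal[of q]] by (simp add: U_alg_def piU_def[abs_def])

lemma piU_eq_iff: "piU q p = piU q r \<longleftrightarrow> p - r \<in> U_ideal q"
  using free_alg.presented_quotient(2)[OF ideal_U_ideal[of q]] by (simp add: piU_def)

lemma piU_zero_iff: "piU q p = \<zero>\<^bsub>U_alg q\<^esub> \<longleftrightarrow> p \<in> U_ideal q"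
proof -
  interpret presented_alg "U_alg q" "piU q" by (rule presented_U_alg)
  show ?thesis using piU_eq_iff[of q p 0] by (simp add: \<pi>_zero)
qed

lemma presented_U: "presented_alg (U_hopf q) (piU q)"
  unfolding U_hopf_def by (rule presented_alg_extend[OF presented_U_alg])

lemma tideal_U_ideal: "tideal (U_ideal q)"
  using free_alg.preimage_tideal[OF ideal_U_ideal[of q]] by simp

lemma U_relations_in_ideal: "p \<in> U_relations q \<Longrightarrow> p \<in> U_ideal q"
  unfolding U_ideal_def using free_alg.R.genideal_self[of "U_relations q"] by (auto simp: free_alg_simps)

lemma U_ideal_minimal: "tideal N \<Longrightarrow> U_relations q \<subseteq> N \<Longrightarrow> p \<in> U_ideal q \<Longrightarrow> p \<in> N"
  using free_alg.genideal_minimal[of N "U_relations q" p]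
  by (auto simp: U_ideal_def free_alg_simps tideal.zero)

lemma U_hopf_eq: "carrier (U_hopf q) = carrier (U_alg q)" "\<zero>\<^bsub>U_hopf q\<^esub> = \<zero>\<^bsub>U_alg q\<^esub>"
  by (simp_all add: U_hopf_def module.defs)

definition fE12 :: "'k::field \<Rightarrow> (gen, 'k) free_algebra" where
  "fE12 q = var (gE I1) * var (gE I2) - psc (inverse q) (var (gE I2) * var (gE I1))"
definition fF12 :: "'k::field \<Rightarrow> (gen, 'k) free_algebra" where
  "fF12 q = var (gF I2) * var (gF I1) - psc q (var (gF I1) * var (gF I2))"

text \<open>The generators of the second ideal, lifted to the free algebra.\<close>

definition small_relations :: "nat \<Rightarrow> 'k::field \<Rightarrow> (gen, 'k) free_algebra set" where
  "small_relations l q =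
     {x ^ l | x. x \<in> {var (gE I1), fE12 q, var (gE I2), var (gF I1), fF12 q, var (gF I2)}} \<union>
     {var (gK i) ^ l - 1 | i. True}"

definition pi_u :: "nat \<Rightarrow> 'k::field \<Rightarrow> (gen, 'k) free_algebra \<Rightarrow> 'k u_elem" where
  "pi_u l q p = small_ideal l q +>\<^bsub>U_hopf q\<^esub> piU q p"

text \<open>The ideal of the free algebra whose quotient is \<open>\<uu>\<close>.\<close>

definition u_ideal :: "nat \<Rightarrow> 'k::field \<Rightarrow> (gen, 'k) free_algebra set" where
  "u_ideal l q = {p. piU q p \<in> small_ideal l q}"

lemma small_ideal_eq: "small_ideal l q = genideal (U_hopf q) (piU q ` small_relations l q)"
proof -
  interpret U: presented_alg "U_hopf q" "piU q" by (rule presented_U)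
  have g: "U_gen q x = piU q (var x)" for x by (simp add: U_gen_def piU_def)
  have e: "U_E12 q = piU q (fE12 q)" "U_F12 q = piU q (fF12 q)"
    by (simp_all add: U_E12_def U_F12_def fE12_def fF12_def Let_def g U.\<pi>_diff U.\<alpha>_mult U.\<pi>_scale)
  have pow: "piU q ` {x ^ l | x. x \<in> X} = {y [^]\<^bsub>U_hopf q\<^esub> l | y. y \<in> piU q ` X}" for X
    by (force simp: U.\<alpha>_pow)
  have K: "piU q ` {var (gK i) ^ l - 1 | i. True} = {piU q (var (gK i)) [^]\<^bsub>U_hopf q\<^esub> l \<ominus>\<^bsub>U_hopf q\<^esub> \<one>\<^bsub>U_hopf q\<^esub> | i. True}"
    by (force simp: U.\<alpha>_pow U.\<pi>_diff U.\<alpha>_one)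
  show ?thesis
    unfolding small_ideal_def small_relations_def Let_def e g image_Un pow K image_insert image_empty ..
qed

lemma ideal_small_ideal: "ideal (small_ideal l q) (U_hopf q)"
proof -
  interpret U: presented_alg "U_hopf q" "piU q" by (rule presented_U)
  show ?thesis unfolding small_ideal_eq by (rule U.R.genideal_ideal) auto
qed

lemma presented_u: "presented_alg (small_u l q) (pi_u l q)"
proof -
  interpret U: presented_alg "U_hopf q" "piU q" by (rule presented_U)
  show ?thesis
    unfolding small_u_def hopf_quot_def pi_u_def[abs_def]
    by (rule presented_alg_extend[OF U.presented_quotient(1)[OF ideal_small_ideal]])
qed

lemma pi_u_eq_iff: "pi_u l q p = pi_u l q r \<longleftrightarrow> p - r \<in> u_ideal l q"
proof -
  interpret U: presented_alg "U_hopf q" "piU q" by (rule presented_U)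
  show ?thesis using U.presented_quotient(2)[OF ideal_small_ideal] by (simp add: pi_u_def u_ideal_def)
qed

lemma pi_u_zero_iff: "pi_u l q p = \<zero>\<^bsub>small_u l q\<^esub> \<longleftrightarrow> p \<in> u_ideal l q"
proof -
  interpret presented_alg "small_u l q" "pi_u l q" by (rule presented_u)
  show ?thesis using pi_u_eq_iff[of l q p 0] by (simp add: \<pi>_zero)
qed

lemma tideal_u_ideal: "tideal (u_ideal l q)"
proof -
  interpret U: presented_alg "U_hopf q" "piU q" by (rule presented_U)
  show ?thesis unfolding u_ideal_def by (rule U.preimage_tideal[OF ideal_small_ideal])
qed

lemma U_ideal_subset_u_ideal: "U_ideal q \<subseteq> u_ideal l q"
proof
  fix p assume "p \<in> U_ideal q"
  then have "piU q p = \<zero>\<^bsub>U_hopf q\<^esub>" using piU_zero_iff[of q p] by (simp add: U_hopf_eq)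
  then show "p \<in> u_ideal l q"
    using additive_subgroup.zero_closed[OF ideal.axioms(1)[OF ideal_small_ideal[of l q]]]
    by (simp add: u_ideal_def)
qed

lemma small_relations_in_ideal: "p \<in> small_relations l q \<Longrightarrow> p \<in> u_ideal l q"
proof -
  interpret U: presented_alg "U_hopf q" "piU q" by (rule presented_U)
  show "p \<in> small_relations l q \<Longrightarrow> p \<in> u_ideal l q"
    unfolding u_ideal_def small_ideal_eq
    using U.R.genideal_self[of "piU q ` small_relations l q"] by (auto simp: image_subset_iff)
qed

text \<open>The universal property of \<open>\<uu>\<close> on the level of the free algebra: pull both ideal quotients
  back to it.\<close>

lemma u_ideal_minimal:
  assumes "tideal N" "U_relations q \<subseteq> N" "small_relations l q \<subseteq> N" "p \<in> u_ideal l q"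
  shows "p \<in> N"
proof -
  interpret U: presented_alg "U_hopf q" "piU q" by (rule presented_U)
  show ?thesis
    by (rule U.genideal_minimal[OF assms(1), of "piU q ` small_relations l q"])
      (use assms U_ideal_minimal in \<open>auto simp: small_ideal_eq u_ideal_def piU_zero_iff[folded U_hopf_eq]\<close>)
qed

lemma u_gen_eq: "u_gen l q g = pi_u l q (var g)"
  by (simp add: u_gen_def pi_u_def U_gen_def piU_def)

section \<open>Quantum binomials and quantum Serre relations modulo an ideal\<close>

text \<open>The Gaussian binomial coefficient with parameter \<open>c\<close>.\<close>

fun gbinom :: "'k::field \<Rightarrow> nat \<Rightarrow> nat \<Rightarrow> 'k" where
  "gbinom c n 0 = 1"
| "gbinom c 0 (Suc k) = 0"
| "gbinom c (Suc n) (Suc k) = c ^ Suc k * gbinom c n (Suc k) + gbinom c n k"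

lemma gbinom_beyond: "n < k \<Longrightarrow> gbinom c n k = 0"
  by (induction c n k rule: gbinom.induct) auto

lemma gbinom_product:
  fixes c :: "'k::field"
  shows "(\<Prod>i<k. c ^ Suc i - 1) * gbinom c n k = (\<Prod>i<k. c ^ (n - i) - 1)"
proof (induction c n k rule: gbinom.induct)
  case (2 c k)
  then show ?case by (simp add: prod_zero_iff) 
next
  case (3 c n k)
  let ?A = "\<lambda>k. \<Prod>i<k. c ^ Suc i - 1" and ?B = "\<lambda>n k. \<Prod>i<k. c ^ (n - i) - 1"
  have "?A (Suc k) * gbinom c (Suc n) (Suc k)
      = c ^ Suc k * (?A (Suc k) * gbinom c n (Suc k)) + (c ^ Suc k - 1) * (?A k * gbinom c n k)"
    by (simp add: algebra_simps)
  also have "\<dots> = ?B n k * (c ^ Suc k * (c ^ (n - k) - 1) + (c ^ Suc k - 1))"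
    unfolding 3 by (simp add: algebra_simps)
  also have "\<dots> = (c ^ Suc n - 1) * ?B n k"
  proof (cases "k \<le> n")
    case True
    then have "c ^ Suc k * c ^ (n - k) = c ^ Suc n" by (simp flip: power_add)
    then have "c ^ Suc k * (c ^ (n - k) - 1) + (c ^ Suc k - 1) = c ^ Suc n - 1"
      by (simp only: right_diff_distrib) simp
    then show ?thesis by (simp only: mult.commute)
  next
    case False
    then have "?B n k = 0" by (intro prod_zero) (auto intro!: bexI[of _ n])
    then show ?thesis by simp
  qed
  also have "\<dots> = ?B (Suc n) (Suc k)"
    by (simp add: prod.lessThan_Suc_shift del: prod.lessThan_Suc power_Suc)
  finally show ?case .
qed simp

definition prim_root :: "nat \<Rightarrow> 'k::field \<Rightarrow> bool" where
  "prim_root l c \<longleftrightarrow> l > 0 \<and> c ^ l = 1 \<and> (\<forall>k. 0 < k \<and> k < l \<longrightarrow> c ^ k \<noteq> 1)"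

text \<open>In \<open>(\<Prod>\<^sub>i (c\<^sup>i\<^sup>+\<^sup>1 - 1)) gbinom c l k = (\<Prod>\<^sub>i
  (c\<^sup>l\<^sup>-\<^sup>i - 1))\<close> the right-hand side contains the factor \<open>c\<^sup>l - 1 = 0\<close>,
  and the product on the left is nonzero for \<open>k < l\<close>.\<close>

lemma gbinom_root_of_unity:
  assumes "prim_root l c" "0 < k" "k < l"
  shows "gbinom c l k = 0"
proof -
  have "(\<Prod>i<k. c ^ (l - i) - 1) = 0"
    using assms by (intro prod_zero) (auto intro!: bexI[of _ 0] simp: prim_root_def)
  moreover have "(\<Prod>i<k. c ^ Suc i - 1) \<noteq> 0"
    using assms by (auto simp: prod_zero_iff prim_root_def simp del: power_Suc)
  ultimately show ?thesis using gbinom_product[where k = k and c = c and n = l] by (metis mult_eq_0_iff)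
qed

locale kideal = tideal N for N :: "('m::monoid_add \<Rightarrow>\<^sub>0 'k::field) set"
begin

lemma psc_mem: "a \<in> N \<Longrightarrow> psc c a \<in> N"
  using tideal_psc[OF tideal_axioms] .

lemma psc_eqv: "a \<approx> b \<Longrightarrow> psc c a \<approx> psc c b"
  using eqv_psc[OF tideal_axioms] .

text \<open>The elements \<open>q\<close>-commute with factor \<open>c\<close>, modulo the ideal.\<close>

definition qc :: "('m \<Rightarrow>\<^sub>0 'k) \<Rightarrow> ('m \<Rightarrow>\<^sub>0 'k) \<Rightarrow> 'k \<Rightarrow> bool" where
  "qc a b c \<longleftrightarrow> a * b \<approx> psc c (b * a)"

lemma qc_mult_right: assumes "qc a b c" "qc a b' c'" shows "qc a (b * b') (c * c')"
proof -
  have "a * b * b' \<approx> psc c (b * a) * b'" using assms(1) unfolding qc_def by (rule eqv_right)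
  also have "psc c (b * a) * b' = psc c (b * (a * b'))" by (simp add: psc_mult_left mult.assoc)
  also have "\<dots> \<approx> psc c (b * psc c' (b' * a))"
    using assms(2) unfolding qc_def by (intro psc_eqv eqv_left)
  finally show ?thesis unfolding qc_def by (simp add: psc_mult_right mult.assoc)
qed

lemma qc_mult_left: assumes "qc a b c" "qc a' b c'" shows "qc (a * a') b (c * c')"
proof -
  have "a * (a' * b) \<approx> a * psc c' (b * a')" using assms(2) unfolding qc_def by (rule eqv_left)
  also have "a * psc c' (b * a') = psc c' (a * b * a')" by (simp add: psc_mult_right mult.assoc)
  also have "\<dots> \<approx> psc c' (psc c (b * a) * a')"
    using assms(1) unfolding qc_def by (intro psc_eqv eqv_right)
  finally show ?thesis unfolding qc_def by (simp add: psc_mult_left mult.assoc mult.commute)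
qed

lemma qc_diff_right: "qc a b c \<Longrightarrow> qc a b' c \<Longrightarrow> qc a (b - b') c"
  unfolding qc_def using eqv_diff[of "a * b" "psc c (b * a)" "a * b'" "psc c (b' * a)"]
  by (simp add: algebra_simps psc.scale_right_diff_distrib)

lemma qc_diff_left: "qc a b c \<Longrightarrow> qc a' b c \<Longrightarrow> qc (a - a') b c"
  unfolding qc_def using eqv_diff[of "a * b" "psc c (b * a)" "a' * b" "psc c (b * a')"]
  by (simp add: algebra_simps psc.scale_right_diff_distrib)

lemma qc_add_left: "qc a b c \<Longrightarrow> qc a' b c \<Longrightarrow> qc (a + a') b c"
  unfolding qc_def using eqv_add[of "a * b" "psc c (b * a)" "a' * b" "psc c (b * a')"]
  by (simp add: algebra_simps psc.scale_right_distrib)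

lemma qc_psc_left: "qc a b c \<Longrightarrow> qc (psc d a) b c"
  unfolding qc_def using psc_eqv[of "a * b" "psc c (b * a)" d]
  by (simp add: psc_mult_left psc_mult_right mult.commute)

lemma qc_psc_right: "qc a b c \<Longrightarrow> qc a (psc d b) c"
  unfolding qc_def using psc_eqv[of "a * b" "psc c (b * a)" d]
  by (simp add: psc_mult_left psc_mult_right mult.commute)

lemma qc_pow_right: "qc a b c \<Longrightarrow> qc a (b ^ n) (c ^ n)"
proof (induction n)
  case 0 then show ?case by (simp add: qc_def)
next
  case (Suc n) then show ?case using qc_mult_right[of a b c "b ^ n" "c ^ n"] by simp
qed

lemma qbinomial:
  assumes xy: "qc x y c"
  shows "(x + y) ^ n \<approx> (\<Sum>k\<le>n. psc (gbinom c n k) (y ^ k * x ^ (n - k)))"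
proof (induction n)
  case (Suc n)
  let ?t = "\<lambda>k. y ^ Suc k * x ^ (n - k)"
  have x: "x * (y ^ k * x ^ m) \<approx> psc (c ^ k) (y ^ k * x ^ Suc m)" for k m
    using eqv_right[OF qc_pow_right[OF xy, unfolded qc_def], of k "x ^ m"]
    by (simp add: mult.assoc psc_mult_left)
  have "(x + y) ^ Suc n \<approx> (x + y) * (\<Sum>k\<le>n. psc (gbinom c n k) (y ^ k * x ^ (n - k)))"
    using eqv_left[OF Suc, of "x + y"] by simp
  also have "\<dots> = (\<Sum>k\<le>n. psc (gbinom c n k) (x * (y ^ k * x ^ (n - k)))) + (\<Sum>k\<le>n. psc (gbinom c n k) (?t k))"
    unfolding distrib_right[of x y] by (simp add: sum_distrib_left psc_mult_right mult.assoc)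
  also have "\<dots> \<approx> (\<Sum>k\<le>n. psc (gbinom c n k) (psc (c ^ k) (y ^ k * x ^ Suc (n - k)))) + (\<Sum>k\<le>n. psc (gbinom c n k) (?t k))"
    by (intro eqv_add eqv_sum psc_eqv x eqv_refl)
  also have "(\<Sum>k\<le>n. psc (gbinom c n k) (psc (c ^ k) (y ^ k * x ^ Suc (n - k))))
      = x ^ Suc n + (\<Sum>k\<le>n. psc (c ^ Suc k * gbinom c n (Suc k)) (?t k))"
  proof -
    have "(\<Sum>k\<le>n. psc (gbinom c n k) (psc (c ^ k) (y ^ k * x ^ Suc (n - k))))
        = (\<Sum>k\<le>Suc n. psc (c ^ k * gbinom c n k) (y ^ k * x ^ (Suc n - k)))"
      by (simp add: gbinom_beyond Suc_diff_le mult.commute)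
    also have "\<dots> = x ^ Suc n + (\<Sum>k\<le>n. psc (c ^ Suc k * gbinom c n (Suc k)) (?t k))"
      by (subst sum.atMost_Suc_shift) simp
    finally show ?thesis .
  qed
  also have "x ^ Suc n + (\<Sum>k\<le>n. psc (c ^ Suc k * gbinom c n (Suc k)) (?t k)) + (\<Sum>k\<le>n. psc (gbinom c n k) (?t k))
      = x ^ Suc n + (\<Sum>k\<le>n. psc (gbinom c (Suc n) (Suc k)) (?t k))"
    by (simp add: sum.distrib psc.scale_left_distrib add.assoc del: power_Suc)
  also have "\<dots> = (\<Sum>k\<le>Suc n. psc (gbinom c (Suc n) k) (y ^ k * x ^ (Suc n - k)))"
    by (simp add: sum.atMost_Suc_shift del: sum.atMost_Suc power_Suc gbinom.simps(3))
  finally show ?case .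
qed simp

lemma qbinomial_root_of_unity:
  assumes "qc x y c" "prim_root l c"
  shows "(x + y) ^ l \<approx> x ^ l + y ^ l"
proof -
  obtain m where m: "l = Suc m" using assms(2) by (cases l) (auto simp: prim_root_def)
  have "(x + y) ^ l \<approx> (\<Sum>k\<le>l. psc (gbinom c l k) (y ^ k * x ^ (l - k)))"
    by (rule qbinomial[OF assms(1)])
  also have "\<dots> = (\<Sum>k\<in>{0, l}. psc (gbinom c l k) (y ^ k * x ^ (l - k)))"
    using gbinom_root_of_unity[OF assms(2)]
    by (intro sum.mono_neutral_right) auto
  also have "\<dots> = x ^ l + psc (gbinom c l l) (y ^ l)" using m by simp
  also have "gbinom c l l = 1"
  proof -
    have "gbinom c n n = 1" for n by (induction n) (simp_all add: gbinom_beyond)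
    then show ?thesis .
  qed
  finally show ?thesis by simp
qed

end

subsection \<open>Sums of two q-commuting solutions of the Serre relations\<close>

definition serre :: "'k::field \<Rightarrow> (idx \<Rightarrow> 'm::monoid_add \<Rightarrow>\<^sub>0 'k) \<Rightarrow> idx \<Rightarrow> idx \<Rightarrow> ('m \<Rightarrow>\<^sub>0 'k)" where
  "serre q x i j = x i * x i * x j - psc (q + inverse q) (x i * x j * x i) + x j * x i * x i"

text \<open>The root vector of the root \<open>\<alpha>\<^sub>1 + \<alpha>\<^sub>2\<close>; the Serre relations say
  that it \<open>q\<close>-commutes with both simple root vectors (lemma \<open>root_vec_qc\<close>).\<close>

definition root_vec :: "'k::field \<Rightarrow> (idx \<Rightarrow> 'm::monoid_add \<Rightarrow>\<^sub>0 'k) \<Rightarrow> ('m \<Rightarrow>\<^sub>0 'k)" where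
  "root_vec q x = x I1 * x I2 - psc (inverse q) (x I2 * x I1)"

context kideal
begin

lemma root_vec_qc:
  assumes "serre q x I1 I2 \<in> N" "serre q x I2 I1 \<in> N" "q \<noteq> 0"
  shows "qc (x I1) (root_vec q x) q" "qc (root_vec q x) (x I2) q"
proof -
  have "x I1 * root_vec q x - psc q (root_vec q x * x I1) = serre q x I1 I2"
    "root_vec q x * x I2 - psc q (x I2 * root_vec q x) = serre q x I2 I1"
    unfolding root_vec_def serre_def
    by (rule poly_mapping_eqI, simp add: algebra_simps psc_mult_left psc_mult_right lookup_add lookup_minus assms mult.assoc)+
  then show "qc (x I1) (root_vec q x) q" "qc (root_vec q x) (x I2) q"
    unfolding qc_def eqv_def using assms by simp_all
qed

text \<open>The part of the Serre relation in \<open>x\<^sub>i + y\<^sub>i\<close> that is pure of type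
  \<open>x\<^sub>i\<^sup>2 y\<^sub>j\<close> or \<open>y\<^sub>i\<^sup>2 x\<^sub>j\<close>: after reordering, its
  coefficient is the quadratic expression in \<open>c\<close> that is assumed to vanish.\<close>

lemma serre_cross1:
  assumes "qc x y c" and "c * c - (q + inverse q) * c + 1 = 0"
  shows "x * x * y - psc (q + inverse q) (x * y * x) + y * x * x \<in> N"
    and "y * y * x - psc (q + inverse q) (y * x * y) + x * y * y \<in> N"
proof -
  define d where "d = x * y - psc c (y * x)"
  have d: "d \<in> N" using assms(1) by (simp add: d_def qc_def eqv_def)
  have c: "c * c = (q + inverse q) * c - 1" using assms(2) by (simp add: algebra_simps)
  have cc: "c * (c * z) = (q + inverse q) * (c * z) - z" for z
    using c by (metis mult.assoc left_diff_distrib mult_1)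
  have "x * x * y - psc (q + inverse q) (x * y * x) + y * x * x
      = x * d + psc c (d * x) - psc (q + inverse q) (d * x)"
    unfolding d_def
    by (rule poly_mapping_eqI)
      (simp add: algebra_simps psc_mult_left psc_mult_right lookup_add lookup_minus mult.assoc, simp add: cc algebra_simps)
  then show "x * x * y - psc (q + inverse q) (x * y * x) + y * x * x \<in> N"
    using d by (simp add: add diff left right psc_mem)
  have "y * y * x - psc (q + inverse q) (y * x * y) + x * y * y
      = d * y + psc c (y * d) - psc (q + inverse q) (y * d)"
    unfolding d_def
    by (rule poly_mapping_eqI)
      (simp add: algebra_simps psc_mult_left psc_mult_right lookup_add lookup_minus mult.assoc, simp add: cc algebra_simps)
  then show "y * y * x - psc (q + inverse q) (y * x * y) + x * y * y \<in> N"
    using d by (simp add: add diff left right psc_mem)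
qed

text \<open>The part with one \<open>x\<^sub>i\<close>, one \<open>y\<^sub>i\<close> and one further factor.  Each sum
  is an explicit combination of the defects of the given commutation rules.\<close>

lemma serre_cross2:
  assumes q: "q \<noteq> 0" and "qc x y (q * q)"
  shows "qc w y (inverse q) \<Longrightarrow> x * y * w + y * x * w + w * x * y + w * y * x
      - psc (q + inverse q) (x * w * y + y * w * x) \<in> N"
    and "qc x v (inverse q) \<Longrightarrow> x * y * v + y * x * v + v * x * y + v * y * x
      - psc (q + inverse q) (x * v * y + y * v * x) \<in> N"
proof -
  define d where "d = x * y - psc (q * q) (y * x)"
  have d: "d \<in> N" using assms(2) by (simp add: d_def qc_def eqv_def)
  {
    assume "qc w y (inverse q)"
    define e where "e = w * y - psc (inverse q) (y * w)"
    have e: "e \<in> N" using \<open>qc w y (inverse q)\<close> by (simp add: e_def qc_def eqv_def)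
    have "x * y * w + y * x * w + w * x * y + w * y * x - psc (q + inverse q) (x * w * y + y * w * x)
        = d * w + w * d + psc (q * q) (e * x) + e * x
          - psc (q + inverse q) (x * e + psc (inverse q) (d * w))"
      unfolding d_def e_def
      by (rule poly_mapping_eqI)
        (simp add: field_simps psc_mult_left psc_mult_right lookup_add lookup_minus mult.assoc psc.scale_right_distrib psc.scale_right_diff_distrib q)
    then show "x * y * w + y * x * w + w * x * y + w * y * x
      - psc (q + inverse q) (x * w * y + y * w * x) \<in> N"
      using d e by (simp add: add diff left right psc_mem)
  next
    assume "qc x v (inverse q)"
    define f where "f = x * v - psc (inverse q) (v * x)"
    have f: "f \<in> N" using \<open>qc x v (inverse q)\<close> by (simp add: f_def qc_def eqv_def)
    have "x * y * v + y * x * v + v * x * y + v * y * x - psc (q + inverse q) (x * v * y + y * v * x)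
        = d * v + psc (q * q) (y * f) + y * f + v * d
          - psc (q + inverse q) (f * y + psc (inverse q) (v * d))"
      unfolding d_def f_def
      by (rule poly_mapping_eqI)
        (simp add: field_simps psc_mult_left psc_mult_right lookup_add lookup_minus mult.assoc psc.scale_right_distrib psc.scale_right_diff_distrib q)
    then show "x * y * v + y * x * v + v * x * y + v * y * x
      - psc (q + inverse q) (x * v * y + y * v * x) \<in> N"
      using d f by (simp add: add diff left right psc_mem)
  }
qed

end

text \<open>The situation of the coproduct: \<open>\<Delta>(E\<^sub>i) = x\<^sub>i + y\<^sub>i\<close> with \<open>x\<^sub>i = K\<^sub>i \<otimes> E\<^sub>i\<close> and
  \<open>y\<^sub>i = E\<^sub>i \<otimes> 1\<close>, and likewise \<open>\<Delta>(F\<^sub>i)\<close> with \<open>x\<^sub>i = F\<^sub>i \<otimes> K\<^sub>i\<^sup>-\<^sup>1\<close> and \<open>y\<^sub>i = 1 \<otimes> F\<^sub>i\<close>.\<close>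

locale serre_pair = kideal N for N :: "('m::monoid_add \<Rightarrow>\<^sub>0 'k::field) set" +
  fixes q :: 'k and x y :: "idx \<Rightarrow> 'm \<Rightarrow>\<^sub>0 'k"
  assumes q: "q \<noteq> 0" and xy: "\<And>i j. qc (x j) (y i) (q powi cartan i j)"
    and serre_x: "\<And>i j. i \<noteq> j \<Longrightarrow> serre q x i j \<in> N" and serre_y: "\<And>i j. i \<noteq> j \<Longrightarrow> serre q y i j \<in> N"
begin

lemma xy1: "qc (x i) (y i) (q * q)" and xy2: "i \<noteq> j \<Longrightarrow> qc (x i) (y j) (inverse q)"
  using xy[of i i] xy[of i j] by (simp_all add: cartan_def power2_eq_square power_int_minus)

lemma serre_sum:
  assumes "i \<noteq> j"
  shows "serre q (\<lambda>i. x i + y i) i j \<in> N"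
proof -
  have 1: "inverse q * inverse q - (q + inverse q) * inverse q + 1 = 0" using q by (simp add: field_simps)
  let ?c = "q + inverse q"
  have "serre q (\<lambda>i. x i + y i) i j = serre q x i j + serre q y i j
     + (x i * x i * y j - psc ?c (x i * y j * x i) + y j * x i * x i)
     + (y i * y i * x j - psc ?c (y i * x j * y i) + x j * y i * y i)
     + (x i * y i * x j + y i * x i * x j + x j * x i * y i + x j * y i * x i
        - psc ?c (x i * x j * y i + y i * x j * x i))
     + (x i * y i * y j + y i * x i * y j + y j * x i * y i + y j * y i * x i
        - psc ?c (x i * y j * y i + y i * y j * x i))"
    unfolding serre_def
    by (simp add: distrib_left distrib_right psc.scale_right_distrib mult.assoc)
  also have "\<dots> \<in> N"
    using assms
    by (intro add serre_x serre_y serre_cross1[OF _ 1] serre_cross2[OF q] xy1 xy2) auto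
  finally show ?thesis .
qed

lemma root_vec_sum:
  "root_vec q (\<lambda>i. x i + y i)
     \<approx> root_vec q x + psc (1 - inverse q * inverse q) (y I1 * x I2) + root_vec q y"
proof -
  have "root_vec q (\<lambda>i. x i + y i)
      - (root_vec q x + psc (1 - inverse q * inverse q) (y I1 * x I2) + root_vec q y)
     = (x I1 * y I2 - psc (inverse q) (y I2 * x I1)) - psc (inverse q) (x I2 * y I1 - psc (inverse q) (y I1 * x I2))"
    unfolding root_vec_def
    by (simp add: distrib_left distrib_right psc.scale_right_distrib psc.scale_left_diff_distrib
        psc.scale_right_diff_distrib)
  also have "\<dots> \<in> N"
  proof (rule diff)
    show "x I1 * y I2 - psc (inverse q) (y I2 * x I1) \<in> N"
      "psc (inverse q) (x I2 * y I1 - psc (inverse q) (y I1 * x I2)) \<in> N"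
      using xy2[of I1 I2] xy2[of I2 I1] by (simp_all add: qc_def eqv_def psc_mem)
  qed
  finally show ?thesis by (simp add: eqv_def)
qed

lemma power_sum: "prim_root l (q * q) \<Longrightarrow> (x i + y i) ^ l \<approx> x i ^ l + y i ^ l"
  by (rule qbinomial_root_of_unity[OF xy1])

text \<open>The three summands of \<open>root_vec_sum\<close> pairwise \<open>q\<^sup>2\<close>-commute, so the
  quantum binomial theorem at a root of unity applies twice.\<close>

lemma root_vec_power_sum:
  assumes l: "prim_root l (q * q)"
  shows "root_vec q (\<lambda>i. x i + y i) ^ l
    \<approx> root_vec q x ^ l + psc ((1 - inverse q * inverse q) ^ l) ((y I1 * x I2) ^ l) + root_vec q y ^ l"
proof -
  let ?X = "root_vec q x" and ?Y = "root_vec q y" and ?W = "psc (1 - inverse q * inverse q) (y I1 * x I2)"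
  have qq: "q * q * inverse q = q" "inverse q * (q * q) = q" using q by simp_all
  have xY: "qc (x i) ?Y q" for i
  proof -
    have "qc (x i) (y I1 * y I2) q" "qc (x i) (y I2 * y I1) q"
      using qc_mult_right[OF xy[of i I1] xy[of i I2]] qc_mult_right[OF xy[of i I2] xy[of i I1]] q
      by (cases i; simp add: cartan_def power2_eq_square power_int_minus qq)+
    then show ?thesis unfolding root_vec_def by (intro qc_diff_right qc_psc_right)
  qed
  have Xy: "qc ?X (y i) q" for i
  proof -
    have "qc (x I1 * x I2) (y i) q" "qc (x I2 * x I1) (y i) q"
      using qc_mult_left[OF xy[of I1 i] xy[of I2 i]] qc_mult_left[OF xy[of I2 i] xy[of I1 i]] q
      by (cases i; simp add: cartan_def power2_eq_square power_int_minus qq)+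
    then show ?thesis unfolding root_vec_def by (intro qc_diff_left qc_psc_left)
  qed
  have XY: "qc ?X ?Y (q * q)"
    unfolding root_vec_def[of q x] by (intro qc_diff_left qc_psc_left qc_mult_left xY)
  have yY: "qc (y I1) ?Y q" and Xx: "qc ?X (x I2) q"
    using root_vec_qc[of q y] root_vec_qc[of q x] serre_x serre_y q by auto
  have WY: "qc ?W ?Y (q * q)" by (intro qc_psc_left qc_mult_left yY xY)
  have XW: "qc ?X ?W (q * q)" by (intro qc_psc_right qc_mult_right Xy Xx)
  have "root_vec q (\<lambda>i. x i + y i) ^ l \<approx> (?X + ?W + ?Y) ^ l"
    by (rule eqv_power[OF root_vec_sum])
  also have "\<dots> \<approx> (?X + ?W) ^ l + ?Y ^ l"
    by (rule qbinomial_root_of_unity[OF qc_add_left[OF XY WY] l])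
  also have "\<dots> \<approx> (?X ^ l + ?W ^ l) + ?Y ^ l"
    by (intro eqv_add eqv_refl qbinomial_root_of_unity[OF XW l])
  also have "?W ^ l = psc ((1 - inverse q * inverse q) ^ l) ((y I1 * x I2) ^ l)"
    by (induction l) (simp_all add: psc_mult_left psc_mult_right)
  finally show ?thesis .
qed

end

section \<open>Homomorphisms out of free algebras\<close>

fun letters :: "'g word \<Rightarrow> 'g list" where "letters (Word w) = w"

lemma letters_add [simp]: "letters (v + w) = letters v @ letters w"
  by (cases v; cases w) simp

lemma letters_0 [simp]: "letters 0 = []"
  by (simp add: zero_word_def)

definition wm :: "'g list \<Rightarrow> ('g, 'k::field) free_algebra" where
  "wm w = Poly_Mapping.single (Word w) 1"

lemma wm_simps: "wm [] = 1" "wm (v @ w) = wm v * wm w" "wm (g # w) = var g * wm w" "wm [g] = var g"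
  by (simp_all add: wm_def var_def mult_single flip: single_one zero_word_def)

lemma single_word: "Poly_Mapping.single w 1 = wm (letters w)"
  by (cases w) (simp add: wm_def)

lemma free_algebra_induct [case_names word add scale zero]:
  fixes p :: "('g, 'k::field) free_algebra"
  assumes "\<And>w. P (wm w)" "\<And>p r. P p \<Longrightarrow> P r \<Longrightarrow> P (p + r)" "\<And>c p. P p \<Longrightarrow> P (psc c p)" "P 0"
  shows "P p"
  by (induction p rule: poly_mapping_linear_induct) (auto simp: single_word intro: assms)

text \<open>The algebra homomorphism from the free algebra with given values on the generators.\<close>

definition fhom :: "('g \<Rightarrow> 'm::monoid_add \<Rightarrow>\<^sub>0 'k::field) \<Rightarrow> ('g, 'k) free_algebra \<Rightarrow> ('m \<Rightarrow>\<^sub>0 'k)" where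
  "fhom h p = lin psc (\<lambda>w. prod_list (map h (letters w))) p"

lemma fhom_linear:
  "fhom h (p + r) = fhom h p + fhom h r" "fhom h (p - r) = fhom h p - fhom h r"
  "fhom h (psc c p) = psc c (fhom h p)" "fhom h 0 = 0"
  by (simp_all add: fhom_def psc.lin_add psc.lin_diff psc.lin_psc)

lemma fhom_wm: "fhom h (wm w) = prod_list (map h w)"
  by (simp add: fhom_def wm_def psc.lin_single)

lemma fhom_mult: "fhom h (p * r) = fhom h p * fhom h r"
proof (induction p rule: free_algebra_induct)
  case (word v)
  show ?case
    by (induction r rule: free_algebra_induct)
      (simp_all add: fhom_wm fhom_linear distrib_left psc_mult_right flip: wm_simps(2))
qed (simp_all add: fhom_linear distrib_right psc_mult_left)

lemma fhom_var [simp]: "fhom h (var g) = h g"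
  using fhom_wm[of h "[g]"] by (simp add: wm_simps)

lemma fhom_one [simp]: "fhom h 1 = 1"
  using fhom_wm[of h "[]"] by (simp add: wm_simps)

lemma fhom_pow: "fhom h (p ^ n) = fhom h p ^ n"
  by (induction n) (simp_all add: fhom_mult)

lemma tideal_fhom: "tideal N \<Longrightarrow> tideal {p. fhom h p \<in> N}"
  unfolding tideal_def by (auto simp: fhom_linear fhom_mult)

definition antihom :: "('g \<Rightarrow> ('g, 'k::field) free_algebra) \<Rightarrow> ('g, 'k) free_algebra \<Rightarrow> ('g, 'k) free_algebra" where
  "antihom s p = lin psc (\<lambda>w. prod_list (map s (rev (letters w)))) p"

lemma antihom_linear:
  "antihom h (p + r) = antihom h p + antihom h r" "antihom h (p - r) = antihom h p - antihom h r"
  "antihom h (psc c p) = psc c (antihom h p)" "antihom h 0 = 0"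
  by (simp_all add: antihom_def psc.lin_add psc.lin_diff psc.lin_psc)

lemma antihom_wm: "antihom h (wm w) = prod_list (map h (rev w))"
  by (simp add: antihom_def wm_def psc.lin_single)

lemma antihom_mult: "antihom h (p * r) = antihom h r * antihom h p"
proof (induction p rule: free_algebra_induct)
  case (word v)
  show ?case
    by (induction r rule: free_algebra_induct)
      (simp_all add: antihom_wm antihom_linear distrib_right psc_mult_left distrib_left psc_mult_right flip: wm_simps(2))
qed (simp_all add: antihom_linear distrib_left psc_mult_right distrib_right psc_mult_left)

lemma antihom_var [simp]: "antihom h (var g) = h g"
  using antihom_wm[of h "[g]"] by (simp add: wm_simps)

lemma antihom_one [simp]: "antihom h 1 = 1"
  using antihom_wm[of h "[]"] by (simp add: wm_simps)

lemma antihom_pow: "antihom h (p ^ n) = antihom h p ^ n"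
  by (induction n) (simp_all add: antihom_mult power_commutes)

lemma tideal_antihom: "tideal N \<Longrightarrow> tideal {p. antihom h p \<in> N}"
  unfolding tideal_def by (auto simp: antihom_linear antihom_mult)

section \<open>The Hopf structure on the free algebra\<close>

abbreviation (input) E where "E i \<equiv> var (gE i)"
abbreviation (input) F where "F i \<equiv> var (gF i)"
abbreviation (input) K where "K i \<equiv> var (gK i)"
abbreviation (input) K' where "K' i \<equiv> var (gK' i)"

fun dlt :: "gen \<Rightarrow> (gen word \<times> gen word \<Rightarrow>\<^sub>0 'k::field)" where
  "dlt (gE i) = bt (K i) (E i) + bt (E i) 1"
| "dlt (gF i) = bt 1 (F i) + bt (F i) (K' i)"
| "dlt (gK i) = bt (K i) (K i)"
| "dlt (gK' i) = bt (K' i) (K' i)"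

fun ant :: "gen \<Rightarrow> (gen, 'k::field) free_algebra" where
  "ant (gE i) = - (K' i * E i)"
| "ant (gF i) = - (F i * K i)"
| "ant (gK i) = K' i"
| "ant (gK' i) = K i"

definition \<Delta>0 :: "(gen, 'k::field) free_algebra \<Rightarrow> (gen word \<times> gen word \<Rightarrow>\<^sub>0 'k)" where "\<Delta>0 = fhom dlt"
definition S0 :: "(gen, 'k::field) free_algebra \<Rightarrow> (gen, 'k) free_algebra" where "S0 = antihom ant"
definition \<epsilon>0 :: "(gen, 'k::field) free_algebra \<Rightarrow> 'k" where
  "\<epsilon>0 p = lin (*) (\<lambda>w. prod_list (map counit_gen (letters w))) p"

lemmas \<Delta>0_simps = fhom_linear[of dlt, folded \<Delta>0_def] fhom_mult[of dlt, folded \<Delta>0_def]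
  fhom_var[of dlt, folded \<Delta>0_def] fhom_one[of dlt, folded \<Delta>0_def] fhom_pow[of dlt, folded \<Delta>0_def]
lemmas S0_simps = antihom_linear[of ant, folded S0_def] antihom_mult[of ant, folded S0_def]
  antihom_var[of ant, folded S0_def] antihom_one[of ant, folded S0_def] antihom_pow[of ant, folded S0_def]

lemma vector_space_mult: "vector_space ((*) :: 'k::field \<Rightarrow> 'k \<Rightarrow> 'k)"
  by unfold_locales (simp_all add: algebra_simps)

lemmas lin_mult = vector_space.lin_add[OF vector_space_mult] vector_space.lin_diff[OF vector_space_mult]
  vector_space.lin_psc[OF vector_space_mult] vector_space.lin_0[OF vector_space_mult]
  vector_space.lin_single[OF vector_space_mult]

lemma \<epsilon>0_linear:
  "\<epsilon>0 (p + r) = \<epsilon>0 p + \<epsilon>0 r" "\<epsilon>0 (p - r) = \<epsilon>0 p - \<epsilon>0 r" "\<epsilon>0 (psc c p) = c * \<epsilon>0 p" "\<epsilon>0 0 = 0"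
  by (simp_all add: \<epsilon>0_def lin_mult)

lemma \<epsilon>0_wm: "\<epsilon>0 (wm w) = prod_list (map counit_gen w)"
  by (simp add: \<epsilon>0_def wm_def lin_mult)

lemma \<epsilon>0_mult: "\<epsilon>0 (p * r) = \<epsilon>0 p * \<epsilon>0 r"
proof (induction p rule: free_algebra_induct)
  case (word v)
  show ?case
    by (induction r rule: free_algebra_induct)
      (simp_all add: \<epsilon>0_wm \<epsilon>0_linear distrib_left psc_mult_right flip: wm_simps(2))
qed (simp_all add: \<epsilon>0_linear distrib_right psc_mult_left)

lemma \<epsilon>0_simps: "\<epsilon>0 (var g) = counit_gen g" "\<epsilon>0 1 = 1" "\<epsilon>0 (p ^ n) = \<epsilon>0 p ^ n"
proof -
  show "\<epsilon>0 (var g) = counit_gen g" "\<epsilon>0 1 = 1" using \<epsilon>0_wm[of "[g]"] \<epsilon>0_wm[of "[]"] by (simp_all add: wm_simps)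
  show "\<epsilon>0 (p ^ n) = \<epsilon>0 p ^ n"
    by (induction n) (simp_all add: \<epsilon>0_mult \<epsilon>0_wm[of "[]", unfolded wm_simps])
qed

lemma cartan_sym: "cartan i j = cartan j i"
  by (simp add: cartan_def)

subsection \<open>Consequences of the defining relations\<close>

lemma const_mult: "const c * p = psc c p"
  by (simp add: const_def psc_conv_mult)

text \<open>The defining relations one by one, with the quantum Serre relations expressed through
  \<open>serre\<close>.\<close>

lemma U_relationsE:
  assumes "p \<in> U_relations q"
  obtains (KK) i j where "p = K i * K j - K j * K i" | (KK') i where "p = K i * K' i - 1"
    | (K'K) i where "p = K' i * K i - 1"
    | (KE) i j where "p = K i * E j * K' i - psc (q powi cartan j i) (E j)"
    | (KF) i j where "p = K i * F j * K' i - psc (q powi (- cartan j i)) (F j)"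
    | (EF1) "p = E I1 * F I1 - F I1 * E I1 - psc (1 / (q - inverse q)) (K I1 - K' I1)"
    | (EF) i j where "p = E i * F j - F j * E i" "(i, j) \<noteq> (I1, I1)"
    | (sE) i j where "p = serre q E i j" "i \<noteq> j" | (sF) i j where "p = serre q F i j" "i \<noteq> j"
  using assms that unfolding U_relations_def const_mult serre_def power2_eq_square mult.assoc Un_iff
    mem_Collect_eq singleton_iff
  by (elim disjE exE conjE) (simp only: mult.assoc, blast)+

text \<open>An ideal of the free algebra that contains the relations of \<open>U\<close>; both \<open>U\<close> and
  \<open>\<uu>\<close> are instances.\<close>

locale U_quotient = kideal N for N :: "(gen, 'k::field) free_algebra set" +
  fixes q :: 'k
  assumes rel: "U_relations q \<subseteq> N" and q: "q \<noteq> 0"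
begin

lemma relD:
  shows KK: "K i * K j \<approx> K j * K i" and KK': "K i * K' i \<approx> 1" and K'K: "K' i * K i \<approx> 1"
    and KEK': "K i * E j * K' i \<approx> psc (q powi cartan j i) (E j)"
    and KFK': "K i * F j * K' i \<approx> psc (q powi (- cartan j i)) (F j)"
    and EF1: "E I1 * F I1 - F I1 * E I1 \<approx> psc (1 / (q - inverse q)) (K I1 - K' I1)"
    and EF: "(i, j) \<noteq> (I1, I1) \<Longrightarrow> E i * F j \<approx> F j * E i"
    and serre_E: "i \<noteq> j \<Longrightarrow> serre q E i j \<in> N" and serre_F: "i \<noteq> j \<Longrightarrow> serre q F i j \<in> N"
proof -
  have r: "p \<in> U_relations q \<Longrightarrow> p \<in> N" for p using rel by blast
  show "K i * K j \<approx> K j * K i" unfolding eqv_def by (rule r) (auto simp: U_relations_def)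
  show "K i * K' i \<approx> 1" unfolding eqv_def by (rule r) (auto simp: U_relations_def)
  show "K' i * K i \<approx> 1" unfolding eqv_def by (rule r) (auto simp: U_relations_def)
  show "K i * E j * K' i \<approx> psc (q powi cartan j i) (E j)"
    unfolding eqv_def by (rule r) (auto simp: U_relations_def const_mult)
  show "K i * F j * K' i \<approx> psc (q powi (- cartan j i)) (F j)"
    unfolding eqv_def const_mult[symmetric] by (rule r) (unfold U_relations_def, blast)
  show "E I1 * F I1 - F I1 * E I1 \<approx> psc (1 / (q - inverse q)) (K I1 - K' I1)"
    unfolding eqv_def const_mult[symmetric] by (rule r) (unfold U_relations_def, blast)
  show "(i, j) \<noteq> (I1, I1) \<Longrightarrow> E i * F j \<approx> F j * E i"
    unfolding eqv_def by (rule r) (unfold U_relations_def, blast)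
  have s: "serre q x i j = x i ^ 2 * x j - const (q + inverse q) * (x i * x j * x i) + x j * x i ^ 2"
    for x :: "idx \<Rightarrow> (gen, 'k) free_algebra"
    by (simp add: serre_def const_mult power2_eq_square mult.assoc)
  show "i \<noteq> j \<Longrightarrow> serre q E i j \<in> N"
    unfolding s by (rule r) (unfold U_relations_def, blast)
  show "i \<noteq> j \<Longrightarrow> serre q F i j \<in> N"
    unfolding s by (rule r) (unfold U_relations_def, blast)
qed

text \<open>Conjugation by \<open>k\<close> rescales \<open>x\<close>, rewritten as commutation rules for
  \<open>k\<close> and its inverse.\<close>

lemma conj_to_qc:
  assumes kk: "k * k' \<approx> 1" "k' * k \<approx> 1" and c: "k * x * k' \<approx> psc c x" "c \<noteq> 0"
  shows "qc k x c" "qc k' x (inverse c)"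
proof -
  have "k * x = k * x * 1" by simp
  also have "\<dots> \<approx> k * x * (k' * k)" by (rule eqv_left[OF eqv_sym[OF kk(2)]])
  also have "\<dots> = k * x * k' * k" by (simp add: mult.assoc)
  also have "\<dots> \<approx> psc c x * k" by (rule eqv_right[OF c(1)])
  finally have 1: "k * x \<approx> psc c (x * k)" by (simp add: psc_mult_left)
  then show "qc k x c" by (simp add: qc_def)
  have "psc c (k' * x) = k' * psc c x" by (simp add: psc_mult_right)
  also have "\<dots> \<approx> k' * (k * x * k')" by (rule eqv_left[OF eqv_sym[OF c(1)]])
  also have "\<dots> = (k' * k) * (x * k')" by (simp add: mult.assoc)
  also have "\<dots> \<approx> 1 * (x * k')" by (rule eqv_right[OF kk(2)])
  finally have "psc (inverse c) (psc c (k' * x)) \<approx> psc (inverse c) (x * k')" by (intro psc_eqv) simp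
  then show "qc k' x (inverse c)" using c(2) by (simp add: qc_def)
qed

lemma qcKE: "qc (K i) (E j) (q powi cartan i j)" and qcK'E: "qc (K' i) (E j) (inverse (q powi cartan i j))"
  and qcKF: "qc (K i) (F j) (inverse (q powi cartan i j))" and qcK'F: "qc (K' i) (F j) (q powi cartan i j)"
proof -
  have c: "cartan j i = cartan i j" by (simp add: cartan_def)
  show "qc (K i) (E j) (q powi cartan i j)" "qc (K' i) (E j) (inverse (q powi cartan i j))"
    using conj_to_qc[OF KK' K'K KEK'[of i j]] q by (simp_all add: c)
  show "qc (K i) (F j) (inverse (q powi cartan i j))" "qc (K' i) (F j) (q powi cartan i j)"
    using conj_to_qc[OF KK' K'K KFK'[of i j]] q by (simp_all add: c power_int_minus)
qed

lemma qc1: "qc a b 1 \<longleftrightarrow> a * b \<approx> b * a" by (simp add: qc_def)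

lemma qc_swap: "qc a b c \<Longrightarrow> c \<noteq> 0 \<Longrightarrow> qc b a (inverse c)"
  unfolding qc_def using psc_eqv[of "a * b" "psc c (b * a)" "inverse c"] eqv_sym by simp

lemma qcKK: "qc (K i) (K j) 1" "qc (K' i) (K j) 1" "qc (K i) (K' j) 1" "qc (K' i) (K' j) 1"
proof -
  show 1: "qc (K i) (K j) 1" for i j using KK by (simp add: qc1)
  have "K i * K j * K' i \<approx> K j * K i * K' i" for i j by (rule eqv_right[OF KK])
  also have "K j * K i * K' i \<approx> psc 1 (K j)" for i j
    using eqv_left[OF KK', of "K j" i] by (simp add: mult.assoc)
  finally have a: "K i * K j * K' i \<approx> psc 1 (K j)" for i j .
  show 2: "qc (K' i) (K j) 1" for i j using conj_to_qc(2)[OF KK' K'K a] by simp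
  show 3: "qc (K i) (K' j) 1" for i j using qc_swap[OF 2] by simp
  have "K i * K' j * K' i \<approx> K' j * K i * K' i" for i j
    using eqv_right[OF 3[unfolded qc1]] .
  also have "K' j * K i * K' i \<approx> psc 1 (K' j)" for i j
    using eqv_left[OF KK', of "K' j" i] by (simp add: mult.assoc)
  finally have b: "K i * K' j * K' i \<approx> psc 1 (K' j)" for i j .
  show "qc (K' i) (K' j) 1" using conj_to_qc(2)[OF KK' K'K b] by simp
qed

lemma K'K_pow: "K' i ^ n * K i ^ n \<approx> 1"
proof (induction n)
  case (Suc n)
  have "K' i ^ Suc n * K i ^ Suc n = K' i ^ n * (K' i * K i) * K i ^ n"
    by (simp only: power_Suc2[of "K' i"] power_Suc[of "K i"] mult.assoc)
  also have "\<dots> \<approx> K' i ^ n * 1 * K i ^ n" by (intro eqv_mult eqv_refl K'K)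
  finally show ?case using Suc eqv_trans by simp
qed simp

lemma small_E12: "fE12 q = root_vec q E" and small_F12: "fF12 q = psc (- q) (root_vec q F)"
  using q by (simp_all add: fE12_def fF12_def root_vec_def psc.scale_right_diff_distrib)

lemma psc_power: "psc c p ^ n = psc (c ^ n) (p ^ n)" for p :: "'m::monoid_add \<Rightarrow>\<^sub>0 'k"
  by (induction n) (simp_all add: psc_mult_left psc_mult_right)

lemma small_relationsD:
  assumes small: "small_relations l q \<subseteq> N"
  shows "E i ^ l \<in> N" "F i ^ l \<in> N" "root_vec q E ^ l \<in> N" "root_vec q F ^ l \<in> N" "K i ^ l \<approx> 1" "K' i ^ l \<approx> 1"
proof -
  show "E i ^ l \<in> N" "F i ^ l \<in> N" using small by (cases i; auto simp: small_relations_def)+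
  show "root_vec q E ^ l \<in> N" using small by (auto simp: small_relations_def small_E12)
  have "fF12 q ^ l \<in> N" using small by (auto simp: small_relations_def)
  then have "psc ((- q) ^ l) (root_vec q F ^ l) \<in> N" by (simp only: small_F12 psc_power)
  from psc_mem[OF this, of "inverse ((- q) ^ l)"] show "root_vec q F ^ l \<in> N" using q by simp
  show k: "K i ^ l \<approx> 1" using small by (auto simp: small_relations_def eqv_def)
  show "K' i ^ l \<approx> 1"
    using eqv_trans[OF eqv_sym[OF eqv_left[OF k, of "K' i ^ l"]] K'K_pow[of i l]] by simp
qed

end

subsection \<open>The coproduct is compatible with the relations\<close>

lemma bt_left_inl: "bt p r = bt p 1 * bt 1 r" "bt p r = bt 1 r * bt p 1"
  by (simp_all flip: bt_mult)

text \<open>Here \<open>T\<close> is an ideal of the tensor square of the free algebra that contains \<open>N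
  \<otimes> 1\<close> and \<open>1 \<otimes> N\<close>: the kernel of the map onto the tensor square of the
  quotient.\<close>

locale \<Delta>_quotient = U_quotient N q + T: kideal T
  for N :: "(gen, 'k::field) free_algebra set" and q :: 'k and T :: "(gen word \<times> gen word \<Rightarrow>\<^sub>0 'k) set" +
  assumes inT: "\<And>p. p \<in> N \<Longrightarrow> bt p 1 \<in> T" "\<And>p. p \<in> N \<Longrightarrow> bt 1 p \<in> T"
begin

lemma bt_T: "p \<in> N \<Longrightarrow> bt p r \<in> T" "r \<in> N \<Longrightarrow> bt p r \<in> T"
  using T.right[OF inT(1)] T.left[OF inT(2)] bt_left_inl(1)[of p r] by simp_all

lemma bt_eqv: assumes "p \<approx> p'" "r \<approx> r'" shows "T.eqv (bt p r) (bt p' r')"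
proof -
  have "bt p r - bt p' r' = bt (p - p') r + bt p' (r - r')" by (simp add: bt_linear)
  also have "\<dots> \<in> T" using assms by (intro T.add bt_T) (simp_all add: eqv_def)
  finally show ?thesis by (simp add: T.eqv_def)
qed

lemma bt_qc: assumes "qc a b c" "qc a' b' c'" shows "T.qc (bt a a') (bt b b') (c * c')"
proof -
  have "T.eqv (bt (a * b) (a' * b')) (bt (psc c (b * a)) (psc c' (b' * a')))"
    using assms unfolding qc_def by (rule bt_eqv)
  then show ?thesis by (simp add: T.qc_def bt_linear bt_mult mult.commute)
qed

lemma qc_unit: "qc 1 b 1" "qc a 1 1" by (simp_all add: qc_def)

definition xE :: "idx \<Rightarrow> (gen word \<times> gen word \<Rightarrow>\<^sub>0 'k)" where "xE i = bt (K i) (E i)"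
definition yE :: "idx \<Rightarrow> (gen word \<times> gen word \<Rightarrow>\<^sub>0 'k)" where "yE i = bt (E i) 1"
definition xF :: "idx \<Rightarrow> (gen word \<times> gen word \<Rightarrow>\<^sub>0 'k)" where "xF i = bt (F i) (K' i)"
definition yF :: "idx \<Rightarrow> (gen word \<times> gen word \<Rightarrow>\<^sub>0 'k)" where "yF i = bt 1 (F i)"

lemma bt3: "bt a b * bt a' b' * bt a'' b'' = bt (a * a' * a'') (b * b' * b'')"
  by (simp add: bt_mult)

lemma K3: "K i * K j * K i \<approx> K i * K i * K j" "K j * K i * K i \<approx> K i * K i * K j"
proof -
  show 1: "K i * K j * K i \<approx> K i * K i * K j" using eqv_left[OF KK[of j i], of "K i"] by (simp add: mult.assoc)
  have "K j * K i * K i \<approx> K i * K j * K i" by (rule eqv_right[OF KK])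
  then show "K j * K i * K i \<approx> K i * K i * K j" using 1 by (rule eqv_trans)
qed

lemma K'3: "K' i * K' j * K' i \<approx> K' i * K' i * K' j" "K' j * K' i * K' i \<approx> K' i * K' i * K' j"
proof -
  have k: "K' i * K' j \<approx> K' j * K' i" for i j using qcKK(4) by (simp add: qc1)
  show 1: "K' i * K' j * K' i \<approx> K' i * K' i * K' j" using eqv_left[OF k[of j i], of "K' i"] by (simp add: mult.assoc)
  have "K' j * K' i * K' i \<approx> K' i * K' j * K' i" by (rule eqv_right[OF k])
  then show "K' j * K' i * K' i \<approx> K' i * K' i * K' j" using 1 by (rule eqv_trans)
qed

lemma serre_pair_E: "serre_pair T q xE yE"
proof unfold_locales
  fix i j
  show "q \<noteq> 0" by (rule q)
  show "T.qc (xE j) (yE i) (q powi cartan i j)"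
    using bt_qc[OF qcKE[of j i] qc_unit(2)[of "E j"]] by (simp add: xE_def yE_def cartan_sym[of j i])
  assume ij: "i \<noteq> j"
  have "T.eqv (serre q xE i j) (bt (K i * K i * K j) (serre q E i j))"
    unfolding serre_def xE_def bt3 bt_linear
    by (intro T.eqv_add T.eqv_diff T.psc_eqv bt_eqv K3 eqv_refl)
  then show "serre q xE i j \<in> T"
    using T.eqv_trans T.eqv_0 bt_T(2)[OF serre_E[OF ij]] by (metis (no_types))
  have "serre q yE i j = bt (serre q E i j) 1"
    unfolding serre_def yE_def bt3 bt_linear by simp
  then show "serre q yE i j \<in> T" using bt_T(1)[OF serre_E[OF ij]] by simp
qed

lemma serre_pair_F: "serre_pair T q xF yF"
proof unfold_locales
  fix i j
  show "q \<noteq> 0" by (rule q)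
  show "T.qc (xF j) (yF i) (q powi cartan i j)"
    using bt_qc[OF qc_unit(2) qcK'F[of j i], of "F j"] by (simp add: xF_def yF_def cartan_sym[of j i])
  assume ij: "i \<noteq> j"
  have "T.eqv (serre q xF i j) (bt (serre q F i j) (K' i * K' i * K' j))"
    unfolding serre_def xF_def bt3 bt_linear
    by (intro T.eqv_add T.eqv_diff T.psc_eqv bt_eqv K'3 eqv_refl)
  then show "serre q xF i j \<in> T"
    using T.eqv_trans T.eqv_0 bt_T(1)[OF serre_F[OF ij]] by (metis (no_types))
  have "serre q yF i j = bt 1 (serre q F i j)"
    unfolding serre_def yF_def bt3 bt_linear by simp
  then show "serre q yF i j \<in> T" using bt_T(2)[OF serre_F[OF ij]] by simp
qed

sublocale SE: serre_pair T q xE yE by (rule serre_pair_E)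
sublocale SF: serre_pair T q xF yF by (rule serre_pair_F)

lemma \<Delta>0_EF: "\<Delta>0 (E i) = xE i + yE i" "\<Delta>0 (F i) = xF i + yF i"
  by (simp_all add: \<Delta>0_simps xE_def yE_def xF_def yF_def add.commute)

lemma \<Delta>0_serre: "\<Delta>0 (serre q E i j) = serre q (\<lambda>i. xE i + yE i) i j"
    "\<Delta>0 (serre q F i j) = serre q (\<lambda>i. xF i + yF i) i j"
  unfolding serre_def \<Delta>0_simps(1-5) \<Delta>0_EF by (rule refl)+

lemma \<Delta>0_root_vec: "\<Delta>0 (root_vec q E) = root_vec q (\<lambda>i. xE i + yE i)"
    "\<Delta>0 (root_vec q F) = root_vec q (\<lambda>i. xF i + yF i)"
  unfolding root_vec_def \<Delta>0_simps(1-5) \<Delta>0_EF by (rule refl)+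

text \<open>The mixed terms \<open>K\<^sub>i F\<^sub>j \<otimes> E\<^sub>i K\<^sub>j\<^sup>-\<^sup>1\<close> of the
  two products agree, because the two commutation factors cancel.\<close>

lemma \<Delta>0_commutator:
  "T.eqv (\<Delta>0 (E i * F j - F j * E i))
      (bt (K i) (E i * F j - F j * E i) + bt (E i * F j - F j * E i) (K' j))"
proof -
  have "T.qc (bt (K i) (E i)) (bt (F j) (K' j)) (inverse (q powi cartan i j) * inverse (inverse (q powi cartan j i)))"
    using q by (intro bt_qc qcKF qc_swap[OF qcK'E]) simp
  then have "T.qc (bt (K i) (E i)) (bt (F j) (K' j)) 1"
    using q by (simp add: cartan_sym[of j i])
  then have d: "bt (K i) (E i) * bt (F j) (K' j) - bt (F j) (K' j) * bt (K i) (E i) \<in> T"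
    by (simp add: T.qc_def T.eqv_def)
  have "\<Delta>0 (E i * F j - F j * E i) - (bt (K i) (E i * F j - F j * E i) + bt (E i * F j - F j * E i) (K' j))
    = bt (K i) (E i) * bt (F j) (K' j) - (bt (F j) (K' j) * bt (K i) (E i) :: gen word \<times> gen word \<Rightarrow>\<^sub>0 'k)"
    by (simp add: \<Delta>0_simps distrib_left distrib_right bt_linear flip: bt_mult)
  then show ?thesis unfolding T.eqv_def using d by (simp only:)
qed

lemma \<Delta>0_U_relations:
  assumes "p \<in> U_relations q"
  shows "\<Delta>0 p \<in> T"
proof -
  have conj: "\<Delta>0 (K i * x * K' i - psc c x) \<in> T"
    if x: "\<Delta>0 x = bt a b + bt a' b'" "K i * a * K' i \<approx> psc d a" "K i * b * K' i \<approx> psc e b" "d * e = c"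
      "K i * a' * K' i \<approx> psc d' a'" "K i * b' * K' i \<approx> psc e' b'" "d' * e' = c" for i x a b a' b' c d e d' e'
  proof -
    have "T.eqv (bt (K i * a * K' i) (K i * b * K' i)) (bt (psc d a) (psc e b))"
      "T.eqv (bt (K i * a' * K' i) (K i * b' * K' i)) (bt (psc d' a') (psc e' b'))"
      by (intro bt_eqv that)+
    note 1 = T.eqv_add[OF this]
    have "e * d = c" "e' * d' = c" using that(4,7) by (simp_all add: mult.commute)
    then show ?thesis
      using 1 that(4,7) by (simp add: T.eqv_def \<Delta>0_simps x(1) distrib_left distrib_right bt_mult bt_linear
          psc.scale_right_distrib mult.assoc)
  qed
  have one: "K i * 1 * K' i \<approx> psc 1 1" for i using KK' by simp
  have KKK: "K i * K j * K' i \<approx> psc 1 (K j)" "K i * K' j * K' i \<approx> psc 1 (K' j)" for i j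
  proof -
    show "K i * K j * K' i \<approx> psc 1 (K j)"
      using eqv_trans[OF eqv_right[OF KK[of i j], of "K' i"] eqv_left[OF KK', of "K j" i, folded mult.assoc]] by simp
    show "K i * K' j * K' i \<approx> psc 1 (K' j)"
      using eqv_trans[OF eqv_right[OF qcKK(3)[of i j, unfolded qc1], of "K' i"] eqv_left[OF KK', of "K' j" i, folded mult.assoc]] by simp
  qed
  show ?thesis
    using assms
  proof (cases rule: U_relationsE)
    case (KK i j) then show ?thesis
      using bt_eqv[OF relD(1)[of i j] relD(1)[of i j]] by (simp add: \<Delta>0_simps bt_mult T.eqv_def)
  next
    case (KK' i) then show ?thesis
      using bt_eqv[OF relD(2)[of i] relD(2)[of i]] by (simp add: \<Delta>0_simps bt_mult bt_one T.eqv_def)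
  next
    case (K'K i) then show ?thesis
      using bt_eqv[OF relD(3)[of i] relD(3)[of i]] by (simp add: \<Delta>0_simps bt_mult bt_one T.eqv_def)
  next
    case (KE i j)
    show ?thesis unfolding KE
      by (rule conj[OF _ KKK(1) KEK' _ KEK' one]) (simp_all add: \<Delta>0_simps)
  next
    case (KF i j)
    show ?thesis unfolding KF
      by (rule conj[OF _ one KFK' _ KFK' KKK(2)]) (simp_all add: \<Delta>0_simps)
  next
    case EF1
    let ?c = "1 / (q - inverse q)"
    have "T.eqv (\<Delta>0 (E I1 * F I1 - F I1 * E I1))
        (bt (K I1) (psc ?c (K I1 - K' I1)) + bt (psc ?c (K I1 - K' I1)) (K' I1))"
      by (rule T.eqv_trans[OF \<Delta>0_commutator]) (intro T.eqv_add bt_eqv relD(6) eqv_refl)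
    also have "bt (K I1) (psc ?c (K I1 - K' I1)) + bt (psc ?c (K I1 - K' I1)) (K' I1)
        = \<Delta>0 (psc ?c (K I1 - K' I1))"
      by (simp add: \<Delta>0_simps bt_linear flip: psc.scale_right_distrib)
    finally show ?thesis unfolding EF1 by (simp add: T.eqv_def \<Delta>0_simps)
  next
    case (EF i j)
    have "bt (K i) (E i * F j - F j * E i) + bt (E i * F j - F j * E i) (K' j) \<in> T"
      using relD(7)[OF EF(2)] by (intro T.add bt_T) (simp_all add: eqv_def)
    then show ?thesis unfolding EF(1)
      using \<Delta>0_commutator[of i j] T.add by (fastforce simp: T.eqv_def)
  next
    case (sE i j) then show ?thesis using SE.serre_sum by (simp add: \<Delta>0_serre)
  next
    case (sF i j) then show ?thesis using SF.serre_sum by (simp add: \<Delta>0_serre)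
  qed
qed

lemma bt_pow: "bt a b ^ n = bt (a ^ n) (b ^ n)"
  by (induction n) (simp_all add: bt_one bt_mult)

text \<open>The coproducts of the \<open>l\<close>-th powers of the root vectors.\<close>

lemma \<Delta>0_root_power:
  assumes l: "prim_root l (q * q)"
  shows "T.eqv (\<Delta>0 (E i ^ l)) (bt (K i ^ l) (E i ^ l) + bt (E i ^ l) 1)"
    and "T.eqv (\<Delta>0 (F i ^ l)) (bt (F i ^ l) (K' i ^ l) + bt 1 (F i ^ l))"
    and "T.eqv (\<Delta>0 (root_vec q E ^ l))
      (bt ((K I1 * K I2) ^ l) (root_vec q E ^ l) + bt (psc ((1 - inverse q * inverse q) ^ l) ((E I1 * K I2) ^ l)) (E I2 ^ l)
       + bt (root_vec q E ^ l) 1)"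
    and "T.eqv (\<Delta>0 (root_vec q F ^ l))
      (bt (root_vec q F ^ l) ((K' I1 * K' I2) ^ l) + bt (F I2 ^ l) (psc ((1 - inverse q * inverse q) ^ l) ((F I1 * K' I2) ^ l))
       + bt 1 (root_vec q F ^ l))"
proof -
  show "T.eqv (\<Delta>0 (E i ^ l)) (bt (K i ^ l) (E i ^ l) + bt (E i ^ l) 1)"
    using SE.power_sum[OF l, of i] by (simp add: \<Delta>0_simps(8) \<Delta>0_EF) (simp add: xE_def yE_def bt_pow)
  show "T.eqv (\<Delta>0 (F i ^ l)) (bt (F i ^ l) (K' i ^ l) + bt 1 (F i ^ l))"
    using SF.power_sum[OF l, of i] by (simp add: \<Delta>0_simps(8) \<Delta>0_EF) (simp add: xF_def yF_def bt_pow)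
  have K21: "K I2 * K I1 \<approx> K I1 * K I2" by (rule KK)
  have K'21: "K' I2 * K' I1 \<approx> K' I1 * K' I2" using qcKK(4)[of I2 I1] by (simp add: qc1)
  have "T.eqv (root_vec q xE) (bt (K I1 * K I2) (root_vec q E))"
    unfolding root_vec_def xE_def bt_mult[symmetric] bt_linear
    by (intro T.eqv_diff T.psc_eqv bt_eqv K21 eqv_refl T.eqv_refl)
  then have X: "T.eqv (root_vec q xE ^ l) (bt ((K I1 * K I2) ^ l) (root_vec q E ^ l))"
    using T.eqv_power by (fastforce simp flip: bt_pow)
  have "root_vec q yE = bt (root_vec q E) 1"
    unfolding root_vec_def yE_def bt_mult[symmetric] bt_linear by simp
  then have Y: "root_vec q yE ^ l = bt (root_vec q E ^ l) 1" by (simp add: bt_pow)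
  have W: "psc c ((yE I1 * xE I2) ^ l) = bt (psc c ((E I1 * K I2) ^ l)) (E I2 ^ l)" for c
    by (simp add: yE_def xE_def bt_pow bt_linear flip: bt_mult)
  show "T.eqv (\<Delta>0 (root_vec q E ^ l))
      (bt ((K I1 * K I2) ^ l) (root_vec q E ^ l) + bt (psc ((1 - inverse q * inverse q) ^ l) ((E I1 * K I2) ^ l)) (E I2 ^ l)
       + bt (root_vec q E ^ l) 1)"
    using SE.root_vec_power_sum[OF l, unfolded W Y, folded \<Delta>0_root_vec \<Delta>0_simps(8)]
    by (rule T.eqv_trans) (intro T.eqv_add X T.eqv_refl)
  have "T.eqv (root_vec q xF) (bt (root_vec q F) (K' I1 * K' I2))"
    unfolding root_vec_def xF_def bt_mult[symmetric] bt_linear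
    by (intro T.eqv_diff T.psc_eqv bt_eqv K'21 eqv_refl T.eqv_refl)
  then have X: "T.eqv (root_vec q xF ^ l) (bt (root_vec q F ^ l) ((K' I1 * K' I2) ^ l))"
    using T.eqv_power by (fastforce simp flip: bt_pow)
  have "root_vec q yF = bt 1 (root_vec q F)"
    unfolding root_vec_def yF_def bt_mult[symmetric] bt_linear by simp
  then have Y: "root_vec q yF ^ l = bt 1 (root_vec q F ^ l)" by (simp add: bt_pow)
  have W: "psc c ((yF I1 * xF I2) ^ l) = bt (F I2 ^ l) (psc c ((F I1 * K' I2) ^ l))" for c
    by (simp add: yF_def xF_def bt_pow bt_linear flip: bt_mult)
  show "T.eqv (\<Delta>0 (root_vec q F ^ l))
      (bt (root_vec q F ^ l) ((K' I1 * K' I2) ^ l) + bt (F I2 ^ l) (psc ((1 - inverse q * inverse q) ^ l) ((F I1 * K' I2) ^ l))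
       + bt 1 (root_vec q F ^ l))"
    using SF.root_vec_power_sum[OF l, unfolded W Y, folded \<Delta>0_root_vec \<Delta>0_simps(8)]
    by (rule T.eqv_trans) (intro T.eqv_add X T.eqv_refl)
qed

lemma \<Delta>0_small_relations:
  assumes l: "prim_root l (q * q)" and small: "small_relations l q \<subseteq> N" and p: "p \<in> small_relations l q"
  shows "\<Delta>0 p \<in> T"
proof -
  have T: "\<Delta>0 p \<in> T" if "T.eqv (\<Delta>0 p) t" "t \<in> T" for p t
    using T.add[OF _ that(2)] that(1) by (fastforce simp: T.eqv_def)
  note E = small_relationsD(1)[OF small] and F = small_relationsD(2)[OF small]
    and E12 = small_relationsD(3)[OF small] and F12 = small_relationsD(4)[OF small]
  have r12: "\<Delta>0 (E i ^ l) \<in> T" "\<Delta>0 (F i ^ l) \<in> T" for i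
    by (rule T[OF \<Delta>0_root_power(1)[OF l]], intro T.add bt_T E, rule T[OF \<Delta>0_root_power(2)[OF l]], intro T.add bt_T F)
  have e12: "\<Delta>0 (root_vec q E ^ l) \<in> T"
    by (rule T[OF \<Delta>0_root_power(3)[OF l]]) (intro T.add bt_T(2)[OF E12] bt_T(2)[OF E] bt_T(1)[OF E12])
  have f12: "\<Delta>0 (root_vec q F ^ l) \<in> T"
    by (rule T[OF \<Delta>0_root_power(4)[OF l]]) (intro T.add bt_T(1)[OF F12] bt_T(1)[OF F] bt_T(2)[OF F12])
  have f12': "\<Delta>0 (fF12 q ^ l) \<in> T"
    unfolding small_F12 psc_power \<Delta>0_simps(3) by (rule T.psc_mem[OF f12])
  have k: "\<Delta>0 (K i ^ l - 1) \<in> T" for i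
  proof -
    have "K i ^ l \<approx> 1" by (rule small_relationsD(5)[OF small])
    then show ?thesis using bt_eqv[of "K i ^ l" 1 "K i ^ l" 1] by (simp add: \<Delta>0_simps bt_pow bt_one T.eqv_def)
  qed
  show ?thesis
    using p r12 e12[folded small_E12] f12' k
    by (auto simp: small_relations_def)
qed

end

section \<open>The Hopf structure of \<open>U\<close> and \<open>\<uu>\<close>\<close>

text \<open>A map of the free algebra that respects the relations descends to the presented algebra.\<close>

lemma alg_hom_lift:
  assumes "presented_alg A \<alpha>" and ker: "\<And>p r. \<alpha> p = \<alpha> r \<Longrightarrow> h p = h r"
    and "\<And>p. h p \<in> carrier B" "\<And>p r. h (p + r) = h p \<oplus>\<^bsub>B\<^esub> h r" "\<And>p r. h (p * r) = h p \<otimes>\<^bsub>B\<^esub> h r"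
      "h 1 = \<one>\<^bsub>B\<^esub>" "\<And>c p. h (psc c p) = c \<odot>\<^bsub>B\<^esub> h p"
  shows "\<exists>f\<in>alg_hom A B. \<forall>p. f (\<alpha> p) = h p"
proof -
  interpret presented_alg A \<alpha> by fact
  define f where "f = (\<lambda>x\<in>carrier A. h (SOME p. \<alpha> p = x))"
  have f: "f (\<alpha> p) = h p" for p
  proof -
    have "\<alpha> (SOME r. \<alpha> r = \<alpha> p) = \<alpha> p" by (rule someI[of "\<lambda>r. \<alpha> r = \<alpha> p"]) simp
    from ker[OF this] show ?thesis by (simp add: f_def)
  qed
  have "f \<in> ring_hom A B"
  proof (rule ring_hom_memI)
    fix x y assume "x \<in> carrier A" "y \<in> carrier A"
    then obtain p r where xy: "x = \<alpha> p" "y = \<alpha> r" by (auto elim!: \<pi>_E)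
    show "f x \<in> carrier B" "f (x \<otimes>\<^bsub>A\<^esub> y) = f x \<otimes>\<^bsub>B\<^esub> f y" "f (x \<oplus>\<^bsub>A\<^esub> y) = f x \<oplus>\<^bsub>B\<^esub> f y"
      unfolding xy \<alpha>_mult[symmetric] \<pi>_add[symmetric] f by (rule assms)+
  next
    show "f \<one>\<^bsub>A\<^esub> = \<one>\<^bsub>B\<^esub>" unfolding \<alpha>_one[symmetric] f by (rule assms)
  qed
  moreover have "f (c \<odot>\<^bsub>A\<^esub> x) = c \<odot>\<^bsub>B\<^esub> f x" if xA: "x \<in> carrier A" for c x
  proof -
    obtain p where x: "x = \<alpha> p" using xA by (rule \<pi>_E)
    show ?thesis unfolding x \<pi>_scale[symmetric] f by (rule assms)
  qed
  ultimately have "f \<in> alg_hom A B" by (simp add: alg_hom_def f_def)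
  then show ?thesis using f by blast
qed

lemma alg_hom_unique:
  fixes \<alpha> :: "('g, 'k::field) free_algebra \<Rightarrow> 'a"
  assumes "presented_alg A \<alpha>" and f: "f \<in> alg_hom A B" and g: "g \<in> alg_hom A B"
    and eq: "\<And>x. f (\<alpha> (var x)) = g (\<alpha> (var x))"
  shows "f = g"
proof -
  interpret presented_alg A \<alpha> by fact
  have w: "f (\<alpha> (wm w)) = g (\<alpha> (wm w))" for w
    by (induction w) (use f g in \<open>simp_all add: wm_simps \<alpha>_mult \<alpha>_one alg_hom_def ring_hom_def eq\<close>)
  have "f (\<alpha> p) = g (\<alpha> p)" for p
  proof (induction p rule: free_algebra_induct)
    case zero
    have "f (\<alpha> (psc 0 (wm []))) = g (\<alpha> (psc 0 (wm [])))"
      unfolding \<pi>_scale using f g w[of "[]"] by (simp add: alg_hom_def)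
    then show ?case by simp
  qed (use f g w in \<open>simp_all add: \<pi>_add \<pi>_scale alg_hom_def ring_hom_def\<close>)
  then have "f x = g x" if "x \<in> carrier A" for x using that by (auto simp: \<pi>_surj)
  then show ?thesis using f g by (intro extensionalityI[of _ "carrier A"]) (auto simp: alg_hom_def)
qed

subsection \<open>The antipode is compatible with the relations\<close>

lemma (in tideal) eqv_mem: "a \<approx> b \<Longrightarrow> b \<in> N \<Longrightarrow> a \<in> N"
  using add[of "a - b" b] by (simp add: eqv_def)

lemma serre_scale: "serre q (\<lambda>a. psc c (x a)) i j = psc (c * c * c) (serre q x i j)"
  unfolding serre_def
  by (rule poly_mapping_eqI) (simp add: psc_mult_left psc_mult_right lookup_add lookup_minus algebra_simps)

context U_quotient
begin

lemma powi_cartan: "q powi cartan i i = q * q" "i \<noteq> j \<Longrightarrow> q powi cartan i j = inverse q"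
  by (simp_all add: cartan_def power2_eq_square power_int_minus)

text \<open>Moving the torus elements to the left multiplies all three terms of the Serre relation by the same power
  of \<open>q\<close>.\<close>

lemma serre_shift:
  assumes ek: "\<And>a b. qc (e b) (k a) (q powi cartan a b)" and kk: "\<And>a b. qc (k a) (k b) 1"
    and s: "serre q e i j \<in> N" and ij: "i \<noteq> j"
  shows "serre q (\<lambda>a. k a * e a) i j \<in> N"
proof -
  have three: "(k a * e a) * (k b * e b) * (k c * e c) \<approx>
      psc (q powi cartan b a * (q powi cartan c b * q powi cartan c a)) (k a * k b * k c * (e a * e b * e c))" for a b c
  proof -
    have 1: "e a * k b \<approx> psc (q powi cartan b a) (k b * e a)" for a b using ek[of a b] by (simp add: qc_def)
    have "k a * (e a * k b) * (e b * k c) * e c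
       \<approx> k a * (psc (q powi cartan b a) (k b * e a)) * (psc (q powi cartan c b) (k c * e b)) * e c"
      by (intro eqv_mult 1 eqv_refl)
    also have "\<dots> = psc (q powi cartan b a * q powi cartan c b) (k a * k b * (e a * k c) * (e b * e c))"
      by (simp add: psc_mult_left psc_mult_right mult.assoc)
    also have "\<dots> \<approx> psc (q powi cartan b a * q powi cartan c b) (k a * k b * psc (q powi cartan c a) (k c * e a) * (e b * e c))"
      by (intro psc_eqv eqv_mult 1 eqv_refl)
    finally show ?thesis by (simp add: psc_mult_left psc_mult_right mult.assoc)
  qed
  have kk': "k a * k b \<approx> k b * k a" for a b using kk by (simp add: qc_def)
  have k1: "k i * k j * k i \<approx> k i * k i * k j"
    using eqv_left[OF kk'[of j i], of "k i"] by (simp add: mult.assoc)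
  have k2: "k j * k i * k i \<approx> k i * k i * k j"
    by (rule eqv_trans[OF eqv_right[OF kk'] k1])
  have ji: "j \<noteq> i" using ij by simp
  have c: "q powi cartan i i * (q powi cartan j i * q powi cartan j i) = 1"
    "q powi cartan j i * (q powi cartan i j * q powi cartan i i) = 1"
    "q powi cartan i j * (q powi cartan i i * q powi cartan i j) = 1"
    using q by (simp_all add: powi_cartan(1) powi_cartan(2)[OF ij] powi_cartan(2)[OF ji] field_simps)
  have "serre q (\<lambda>a. k a * e a) i j \<approx> k i * k i * k j * (e i * e i * e j)
    - psc (q + inverse q) (k i * k j * k i * (e i * e j * e i)) + k j * k i * k i * (e j * e i * e i)"
    unfolding serre_def
    by (intro eqv_add eqv_diff psc_eqv three[of i i j, unfolded c psc.scale_one]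
        three[of i j i, unfolded c psc.scale_one] three[of j i i, unfolded c psc.scale_one])
  also have "\<dots> \<approx> k i * k i * k j * (e i * e i * e j)
    - psc (q + inverse q) (k i * k i * k j * (e i * e j * e i)) + k i * k i * k j * (e j * e i * e i)"
    by (intro eqv_add eqv_diff psc_eqv eqv_right k1 k2 eqv_refl)
  also have "\<dots> = k i * k i * k j * serre q e i j"
    by (simp add: serre_def algebra_simps psc_mult_right)
  finally show ?thesis by (rule eqv_mem[OF _ left[OF s]])
qed

lemma S0_U_relations:
  assumes "p \<in> U_relations q"
  shows "S0 p \<in> N"
proof -
  have comm: "S0 (E i * F j - F j * E i) \<approx> - (K' i * (E i * F j - F j * E i) * K j)" for i j
  proof -
    have "F j * (K j * K' i) * E i \<approx> F j * (K' i * K j) * E i"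
      using qcKK(2)[of i j] by (intro eqv_right eqv_left) (simp add: qc1 eqv_sym)
    also have "\<dots> = (F j * K' i) * (K j * E i)" by (simp add: mult.assoc)
    also have "\<dots> \<approx> psc (inverse (q powi cartan i j)) (K' i * F j) * psc (q powi cartan j i) (E i * K j)"
      using qc_swap[OF qcK'F[of i j]] qcKE[of j i] q by (intro eqv_mult) (simp_all add: qc_def)
    also have "\<dots> = K' i * (F j * E i) * K j"
      using q by (simp add: psc_mult_left psc_mult_right mult.assoc cartan_sym[of j i])
    finally have "F j * K j * (K' i * E i) - K' i * E i * (F j * K j) \<approx> K' i * (F j * E i) * K j - K' i * (E i * F j) * K j"
      by (intro eqv_diff) (simp_all add: mult.assoc)
    then show ?thesis by (simp add: S0_simps algebra_simps)
  qed
  show ?thesis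
    using assms
  proof (cases rule: U_relationsE)
    case (KK i j) then show ?thesis using qcKK(4)[of j i] by (simp add: S0_simps qc1 eqv_def)
  next
    case (KK' i) then show ?thesis using relD(2)[of i] by (simp add: S0_simps eqv_def)
  next
    case (K'K i) then show ?thesis using relD(3)[of i] by (simp add: S0_simps eqv_def)
  next
    case (KE i j)
    have "K i * K' j * E j * K' i \<approx> K' j * K i * E j * K' i"
      using qcKK(3)[of i j] by (intro eqv_right) (simp add: qc1)
    also have "\<dots> \<approx> K' j * psc (q powi cartan j i) (E j)"
      using eqv_left[OF relD(4)[of i j], of "K' j"] by (simp add: mult.assoc)
    finally have "- (K i * K' j * E j * K' i) \<approx> - psc (q powi cartan j i) (K' j * E j)"
      by (intro eqv_uminus) (simp add: psc_mult_right)
    then show ?thesis using KE by (simp add: S0_simps eqv_def mult.assoc)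
  next
    case (KF i j)
    have "K i * F j * (K j * K' i) \<approx> K i * F j * (K' i * K j)"
      using qcKK(3)[of j i] by (intro eqv_left) (simp add: qc1)
    also have "\<dots> \<approx> psc (q powi (- cartan j i)) (F j) * K j"
      using eqv_right[OF relD(5)[of i j], of "K j"] by (simp add: mult.assoc)
    finally have "- (K i * F j * (K j * K' i)) \<approx> - psc (q powi (- cartan j i)) (F j * K j)"
      by (intro eqv_uminus) (simp add: psc_mult_left)
    then show ?thesis using KF by (simp add: S0_simps eqv_def mult.assoc)
  next
    case EF1
    let ?c = "1 / (q - inverse q)"
    have "S0 (E I1 * F I1 - F I1 * E I1) \<approx> - (K' I1 * (E I1 * F I1 - F I1 * E I1) * K I1)" by (rule comm)
    also have "\<dots> \<approx> - (K' I1 * psc ?c (K I1 - K' I1) * K I1)"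
      by (intro eqv_uminus eqv_right eqv_left relD(6))
    also have "\<dots> = - psc ?c (K' I1 * K I1 * K I1 - K' I1 * (K' I1 * K I1))"
      by (simp add: psc_mult_left psc_mult_right algebra_simps)
    also have "\<dots> \<approx> - psc ?c (1 * K I1 - K' I1 * 1)"
      by (intro eqv_uminus psc_eqv eqv_diff eqv_right eqv_left K'K)
    also have "\<dots> = S0 (psc ?c (K I1 - K' I1))"
      by (simp add: S0_simps psc.scale_right_diff_distrib)
    finally show ?thesis unfolding EF1 by (simp add: eqv_def S0_simps)
  next
    case (EF i j)
    have "E i * F j - F j * E i \<in> N" using relD(7)[OF EF(2)] by (simp add: eqv_def)
    then have "- (K' i * (E i * F j - F j * E i) * K j) \<in> N" by (intro uminus left right)
    then show ?thesis unfolding EF(1) by (rule eqv_mem[OF comm])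
  next
    case (sE i j)
    have "serre q (\<lambda>a. K' a * E a) i j \<in> N"
    proof (rule serre_shift[OF _ qcKK(4) serre_E[OF sE(2)] sE(2)])
      show "qc (E b) (K' a) (q powi cartan a b)" for a b using qc_swap[OF qcK'E[of a b]] q by simp
    qed
    moreover have "S0 (serre q E i j) = - serre q (\<lambda>a. K' a * E a) i j"
      unfolding serre_def by (rule poly_mapping_eqI) (simp add: S0_simps mult.assoc lookup_add lookup_minus)
    ultimately show ?thesis unfolding sE(1) using uminus by simp
  next
    case (sF i j)
    have 1: "serre q (\<lambda>a. K a * F a) i j \<in> N"
    proof (rule serre_shift[OF _ qcKK(1) serre_F[OF sF(2)] sF(2)])
      show "qc (F b) (K a) (q powi cartan a b)" for a b using qc_swap[OF qcKF[of a b]] q by simp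
    qed
    have 2: "F a * K a \<approx> psc (q * q) (K a * F a)" for a
      using qc_swap[OF qcKF[of a a]] q by (simp add: qc_def cartan_def power2_eq_square)
    have "serre q (\<lambda>a. F a * K a) i j \<approx> serre q (\<lambda>a. psc (q * q) (K a * F a)) i j"
      unfolding serre_def by (intro eqv_add eqv_diff psc_eqv eqv_mult 2)
    also have "\<dots> = psc (q * q * (q * q) * (q * q)) (serre q (\<lambda>a. K a * F a) i j)"
      by (rule serre_scale)
    finally have "serre q (\<lambda>a. F a * K a) i j \<in> N" by (rule eqv_mem[OF _ psc_mem[OF 1]])
    moreover have "S0 (serre q F i j) = - serre q (\<lambda>a. F a * K a) i j"
      unfolding serre_def by (rule poly_mapping_eqI) (simp add: S0_simps mult.assoc lookup_add lookup_minus)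
    ultimately show ?thesis unfolding sF(1) using uminus by simp
  qed
qed

end

lemma \<epsilon>0_relations: "q \<noteq> 0 \<Longrightarrow> p \<in> U_relations q \<Longrightarrow> \<epsilon>0 p = 0"
  unfolding U_relations_def
  by (auto simp: \<epsilon>0_linear \<epsilon>0_mult \<epsilon>0_simps const_mult)

text \<open>The map \<open>m (S \<otimes> id)\<close>.\<close>

definition mS :: "(gen word \<times> gen word \<Rightarrow>\<^sub>0 'k::field) \<Rightarrow> (gen, 'k) free_algebra" where
  "mS z = lin psc (\<lambda>(v, w). S0 (wm (letters v)) * wm (letters w)) z"

lemma mS_linear: "mS (x + y) = mS x + mS y" "mS (x - y) = mS x - mS y" "mS (psc c x) = psc c (mS x)" "mS 0 = 0"
  "mS (- x) = - mS x"
  by (simp_all add: mS_def psc.lin_add psc.lin_diff psc.lin_psc psc.lin_uminus)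

lemma mS_bt: "mS (bt p r) = S0 p * r"
proof (induction p rule: poly_mapping_linear_induct)
  case (single v)
  show ?case
    by (induction r rule: poly_mapping_linear_induct)
      (simp_all add: mS_linear bt_linear distrib_left psc_mult_right, simp add: mS_def psc.lin_single single_word)
qed (simp_all add: mS_linear bt_linear S0_simps distrib_right psc_mult_left)

lemma (in U_quotient) mS_dlt: "mS (dlt g * z) \<approx> psc (counit_gen g) (mS z)"
proof (induction z rule: poly_mapping_linear_induct)
  case (single z)
  obtain v w where z: "z = (v, w)" by (cases z)
  have s: "(Poly_Mapping.single z 1 :: gen word \<times> gen word \<Rightarrow>\<^sub>0 'k) = bt (wm (letters v)) (wm (letters w))"
    by (simp add: z flip: single_word)
  let ?c = "wm (letters v) :: (gen, 'k) free_algebra" and ?d = "wm (letters w) :: (gen, 'k) free_algebra"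
  have key: "S0 ?c * X * ?d \<approx> psc e (S0 ?c * ?d)" if "X \<approx> psc e 1" for X e
    using eqv_mult[OF eqv_left[OF that, of "S0 ?c"] eqv_refl[of ?d]] by (simp add: psc_mult_left psc_mult_right)
  show ?case
  proof (cases g)
    case (gE i) then show ?thesis
      by (simp add: s distrib_right mS_linear mS_bt S0_simps mult.assoc flip: bt_mult)
  next
    case (gF i)
    have "F i - F i * K i * K' i \<approx> psc 0 1"
      using eqv_diff[OF eqv_refl[of "F i"] eqv_left[OF KK'[of i], of "F i"]] by (simp add: mult.assoc)
    from key[OF this] gF show ?thesis
      by (simp add: s distrib_right mS_linear mS_bt S0_simps algebra_simps flip: bt_mult)
  next
    case (gK i) then show ?thesis using key[of "K' i * K i" 1] K'K[of i]
      by (simp add: s mS_linear mS_bt S0_simps algebra_simps flip: bt_mult)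
  next
    case (gK' i) then show ?thesis using key[of "K i * K' i" 1] KK'[of i]
      by (simp add: s mS_linear mS_bt S0_simps algebra_simps flip: bt_mult)
  qed
next
  case (add p r) then show ?case
    using eqv_add[OF add.IH] by (simp add: distrib_left mS_linear psc.scale_right_distrib)
next
  case (scale c p) then show ?case
    using psc_eqv[OF scale.IH, of c] by (simp add: psc_mult_right mS_linear mult.commute)
qed (simp add: mS_linear)

lemma (in U_quotient) mS_\<Delta>0: "mS (\<Delta>0 p) \<approx> psc (\<epsilon>0 p) 1"
proof (induction p rule: free_algebra_induct)
  case (word w)
  show ?case
  proof (induction w)
    case Nil
    have "mS 1 = (1 :: (gen, 'k) free_algebra)"
      using mS_bt[of "1 :: (gen, 'k) free_algebra" 1] by (simp add: S0_simps bt_one)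
    then show ?case by (simp add: wm_simps \<Delta>0_simps \<epsilon>0_simps)
  next
    case (Cons g w)
    have "mS (\<Delta>0 (wm (g # w))) \<approx> psc (counit_gen g) (mS (\<Delta>0 (wm w)))"
      using mS_dlt[of g "\<Delta>0 (wm w)"] by (simp add: wm_simps(3) \<Delta>0_simps)
    also have "\<dots> \<approx> psc (counit_gen g) (psc (\<epsilon>0 (wm w)) 1)" by (rule psc_eqv[OF Cons.IH])
    finally show ?case by (simp add: wm_simps(3) \<epsilon>0_mult \<epsilon>0_simps)
  qed
next
  case (add p r) then show ?case
    using eqv_add[OF add.IH] by (simp add: \<Delta>0_simps mS_linear \<epsilon>0_linear psc.scale_left_distrib)
next
  case (scale c p) then show ?case
    using psc_eqv[OF scale.IH, of c] by (simp add: \<Delta>0_simps mS_linear \<epsilon>0_linear)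
qed (simp add: \<Delta>0_simps mS_linear \<epsilon>0_linear)

subsection \<open>The structure maps of \<open>U\<close>\<close>

definition tU :: "'k::field \<Rightarrow> (gen word \<times> gen word \<Rightarrow>\<^sub>0 'k) \<Rightarrow> ('k U_elem \<times> 'k U_elem \<Rightarrow>\<^sub>0 'k) set" where
  "tU q = presented_pair.\<tau> (U_alg q) (piU q) (U_alg q) (piU q)"

lemma U_pair: "presented_alg_pair (U_alg q) (piU q) (U_alg q) (piU q)"
  using presented_U_alg by (rule presented_alg_pair.intro) (rule presented_U_alg)

lemma presented_tU: "presented_alg (tensor (U_alg q) (U_alg q)) (tU q)"
  unfolding tU_def by (rule presented_alg_pair.presented_alg_tensor[OF U_pair])

abbreviation kerU :: "'k::field \<Rightarrow> (gen word \<times> gen word \<Rightarrow>\<^sub>0 'k) set" where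
  "kerU q \<equiv> {p. tU q p = \<zero>\<^bsub>tensor (U_alg q) (U_alg q)\<^esub>}"

context
  fixes q :: "'k::field"
  assumes q: "q \<noteq> 0"
begin

interpretation UU: presented_alg_pair "U_alg q" "piU q" "U_alg q" "piU q" by (rule U_pair)

lemma \<Delta>_quotient_U: "\<Delta>_quotient (U_ideal q) q (kerU q)"
proof (intro \<Delta>_quotient.intro U_quotient.intro kideal.intro U_quotient_axioms.intro \<Delta>_quotient_axioms.intro)
  show "tideal (U_ideal q)" by (rule tideal_U_ideal)
  show "U_relations q \<subseteq> U_ideal q" using U_relations_in_ideal by blast
  show "q \<noteq> 0" by (rule q)
  show "tideal (kerU q)" by (rule presented_alg.kernel_tideal[OF presented_tU])
  fix p assume p: "p \<in> U_ideal q"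
  then have 0: "piU q p = piU q 0" using piU_eq_iff[of q p 0] by simp
  have "tU q (bt p r) = tU q 0" "tU q (bt r p) = tU q 0" for r
    using UU.pure_tensor_\<tau>[of p r] UU.pure_tensor_\<tau>[of r p] UU.pure_tensor_\<tau>[of 0 r] UU.pure_tensor_\<tau>[of r 0]
    by (simp_all add: 0 tU_def bt_linear)
  then show "bt p 1 \<in> kerU q" "bt 1 p \<in> kerU q"
    by (simp_all add: tU_def UU.T.\<pi>_zero)
qed

lemma \<Delta>0_U_ideal: "p \<in> U_ideal q \<Longrightarrow> \<Delta>0 p \<in> kerU q"
  using U_ideal_minimal[OF tideal_fhom[OF presented_alg.kernel_tideal[OF presented_tU[of q]], of dlt], of q p]
    \<Delta>_quotient.\<Delta>0_U_relations[OF \<Delta>_quotient_U]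
  by (auto simp: \<Delta>0_def)

lemma S0_U_ideal: "p \<in> U_ideal q \<Longrightarrow> S0 p \<in> U_ideal q"
  using U_ideal_minimal[OF tideal_antihom[OF tideal_U_ideal[of q], of ant], where q = q and p = p]
    U_quotient.S0_U_relations[OF \<Delta>_quotient.axioms(1)[OF \<Delta>_quotient_U]]
  by (auto simp: S0_def)

lemma \<epsilon>0_U_ideal: "p \<in> U_ideal q \<Longrightarrow> \<epsilon>0 p = 0"
proof -
  have "tideal {p. \<epsilon>0 p = (0::'k)}" by unfold_locales (simp_all add: \<epsilon>0_linear \<epsilon>0_mult)
  then show "p \<in> U_ideal q \<Longrightarrow> \<epsilon>0 p = 0" using U_ideal_minimal[of "{p. \<epsilon>0 p = 0}" q p] \<epsilon>0_relations[OF q] by auto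
qed

lemma comult_U: "comult (U_hopf q) (piU q p) = tU q (\<Delta>0 p)"
proof -
  interpret T: presented_alg "tensor (U_alg q) (U_alg q)" "tU q" by (rule presented_tU)
  have g: "U_gen q x = piU q (var x)" for x by (simp add: U_gen_def piU_def)
  have one: "\<one>\<^bsub>U_alg q\<^esub> = piU q 1" using UU.A.\<alpha>_one by simp
  have cg: "comult_gen q g = tU q (\<Delta>0 (var g))" for g
    by (cases g) (simp_all add: g one \<Delta>0_simps T.\<pi>_add, simp_all add: tU_def UU.pure_tensor_\<tau>)
  have "\<exists>f\<in>alg_hom (U_alg q) (tensor (U_alg q) (U_alg q)). \<forall>p. f (piU q p) = tU q (\<Delta>0 p)"
  proof (rule alg_hom_lift[OF presented_U_alg])
    show "tU q (\<Delta>0 p) = tU q (\<Delta>0 r)" if "piU q p = piU q r" for p r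
      using that \<Delta>0_U_ideal[of "p - r"] by (subst T.\<pi>_eq_iff) (simp add: piU_eq_iff \<Delta>0_simps)
  qed (simp_all add: \<Delta>0_simps T.\<pi>_add T.\<alpha>_mult T.\<alpha>_one T.\<pi>_scale)
  then obtain f where f: "f \<in> alg_hom (U_alg q) (tensor (U_alg q) (U_alg q))" "\<And>p. f (piU q p) = tU q (\<Delta>0 p)" by blast
  have "comult (U_hopf q) = f"
    unfolding U_hopf_def
    by (simp add: module.defs hopf.defs, rule the_equality)
      (use f cg in \<open>auto simp: g intro: alg_hom_unique[OF presented_U_alg]\<close>)
  then show ?thesis using f(2) by simp
qed

lemma antipode_U: "antipode (U_hopf q) (piU q p) = piU q (S0 p)"
proof -
  have g: "U_gen q x = piU q (var x)" for x by (simp add: U_gen_def piU_def)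
  have cg: "antipode_gen q g = piU q (S0 (var g))" for g
    by (cases g) (simp_all add: g S0_simps UU.A.\<alpha>_mult UU.A.\<pi>_uminus)
  have "\<exists>f\<in>alg_hom (U_alg q) (op_algebra (U_alg q)). \<forall>p. f (piU q p) = piU q (S0 p)"
  proof (rule alg_hom_lift[OF presented_U_alg])
    show "piU q (S0 p) = piU q (S0 r)" if "piU q p = piU q r" for p r
      using that S0_U_ideal[of "p - r"] by (simp add: piU_eq_iff S0_simps)
  qed (simp_all add: S0_simps op_algebra_def UU.A.\<pi>_add UU.A.\<alpha>_mult UU.A.\<alpha>_one UU.A.\<pi>_scale)
  then obtain f where f: "f \<in> alg_hom (U_alg q) (op_algebra (U_alg q))" "\<And>p. f (piU q p) = piU q (S0 p)" by blast
  have "antipode (U_hopf q) = f"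
    unfolding U_hopf_def
    by (simp add: module.defs hopf.defs, rule the_equality)
      (use f cg in \<open>auto simp: g intro: alg_hom_unique[OF presented_U_alg]\<close>)
  then show ?thesis using f(2) by simp
qed

lemma counit_U: "counit (U_hopf q) (piU q p) = \<epsilon>0 p"
proof -
  have g: "U_gen q x = piU q (var x)" for x by (simp add: U_gen_def piU_def)
  have "\<exists>f\<in>alg_hom (U_alg q) ground_field. \<forall>p. f (piU q p) = \<epsilon>0 p"
  proof (rule alg_hom_lift[OF presented_U_alg])
    show "\<epsilon>0 p = \<epsilon>0 r" if "piU q p = piU q r" for p r
      using that \<epsilon>0_U_ideal[of "p - r"] by (simp add: piU_eq_iff \<epsilon>0_linear)
  qed (simp_all add: \<epsilon>0_linear \<epsilon>0_mult \<epsilon>0_simps ground_field_def type_ring_def ring.defs module.defs)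
  then obtain f where f: "f \<in> alg_hom (U_alg q) ground_field" "\<And>p. f (piU q p) = \<epsilon>0 p" by blast
  have "counit (U_hopf q) = f"
    unfolding U_hopf_def
    by (simp add: module.defs hopf.defs, rule the_equality)
      (use f in \<open>auto simp: g \<epsilon>0_simps intro: alg_hom_unique[OF presented_U_alg]\<close>)
  then show ?thesis using f(2) by simp
qed

lemma mS_kerU: "z \<in> kerU q \<Longrightarrow> mS z \<in> U_ideal q"
proof -
  interpret N: tideal "U_ideal q" by (rule tideal_U_ideal)
  assume "z \<in> kerU q"
  then have "UU.\<tau> z = \<zero>\<^bsub>tensor (U_alg q) (U_alg q)\<^esub>" by (simp add: tU_def)
  then show ?thesis
    by (rule UU.kernel_induct)
      (auto simp: mS_linear mS_bt piU_zero_iff intro: N.add N.uminus N.zero N.left N.right S0_U_ideal)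
qed

end

subsection \<open>The structure maps of \<open>\<uu>\<close>\<close>

text \<open>The underlying algebra of \<open>\<uu>\<close>, over which the tensors in the definition of its coproduct
  are formed.\<close>

abbreviation su where "su l q \<equiv> alg_quot (U_hopf q) (small_ideal l q)"

lemma presented_su: "presented_alg (su l q) (pi_u l q)"
  unfolding pi_u_def[abs_def]
  by (rule presented_alg.presented_quotient(1)[OF presented_U ideal_small_ideal])

definition tu :: "nat \<Rightarrow> 'k::field \<Rightarrow> (gen word \<times> gen word \<Rightarrow>\<^sub>0 'k) \<Rightarrow> ('k u_elem \<times> 'k u_elem \<Rightarrow>\<^sub>0 'k) set" where
  "tu l q = presented_pair.\<tau> (su l q) (pi_u l q) (su l q) (pi_u l q)"

lemma u_pair: "presented_alg_pair (su l q) (pi_u l q) (su l q) (pi_u l q)"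
  using presented_su by (rule presented_alg_pair.intro) (rule presented_su)

lemma presented_tu: "presented_alg (tensor (su l q) (su l q)) (tu l q)"
  unfolding tu_def by (rule presented_alg_pair.presented_alg_tensor[OF u_pair])

abbreviation keru :: "nat \<Rightarrow> 'k::field \<Rightarrow> (gen word \<times> gen word \<Rightarrow>\<^sub>0 'k) set" where
  "keru l q \<equiv> {p. tu l q p = \<zero>\<^bsub>tensor (su l q) (su l q)\<^esub>}"

context
  fixes l :: nat and q :: "'k::field"
  assumes q: "q \<noteq> 0" and l: "prim_root l (q * q)" and ql: "q ^ l = 1"
begin

interpretation uu: presented_alg_pair "su l q" "pi_u l q" "su l q" "pi_u l q" by (rule u_pair)

lemma \<Delta>_quotient_u: "\<Delta>_quotient (u_ideal l q) q (keru l q)"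
proof (intro \<Delta>_quotient.intro U_quotient.intro kideal.intro U_quotient_axioms.intro \<Delta>_quotient_axioms.intro)
  show "tideal (u_ideal l q)" by (rule tideal_u_ideal)
  show "U_relations q \<subseteq> u_ideal l q" using U_relations_in_ideal U_ideal_subset_u_ideal by blast
  show "q \<noteq> 0" by (rule q)
  show "tideal (keru l q)" by (rule presented_alg.kernel_tideal[OF presented_tu])
  fix p assume p: "p \<in> u_ideal l q"
  then have 0: "pi_u l q p = pi_u l q 0" using pi_u_eq_iff[of l q p 0] by simp
  have "tu l q (bt p r) = tu l q 0" "tu l q (bt r p) = tu l q 0" for r
    using uu.pure_tensor_\<tau>[of p r] uu.pure_tensor_\<tau>[of r p] uu.pure_tensor_\<tau>[of 0 r] uu.pure_tensor_\<tau>[of r 0]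
    by (simp_all add: 0 tu_def bt_linear)
  then show "bt p 1 \<in> keru l q" "bt 1 p \<in> keru l q"
    by (simp_all add: tu_def uu.T.\<pi>_zero)
qed

lemma small_relations_subset: "small_relations l q \<subseteq> u_ideal l q"
  using small_relations_in_ideal by blast

lemma \<Delta>0_u_ideal: "p \<in> u_ideal l q \<Longrightarrow> \<Delta>0 p \<in> keru l q"
  using u_ideal_minimal[OF tideal_fhom[OF presented_alg.kernel_tideal[OF presented_tu[where l = l and q = q]], of dlt], where q = q and l = l and p = p]
    \<Delta>_quotient.\<Delta>0_U_relations[OF \<Delta>_quotient_u]
    \<Delta>_quotient.\<Delta>0_small_relations[OF \<Delta>_quotient_u l small_relations_subset]
  by (auto simp: \<Delta>0_def)

lemma \<epsilon>0_u_ideal: "p \<in> u_ideal l q \<Longrightarrow> \<epsilon>0 p = 0"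
proof -
  have "tideal {p. \<epsilon>0 p = (0::'k)}" by unfold_locales (simp_all add: \<epsilon>0_linear \<epsilon>0_mult)
  moreover have "small_relations l q \<subseteq> {p. \<epsilon>0 p = 0}"
    using l by (auto simp: small_relations_def \<epsilon>0_simps \<epsilon>0_linear \<epsilon>0_mult fE12_def fF12_def prim_root_def)
  ultimately show "p \<in> u_ideal l q \<Longrightarrow> \<epsilon>0 p = 0"
    using u_ideal_minimal[where N = "{p. \<epsilon>0 p = 0}" and q = q and l = l and p = p] \<epsilon>0_relations[OF q] by auto
qed

text \<open>Applying \<open>m (S \<otimes> id)\<close> to the coproduct of a power \<open>r\<close> of a root vector gives \<open>\<epsilon>(r) = 0\<close> on one
  side and \<open>S(r)\<close>, up to a unit and terms of the ideal, on the other.\<close>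

lemma S0_small_relations:
  assumes "p \<in> small_relations l q"
  shows "S0 p \<in> u_ideal l q"
proof -
  interpret U: \<Delta>_quotient "U_ideal q" q "kerU q" by (rule \<Delta>_quotient_U[OF q])
  interpret u: \<Delta>_quotient "u_ideal l q" q "keru l q" by (rule \<Delta>_quotient_u)
  have ze: "mS t \<in> u_ideal l q" if "U.T.eqv (\<Delta>0 r) t" "\<epsilon>0 r = 0" for r t
  proof -
    have "mS (\<Delta>0 r - t) \<in> U_ideal q" using that(1) by (intro mS_kerU[OF q]) (simp add: U.T.eqv_def)
    then have "mS (\<Delta>0 r) - mS t \<in> u_ideal l q" using U_ideal_subset_u_ideal by (auto simp: mS_linear)
    moreover have "mS (\<Delta>0 r) \<in> u_ideal l q" using u.mS_\<Delta>0[of r] that(2) by (simp add: u.eqv_def)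
    ultimately have "mS (\<Delta>0 r) - (mS (\<Delta>0 r) - mS t) \<in> u_ideal l q" by (rule u.diff[rotated])
    then show ?thesis by simp
  qed
  have cancel: "x \<in> u_ideal l q" if "x * k \<in> u_ideal l q" "u.eqv (k * k') 1" for x k k'
  proof -
    have "u.eqv (x * (k * k')) (x * 1)" by (rule u.eqv_left[OF that(2)])
    moreover have "x * (k * k') \<in> u_ideal l q" using u.right[OF that(1), of k'] by (simp add: mult.assoc)
    ultimately show ?thesis using u.eqv_mem[OF u.eqv_sym] by simp
  qed
  have l0: "l > 0" using l by (simp add: prim_root_def)
  note r = u.small_relationsD[OF small_relations_subset]
  note E = r(1) and F = r(2) and E12 = r(3) and F12 = r(4)
  have e0: "\<epsilon>0 (E i ^ l) = 0" "\<epsilon>0 (F i ^ l) = 0" "\<epsilon>0 (root_vec q E ^ l) = 0" "\<epsilon>0 (root_vec q F ^ l) = 0" for i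
    using l0 by (simp_all add: \<epsilon>0_simps root_vec_def \<epsilon>0_linear \<epsilon>0_mult)
  have drop: "x \<in> u_ideal l q" if "x + y \<in> u_ideal l q" "y \<in> u_ideal l q" for x y
    using u.diff[OF that] by simp
  have sE: "S0 (E i ^ l) \<in> u_ideal l q" for i
    using ze[OF U.\<Delta>0_root_power(1)[OF l] e0(1), of i] u.left[OF E[of i], of "S0 (K i ^ l)"]
    by (simp add: mS_linear mS_bt add.commute) (metis drop)
  note kinv = u.K'K_pow
  have sF: "S0 (F i ^ l) \<in> u_ideal l q" for i
  proof -
    have "S0 (F i ^ l) * K' i ^ l + F i ^ l \<in> u_ideal l q"
      using ze[OF U.\<Delta>0_root_power(2)[OF l] e0(2), of i] by (simp add: mS_linear mS_bt S0_simps)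
    then show ?thesis using cancel[OF drop[OF _ F] kinv] by blast
  qed
  have sE12: "S0 (root_vec q E ^ l) \<in> u_ideal l q"
  proof -
    have "S0 ((K I1 * K I2) ^ l) * root_vec q E ^ l
        + S0 (psc ((1 - inverse q * inverse q) ^ l) ((E I1 * K I2) ^ l)) * E I2 ^ l + S0 (root_vec q E ^ l) \<in> u_ideal l q"
      using ze[OF U.\<Delta>0_root_power(3)[OF l] e0(3)] by (simp add: mS_linear mS_bt)
    moreover have "S0 ((K I1 * K I2) ^ l) * root_vec q E ^ l
        + S0 (psc ((1 - inverse q * inverse q) ^ l) ((E I1 * K I2) ^ l)) * E I2 ^ l \<in> u_ideal l q"
      by (intro u.add u.left E12 E)
    ultimately show ?thesis using drop by (metis add.commute)
  qed
  have sF12: "S0 (root_vec q F ^ l) \<in> u_ideal l q"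
  proof -
    let ?k = "(K' I1 * K' I2) ^ l" and ?k' = "K I2 ^ l * K I1 ^ l"
    have "S0 (root_vec q F ^ l) * ?k + (S0 (F I2 ^ l) * psc ((1 - inverse q * inverse q) ^ l) ((F I1 * K' I2) ^ l)
        + root_vec q F ^ l) \<in> u_ideal l q"
      using ze[OF U.\<Delta>0_root_power(4)[OF l] e0(4)] by (simp add: mS_linear mS_bt S0_simps add.assoc)
    moreover have "S0 (F I2 ^ l) * psc ((1 - inverse q * inverse q) ^ l) ((F I1 * K' I2) ^ l)
        + root_vec q F ^ l \<in> u_ideal l q"
      by (intro u.add u.right sF F12)
    ultimately have 1: "S0 (root_vec q F ^ l) * ?k \<in> u_ideal l q" by (rule drop)
    have "u.eqv ((K' I1 * K' I2) ^ n) (K' I1 ^ n * K' I2 ^ n)" for n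
    proof (induction n)
      case (Suc n)
      have c: "u.qc (K' I2) (K' I1 ^ n) 1" using u.qc_pow_right[OF u.qcKK(4), of I2 I1 n] by simp
      have "(K' I1 * K' I2) ^ Suc n = (K' I1 * K' I2) * (K' I1 * K' I2) ^ n" by simp
      also have "u.eqv \<dots> ((K' I1 * K' I2) * (K' I1 ^ n * K' I2 ^ n))" by (rule u.eqv_left[OF Suc])
      also have "\<dots> = K' I1 * (K' I2 * K' I1 ^ n) * K' I2 ^ n" by (simp add: mult.assoc)
      also have "u.eqv \<dots> (K' I1 * (K' I1 ^ n * K' I2) * K' I2 ^ n)"
        using c by (intro u.eqv_right u.eqv_left) (simp add: u.qc_def)
      finally show ?case by (simp add: mult.assoc)
    qed simp
    then have "u.eqv (?k * ?k') (K' I1 ^ l * K' I2 ^ l * ?k')" by (rule u.eqv_right)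
    also have "\<dots> = K' I1 ^ l * (K' I2 ^ l * K I2 ^ l) * K I1 ^ l" by (simp add: mult.assoc)
    also have "u.eqv \<dots> (K' I1 ^ l * 1 * K I1 ^ l)" by (intro u.eqv_mult u.eqv_refl kinv)
    also have "u.eqv \<dots> 1" using kinv by simp
    finally show ?thesis using cancel[OF 1] by blast
  qed
  have sK: "S0 (K i ^ l - 1) \<in> u_ideal l q" for i
    using r(6)[of i] by (simp add: u.eqv_def S0_simps)
  have sF12': "S0 (fF12 q ^ l) \<in> u_ideal l q"
    unfolding u.small_F12 u.psc_power S0_simps(3) by (rule u.psc_mem[OF sF12])
  show ?thesis
    using assms sE sF sE12[folded u.small_E12] sF12' sK by (auto simp: small_relations_def)
qed

lemma S0_u_ideal: "p \<in> u_ideal l q \<Longrightarrow> S0 p \<in> u_ideal l q"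
  using u_ideal_minimal[OF tideal_antihom[OF tideal_u_ideal[of l q], of ant], where q = q and l = l and p = p]
    U_quotient.S0_U_relations[OF \<Delta>_quotient.axioms(1)[OF \<Delta>_quotient_u]] S0_small_relations
  by (auto simp: S0_def)

text \<open>The operations of the quotient are defined through chosen representatives, which differ from any given one
  by an element of the ideal.\<close>

lemma some_rep:
  obtains r where "(SOME x. x \<in> pi_u l q p) = piU q r" "r - p \<in> u_ideal l q"
proof -
  interpret U: presented_alg "U_hopf q" "piU q" by (rule presented_U)
  interpret I: ideal "small_ideal l q" "U_hopf q" by (rule ideal_small_ideal)
  have "(SOME x. x \<in> pi_u l q p) \<in> pi_u l q p"
    using I.a_rcos_self[of "piU q p"] by (intro someI[of "\<lambda>x. x \<in> pi_u l q p" "piU q p"]) (simp add: pi_u_def)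
  moreover have "pi_u l q p \<subseteq> carrier (U_hopf q)"
    unfolding pi_u_def by (rule U.C.a_r_coset_subset_G[OF I.a_subset]) simp
  ultimately obtain r where r: "(SOME x. x \<in> pi_u l q p) = piU q r" by (auto simp: U.\<pi>_surj)
  have "piU q r \<in> small_ideal l q +>\<^bsub>U_hopf q\<^esub> piU q p"
    using \<open>(SOME x. x \<in> pi_u l q p) \<in> pi_u l q p\<close> unfolding r by (simp add: pi_u_def)
  then have "small_ideal l q +>\<^bsub>U_hopf q\<^esub> piU q p = small_ideal l q +>\<^bsub>U_hopf q\<^esub> piU q r"
    by (rule U.C.a_repr_independence) (simp_all add: I.a_subgroup)
  then have "r - p \<in> u_ideal l q" using pi_u_eq_iff[of l q r p] by (simp add: pi_u_def)
  then show ?thesis using r that by blast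
qed

lemma antipode_u: "antipode (small_u l q) (pi_u l q p) = pi_u l q (S0 p)"
proof -
  obtain r where r: "(SOME x. x \<in> pi_u l q p) = piU q r" "r - p \<in> u_ideal l q" by (rule some_rep)
  have "antipode (small_u l q) (pi_u l q p) = pi_u l q (S0 r)"
    by (simp add: small_u_def hopf_quot_def module.defs hopf.defs r antipode_U[OF q], simp add: pi_u_def)
  also have "\<dots> = pi_u l q (S0 p)" using S0_u_ideal[OF r(2)] by (simp add: pi_u_eq_iff S0_simps)
  finally show ?thesis .
qed

lemma counit_u: "counit (small_u l q) (pi_u l q p) = \<epsilon>0 p"
proof -
  obtain r where r: "(SOME x. x \<in> pi_u l q p) = piU q r" "r - p \<in> u_ideal l q" by (rule some_rep)
  have "counit (small_u l q) (pi_u l q p) = \<epsilon>0 r"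
    by (simp add: small_u_def hopf_quot_def module.defs hopf.defs r counit_U[OF q])
  also have "\<dots> = \<epsilon>0 p" using \<epsilon>0_u_ideal[OF r(2)] by (simp add: \<epsilon>0_linear)
  finally show ?thesis .
qed

lemma comult_u: "comult (small_u l q) (pi_u l q p) = tu l q (\<Delta>0 p)"
proof -
  interpret UU: presented_alg_pair "U_alg q" "piU q" "U_alg q" "piU q" by (rule U_pair)
  interpret T: presented_alg "tensor (su l q) (su l q)" "tu l q" by (rule presented_tu)
  obtain r where r: "(SOME x. x \<in> pi_u l q p) = piU q r" "r - p \<in> u_ideal l q" by (rule some_rep)
  let ?f = "\<lambda>x1 x2. pure_tensor (su l q) (su l q) (small_ideal l q +>\<^bsub>U_hopf q\<^esub> x1) (small_ideal l q +>\<^bsub>U_hopf q\<^esub> x2)"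
  have f: "?f (piU q a) (piU q b) = tu l q (bt a b)" for a b
    using uu.pure_tensor_\<tau>[of a b] by (simp add: tu_def pi_u_def)
  have bil: "kbil (U_alg q) (U_alg q) (tensor (su l q) (su l q)) ?f"
    unfolding kbil_def klin_def
    by (auto elim!: UU.A.\<pi>_E simp: f bt_linear T.\<pi>_add T.\<pi>_scale simp flip: UU.A.\<pi>_add UU.A.\<pi>_scale)
  have "comult (small_u l q) (pi_u l q p) = sweedler2 (U_hopf q) (tensor (su l q) (su l q)) ?f (piU q r)"
    by (simp add: small_u_def hopf_quot_def module.defs hopf.defs r)
  also have "\<dots> = tensor_lift (tensor (su l q) (su l q)) ?f (UU.\<tau> (\<Delta>0 r))"
    by (simp add: sweedler2_def comult_U[OF q] tU_def)
  also have "\<dots> = tu l q (lin psc (\<lambda>(a, b). Poly_Mapping.single (a, b) 1) (\<Delta>0 r))"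
    by (rule UU.tensor_lift_\<tau>[OF T.presented_axioms bil]) (simp add: f)
  also have "\<dots> = tu l q (\<Delta>0 r)" using lin_single_id[of "\<Delta>0 r"] by (simp add: case_prod_unfold)
  also have "\<dots> = tu l q (\<Delta>0 p)"
    using \<Delta>0_u_ideal[OF r(2)] by (subst T.\<pi>_eq_iff) (simp add: \<Delta>0_simps)
  finally show ?thesis .
qed

end

section \<open>Sweedler sums over words\<close>

text \<open>For a coproduct that sends every letter to a sum of pairs of words, \<open>sw \<delta> f w\<close> is the Sweedler
  sum \<open>\<Sum> f w\<^sub>(\<^sub>1\<^sub>) w\<^sub>(\<^sub>2\<^sub>)\<close>.\<close>

fun sw :: "('g \<Rightarrow> ('g list \<times> 'g list) list) \<Rightarrow> ('g list \<Rightarrow> 'g list \<Rightarrow> 'b::comm_monoid_add) \<Rightarrow> 'g list \<Rightarrow> 'b" where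
  "sw \<delta> f [] = f [] []"
| "sw \<delta> f (g # w) = (\<Sum>(a, b)\<leftarrow>\<delta> g. sw \<delta> (\<lambda>c d. f (a @ c) (b @ d)) w)"

lemma sum_list_hom:
  assumes "h 0 = 0" "\<And>x y. h (x + y) = h x + h y"
  shows "h (\<Sum>x\<leftarrow>xs. f x) = (\<Sum>x\<leftarrow>xs. h (f x))"
  by (induction xs) (simp_all add: assms)

lemma sw_hom:
  assumes "h 0 = 0" "\<And>x y. h (x + y) = h x + h y"
  shows "h (sw \<delta> f w) = sw \<delta> (\<lambda>a b. h (f a b)) w"
  by (induction w arbitrary: f) (simp_all add: sum_list_hom[of h, OF assms] case_prod_unfold)

lemma sw_0: "sw \<delta> (\<lambda>a b. 0) w = 0"
  by (induction w) (simp_all add: case_prod_unfold)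

lemma sw_add: "sw \<delta> (\<lambda>a b. f a b + g a b) w = sw \<delta> f w + sw \<delta> g w"
  by (induction w arbitrary: f g) (simp_all add: case_prod_unfold sum_list_addf)

lemma sw_cmult: "sw \<delta> (\<lambda>a b. c * f a b) w = (c :: 'b::comm_semiring_0) * sw \<delta> f w"
  by (rule sw_hom[of "\<lambda>x. c * x", symmetric]) (simp_all add: distrib_left)

lemma sw_multc: "sw \<delta> (\<lambda>a b. f a b * c) w = sw \<delta> f w * (c :: 'b::comm_semiring_0)"
  by (rule sw_hom[of "\<lambda>x. x * c", symmetric]) (simp_all add: distrib_right)

lemma sw_sum_list: "sw \<delta> (\<lambda>a b. \<Sum>x\<leftarrow>xs. f x a b) w = (\<Sum>x\<leftarrow>xs. sw \<delta> (f x) w)"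
  by (induction xs) (simp_all add: sw_0 sw_add)

lemma sw_swap:
  "sw \<delta> (\<lambda>a b. sw \<epsilon> (\<lambda>c d. f a b c d) x) w = sw \<epsilon> (\<lambda>c d. sw \<delta> (\<lambda>a b. f a b c d) w) x"
  by (induction x arbitrary: f) (simp_all add: case_prod_unfold sw_sum_list)

lemma sw_append:
  "sw \<delta> f (v @ w) = sw \<delta> (\<lambda>a b. sw \<delta> (\<lambda>c d. f (a @ c) (b @ d)) w) v"
  by (induction v arbitrary: f) (simp_all add: case_prod_unfold)

lemma sw_kernel:
  assumes hadd: "\<And>x y. h (x + y) = hadd (h x) (h y)" and "\<And>a b. h (f a b) = h (g a b)"
  shows "h (sw \<delta> f w) = h (sw \<delta> g w)"
  using assms(2)
proof (induction w arbitrary: f g)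
  case (Cons x w)
  note IH = Cons.IH and pr = Cons.prems
  have "h (\<Sum>(a, b)\<leftarrow>xs. sw \<delta> (\<lambda>c d. f (a @ c) (b @ d)) w) = h (\<Sum>(a, b)\<leftarrow>xs. sw \<delta> (\<lambda>c d. g (a @ c) (b @ d)) w)" for xs
  proof (induction xs)
    case (Cons ab xs)
    have "h (sw \<delta> (\<lambda>c d. f (fst ab @ c) (snd ab @ d)) w) = h (sw \<delta> (\<lambda>c d. g (fst ab @ c) (snd ab @ d)) w)"
      by (rule IH) (rule pr)
    then show ?case using Cons by (simp add: hadd case_prod_unfold)
  qed simp
  then show ?case by simp
qed simp

text \<open>Both sides are multiplicative in the word, so coassociativity propagates from letters to words.\<close>

lemma coassoc_from_letters:
  fixes f :: "'g list \<Rightarrow> 'g list \<Rightarrow> 'g list \<Rightarrow> 'b::comm_monoid_add"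
  assumes letter: "\<And>(f :: 'g list \<Rightarrow> 'g list \<Rightarrow> 'g list \<Rightarrow> 'b) g.
     sw \<delta> (\<lambda>x c. sw \<delta> (\<lambda>a b. f a b c) x) [g] = sw \<delta> (\<lambda>a x. sw \<delta> (\<lambda>b c. f a b c) x) [g]"
  shows "sw \<delta> (\<lambda>x c. sw \<delta> (\<lambda>a b. f a b c) x) w = sw \<delta> (\<lambda>a x. sw \<delta> (\<lambda>b c. f a b c) x) w"
proof (induction w arbitrary: f)
  case (Cons g w)
  have "sw \<delta> (\<lambda>x c. sw \<delta> (\<lambda>a b. f a b c) x) ([g] @ w)
      = sw \<delta> (\<lambda>x c. sw \<delta> (\<lambda>x' c'. sw \<delta> (\<lambda>a b. sw \<delta> (\<lambda>a' b'. f (a @ a') (b @ b') (c @ c')) x') x) w) [g]"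
    by (simp only: sw_append)
  also have "\<dots> = sw \<delta> (\<lambda>x c. sw \<delta> (\<lambda>a b. sw \<delta> (\<lambda>x' c'. sw \<delta> (\<lambda>a' b'. f (a @ a') (b @ b') (c @ c')) x') w) x) [g]"
    by (subst sw_swap) (rule refl)
  also have "\<dots> = sw \<delta> (\<lambda>a x. sw \<delta> (\<lambda>b c. sw \<delta> (\<lambda>x' c'. sw \<delta> (\<lambda>a' b'. f (a @ a') (b @ b') (c @ c')) x') w) x) [g]"
    by (rule letter)
  also have "\<dots> = sw \<delta> (\<lambda>a x. sw \<delta> (\<lambda>b c. sw \<delta> (\<lambda>a' x'. sw \<delta> (\<lambda>b' c'. f (a @ a') (b @ b') (c @ c')) x') w) x) [g]"
    by (simp only: Cons.IH)
  also have "\<dots> = sw \<delta> (\<lambda>a x. sw \<delta> (\<lambda>a' x'. sw \<delta> (\<lambda>b c. sw \<delta> (\<lambda>b' c'. f (a @ a') (b @ b') (c @ c')) x') x) w) [g]"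
    by (subst sw_swap) (rule refl)
  also have "\<dots> = sw \<delta> (\<lambda>a x. sw \<delta> (\<lambda>b c. f a b c) x) ([g] @ w)"
    by (simp only: sw_append)
  finally show ?case by simp
qed simp

section \<open>The Borel subalgebras\<close>

text \<open>Both Borel parts are generated by letters \<open>X\<^sub>i\<close> (that is \<open>E\<^sub>i\<close> or \<open>F\<^sub>i\<close>), \<open>L\<^sub>i = K\<^sub>i\<close> and
  \<open>L\<^sub>i' = K\<^sub>i\<^sup>-\<^sup>1\<close>.\<close>

datatype bgen = X idx | L idx | L' idx

primrec eE :: "bgen \<Rightarrow> gen" where "eE (X i) = gE i" | "eE (L i) = gK i" | "eE (L' i) = gK' i"
primrec eF :: "bgen \<Rightarrow> gen" where "eF (X i) = gF i" | "eF (L i) = gK i" | "eF (L' i) = gK' i"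

primrec \<delta>A :: "bgen \<Rightarrow> (bgen list \<times> bgen list) list" where
  "\<delta>A (X i) = [([L i], [X i]), ([X i], [])]"
| "\<delta>A (L i) = [([L i], [L i])]" | "\<delta>A (L' i) = [([L' i], [L' i])]"

primrec \<delta>H :: "bgen \<Rightarrow> (bgen list \<times> bgen list) list" where
  "\<delta>H (X i) = [([], [X i]), ([X i], [L' i])]"
| "\<delta>H (L i) = [([L i], [L i])]" | "\<delta>H (L' i) = [([L' i], [L' i])]"

primrec anA :: "bgen \<Rightarrow> bgen list" where "anA (X i) = [L' i, X i]" | "anA (L i) = [L' i]" | "anA (L' i) = [L i]"
primrec anH :: "bgen \<Rightarrow> bgen list" where "anH (X i) = [X i, L i]" | "anH (L i) = [L' i]" | "anH (L' i) = [L i]"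
primrec sgn_letter :: "bgen \<Rightarrow> 'k::field" where "sgn_letter (X i) = - 1" | "sgn_letter (L i) = 1" | "sgn_letter (L' i) = 1"

lemma coassoc_A: "sw \<delta>A (\<lambda>x c. sw \<delta>A (\<lambda>a b. f a b c) x) w = sw \<delta>A (\<lambda>a x. sw \<delta>A (\<lambda>b c. f a b c) x) w"
proof (rule coassoc_from_letters)
  fix f :: "bgen list \<Rightarrow> bgen list \<Rightarrow> bgen list \<Rightarrow> 'a" and g
  show "sw \<delta>A (\<lambda>x c. sw \<delta>A (\<lambda>a b. f a b c) x) [g] = sw \<delta>A (\<lambda>a x. sw \<delta>A (\<lambda>b c. f a b c) x) [g]"
    by (cases g) (simp_all add: add_ac)
qed

lemma coassoc_H: "sw \<delta>H (\<lambda>x c. sw \<delta>H (\<lambda>a b. f a b c) x) w = sw \<delta>H (\<lambda>a x. sw \<delta>H (\<lambda>b c. f a b c) x) w"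
proof (rule coassoc_from_letters)
  fix f :: "bgen list \<Rightarrow> bgen list \<Rightarrow> bgen list \<Rightarrow> 'a" and g
  show "sw \<delta>H (\<lambda>x c. sw \<delta>H (\<lambda>a b. f a b c) x) [g] = sw \<delta>H (\<lambda>a x. sw \<delta>H (\<lambda>b c. f a b c) x) [g]"
    by (cases g) (simp_all add: add_ac)
qed

text \<open>The common description of the two Borel parts: \<open>e\<close> names the letters as generators of
  \<open>\<uu>\<close>, and \<open>\<delta>\<close>, \<open>an\<close> are the coproduct and, up to sign, the antipode
  of letters.\<close>

locale borel =
  fixes l :: nat and q :: "'k::field" and e :: "bgen \<Rightarrow> gen"
    and \<delta> :: "bgen \<Rightarrow> (bgen list \<times> bgen list) list" and an :: "bgen \<Rightarrow> bgen list"
  assumes q: "q \<noteq> 0" and l: "prim_root l (q * q)" and ql: "q ^ l = 1"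
    and eL: "e (L i) = gK i" "e (L' i) = gK' i"
    and dlt: "dlt (e g) = (\<Sum>(a, b)\<leftarrow>\<delta> g. bt (wm (map e a)) (wm (map e b) :: (gen, 'k) free_algebra))"
    and ant: "ant (e g) = psc (sgn_letter g) (wm (map e (an g)) :: (gen, 'k) free_algebra)"
begin

definition \<iota> :: "(bgen list \<Rightarrow>\<^sub>0 'k) \<Rightarrow> (gen, 'k) free_algebra" where
  "\<iota> p = lin psc (\<lambda>w. wm (map e w)) p"

lemma \<iota>_simps: "\<iota> (p + r) = \<iota> p + \<iota> r" "\<iota> (p - r) = \<iota> p - \<iota> r" "\<iota> (psc c p) = psc c (\<iota> p)" "\<iota> 0 = 0"
  "\<iota> (Poly_Mapping.single w c) = psc c (wm (map e w))"
  by (simp_all add: \<iota>_def psc.lin_add psc.lin_diff psc.lin_psc psc.lin_single)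

definition \<pi>B :: "(bgen list \<Rightarrow>\<^sub>0 'k) \<Rightarrow> 'k u_elem" where "\<pi>B p = pi_u l q (\<iota> p)"

abbreviation bB where "bB w \<equiv> \<pi>B (Poly_Mapping.single w 1)"

sublocale u: presented_alg "small_u l q" "pi_u l q" by (rule presented_u)
sublocale uu: presented_alg_pair "su l q" "pi_u l q" "su l q" "pi_u l q" by (rule u_pair)

lemma \<Delta>0_word: "\<Delta>0 (wm (map e w)) = sw \<delta> (\<lambda>a b. bt (wm (map e a)) (wm (map e b) :: (gen, 'k) free_algebra)) w"
proof (induction w)
  case Nil
  show ?case by (simp add: wm_simps \<Delta>0_simps bt_one)
next
  case (Cons g w)
  have "\<Delta>0 (wm (map e (g # w)) :: (gen, 'k) free_algebra) = dlt (e g) * \<Delta>0 (wm (map e w))"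
    by (simp add: wm_simps(3) \<Delta>0_simps)
  also have "\<dots> = (\<Sum>(a, b)\<leftarrow>\<delta> g. bt (wm (map e a)) (wm (map e b)) * sw \<delta> (\<lambda>a b. bt (wm (map e a)) (wm (map e b))) w)"
    unfolding dlt Cons by (induction "\<delta> g") (simp_all add: distrib_right case_prod_unfold sum_list_mult_const)
  also have "\<dots> = sw \<delta> (\<lambda>a b. bt (wm (map e a)) (wm (map e b))) (g # w)"
    by (simp add: sw_hom[of "\<lambda>x. bt (wm (map e _)) (wm (map e _)) * x"] distrib_left wm_simps(2) bt_mult)
  finally show ?case .
qed

definition awrd :: "bgen list \<Rightarrow> bgen list" where "awrd w = concat (map an (rev w))"
definition asgn :: "bgen list \<Rightarrow> 'k" where "asgn w = prod_list (map sgn_letter w)"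

lemma S0_word: "S0 (wm (map e w)) = psc (asgn w) (wm (map e (awrd w)))"
proof (induction w)
  case Nil show ?case by (simp add: wm_simps S0_simps awrd_def asgn_def)
next
  case (Cons g w) then show ?case
    by (simp add: wm_simps(2,3) S0_simps awrd_def asgn_def ant psc_mult_left psc_mult_right mult.commute)
qed

abbreviation B :: "'k u_elem set" where "B \<equiv> range \<pi>B"

lemma \<pi>B_word: "bB w = pi_u l q (wm (map e w))"
  by (simp add: \<pi>B_def \<iota>_simps)

lemma \<pi>B_linear: "\<pi>B (p + r) = \<pi>B p \<oplus>\<^bsub>small_u l q\<^esub> \<pi>B r" "\<pi>B (psc c p) = c \<odot>\<^bsub>small_u l q\<^esub> \<pi>B p"
  "\<pi>B 0 = \<zero>\<^bsub>small_u l q\<^esub>"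
  by (simp_all add: \<pi>B_def \<iota>_simps u.\<pi>_add u.\<pi>_scale u.\<pi>_zero)

lemma B_closed: "x \<in> B \<Longrightarrow> y \<in> B \<Longrightarrow> x \<oplus>\<^bsub>small_u l q\<^esub> y \<in> B" "x \<in> B \<Longrightarrow> c \<odot>\<^bsub>small_u l q\<^esub> x \<in> B"
  by (auto simp flip: \<pi>B_linear)

lemma \<pi>B_mult_word: "bB v \<otimes>\<^bsub>small_u l q\<^esub> bB w = bB (v @ w)"
  by (simp add: \<pi>B_word wm_simps(2) flip: u.\<alpha>_mult)

lemma \<iota>_mult: "\<exists>s. \<iota> p * \<iota> r = \<iota> s"
proof (induction p rule: poly_mapping_linear_induct)
  case (single v)
  show ?case
  proof (induction r rule: poly_mapping_linear_induct)
    case (single w)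
    show ?case by (rule exI[of _ "Poly_Mapping.single (v @ w) 1"]) (simp add: \<iota>_simps wm_simps)
  next
    case (add p r) then show ?case by (metis \<iota>_simps(1) distrib_left)
  next
    case (scale c p) then show ?case by (metis \<iota>_simps(3) psc_mult_right)
  qed (metis \<iota>_simps(4) mult_zero_right)
next
  case (add p r) then show ?case by (metis \<iota>_simps(1) distrib_right)
next
  case (scale c p) then show ?case by (metis \<iota>_simps(3) psc_mult_left)
qed (metis \<iota>_simps(4) mult_zero_left)

lemma S0_\<iota>: "\<exists>s. S0 (\<iota> p) = \<iota> s"
proof (induction p rule: poly_mapping_linear_induct)
  case (single w)
  show ?case by (rule exI[of _ "Poly_Mapping.single (awrd w) (asgn w)"]) (simp add: \<iota>_simps S0_word)
next
  case (add p r) then show ?case by (metis \<iota>_simps(1) S0_simps(1))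
next
  case (scale c p) then show ?case by (metis \<iota>_simps(3) S0_simps(3))
qed (metis \<iota>_simps(4) S0_simps(4))

lemma keys_add_subset: "Poly_Mapping.keys p \<subseteq> S \<Longrightarrow> Poly_Mapping.keys r \<subseteq> S \<Longrightarrow> Poly_Mapping.keys (p + r) \<subseteq> S"
  using keys_add[of p r] by blast

text \<open>The coproduct of a word in the letters is a sum of pairs of such words, which gives a representative of
  the coproduct with terms in the Borel part.\<close>

lemma keys_push: "Poly_Mapping.keys (uu.push (\<Delta>0 (\<iota> p))) \<subseteq> B \<times> B"
proof (induction p rule: poly_mapping_linear_induct)
  case (single w)
  have k: "Poly_Mapping.keys (sw \<delta> f v) \<subseteq> B \<times> B" if "\<And>a b. Poly_Mapping.keys (f a b) \<subseteq> B \<times> B"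
    for f :: "bgen list \<Rightarrow> bgen list \<Rightarrow> ('k u_elem \<times> 'k u_elem \<Rightarrow>\<^sub>0 'k)" and v
    using that
  proof (induction v arbitrary: f)
    case (Cons g v)
    note IH = Cons.IH and pr = Cons.prems
    have "Poly_Mapping.keys (\<Sum>(a, b)\<leftarrow>xs. sw \<delta> (\<lambda>c d. f (a @ c) (b @ d)) v) \<subseteq> B \<times> B" for xs
    proof (induction xs)
      case (Cons ab xs)
      have "Poly_Mapping.keys (sw \<delta> (\<lambda>c d. f (fst ab @ c) (snd ab @ d)) v) \<subseteq> B \<times> B"
        by (rule IH) (rule pr)
      then show ?case using Cons by (simp add: case_prod_unfold keys_add_subset)
    qed simp
    then show ?case by simp
  qed simp
  have "uu.push (\<Delta>0 (wm (map e w))) = sw \<delta> (\<lambda>a b. uu.push (bt (wm (map e a)) (wm (map e b)))) w"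
    unfolding \<Delta>0_word by (rule sw_hom) (simp_all add: uu.push_linear)
  moreover have "Poly_Mapping.keys (uu.push (bt (wm (map e a)) (wm (map e b)))) \<subseteq> B \<times> B" for a b
    by (simp add: wm_def uu.push_def psc.lin_single) (auto simp: \<pi>B_word wm_def intro!: range_eqI[of _ \<pi>B "Poly_Mapping.single _ 1"])
  ultimately show ?case using k by (simp add: \<iota>_simps)
next
  case (add p r) then show ?case
    by (simp add: \<iota>_simps \<Delta>0_simps uu.push_linear keys_add_subset)
next
  case (scale c p)
  have "Poly_Mapping.keys (psc c x) \<subseteq> Poly_Mapping.keys x" for x :: "'k u_elem \<times> 'k u_elem \<Rightarrow>\<^sub>0 'k"
    by (auto simp: in_keys_iff)
  then show ?case using scale by (simp add: \<iota>_simps \<Delta>0_simps uu.push_linear) (meson order_trans)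
qed (simp add: \<iota>_simps \<Delta>0_simps uu.push_linear)

lemma comult_mem: "uu.push (\<Delta>0 (\<iota> p)) \<in> comult (small_u l q) (\<pi>B p)"
  using uu.push_mem_\<tau>[of "\<Delta>0 (\<iota> p)"] by (simp add: \<pi>B_def comult_u[OF q l ql] tu_def)

definition gens :: "'k u_elem set" where "gens = u_gen l q ` (range (\<lambda>i. e (X i)) \<union> range gK)"

definition Bo :: "('k, 'k u_elem) hopf" where "Bo = hopf_generate (small_u l q) gens"

lemma hopf_subalgebra_B: "hopf_subalgebra (small_u l q) B"
  unfolding hopf_subalgebra_def
proof (intro conjI ballI allI)
  show "B \<subseteq> carrier (small_u l q)" by (auto simp: \<pi>B_def)
  show "\<one>\<^bsub>small_u l q\<^esub> \<in> B" using \<pi>B_word[of "[]"] by (metis list.map(1) rangeI u.\<alpha>_one wm_simps(1))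
  fix x assume "x \<in> B"
  then obtain p where x: "x = \<pi>B p" by blast
  show "c \<odot>\<^bsub>small_u l q\<^esub> x \<in> B" for c using \<open>x \<in> B\<close> by (rule B_closed)
  obtain s where "S0 (\<iota> p) = \<iota> s" using S0_\<iota> by blast
  then show "antipode (small_u l q) x \<in> B" by (simp add: x \<pi>B_def antipode_u[OF q l ql])
  show "\<exists>p\<in>comult (small_u l q) x. Poly_Mapping.keys p \<subseteq> B \<times> B"
    unfolding x using keys_push comult_mem by (intro bexI)
  fix y assume "y \<in> B"
  then show "x \<oplus>\<^bsub>small_u l q\<^esub> y \<in> B" using \<open>x \<in> B\<close> by (intro B_closed)
  obtain r where y: "y = \<pi>B r" using \<open>y \<in> B\<close> by blast
  obtain s where "\<iota> p * \<iota> r = \<iota> s" using \<iota>_mult by blast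
  then show "x \<otimes>\<^bsub>small_u l q\<^esub> y \<in> B" by (simp add: x y \<pi>B_def flip: u.\<alpha>_mult)
qed

lemma u_letter: "pi_u l q (var (e g)) = bB [g]"
  by (simp add: \<pi>B_word wm_simps)

lemma gens_B: "gens \<subseteq> B"
proof -
  have "u_gen l q (e g) \<in> B" for g by (simp add: u_gen_eq u_letter)
  from this[of "X i" for i] this[of "L i" for i] show ?thesis by (auto simp: gens_def eL)
qed

text \<open>A Hopf subalgebra contains \<open>K\<^sub>i\<^sup>-\<^sup>1 = S(K\<^sub>i)\<close>, hence all words in the
  letters.\<close>

lemma B_minimal:
  assumes "hopf_subalgebra (small_u l q) B'" "gens \<subseteq> B'"
  shows "B \<subseteq> B'"
proof -
  note h = assms(1)[unfolded hopf_subalgebra_def]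
  have K: "u_gen l q (gK i) \<in> B'" for i using assms(2) by (auto simp: gens_def)
  have "antipode (small_u l q) (u_gen l q (gK i)) \<in> B'" for i using K h by blast
  then have K': "u_gen l q (gK' i) \<in> B'" for i
    by (simp add: u_gen_eq antipode_u[OF q l ql] S0_simps)
  have "u_gen l q (e g) \<in> B'" for g
    using assms(2) K K' by (cases g) (auto simp: gens_def eL)
  then have g: "bB [g] \<in> B'" for g by (simp add: u_gen_eq u_letter)
  have "bB [] \<in> B'" using h by (simp add: \<pi>B_word wm_simps u.\<alpha>_one)
  then have w: "bB w \<in> B'" for w
  proof (induction w)
    case (Cons x w)
    then have "bB [x] \<otimes>\<^bsub>small_u l q\<^esub> bB w \<in> B'" using g[of x] h by blast
    then show ?case by (simp add: \<pi>B_mult_word)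
  qed
  have "\<pi>B p \<in> B'" for p
  proof (induction p rule: poly_mapping_linear_induct)
    case zero
    have "\<pi>B (psc 0 (Poly_Mapping.single [] 1)) \<in> B'" unfolding \<pi>B_linear using h w by blast
    then show ?case by simp
  qed (use h w in \<open>simp_all add: \<pi>B_linear\<close>)
  then show ?thesis by blast
qed

lemma Bo_eq: "Bo = hopf_restrict (small_u l q) B"
proof -
  have "\<Inter>{B'. hopf_subalgebra (small_u l q) B' \<and> gens \<subseteq> B'} = B"
    using hopf_subalgebra_B gens_B B_minimal by blast
  then show ?thesis by (simp add: Bo_def hopf_generate_def)
qed

lemma Bo_simps:
  "carrier Bo = B" "x \<otimes>\<^bsub>Bo\<^esub> y = x \<otimes>\<^bsub>small_u l q\<^esub> y" "\<one>\<^bsub>Bo\<^esub> = \<one>\<^bsub>small_u l q\<^esub>" "\<zero>\<^bsub>Bo\<^esub> = \<zero>\<^bsub>small_u l q\<^esub>"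
  "x \<oplus>\<^bsub>Bo\<^esub> y = x \<oplus>\<^bsub>small_u l q\<^esub> y" "c \<odot>\<^bsub>Bo\<^esub> x = c \<odot>\<^bsub>small_u l q\<^esub> x"
  "antipode Bo = antipode (small_u l q)" "counit Bo = counit (small_u l q)"
  "comult Bo x = {p \<in> comult (small_u l q) x. Poly_Mapping.keys p \<subseteq> B \<times> B}"
  by (simp_all add: Bo_eq hopf_restrict_def)

lemma presented_Bo: "presented psc Bo \<pi>B"
  by unfold_locales (simp_all add: \<pi>B_linear Bo_simps)

sublocale Bo: presented psc Bo \<pi>B by (rule presented_Bo)

lemma Bo_mult_word: "bB v \<otimes>\<^bsub>Bo\<^esub> bB w = bB (v @ w)"
  by (simp add: Bo_simps \<pi>B_mult_word)

lemma Bo_one: "\<one>\<^bsub>Bo\<^esub> = bB []"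
  by (simp add: Bo_simps \<pi>B_word wm_simps u.\<alpha>_one)

lemma \<pi>B_zero_iff: "\<pi>B p = \<zero>\<^bsub>Bo\<^esub> \<longleftrightarrow> \<iota> p \<in> u_ideal l q"
  by (simp add: \<pi>B_def Bo_simps pi_u_zero_iff)

lemma antipode_word: "antipode Bo (bB w) = asgn w \<odot>\<^bsub>Bo\<^esub> bB (awrd w)"
  by (simp add: Bo_simps \<pi>B_word antipode_u[OF q l ql] S0_word u.\<pi>_scale)

lemma counit_word: "counit Bo (bB w) = prod_list (map (counit_gen \<circ> e) w)"
  by (simp add: Bo_simps \<pi>B_word counit_u[OF q l ql] \<epsilon>0_wm)

text \<open>A linear projection of \<open>\<uu>\<close> onto the Borel part extends bilinear maps from the Borel part to
  \<open>\<uu>\<close>.  Hence Sweedler sums may be computed with any representative of the coproduct.\<close>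

lemma projection: "\<exists>P. klin (small_u l q) (small_u l q) P \<and> (\<forall>x\<in>carrier (small_u l q). P x \<in> B) \<and> (\<forall>x\<in>B. P x = x)"
proof -
  let ?W = "{p. pi_u l q p \<in> B} :: (gen, 'k) free_algebra set"
  have W: "psc.subspace ?W"
    unfolding psc.subspace_def
    by (auto simp: u.\<pi>_add u.\<pi>_scale B_closed) (metis \<pi>B_linear(3) rangeI u.\<pi>_zero)
  obtain S where S: "S \<subseteq> ?W" "psc.independent S" "?W \<subseteq> psc.span S"
    using psc.maximal_independent_subset by blast
  have span: "psc.span S = ?W" using S psc.span_minimal[OF S(1) W] by blast
  interpret pp: vector_space_pair "psc :: 'k \<Rightarrow> (gen, 'k) free_algebra \<Rightarrow> _" "psc :: 'k \<Rightarrow> (gen, 'k) free_algebra \<Rightarrow> _" ..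
  obtain g where g: "Vector_Spaces.linear psc psc g" "\<forall>x\<in>S. g x = x" "range g = psc.span ((\<lambda>x. x) ` S)"
    using pp.linear_independent_extend_subspace[OF S(2), of "\<lambda>x. x"] by auto
  interpret g: Vector_Spaces.linear psc psc g by (rule g(1))
  have gW: "g x = x" if "x \<in> ?W" for x
  proof -
    have "x \<in> psc.span S" using that span by blast
    then show ?thesis
      by (rule pp.linear_eq_on[OF g(1) psc.linear_id[unfolded id_def]]) (use g(2) in auto)
  qed
  have gr: "pi_u l q (g x) \<in> B" for x
  proof -
    have "g x \<in> psc.span S" using g(3) by auto
    then show ?thesis using span by blast
  qed
  have ker: "pi_u l q (g p) = pi_u l q (g r)" if "pi_u l q p = pi_u l q r" for p r
  proof -
    have "pi_u l q (p - r) = \<zero>\<^bsub>small_u l q\<^esub>" using that u.\<pi>_eq_iff by blast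
    then have "p - r \<in> ?W" using \<pi>B_linear(3) by (metis mem_Collect_eq rangeI)
    then have "g (p - r) = p - r" by (rule gW)
    then show ?thesis using that by (subst u.\<pi>_eq_iff) (simp add: g.diff[symmetric] u.\<pi>_eq_iff[symmetric])
  qed
  define P where "P x = pi_u l q (g (SOME p. pi_u l q p = x))" for x
  have P: "P (pi_u l q p) = pi_u l q (g p)" for p
    unfolding P_def by (rule ker) (rule someI[of "\<lambda>r. pi_u l q r = pi_u l q p"], simp)
  show ?thesis
  proof (intro exI[of _ P] conjI ballI)
    show "klin (small_u l q) (small_u l q) P"
      unfolding klin_def
      by (auto elim!: u.\<pi>_E simp: P g.add g.scale u.\<pi>_add u.\<pi>_scale simp flip: u.\<pi>_add u.\<pi>_scale)
    show "P x \<in> B" if "x \<in> carrier (small_u l q)" for x using that gr by (auto elim!: u.\<pi>_E simp: P)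
    show "P x = x" if x: "x \<in> B" for x
    proof -
      obtain p where p: "x = pi_u l q p" using x by (auto simp: \<pi>B_def)
      then show ?thesis using gW[of p] x by (simp add: P)
    qed
  qed
qed

lemma sweedler2_word:
  assumes C: "presented sc C \<gamma>" and f: "kbil Bo Bo C f" and g: "\<And>v w. f (bB v) (bB w) = \<gamma> (g v w)"
  shows "sweedler2 Bo C f (\<pi>B p) = \<gamma> (lin sc (sw \<delta> g) p)"
proof -
  interpret C: presented sc C \<gamma> by (rule C)
  obtain P where P0: "klin (small_u l q) (small_u l q) P \<and> (\<forall>x\<in>carrier (small_u l q). P x \<in> B) \<and> (\<forall>x\<in>B. P x = x)"
    using projection ..
  then have P: "klin (small_u l q) (small_u l q) P" "\<And>x. x \<in> carrier (small_u l q) \<Longrightarrow> P x \<in> B" "\<And>x. x \<in> B \<Longrightarrow> P x = x"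
    by blast+
  note fl = klinD[OF kbilD(1)[OF f], unfolded Bo_simps] and fr = klinD[OF kbilD(2)[OF f], unfolded Bo_simps]
  note Pl = klinD[OF P(1)]
  define f' where "f' x y = f (P x) (P y)" for x y
  have su: "carrier (su l q) = carrier (small_u l q)" "add (su l q) = add (small_u l q)"
    "smult (su l q) = smult (small_u l q)"
    by (simp_all add: small_u_def hopf_quot_def module.defs)
  have f': "kbil (su l q) (su l q) C f'"
    unfolding kbil_def klin_def f'_def su using P(2) Pl fl fr by auto
  define g' where "g' x y = (SOME z. \<gamma> z = f' (pi_u l q (Poly_Mapping.single x 1)) (pi_u l q (Poly_Mapping.single y 1)))" for x y
  have g': "f' (pi_u l q (Poly_Mapping.single x 1)) (pi_u l q (Poly_Mapping.single y 1)) = \<gamma> (g' x y)" for x y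
  proof -
    have "f' (pi_u l q (Poly_Mapping.single x 1)) (pi_u l q (Poly_Mapping.single y 1)) \<in> carrier C"
      using klinD(1)[OF kbilD(1)[OF f']] su by simp
    then obtain z where "\<gamma> z = f' (pi_u l q (Poly_Mapping.single x 1)) (pi_u l q (Poly_Mapping.single y 1))"
      by (auto elim: C.\<pi>_E)
    from someI[of "\<lambda>z. \<gamma> z = f' (pi_u l q (Poly_Mapping.single x 1)) (pi_u l q (Poly_Mapping.single y 1))", OF this]
    show ?thesis unfolding g'_def by simp
  qed
  define s where "s = (SOME s. s \<in> comult Bo (\<pi>B p))"
  have "s \<in> comult Bo (\<pi>B p)"
    unfolding s_def by (rule someI[of _ "uu.push (\<Delta>0 (\<iota> p))"]) (simp add: Bo_simps comult_mem keys_push)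
  then have s: "s \<in> uu.\<tau> (\<Delta>0 (\<iota> p))" "Poly_Mapping.keys s \<subseteq> B \<times> B"
    by (simp_all add: Bo_simps \<pi>B_def comult_u[OF q l ql] tu_def)
  have "sweedler2 Bo C f (\<pi>B p) = (\<Oplus>\<^bsub>C\<^esub>z\<in>Poly_Mapping.keys s. Poly_Mapping.lookup s z \<odot>\<^bsub>C\<^esub> f (fst z) (snd z))"
    by (simp add: sweedler2_def tensor_lift_def s_def Let_def)
  also have "\<dots> = (\<Oplus>\<^bsub>C\<^esub>z\<in>Poly_Mapping.keys s. Poly_Mapping.lookup s z \<odot>\<^bsub>C\<^esub> f' (fst z) (snd z))"
    using s(2) P(3) fl(1) by (intro C.C.finsum_cong') (auto simp: f'_def subset_iff intro!: C.smult_closed)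
  also have "\<dots> = \<gamma> (lin sc (\<lambda>(x, y). g' x y) (\<Delta>0 (\<iota> p)))"
    by (rule uu.evaluate_bilinear[OF C f' g' s(1)])
  also have "\<dots> = \<gamma> (lin sc (sw \<delta> g) p)"
  proof (induction p rule: poly_mapping_linear_induct)
    case (single w)
    have "lin sc (\<lambda>(x, y). g' x y) (\<Delta>0 (wm (map e w))) = sw \<delta> (\<lambda>a b. g' (Word (map e a)) (Word (map e b))) w"
      unfolding \<Delta>0_word by (subst sw_hom) (simp_all add: C.lin_add wm_def C.lin_single)
    moreover have "\<gamma> (sw \<delta> (\<lambda>a b. g' (Word (map e a)) (Word (map e b))) w) = \<gamma> (sw \<delta> g w)"
    proof (rule sw_kernel[where h = \<gamma> and hadd = "add C"])
      show "\<gamma> (g' (Word (map e a)) (Word (map e b))) = \<gamma> (g a b)" for a b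
        using g'[of "Word (map e a)" "Word (map e b)"] g[of a b]
          P(3)[OF rangeI, of "Poly_Mapping.single a 1"] P(3)[OF rangeI, of "Poly_Mapping.single b 1"]
        by (simp add: f'_def \<pi>B_word wm_def)
    qed (rule C.\<pi>_add)
    ultimately show ?case by (simp add: \<iota>_simps C.lin_single)
  qed (simp_all add: \<iota>_simps \<Delta>0_simps C.lin_add C.lin_psc C.\<pi>_add C.\<pi>_scale)
  finally show ?thesis .
qed

end

section \<open>The double crossproduct on words\<close>

text \<open>Sweedler sums over three and over five tensor factors.\<close>

definition sw3 where "sw3 \<delta> f w = sw \<delta> (\<lambda>a r. sw \<delta> (\<lambda>b c. f a b c) r) w"
definition sw5 where
  "sw5 \<delta> f w = sw \<delta> (\<lambda>a r. sw \<delta> (\<lambda>b r. sw \<delta> (\<lambda>c r. sw \<delta> (\<lambda>d e. f a b c d e) r) r) r) w"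

text \<open>The same as \<open>sw_swap\<close>, for a sum that occurs as a function of the word.\<close>

lemma sw_swap_fun: "sw \<delta> (\<lambda>a b. sw \<epsilon> (\<lambda>c d. f a b c d) x) = (\<lambda>w. sw \<epsilon> (\<lambda>c d. sw \<delta> (\<lambda>a b. f a b c d) w) x)"
  by (rule ext) (rule sw_swap)

lemma sw3_hom:
  assumes "h 0 = 0" "\<And>x y. h (x + y) = h x + h y"
  shows "h (sw3 \<delta> f w) = sw3 \<delta> (\<lambda>a b c. h (f a b c)) w"
  unfolding sw3_def by (simp only: sw_hom[of h, OF assms])

lemma sw3_append:
  "sw3 \<delta> f (v @ w) = sw3 \<delta> (\<lambda>a b c. sw3 \<delta> (\<lambda>a' b' c'. f (a @ a') (b @ b') (c @ c')) w) v"
  unfolding sw3_def sw_append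
  by (rule arg_cong[of _ _ "\<lambda>f. sw \<delta> f v"], intro ext) (rule sw_swap)

lemma sw3_sw: "sw3 \<delta> (\<lambda>a b c. sw \<epsilon> (\<lambda>d e. f a b c d e) x) w = sw \<epsilon> (\<lambda>d e. sw3 \<delta> (\<lambda>a b c. f a b c d e) w) x"
  unfolding sw3_def by (simp only: sw_swap_fun[where \<delta> = \<delta> and \<epsilon> = \<epsilon>])

lemma sw3_swap: "sw3 \<delta> (\<lambda>a b c. sw3 \<epsilon> (\<lambda>d e f. G a b c d e f) x) w = sw3 \<epsilon> (\<lambda>d e f. sw3 \<delta> (\<lambda>a b c. G a b c d e f) w) x"
  unfolding sw3_def by (simp only: sw_swap_fun[where \<delta> = \<delta> and \<epsilon> = \<epsilon>])

lemma sw5_sw3: "sw5 \<delta> (\<lambda>a b c d e. sw3 \<epsilon> (\<lambda>f g h. G a b c d e f g h) x) w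
    = sw3 \<epsilon> (\<lambda>f g h. sw5 \<delta> (\<lambda>a b c d e. G a b c d e f g h) w) x"
  unfolding sw3_def sw5_def by (simp only: sw_swap_fun[where \<delta> = \<delta> and \<epsilon> = \<epsilon>])

lemma sw5_swap: "sw5 \<delta> (\<lambda>a b c d e. sw5 \<epsilon> (\<lambda>f g h i j. G a b c d e f g h i j) x) w
    = sw5 \<epsilon> (\<lambda>f g h i j. sw5 \<delta> (\<lambda>a b c d e. G a b c d e f g h i j) w) x"
  unfolding sw5_def by (simp only: sw_swap_fun[where \<delta> = \<delta> and \<epsilon> = \<epsilon>])

lemma coassoc5:
  fixes G :: "'g list \<Rightarrow> 'g list \<Rightarrow> 'g list \<Rightarrow> 'g list \<Rightarrow> 'g list \<Rightarrow> 'b::comm_monoid_add"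
  assumes co: "\<And>(f :: _ \<Rightarrow> _ \<Rightarrow> _ \<Rightarrow> 'b) w.
    sw \<delta> (\<lambda>x c. sw \<delta> (\<lambda>a b. f a b c) x) w = sw \<delta> (\<lambda>a x. sw \<delta> (\<lambda>b c. f a b c) x) w"
  shows "sw3 \<delta> (\<lambda>c1 c2 c3. sw \<delta> (\<lambda>p p'. sw \<delta> (\<lambda>r r'. G p p' c2 r r') c3) c1) w = sw5 \<delta> G w"
    and "sw3 \<delta> (\<lambda>x1 x2 x3. sw3 \<delta> (\<lambda>u s t. G x1 u s t x3) x2) w = sw5 \<delta> G w"
proof -
  have "sw3 \<delta> (\<lambda>c1 c2 c3. sw \<delta> (\<lambda>p p'. sw \<delta> (\<lambda>r r'. G p p' c2 r r') c3) c1) w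
      = sw \<delta> (\<lambda>c1 x. sw \<delta> (\<lambda>p p'. sw \<delta> (\<lambda>c2 c3. sw \<delta> (\<lambda>r r'. G p p' c2 r r') c3) x) c1) w"
    unfolding sw3_def by (rule arg_cong[of _ _ "\<lambda>f. sw \<delta> f w"], intro ext) (rule sw_swap)
  also have "\<dots> = sw5 \<delta> G w" unfolding sw5_def by (rule co)
  finally show "sw3 \<delta> (\<lambda>c1 c2 c3. sw \<delta> (\<lambda>p p'. sw \<delta> (\<lambda>r r'. G p p' c2 r r') c3) c1) w = sw5 \<delta> G w" .
  show "sw3 \<delta> (\<lambda>x1 x2 x3. sw3 \<delta> (\<lambda>u s t. G x1 u s t x3) x2) w = sw5 \<delta> G w"
    unfolding sw3_def sw5_def by (simp only: co[THEN ext])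
qed

text \<open>The counit on words.\<close>

definition eps :: "bgen list \<Rightarrow> 'k::field" where
  "eps w = (if set w \<inter> range X = {} then 1 else 0)"

lemma eps_simps [simp]: "eps [] = 1" "eps (X i # w) = 0" "eps (L i # w) = eps w" "eps (L' i # w) = eps w"
  "eps (v @ w) = eps v * (eps w :: 'k::field)"
  by (auto simp: eps_def)

lemma counit_A:
  fixes f :: "bgen list \<Rightarrow> ('m \<Rightarrow>\<^sub>0 'k::field)"
  shows "sw \<delta>A (\<lambda>a b. psc (eps a) (f b)) w = f w" "sw \<delta>A (\<lambda>a b. psc (eps b) (f a)) w = f w"
proof -
  have "sw \<delta>A (\<lambda>a b. psc (eps a) (f b)) w = f w" for f :: "bgen list \<Rightarrow> ('m \<Rightarrow>\<^sub>0 'k)"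
  proof (induction w arbitrary: f)
    case (Cons g w)
    then show ?case by (cases g) (simp_all add: Cons.IH[of "\<lambda>b. f (_ # b)"] sw_0)
  qed simp
  then show "sw \<delta>A (\<lambda>a b. psc (eps a) (f b)) w = f w" .
  have "sw \<delta>A (\<lambda>a b. psc (eps b) (f a)) w = f w" for f :: "bgen list \<Rightarrow> ('m \<Rightarrow>\<^sub>0 'k)"
  proof (induction w arbitrary: f)
    case (Cons g w)
    then show ?case by (cases g) (simp_all add: Cons.IH[of "\<lambda>b. f (_ # b)"] sw_0)
  qed simp
  then show "sw \<delta>A (\<lambda>a b. psc (eps b) (f a)) w = f w" .
qed

lemma counit_H:
  fixes f :: "bgen list \<Rightarrow> ('m \<Rightarrow>\<^sub>0 'k::field)"
  shows "sw \<delta>H (\<lambda>a b. psc (eps a) (f b)) w = f w" "sw \<delta>H (\<lambda>a b. psc (eps b) (f a)) w = f w"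
proof -
  have "sw \<delta>H (\<lambda>a b. psc (eps a) (f b)) w = f w" for f :: "bgen list \<Rightarrow> ('m \<Rightarrow>\<^sub>0 'k)"
  proof (induction w arbitrary: f)
    case (Cons g w)
    then show ?case by (cases g) (simp_all add: Cons.IH[of "\<lambda>b. f (_ # b)"] sw_0)
  qed simp
  then show "sw \<delta>H (\<lambda>a b. psc (eps a) (f b)) w = f w" .
  have "sw \<delta>H (\<lambda>a b. psc (eps b) (f a)) w = f w" for f :: "bgen list \<Rightarrow> ('m \<Rightarrow>\<^sub>0 'k)"
  proof (induction w arbitrary: f)
    case (Cons g w)
    then show ?case by (cases g) (simp_all add: Cons.IH[of "\<lambda>b. f (_ # b)"] sw_0)
  qed simp
  then show "sw \<delta>H (\<lambda>a b. psc (eps b) (f a)) w = f w" .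
qed

text \<open>\<open>P\<close> and \<open>Pm\<close> are the pairing and its convolution inverse on words.\<close>

locale word_pairing =
  fixes P Pm :: "bgen list \<Rightarrow> bgen list \<Rightarrow> 'k::field"
  assumes P_left: "P (v @ w) x = sw \<delta>H (\<lambda>x1 x2. P v x1 * P w x2) x"
    and P_right: "P a (x @ y) = sw \<delta>A (\<lambda>a1 a2. P a1 y * P a2 x) a"
    and P_Nil: "P [] x = eps x" "P a [] = eps a"
    and Pm_left: "Pm (v @ w) x = sw \<delta>H (\<lambda>x1 x2. Pm w x1 * Pm v x2) x"
    and Pm_right: "Pm a (x @ y) = sw \<delta>A (\<lambda>a1 a2. Pm a1 x * Pm a2 y) a"
    and Pm_Nil: "Pm [] x = eps x" "Pm a [] = eps a"
begin

text \<open>The product \<open>(a \<otimes> x)(b \<otimes> y)\<close> of the double crossproduct for words.\<close>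

definition m4 :: "bgen list \<Rightarrow> bgen list \<Rightarrow> bgen list \<Rightarrow> bgen list \<Rightarrow> (bgen list \<times> bgen list \<Rightarrow>\<^sub>0 'k)" where
  "m4 a x b y = sw3 \<delta>A (\<lambda>b1 b2 b3. sw3 \<delta>H (\<lambda>x1 x2 x3.
      Poly_Mapping.single (a @ b2, x2 @ y) (P b1 x1 * Pm b3 x3)) x) b"

lemma single_sw: "Poly_Mapping.single k (c * sw \<delta> f w) = sw \<delta> (\<lambda>a b. Poly_Mapping.single k (c * f a b)) w"
  for c :: 'k
  by (rule sw_hom[of "\<lambda>x. Poly_Mapping.single k (c * x)"]) (simp_all add: distrib_left single_add)

lemma single_sw2: "Poly_Mapping.single k (c * sw \<delta> f v * sw \<epsilon> g w)
    = sw \<delta> (\<lambda>a b. sw \<epsilon> (\<lambda>d e. Poly_Mapping.single k (c * f a b * g d e)) w) v" for c :: 'k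
proof -
  have "c * sw \<delta> f v * sw \<epsilon> g w = c * sw \<epsilon> g w * sw \<delta> f v" by (simp add: mult_ac)
  then have "Poly_Mapping.single k (c * sw \<delta> f v * sw \<epsilon> g w)
      = sw \<delta> (\<lambda>a b. Poly_Mapping.single k (c * sw \<epsilon> g w * f a b)) v" by (simp only: single_sw)
  also have "\<dots> = sw \<delta> (\<lambda>a b. Poly_Mapping.single k (c * f a b * sw \<epsilon> g w)) v"
    by (rule arg_cong[of _ _ "\<lambda>f. sw \<delta> f v"], intro ext) (simp add: mult_ac)
  finally show ?thesis by (simp only: single_sw)
qed

text \<open>Both ways of bracketing a triple product are brought to the same normal form: a sum over the fivefold
  coproducts of the two inner words, in which every pairing of a product has been expanded.\<close>

lemma m4_assoc_left:
  "lin psc (\<lambda>(v, w). m4 v w c z) (m4 a x b y)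
    = sw3 \<delta>A (\<lambda>b1 b2 b3. sw3 \<delta>H (\<lambda>y1 y2 y3. sw5 \<delta>H (\<lambda>x1 x2 x3 x4 x5. sw5 \<delta>A (\<lambda>c1 c2 c3 c4 c5.
        Poly_Mapping.single (a @ b2 @ c3, x3 @ y2 @ z)
          (P b1 x1 * P c1 y1 * P c2 x2 * Pm b3 x5 * Pm c4 x4 * Pm c5 y3)) c) x) y) b"
proof -
  let ?T = "\<lambda>b1 b2 b3 x1 x2 x3 x4 x5 c1 c2 c3 c4 c5 y1 y2 y3. Poly_Mapping.single (a @ b2 @ c3, x3 @ y2 @ z)
          (P b1 x1 * P c1 y1 * P c2 x2 * Pm b3 x5 * Pm c4 x4 * Pm c5 y3)"
  have step: "psc (P b1 x1 * Pm b3 x3) (m4 (a @ b2) (x2 @ y) c z)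
     = sw5 \<delta>A (\<lambda>c1 c2 c3 c4 c5. sw3 \<delta>H (\<lambda>u s t. sw3 \<delta>H (\<lambda>y1 y2 y3.
          ?T b1 b2 b3 x1 u s t x3 c1 c2 c3 c4 c5 y1 y2 y3) y) x2) c" for b1 b2 b3 x1 x2 x3
  proof -
    have t: "psc (P b1 x1 * Pm b3 x3) (Poly_Mapping.single ((a @ b2) @ c2, (s @ s') @ z) (P c1 (u @ u') * Pm c3 (t @ t')))
        = sw \<delta>A (\<lambda>p p'. sw \<delta>A (\<lambda>r r'. ?T b1 b2 b3 x1 u s t x3 p p' c2 r r' u' s' t') c3) c1" for c1 c2 c3 u s t u' s' t'
    proof -
      have "psc (P b1 x1 * Pm b3 x3) (Poly_Mapping.single ((a @ b2) @ c2, (s @ s') @ z) (P c1 (u @ u') * Pm c3 (t @ t')))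
        = Poly_Mapping.single (a @ b2 @ c2, s @ s' @ z)
            (P b1 x1 * Pm b3 x3 * sw \<delta>A (\<lambda>p p'. P p u' * P p' u) c1 * sw \<delta>A (\<lambda>r r'. Pm r t * Pm r' t') c3)"
        by (simp add: P_right Pm_right mult.assoc)
      also have "\<dots> = sw \<delta>A (\<lambda>p p'. sw \<delta>A (\<lambda>r r'. ?T b1 b2 b3 x1 u s t x3 p p' c2 r r' u' s' t') c3) c1"
        unfolding single_sw2 by (simp add: mult_ac)
      finally show ?thesis .
    qed
    have "psc (P b1 x1 * Pm b3 x3) (m4 (a @ b2) (x2 @ y) c z)
      = sw3 \<delta>A (\<lambda>c1 c2 c3. sw3 \<delta>H (\<lambda>u s t. sw3 \<delta>H (\<lambda>u' s' t'.
          psc (P b1 x1 * Pm b3 x3) (Poly_Mapping.single ((a @ b2) @ c2, (s @ s') @ z) (P c1 (u @ u') * Pm c3 (t @ t')))) y) x2) c"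
      unfolding m4_def sw3_append by (simp only: sw3_hom[of "psc _", OF psc.scale_zero_right psc.scale_right_distrib])
    also have "\<dots> = sw3 \<delta>A (\<lambda>c1 c2 c3. sw \<delta>A (\<lambda>p p'. sw \<delta>A (\<lambda>r r'. sw3 \<delta>H (\<lambda>u s t. sw3 \<delta>H (\<lambda>u' s' t'.
          ?T b1 b2 b3 x1 u s t x3 p p' c2 r r' u' s' t') y) x2) c3) c1) c"
      unfolding t by (simp only: sw3_sw)
    also have "\<dots> = sw5 \<delta>A (\<lambda>c1 c2 c3 c4 c5. sw3 \<delta>H (\<lambda>u s t. sw3 \<delta>H (\<lambda>y1 y2 y3.
          ?T b1 b2 b3 x1 u s t x3 c1 c2 c3 c4 c5 y1 y2 y3) y) x2) c"
      by (rule coassoc5(1)[OF coassoc_A])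
    finally show ?thesis .
  qed
  have "lin psc (\<lambda>(v, w). m4 v w c z) (m4 a x b y)
     = sw3 \<delta>A (\<lambda>b1 b2 b3. sw3 \<delta>H (\<lambda>x1 x2 x3. psc (P b1 x1 * Pm b3 x3) (m4 (a @ b2) (x2 @ y) c z)) x) b"
    unfolding m4_def[of a x b y]
    by (simp only: sw3_hom[of "lin psc _", OF psc.lin_0 psc.lin_add] psc.lin_single prod.case)
  also have "\<dots> = sw3 \<delta>A (\<lambda>b1 b2 b3. sw3 \<delta>H (\<lambda>x1 x2 x3. sw3 \<delta>H (\<lambda>u s t. sw3 \<delta>H (\<lambda>y1 y2 y3. sw5 \<delta>A (\<lambda>c1 c2 c3 c4 c5.
          ?T b1 b2 b3 x1 u s t x3 c1 c2 c3 c4 c5 y1 y2 y3) c) y) x2) x) b"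
    unfolding step by (simp only: sw5_sw3)
  also have "\<dots> = sw3 \<delta>A (\<lambda>b1 b2 b3. sw5 \<delta>H (\<lambda>x1 u s t x3. sw3 \<delta>H (\<lambda>y1 y2 y3. sw5 \<delta>A (\<lambda>c1 c2 c3 c4 c5.
          ?T b1 b2 b3 x1 u s t x3 c1 c2 c3 c4 c5 y1 y2 y3) c) y) x) b"
    by (simp only: coassoc5(2)[OF coassoc_H])
  also have "\<dots> = sw3 \<delta>A (\<lambda>b1 b2 b3. sw3 \<delta>H (\<lambda>y1 y2 y3. sw5 \<delta>H (\<lambda>x1 u s t x3. sw5 \<delta>A (\<lambda>c1 c2 c3 c4 c5.
          ?T b1 b2 b3 x1 u s t x3 c1 c2 c3 c4 c5 y1 y2 y3) c) x) y) b"
    by (simp only: sw5_sw3)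
  finally show ?thesis .
qed

lemma m4_assoc_right:
  "lin psc (\<lambda>(v, w). m4 a x v w) (m4 b y c z)
    = sw3 \<delta>A (\<lambda>b1 b2 b3. sw3 \<delta>H (\<lambda>y1 y2 y3. sw5 \<delta>H (\<lambda>x1 x2 x3 x4 x5. sw5 \<delta>A (\<lambda>c1 c2 c3 c4 c5.
        Poly_Mapping.single (a @ b2 @ c3, x3 @ y2 @ z)
          (P b1 x1 * P c1 y1 * P c2 x2 * Pm b3 x5 * Pm c4 x4 * Pm c5 y3)) c) x) y) b"
proof -
  let ?T = "\<lambda>b1 b2 b3 x1 x2 x3 x4 x5 c1 c2 c3 c4 c5 y1 y2 y3. Poly_Mapping.single (a @ b2 @ c3, x3 @ y2 @ z)
          (P b1 x1 * P c1 y1 * P c2 x2 * Pm b3 x5 * Pm c4 x4 * Pm c5 y3)"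
  have step: "psc (P c1 y1 * Pm c3 y3) (m4 a x (b @ c2) (y2 @ z))
     = sw3 \<delta>A (\<lambda>b1 b2 b3. sw3 \<delta>A (\<lambda>u s t. sw5 \<delta>H (\<lambda>x1 x2 x3 x4 x5.
          ?T b1 b2 b3 x1 x2 x3 x4 x5 c1 u s t c3 y1 y2 y3) x) c2) b" for c1 c2 c3 y1 y2 y3
  proof -
    have t: "psc (P c1 y1 * Pm c3 y3) (Poly_Mapping.single (a @ b2 @ s, x2 @ y2 @ z) (P (b1 @ u) x1 * Pm (b3 @ t) x3))
        = sw \<delta>H (\<lambda>p p'. sw \<delta>H (\<lambda>r r'. ?T b1 b2 b3 p p' x2 r r' c1 u s t c3 y1 y2 y3) x3) x1" for b1 b2 b3 u s t x1 x2 x3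
    proof -
      have "psc (P c1 y1 * Pm c3 y3) (Poly_Mapping.single (a @ b2 @ s, x2 @ y2 @ z) (P (b1 @ u) x1 * Pm (b3 @ t) x3))
        = Poly_Mapping.single (a @ b2 @ s, x2 @ y2 @ z)
            (P c1 y1 * Pm c3 y3 * sw \<delta>H (\<lambda>p p'. P b1 p * P u p') x1 * sw \<delta>H (\<lambda>r r'. Pm t r * Pm b3 r') x3)"
        by (simp add: P_left Pm_left mult.assoc)
      also have "\<dots> = sw \<delta>H (\<lambda>p p'. sw \<delta>H (\<lambda>r r'. ?T b1 b2 b3 p p' x2 r r' c1 u s t c3 y1 y2 y3) x3) x1"
        unfolding single_sw2 by (simp add: mult_ac)
      finally show ?thesis .
    qed
    have "psc (P c1 y1 * Pm c3 y3) (m4 a x (b @ c2) (y2 @ z))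
      = sw3 \<delta>A (\<lambda>b1 b2 b3. sw3 \<delta>A (\<lambda>u s t. sw3 \<delta>H (\<lambda>x1 x2 x3.
          psc (P c1 y1 * Pm c3 y3) (Poly_Mapping.single (a @ b2 @ s, x2 @ y2 @ z) (P (b1 @ u) x1 * Pm (b3 @ t) x3))) x) c2) b"
      unfolding m4_def sw3_append by (simp only: sw3_hom[of "psc _", OF psc.scale_zero_right psc.scale_right_distrib])
    also have "\<dots> = sw3 \<delta>A (\<lambda>b1 b2 b3. sw3 \<delta>A (\<lambda>u s t. sw3 \<delta>H (\<lambda>x1 x2 x3.
          sw \<delta>H (\<lambda>p p'. sw \<delta>H (\<lambda>r r'. ?T b1 b2 b3 p p' x2 r r' c1 u s t c3 y1 y2 y3) x3) x1) x) c2) b"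
      unfolding t ..
    also have "\<dots> = sw3 \<delta>A (\<lambda>b1 b2 b3. sw3 \<delta>A (\<lambda>u s t. sw5 \<delta>H (\<lambda>x1 x2 x3 x4 x5.
          ?T b1 b2 b3 x1 x2 x3 x4 x5 c1 u s t c3 y1 y2 y3) x) c2) b"
      by (simp only: coassoc5(1)[OF coassoc_H])
    finally show ?thesis .
  qed
  have "lin psc (\<lambda>(v, w). m4 a x v w) (m4 b y c z)
     = sw3 \<delta>A (\<lambda>c1 c2 c3. sw3 \<delta>H (\<lambda>y1 y2 y3. psc (P c1 y1 * Pm c3 y3) (m4 a x (b @ c2) (y2 @ z))) y) c"
    unfolding m4_def[of b y c z]
    by (simp only: sw3_hom[of "lin psc _", OF psc.lin_0 psc.lin_add] psc.lin_single prod.case)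
  also have "\<dots> = sw3 \<delta>A (\<lambda>c1 c2 c3. sw3 \<delta>H (\<lambda>y1 y2 y3. sw3 \<delta>A (\<lambda>u s t. sw3 \<delta>A (\<lambda>b1 b2 b3. sw5 \<delta>H (\<lambda>x1 x2 x3 x4 x5.
          ?T b1 b2 b3 x1 x2 x3 x4 x5 c1 u s t c3 y1 y2 y3) x) b) c2) y) c"
    unfolding step by (subst sw3_swap) (rule refl)
  also have "\<dots> = sw3 \<delta>A (\<lambda>c1 c2 c3. sw3 \<delta>A (\<lambda>u s t. sw3 \<delta>H (\<lambda>y1 y2 y3. sw3 \<delta>A (\<lambda>b1 b2 b3. sw5 \<delta>H (\<lambda>x1 x2 x3 x4 x5.
          ?T b1 b2 b3 x1 x2 x3 x4 x5 c1 u s t c3 y1 y2 y3) x) b) y) c2) c"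
    by (rule arg_cong[of _ _ "\<lambda>f. sw3 \<delta>A f c"], intro ext) (rule sw3_swap)
  also have "\<dots> = sw5 \<delta>A (\<lambda>c1 u s t c3. sw3 \<delta>H (\<lambda>y1 y2 y3. sw3 \<delta>A (\<lambda>b1 b2 b3. sw5 \<delta>H (\<lambda>x1 x2 x3 x4 x5.
          ?T b1 b2 b3 x1 x2 x3 x4 x5 c1 u s t c3 y1 y2 y3) x) b) y) c"
    by (rule coassoc5(2)[OF coassoc_A])
  also have "\<dots> = sw3 \<delta>H (\<lambda>y1 y2 y3. sw3 \<delta>A (\<lambda>b1 b2 b3. sw5 \<delta>A (\<lambda>c1 u s t c3. sw5 \<delta>H (\<lambda>x1 x2 x3 x4 x5.
          ?T b1 b2 b3 x1 x2 x3 x4 x5 c1 u s t c3 y1 y2 y3) x) c) b) y"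
    by (simp only: sw5_sw3)
  also have "\<dots> = sw3 \<delta>A (\<lambda>b1 b2 b3. sw3 \<delta>H (\<lambda>y1 y2 y3. sw5 \<delta>A (\<lambda>c1 u s t c3. sw5 \<delta>H (\<lambda>x1 x2 x3 x4 x5.
          ?T b1 b2 b3 x1 x2 x3 x4 x5 c1 u s t c3 y1 y2 y3) x) c) y) b"
    by (rule sw3_swap)
  also have "\<dots> = sw3 \<delta>A (\<lambda>b1 b2 b3. sw3 \<delta>H (\<lambda>y1 y2 y3. sw5 \<delta>H (\<lambda>x1 x2 x3 x4 x5. sw5 \<delta>A (\<lambda>c1 u s t c3.
          ?T b1 b2 b3 x1 x2 x3 x4 x5 c1 u s t c3 y1 y2 y3) c) x) y) b"
    by (rule arg_cong[of _ _ "\<lambda>f. sw3 \<delta>A f b"], intro ext, rule arg_cong[of _ _ "\<lambda>f. sw3 \<delta>H f y"], intro ext) (rule sw5_swap)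
  finally show ?thesis .
qed

lemma m4_right: "m4 a x [] y = Poly_Mapping.single (a, x @ y) 1"
proof -
  have "m4 a x [] y = sw \<delta>H (\<lambda>x1 r. psc (eps x1) (sw \<delta>H (\<lambda>x2 x3. psc (eps x3) (Poly_Mapping.single (a, x2 @ y) 1)) r)) x"
    by (simp add: m4_def sw3_def P_Nil Pm_Nil sw_hom[of "psc _"] psc.scale_right_distrib)
  then show ?thesis by (simp only: counit_H)
qed

lemma m4_left: "m4 a [] b y = Poly_Mapping.single (a @ b, y) 1"
proof -
  have "m4 a [] b y = sw \<delta>A (\<lambda>x1 r. psc (eps x1) (sw \<delta>A (\<lambda>x2 x3. psc (eps x3) (Poly_Mapping.single (a @ x2, y) 1)) r)) b"
    by (simp add: m4_def sw3_def P_Nil Pm_Nil sw_hom[of "psc _"] psc.scale_right_distrib)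
  then show ?thesis by (simp only: counit_A)
qed

definition mul :: "(bgen list \<times> bgen list \<Rightarrow>\<^sub>0 'k) \<Rightarrow> (bgen list \<times> bgen list \<Rightarrow>\<^sub>0 'k) \<Rightarrow> (bgen list \<times> bgen list \<Rightarrow>\<^sub>0 'k)"
    (infixl \<open>\<star>\<close> 70) where
  "s \<star> t = lin psc (\<lambda>(a, x). lin psc (\<lambda>(b, y). m4 a x b y) t) s"

abbreviation D1 where "D1 v w \<equiv> Poly_Mapping.single (v, w) (1::'k)"

lemma mul_linear:
  "(s + s') \<star> t = s \<star> t + s' \<star> t" "psc c s \<star> t = psc c (s \<star> t)" "0 \<star> t = 0" "(s - s') \<star> t = s \<star> t - s' \<star> t"
  "s \<star> (t + t') = s \<star> t + s \<star> t'" "s \<star> psc c t = psc c (s \<star> t)" "s \<star> 0 = 0" "s \<star> (t - t') = s \<star> t - s \<star> t'"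
proof -
  show "(s + s') \<star> t = s \<star> t + s' \<star> t" "psc c s \<star> t = psc c (s \<star> t)" "0 \<star> t = 0" "(s - s') \<star> t = s \<star> t - s' \<star> t"
    by (simp_all add: mul_def psc.lin_add psc.lin_psc psc.lin_diff)
  show 1: "s \<star> (t + t') = s \<star> t + s \<star> t'" "s \<star> psc c t = psc c (s \<star> t)" "s \<star> 0 = 0" for t t'
    by (simp_all add: mul_def psc.lin_add psc.lin_psc psc.lin_fun_add psc.lin_fun_scale case_prod_unfold)
  show "s \<star> (t - t') = s \<star> t - s \<star> t'" using 1(1)[of "t - t'" t'] by simp
qed

lemma mul_single: "D1 a x \<star> D1 b y = m4 a x b y"
  by (simp add: mul_def psc.lin_single)

lemma mul_sum: "(\<Sum>i\<in>A. f i) \<star> t = (\<Sum>i\<in>A. f i \<star> t)" "s \<star> (\<Sum>i\<in>A. f i) = (\<Sum>i\<in>A. s \<star> f i)"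
  by (induction A rule: infinite_finite_induct) (simp_all add: mul_linear)

lemma mul_assoc: "s \<star> t \<star> u = s \<star> (t \<star> u)"
proof (induction s rule: poly_mapping_linear_induct)
  case (single s)
  show ?case
  proof (induction t rule: poly_mapping_linear_induct)
    case (single t)
    show ?case
    proof (induction u rule: poly_mapping_linear_induct)
      case (single u)
      obtain a x b y c z where [simp]: "s = (a, x)" "t = (b, y)" "u = (c, z)"
        by (cases s, cases t, cases u)
      have "m4 a x b y \<star> D1 c z = lin psc (\<lambda>(v, w). m4 v w c z) (m4 a x b y)"
        by (simp add: mul_def psc.lin_single)
      moreover have "D1 a x \<star> m4 b y c z = lin psc (\<lambda>(v, w). m4 a x v w) (m4 b y c z)"
        by (simp add: mul_def psc.lin_single)
      ultimately show ?case by (simp add: mul_single m4_assoc_left m4_assoc_right)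
    qed (simp_all add: mul_linear)
  qed (simp_all add: mul_linear)
qed (simp_all add: mul_linear)

lemma mul_one: "D1 [] [] \<star> s = s" "s \<star> D1 [] [] = s"
proof -
  show "D1 [] [] \<star> s = s"
    by (induction s rule: poly_mapping_linear_induct) (auto simp: mul_linear mul_single m4_left)
  show "s \<star> D1 [] [] = s"
    by (induction s rule: poly_mapping_linear_induct) (auto simp: mul_linear mul_single m4_right)
qed

lemma mul_words: "D1 a x \<star> D1 [] y = D1 a (x @ y)" "D1 a [] \<star> D1 b y = D1 (a @ b) y"
  "D1 a x = D1 a [] \<star> D1 [] x"
  by (simp_all add: mul_single m4_right m4_left)

end

section \<open>The double crossproduct as a ring\<close>

text \<open>Scalar-valued Sweedler sums are an instance of the general ones.\<close>

lemma presented_ground_field: "presented ((*) :: 'k::field \<Rightarrow> 'k \<Rightarrow> 'k) ground_field (\<lambda>x. x)"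
proof -
  interpret vector_space "(*) :: 'k \<Rightarrow> 'k \<Rightarrow> 'k" by (rule vector_space_mult)
  show ?thesis
    by unfold_locales (simp_all add: ground_field_def type_ring_def ring.defs module.defs)
qed

lemma ground_field_simps: "carrier ground_field = UNIV" "x \<oplus>\<^bsub>ground_field\<^esub> y = x + y" "c \<odot>\<^bsub>ground_field\<^esub> x = c * x"
  by (simp_all add: ground_field_def type_ring_def ring.defs module.defs)

subsection \<open>Linearity of expressions\<close>

lemma (in presented) klin_evaluate:
  assumes "\<And>y. y \<in> Poly_Mapping.keys s \<Longrightarrow> klin Z C (\<lambda>z. f z y)"
    and Z: "\<And>x y. x \<in> carrier Z \<Longrightarrow> y \<in> carrier Z \<Longrightarrow> x \<oplus>\<^bsub>Z\<^esub> y \<in> carrier Z"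
      "\<And>c x. x \<in> carrier Z \<Longrightarrow> c \<odot>\<^bsub>Z\<^esub> x \<in> carrier Z"
  shows "klin Z C (\<lambda>z. \<Oplus>\<^bsub>C\<^esub>y\<in>Poly_Mapping.keys s. Poly_Mapping.lookup s y \<odot>\<^bsub>C\<^esub> f z y)"
proof -
  have "klin Z C (\<lambda>z. \<Oplus>\<^bsub>C\<^esub>y\<in>S. Poly_Mapping.lookup s y \<odot>\<^bsub>C\<^esub> f z y)" if "S \<subseteq> Poly_Mapping.keys s" for S
    using finite_subset[OF that finite_keys] that
  proof (induction S)
    case empty
    have "c \<odot>\<^bsub>C\<^esub> \<zero>\<^bsub>C\<^esub> = \<zero>\<^bsub>C\<^esub>" for c using \<pi>_scale[of c 0] by (simp add: \<pi>_zero)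
    then show ?case by (simp add: klin_def)
  next
    case (insert y S)
    then have IH: "klin Z C (\<lambda>z. \<Oplus>\<^bsub>C\<^esub>y\<in>S. Poly_Mapping.lookup s y \<odot>\<^bsub>C\<^esub> f z y)" by simp
    have fy: "klin Z C (\<lambda>z. f z y)" using assms(1) insert by simp
    have cl: "Poly_Mapping.lookup s y' \<odot>\<^bsub>C\<^esub> f z y' \<in> carrier C" if "z \<in> carrier Z" "y' \<in> insert y S" for z y'
    proof -
      have "klin Z C (\<lambda>z. f z y')" using assms(1)[of y'] that insert.prems by auto
      from klinD(1)[OF this that(1)] show ?thesis by (rule smult_closed)
    qed
    have eq: "(\<Oplus>\<^bsub>C\<^esub>y\<in>insert y S. Poly_Mapping.lookup s y \<odot>\<^bsub>C\<^esub> f z y)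
        = Poly_Mapping.lookup s y \<odot>\<^bsub>C\<^esub> f z y \<oplus>\<^bsub>C\<^esub> (\<Oplus>\<^bsub>C\<^esub>y\<in>S. Poly_Mapping.lookup s y \<odot>\<^bsub>C\<^esub> f z y)" if "z \<in> carrier Z" for z
      using insert.hyps cl[OF that] by (subst C.finsum_insert) auto
    note k = klinD[OF IH] and k' = klinD[OF fy]
    show ?case
      unfolding klin_def
    proof (intro conjI ballI allI)
      fix x assume x: "x \<in> carrier Z"
      show "(\<Oplus>\<^bsub>C\<^esub>y\<in>insert y S. Poly_Mapping.lookup s y \<odot>\<^bsub>C\<^esub> f x y) \<in> carrier C"
        using cl[OF x] by (intro C.finsum_closed) auto
      show "(\<Oplus>\<^bsub>C\<^esub>y\<in>insert y S. Poly_Mapping.lookup s y \<odot>\<^bsub>C\<^esub> f (c \<odot>\<^bsub>Z\<^esub> x) y)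
          = c \<odot>\<^bsub>C\<^esub> (\<Oplus>\<^bsub>C\<^esub>y\<in>insert y S. Poly_Mapping.lookup s y \<odot>\<^bsub>C\<^esub> f x y)" for c
        using x by (simp only: eq Z k k' smult_distrib smult_closed smult_smult mult.commute)
      fix z assume z: "z \<in> carrier Z"
      show "(\<Oplus>\<^bsub>C\<^esub>y\<in>insert y S. Poly_Mapping.lookup s y \<odot>\<^bsub>C\<^esub> f (x \<oplus>\<^bsub>Z\<^esub> z) y)
          = (\<Oplus>\<^bsub>C\<^esub>y\<in>insert y S. Poly_Mapping.lookup s y \<odot>\<^bsub>C\<^esub> f x y) \<oplus>\<^bsub>C\<^esub>
            (\<Oplus>\<^bsub>C\<^esub>y\<in>insert y S. Poly_Mapping.lookup s y \<odot>\<^bsub>C\<^esub> f z y)"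
        using x z by (simp add: eq Z k k' smult_distrib smult_closed C.a_ac C.finsum_closed)
    qed
  qed
  then show ?thesis by blast
qed

lemma (in presented_pair) klin_tensor_lift:
  assumes C: "presented sc C \<gamma>"
    and f: "\<And>x y. x \<in> carrier A \<Longrightarrow> y \<in> carrier B \<Longrightarrow> klin Z C (\<lambda>z. f z x y)"
    and Z: "\<And>x y. x \<in> carrier Z \<Longrightarrow> y \<in> carrier Z \<Longrightarrow> x \<oplus>\<^bsub>Z\<^esub> y \<in> carrier Z"
      "\<And>c x. x \<in> carrier Z \<Longrightarrow> c \<odot>\<^bsub>Z\<^esub> x \<in> carrier Z"
    and t: "t \<in> carrier (tensor A B)"
  shows "klin Z C (\<lambda>z. tensor_lift C (f z) t)"
proof -
  obtain p where p: "t = \<tau> p" using t by (rule T.\<pi>_E)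
  have "(SOME s. s \<in> t) \<in> formal_sums A B"
    using someI[of "\<lambda>s. s \<in> t", OF push_mem_\<tau>[of p, folded p]] by (simp add: p mem_\<tau>)
  then show ?thesis
    unfolding tensor_lift_def Let_def
    by (intro presented.klin_evaluate[OF C] f Z) (auto simp: formal_sums_def)
qed

context borel
begin

lemma Bo_closed: "x \<in> carrier Bo \<Longrightarrow> y \<in> carrier Bo \<Longrightarrow> x \<oplus>\<^bsub>Bo\<^esub> y \<in> carrier Bo"
  "x \<in> carrier Bo \<Longrightarrow> c \<odot>\<^bsub>Bo\<^esub> x \<in> carrier Bo"
  by (auto simp: Bo.smult_closed)

lemma klin_sweedler2_param:
  assumes C: "presented sc C \<gamma>"
    and f: "\<And>x y. x \<in> carrier Bo \<Longrightarrow> y \<in> carrier Bo \<Longrightarrow> klin Z C (\<lambda>z. f z x y)"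
    and Z: "\<And>x y. x \<in> carrier Z \<Longrightarrow> y \<in> carrier Z \<Longrightarrow> x \<oplus>\<^bsub>Z\<^esub> y \<in> carrier Z"
      "\<And>c x. x \<in> carrier Z \<Longrightarrow> c \<odot>\<^bsub>Z\<^esub> x \<in> carrier Z"
    and x: "x \<in> carrier Bo"
  shows "klin Z C (\<lambda>z. sweedler2 Bo C (f z) x)"
proof -
  obtain p where p: "x = \<pi>B p" using x by (rule Bo.\<pi>_E)
  have "(SOME s. s \<in> comult Bo x) \<in> comult Bo x"
    unfolding p by (rule someI[of _ "uu.push (\<Delta>0 (\<iota> p))"]) (simp add: Bo_simps comult_mem keys_push)
  then have "Poly_Mapping.keys (SOME s. s \<in> comult Bo x) \<subseteq> carrier Bo \<times> carrier Bo"
    by (simp add: Bo_simps)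
  then show ?thesis
    unfolding sweedler2_def tensor_lift_def Let_def
    by (intro presented.klin_evaluate[OF C] f Z) auto
qed

lemma klin_sweedler2:
  assumes C: "presented sc C \<gamma>" and f: "kbil Bo Bo C f"
  shows "klin Bo C (sweedler2 Bo C f)"
proof -
  interpret C: presented sc C \<gamma> by (rule C)
  define g where "g v w = (SOME z. \<gamma> z = f (bB v) (bB w))" for v w
  have g: "f (bB v) (bB w) = \<gamma> (g v w)" for v w
  proof -
    have "f (bB v) (bB w) \<in> carrier C" by (rule klinD(1)[OF kbilD(1)[OF f]]) simp_all
    then obtain z where "\<gamma> z = f (bB v) (bB w)" by (auto elim: C.\<pi>_E)
    from someI[of "\<lambda>z. \<gamma> z = f (bB v) (bB w)", OF this] show ?thesis by (simp add: g_def)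
  qed
  show ?thesis
    unfolding klin_def
    by (auto elim!: Bo.\<pi>_E simp: sweedler2_word[OF C f g] C.lin_add C.lin_psc C.\<pi>_add C.\<pi>_scale
        simp flip: Bo.\<pi>_add Bo.\<pi>_scale)
qed

text \<open>Trilinear maps.\<close>

definition ktri :: "('k, 'c, 'm) module_scheme \<Rightarrow> ('k u_elem \<Rightarrow> 'k u_elem \<Rightarrow> 'k u_elem \<Rightarrow> 'c) \<Rightarrow> bool" where
  "ktri C f \<longleftrightarrow> (\<forall>x\<in>carrier Bo. \<forall>y\<in>carrier Bo.
      klin Bo C (\<lambda>z. f z x y) \<and> klin Bo C (\<lambda>z. f x z y) \<and> klin Bo C (\<lambda>z. f x y z))"

lemma ktri_kbil: "ktri C f \<Longrightarrow> x \<in> carrier Bo \<Longrightarrow> kbil Bo Bo C (f x)"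
  by (simp add: ktri_def kbil_def)

lemma ktri_kbil_sweedler:
  assumes C: "presented sc C \<gamma>" and f: "ktri C f"
  shows "kbil Bo Bo C (\<lambda>x1 x'. sweedler2 Bo C (\<lambda>x2 x3. f x1 x2 x3) x')"
  unfolding kbil_def
proof (intro conjI ballI)
  fix a assume "a \<in> carrier Bo"
  then show "klin Bo C (sweedler2 Bo C (f a))" by (intro klin_sweedler2[OF C] ktri_kbil[OF f])
  show "klin Bo C (\<lambda>z. sweedler2 Bo C (f z) a)"
    by (rule klin_sweedler2_param[OF C]) (use f \<open>a \<in> carrier Bo\<close> Bo_closed in \<open>auto simp: ktri_def\<close>)
qed

lemma klin_sweedler3:
  assumes C: "presented sc C \<gamma>" and f: "ktri C f"
  shows "klin Bo C (sweedler3 Bo C f)"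
  unfolding sweedler3_def[abs_def] by (rule klin_sweedler2[OF C ktri_kbil_sweedler[OF C f]])

lemma klin_sweedler3_param:
  assumes C: "presented sc C \<gamma>"
    and f: "\<And>x y w. x \<in> carrier Bo \<Longrightarrow> y \<in> carrier Bo \<Longrightarrow> w \<in> carrier Bo \<Longrightarrow> klin Z C (\<lambda>z. f z x y w)"
    and Z: "\<And>x y. x \<in> carrier Z \<Longrightarrow> y \<in> carrier Z \<Longrightarrow> x \<oplus>\<^bsub>Z\<^esub> y \<in> carrier Z"
      "\<And>c x. x \<in> carrier Z \<Longrightarrow> c \<odot>\<^bsub>Z\<^esub> x \<in> carrier Z"
    and x: "x \<in> carrier Bo"
  shows "klin Z C (\<lambda>z. sweedler3 Bo C (f z) x)"
  unfolding sweedler3_def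
  by (intro klin_sweedler2_param[OF C] f Z x)

lemma sweedler3_word:
  assumes C: "presented sc C \<gamma>" and f: "ktri C f"
    and g: "\<And>u v w. f (bB u) (bB v) (bB w) = \<gamma> (g u v w)"
  shows "sweedler3 Bo C f (bB w) = \<gamma> (sw3 \<delta> g w)"
proof -
  interpret C: presented sc C \<gamma> by (rule C)
  have "sweedler2 Bo C (f (bB v)) (bB w) = \<gamma> (sw \<delta> (g v) w)" for v w
    using sweedler2_word[OF C ktri_kbil[OF f] g, of v "Poly_Mapping.single w 1"] by (simp add: C.lin_single)
  then show ?thesis
    unfolding sweedler3_def sw3_def
    using sweedler2_word[OF C ktri_kbil_sweedler[OF C f], of "\<lambda>v w. sw \<delta> (g v) w" "Poly_Mapping.single w 1"]
    by (simp add: C.lin_single)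
qed

end

text \<open>From here on \<open>A\<close> is \<open>\<uu>\<^sup>\<ge>\<^sup>0\<close> and \<open>H\<close> is
  \<open>\<uu>\<^sup>\<le>\<^sup>0\<close>.\<close>

locale pairing_setup =
  fixes l :: nat and q :: "'k::field" and \<phi> :: "'k u_elem \<Rightarrow> 'k u_elem \<Rightarrow> 'k"
  assumes l3: "l \<ge> 3" and oddl: "odd l" and prim: "primitive_root_of_unity l q" and pairing: "is_borel_pairing l q \<phi>"
begin

lemma q0: "q \<noteq> 0" and ql: "q ^ l = 1"
  using prim l3 by (auto simp: primitive_root_of_unity_def power_0_left)

lemma prim_q2: "prim_root l (q * q)"
  unfolding prim_root_def
proof (intro conjI allI impI)
  show "l > 0" using l3 by simp
  show "(q * q) ^ l = 1" by (simp add: power_mult_distrib ql)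
  fix k assume k: "0 < k \<and> k < l"
  show "(q * q) ^ k \<noteq> 1"
  proof
    assume "(q * q) ^ k = 1"
    then have pw: "q ^ (2 * k) = 1" by (simp add: power_mult power2_eq_square)
    have "2 * k \<noteq> l" using oddl by auto
    then consider "2 * k < l" | "l < 2 * k" by linarith
    then show False
    proof cases
      case 1
      then show False using pw k prim by (auto simp: primitive_root_of_unity_def)
    next
      case 2
      have "q ^ (2 * k) = q ^ (2 * k - l) * q ^ l" using 2 by (simp flip: power_add)
      then have "q ^ (2 * k - l) = 1" using pw ql by simp
      moreover have "0 < 2 * k - l" "2 * k - l < l" using 2 k by auto
      ultimately show False using prim by (auto simp: primitive_root_of_unity_def)
    qed
  qed
qed

sublocale A: borel l q eE \<delta>A anA
proof
  show "dlt (eE g) = (\<Sum>(a, b)\<leftarrow>\<delta>A g. bt (wm (map eE a)) (wm (map eE b)))" for g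
    by (cases g) (simp_all add: wm_simps)
  show "ant (eE g) = psc (sgn_letter g) (wm (map eE (anA g)))" for g
    by (cases g) (simp_all add: wm_simps)
qed (simp_all add: q0 ql prim_q2)

sublocale H: borel l q eF \<delta>H anH
proof
  show "dlt (eF g) = (\<Sum>(a, b)\<leftarrow>\<delta>H g. bt (wm (map eF a)) (wm (map eF b)))" for g
    by (cases g) (simp_all add: wm_simps)
  show "ant (eF g) = psc (sgn_letter g) (wm (map eF (anH g)))" for g
    by (cases g) (simp_all add: wm_simps)
qed (simp_all add: q0 ql prim_q2)

lemma ge0_eq: "u_ge0 l q = A.Bo" and le0_eq: "u_le0 l q = H.Bo"
  by (simp_all add: u_ge0_def u_le0_def A.Bo_def H.Bo_def A.gens_def H.gens_def)

sublocale AH: presented_pair A.Bo A.\<pi>B H.Bo H.\<pi>B ..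

lemma skew: "skew_pairing A.Bo H.Bo \<phi>"
  using pairing by (simp add: is_borel_pairing_def ge0_eq le0_eq)

lemma \<phi>_klin: "x \<in> carrier H.Bo \<Longrightarrow> klin A.Bo ground_field (\<lambda>a. \<phi> a x)"
    "a \<in> carrier A.Bo \<Longrightarrow> klin H.Bo ground_field (\<phi> a)"
  using skew by (auto simp: skew_pairing_def klin_def ground_field_simps)

lemma antipode_klin: "klin A.Bo A.Bo (antipode A.Bo)"
proof -
  have "antipode A.Bo (A.\<pi>B p) \<in> carrier A.Bo" for p
    using A.hopf_subalgebra_B by (auto simp: hopf_subalgebra_def A.Bo_simps)
  moreover have a: "antipode A.Bo (A.\<pi>B p) = pi_u l q (S0 (A.\<iota> p))" for p
    by (simp add: A.Bo_simps A.\<pi>B_def antipode_u[OF q0 prim_q2 ql])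
  ultimately show ?thesis
    unfolding klin_def
    by (auto elim!: A.Bo.\<pi>_E simp flip: A.Bo.\<pi>_add A.Bo.\<pi>_scale)
      (auto simp: a A.\<iota>_simps S0_simps A.Bo_simps A.u.\<pi>_add A.u.\<pi>_scale)
qed

lemma klin_comp: "klin Z Y g \<Longrightarrow> klin Y C f \<Longrightarrow> klin Z C (\<lambda>z. f (g z))"
  by (simp add: klin_def)

lemma mult_klin:
  "b \<in> carrier A.Bo \<Longrightarrow> klin A.Bo A.Bo (\<lambda>a. a \<otimes>\<^bsub>A.Bo\<^esub> b)" "a \<in> carrier A.Bo \<Longrightarrow> klin A.Bo A.Bo (\<lambda>b. a \<otimes>\<^bsub>A.Bo\<^esub> b)"
  "y \<in> carrier H.Bo \<Longrightarrow> klin H.Bo H.Bo (\<lambda>x. x \<otimes>\<^bsub>H.Bo\<^esub> y)" "x \<in> carrier H.Bo \<Longrightarrow> klin H.Bo H.Bo (\<lambda>y. x \<otimes>\<^bsub>H.Bo\<^esub> y)"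
proof -
  have sub: "A.B \<subseteq> carrier (small_u l q)" "H.B \<subseteq> carrier (small_u l q)" by (auto simp: A.\<pi>B_def H.\<pi>B_def)
  have cl: "x \<otimes>\<^bsub>small_u l q\<^esub> y \<in> A.B" if "x \<in> A.B" "y \<in> A.B" for x y
    using A.hopf_subalgebra_B that unfolding hopf_subalgebra_def by blast
  have cl': "x \<otimes>\<^bsub>small_u l q\<^esub> y \<in> H.B" if "x \<in> H.B" "y \<in> H.B" for x y
    using H.hopf_subalgebra_B that unfolding hopf_subalgebra_def by blast
  have sl: "(c \<odot>\<^bsub>small_u l q\<^esub> x) \<otimes>\<^bsub>small_u l q\<^esub> y = c \<odot>\<^bsub>small_u l q\<^esub> (x \<otimes>\<^bsub>small_u l q\<^esub> y)"
    "x \<otimes>\<^bsub>small_u l q\<^esub> (c \<odot>\<^bsub>small_u l q\<^esub> y) = c \<odot>\<^bsub>small_u l q\<^esub> (x \<otimes>\<^bsub>small_u l q\<^esub> y)"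
    if xy: "x \<in> carrier (small_u l q)" "y \<in> carrier (small_u l q)" for c x y
  proof -
    obtain p r where [simp]: "x = pi_u l q p" "y = pi_u l q r" using xy by (auto elim!: A.u.\<pi>_E)
    show "(c \<odot>\<^bsub>small_u l q\<^esub> x) \<otimes>\<^bsub>small_u l q\<^esub> y = c \<odot>\<^bsub>small_u l q\<^esub> (x \<otimes>\<^bsub>small_u l q\<^esub> y)"
      "x \<otimes>\<^bsub>small_u l q\<^esub> (c \<odot>\<^bsub>small_u l q\<^esub> y) = c \<odot>\<^bsub>small_u l q\<^esub> (x \<otimes>\<^bsub>small_u l q\<^esub> y)"
      by (simp_all add: psc_mult_left psc_mult_right flip: A.u.\<pi>_scale A.u.\<alpha>_mult)
  qed
  note [simp] = subsetD[OF sub(1)] subsetD[OF sub(2)]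
  show "b \<in> carrier A.Bo \<Longrightarrow> klin A.Bo A.Bo (\<lambda>a. a \<otimes>\<^bsub>A.Bo\<^esub> b)" "a \<in> carrier A.Bo \<Longrightarrow> klin A.Bo A.Bo (\<lambda>b. a \<otimes>\<^bsub>A.Bo\<^esub> b)"
    unfolding klin_def A.Bo_simps by (intro conjI ballI allI cl A.u.R.l_distr A.u.R.r_distr sl; simp)+
  show "y \<in> carrier H.Bo \<Longrightarrow> klin H.Bo H.Bo (\<lambda>x. x \<otimes>\<^bsub>H.Bo\<^esub> y)" "x \<in> carrier H.Bo \<Longrightarrow> klin H.Bo H.Bo (\<lambda>y. x \<otimes>\<^bsub>H.Bo\<^esub> y)"
    unfolding klin_def H.Bo_simps by (intro conjI ballI allI cl' A.u.R.l_distr A.u.R.r_distr sl; simp)+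
qed

abbreviation T where "T \<equiv> tensor A.Bo H.Bo"
abbreviation pt where "pt \<equiv> pure_tensor A.Bo H.Bo"

lemma T_scale_add: "t \<in> carrier T \<Longrightarrow> (c + d) \<odot>\<^bsub>T\<^esub> t = c \<odot>\<^bsub>T\<^esub> t \<oplus>\<^bsub>T\<^esub> d \<odot>\<^bsub>T\<^esub> t"
  by (auto elim!: AH.T.\<pi>_E simp: psc.scale_left_distrib simp flip: AH.T.\<pi>_scale AH.T.\<pi>_add)

lemma T_smult_klin:
  "klin Z ground_field f \<Longrightarrow> t \<in> carrier T \<Longrightarrow> klin Z T (\<lambda>z. (f z * c) \<odot>\<^bsub>T\<^esub> t)"
  "klin Z ground_field f \<Longrightarrow> t \<in> carrier T \<Longrightarrow> klin Z T (\<lambda>z. (c * f z) \<odot>\<^bsub>T\<^esub> t)"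
  "klin Z T g \<Longrightarrow> klin Z T (\<lambda>z. c \<odot>\<^bsub>T\<^esub> g z)"
  by (simp_all add: klin_def ground_field_simps AH.T.smult_closed AH.T.smult_distrib AH.T.smult_smult mult_ac
      T_scale_add distrib_left distrib_right)

lemma pt_klin:
  "klin Z A.Bo g \<Longrightarrow> y \<in> carrier H.Bo \<Longrightarrow> klin Z T (\<lambda>z. pt (g z) y)"
  "klin Z H.Bo h \<Longrightarrow> x \<in> carrier A.Bo \<Longrightarrow> klin Z T (\<lambda>z. pt x (h z))"
  using klin_comp[OF _ kbilD(2)[OF AH.kbil_pure_tensor]] klin_comp[OF _ kbilD(1)[OF AH.kbil_pure_tensor]] by blast+

text \<open>The pairing of words, and its convolution inverse \<open>\<phi>(S(a), x)\<close>.\<close>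

definition P :: "bgen list \<Rightarrow> bgen list \<Rightarrow> 'k" where "P v w = \<phi> (A.bB v) (H.bB w)"
definition Pm :: "bgen list \<Rightarrow> bgen list \<Rightarrow> 'k" where "Pm v w = A.asgn v * P (A.awrd v) w"

lemma P_left: "P (v @ w) x = sw \<delta>H (\<lambda>x1 x2. P v x1 * P w x2) x"
proof -
  have kb: "kbil H.Bo H.Bo ground_field (\<lambda>x1 x2. \<phi> (A.bB v) x1 * \<phi> (A.bB w) x2)"
    using \<phi>_klin(2)[of "A.bB v"] \<phi>_klin(2)[of "A.bB w"]
    by (simp add: kbil_def klin_def ground_field_simps algebra_simps)
  have "P (v @ w) x = sweedler2 H.Bo ground_field (\<lambda>x1 x2. \<phi> (A.bB v) x1 * \<phi> (A.bB w) x2) (H.bB x)"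
    using skew by (simp add: P_def skew_pairing_def flip: A.Bo_mult_word)
  also have "\<dots> = sw \<delta>H (\<lambda>x1 x2. P v x1 * P w x2) x"
    using H.sweedler2_word[OF presented_ground_field kb, of "\<lambda>x1 x2. P v x1 * P w x2" "Poly_Mapping.single x 1"]
    by (simp add: P_def lin_mult)
  finally show ?thesis .
qed

lemma P_right: "P a (x @ y) = sw \<delta>A (\<lambda>a1 a2. P a1 y * P a2 x) a"
proof -
  have kb: "kbil A.Bo A.Bo ground_field (\<lambda>a1 a2. \<phi> a1 (H.bB y) * \<phi> a2 (H.bB x))"
    using \<phi>_klin(1)[of "H.bB x"] \<phi>_klin(1)[of "H.bB y"]
    by (simp add: kbil_def klin_def ground_field_simps algebra_simps)
  have "P a (x @ y) = sweedler2 A.Bo ground_field (\<lambda>a1 a2. \<phi> a1 (H.bB y) * \<phi> a2 (H.bB x)) (A.bB a)"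
    using skew by (simp add: P_def skew_pairing_def flip: H.Bo_mult_word)
  also have "\<dots> = sw \<delta>A (\<lambda>a1 a2. P a1 y * P a2 x) a"
    using A.sweedler2_word[OF presented_ground_field kb, of "\<lambda>a1 a2. P a1 y * P a2 x" "Poly_Mapping.single a 1"]
    by (simp add: P_def lin_mult)
  finally show ?thesis .
qed

lemma counit_eps: "prod_list (map (counit_gen \<circ> eE) w) = (eps w :: 'k)" "prod_list (map (counit_gen \<circ> eF) w) = (eps w :: 'k)"
proof -
  show "prod_list (map (counit_gen \<circ> eE) w) = (eps w :: 'k)"
  proof (induction w)
    case (Cons g w) then show ?case by (cases g) simp_all
  qed simp
  show "prod_list (map (counit_gen \<circ> eF) w) = (eps w :: 'k)"
  proof (induction w)
    case (Cons g w) then show ?case by (cases g) simp_all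
  qed simp
qed

lemma P_Nil: "P [] x = eps x" "P a [] = eps a"
  using skew by (simp_all add: P_def skew_pairing_def A.counit_word H.counit_word counit_eps flip: A.Bo_one H.Bo_one)

lemma A_KK: "A.bB [L' i, L i] = A.bB []"
proof -
  interpret U: \<Delta>_quotient "u_ideal l q" q "keru l q" by (rule \<Delta>_quotient_u[OF q0 prim_q2 ql])
  show ?thesis using U.K'K[of i] by (simp add: A.\<pi>B_word pi_u_eq_iff U.eqv_def wm_simps)
qed

lemma awrd_simps: "A.awrd (v @ w) = A.awrd w @ A.awrd v" "A.awrd [] = []" "A.awrd [g] = anA g" "A.awrd (g # w) = A.awrd w @ anA g"
  "A.asgn (v @ w) = A.asgn v * A.asgn w" "A.asgn [] = 1" "A.asgn [g] = sgn_letter g" "A.asgn (g # w) = sgn_letter g * A.asgn w"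
  by (simp_all add: A.awrd_def A.asgn_def)

lemma Pm_left: "Pm (v @ w) x = sw \<delta>H (\<lambda>x1 x2. Pm w x1 * Pm v x2) x"
proof -
  have "Pm (v @ w) x = A.asgn v * A.asgn w * sw \<delta>H (\<lambda>x1 x2. P (A.awrd w) x1 * P (A.awrd v) x2) x"
    by (simp add: Pm_def awrd_simps P_left)
  also have "\<dots> = sw \<delta>H (\<lambda>x1 x2. Pm w x1 * Pm v x2) x"
    by (simp add: Pm_def mult_ac flip: sw_cmult)
  finally show ?thesis .
qed

lemma Pm_Nil: "Pm [] x = eps x" "Pm a [] = eps a"
proof -
  show "Pm [] x = eps x" by (simp add: Pm_def awrd_simps P_Nil)
  have "A.asgn a * eps (A.awrd a) = (eps a :: 'k)"
  proof (induction a)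
    case (Cons g w) then show ?case by (cases g) (simp_all add: awrd_simps)
  qed (simp add: awrd_simps)
  then show "Pm a [] = eps a" by (simp add: Pm_def P_Nil)
qed

text \<open>The antipode reverses the coproduct as well as the product.  For \<open>E\<^sub>i\<close> the cancellation
  \<open>K\<^sub>i\<^sup>-\<^sup>1 K\<^sub>i = 1\<close> enters.\<close>

lemma Pm_right_letter: "Pm [g] (x @ y) = (\<Sum>(a, b)\<leftarrow>\<delta>A g. Pm a x * Pm b y)"
proof -
  have KK: "P [L' i, L i] y = eps y" for i using A_KK[of i] P_Nil(1)[of y] by (simp add: P_def)
  show ?thesis
    by (cases g) (simp_all add: Pm_def awrd_simps P_right P_Nil KK algebra_simps)
qed

lemma Pm_right: "Pm a (x @ y) = sw \<delta>A (\<lambda>a1 a2. Pm a1 x * Pm a2 y) a"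
proof (induction a arbitrary: x y)
  case Nil show ?case by (simp add: Pm_Nil)
next
  case (Cons g w)
  have "Pm (g # w) (x @ y) = sw \<delta>H (\<lambda>z1 z2. Pm w z1 * Pm [g] z2) (x @ y)"
    using Pm_left[of "[g]" w] by simp
  also have "\<dots> = sw \<delta>H (\<lambda>x1 x2. sw \<delta>H (\<lambda>y1 y2. sw \<delta>A (\<lambda>a1 a2. Pm a1 x1 * Pm a2 y1) w * (\<Sum>(a, b)\<leftarrow>\<delta>A g. Pm a x2 * Pm b y2)) y) x"
    by (simp add: sw_append Cons Pm_right_letter)
  also have "\<dots> = (\<Sum>(a, b)\<leftarrow>\<delta>A g. sw \<delta>H (\<lambda>x1 x2. sw \<delta>H (\<lambda>y1 y2. sw \<delta>A (\<lambda>a1 a2. (Pm a1 x1 * Pm a x2) * (Pm a2 y1 * Pm b y2)) w) y) x)"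
    by (simp add: case_prod_unfold sum_list_const_mult[symmetric] sw_sum_list mult_ac flip: sw_cmult sw_multc)
  also have "\<dots> = (\<Sum>(a, b)\<leftarrow>\<delta>A g. sw \<delta>A (\<lambda>a1 a2. sw \<delta>H (\<lambda>x1 x2. sw \<delta>H (\<lambda>y1 y2. (Pm a1 x1 * Pm a x2) * (Pm a2 y1 * Pm b y2)) y) x) w)"
    by (simp only: sw_swap_fun[where \<delta> = \<delta>H and \<epsilon> = \<delta>A])
  also have "\<dots> = (\<Sum>(a, b)\<leftarrow>\<delta>A g. sw \<delta>A (\<lambda>a1 a2. Pm (a @ a1) x * Pm (b @ a2) y) w)"
    by (simp add: Pm_left sw_cmult sw_multc)
  also have "\<dots> = sw \<delta>A (\<lambda>a1 a2. Pm a1 x * Pm a2 y) (g # w)" by simp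
  finally show ?case .
qed

sublocale word_pairing P Pm
  by unfold_locales (rule P_left P_right P_Nil Pm_left Pm_right Pm_Nil)+

notation mul (infixl \<open>\<star>\<close> 70)

subsection \<open>Its multiplication in terms of words\<close>

abbreviation D where "D \<equiv> double_crossproduct A.Bo H.Bo \<phi>"

text \<open>The summand of the multiplication of \<open>D\<close>, and its Sweedler sum \<open>G\<close>.  They are
  multilinear, so they are determined by their values on words.\<close>

definition W where
  "W a y b1 b2 b3 x1 x2 x3 = (\<phi> b1 x1 * \<phi> (antipode A.Bo b3) x3) \<odot>\<^bsub>T\<^esub> pt (a \<otimes>\<^bsub>A.Bo\<^esub> b2) (x2 \<otimes>\<^bsub>H.Bo\<^esub> y)"

definition G where
  "G a x b y = sweedler3 A.Bo T (\<lambda>b1 b2 b3. sweedler3 H.Bo T (\<lambda>x1 x2 x3. W a y b1 b2 b3 x1 x2 x3) x) b"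

lemma W_klin:
  assumes "a \<in> carrier A.Bo" "b1 \<in> carrier A.Bo" "b2 \<in> carrier A.Bo" "b3 \<in> carrier A.Bo"
    "y \<in> carrier H.Bo" "x1 \<in> carrier H.Bo" "x2 \<in> carrier H.Bo" "x3 \<in> carrier H.Bo"
  shows "klin A.Bo T (\<lambda>z. W z y b1 b2 b3 x1 x2 x3)" "klin H.Bo T (\<lambda>z. W a z b1 b2 b3 x1 x2 x3)"
    "klin A.Bo T (\<lambda>z. W a y z b2 b3 x1 x2 x3)" "klin A.Bo T (\<lambda>z. W a y b1 z b3 x1 x2 x3)"
    "klin A.Bo T (\<lambda>z. W a y b1 b2 z x1 x2 x3)" "klin H.Bo T (\<lambda>z. W a y b1 b2 b3 z x2 x3)"
    "klin H.Bo T (\<lambda>z. W a y b1 b2 b3 x1 z x3)" "klin H.Bo T (\<lambda>z. W a y b1 b2 b3 x1 x2 z)"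
proof -
  note c = klinD(1)[OF mult_klin(1)] klinD(1)[OF mult_klin(3)] klinD(1)[OF antipode_klin]
    klinD(1)[OF kbilD(1)[OF AH.kbil_pure_tensor]]
  show "klin A.Bo T (\<lambda>z. W z y b1 b2 b3 x1 x2 x3)" "klin H.Bo T (\<lambda>z. W a z b1 b2 b3 x1 x2 x3)"
    "klin A.Bo T (\<lambda>z. W a y z b2 b3 x1 x2 x3)" "klin A.Bo T (\<lambda>z. W a y b1 z b3 x1 x2 x3)"
    "klin A.Bo T (\<lambda>z. W a y b1 b2 z x1 x2 x3)" "klin H.Bo T (\<lambda>z. W a y b1 b2 b3 z x2 x3)"
    "klin H.Bo T (\<lambda>z. W a y b1 b2 b3 x1 z x3)" "klin H.Bo T (\<lambda>z. W a y b1 b2 b3 x1 x2 z)"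
    unfolding W_def
    using assms klin_comp[OF antipode_klin \<phi>_klin(1)]
    by (intro T_smult_klin pt_klin mult_klin \<phi>_klin c; simp)+
qed

lemma ktri_W: "a \<in> carrier A.Bo \<Longrightarrow> y \<in> carrier H.Bo \<Longrightarrow> b1 \<in> carrier A.Bo \<Longrightarrow> b2 \<in> carrier A.Bo \<Longrightarrow> b3 \<in> carrier A.Bo \<Longrightarrow>
    H.ktri T (W a y b1 b2 b3)"
  by (auto simp: H.ktri_def W_klin)

lemma ktri_W2: "a \<in> carrier A.Bo \<Longrightarrow> y \<in> carrier H.Bo \<Longrightarrow> x \<in> carrier H.Bo \<Longrightarrow>
    A.ktri T (\<lambda>b1 b2 b3. sweedler3 H.Bo T (W a y b1 b2 b3) x)"
  unfolding A.ktri_def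
  by (intro ballI conjI H.klin_sweedler3_param[OF AH.presented_tensor] W_klin A.Bo_closed)

lemma G_klin:
  assumes "a \<in> carrier A.Bo" "b \<in> carrier A.Bo" "x \<in> carrier H.Bo" "y \<in> carrier H.Bo"
  shows "klin A.Bo T (\<lambda>z. G z x b y)" "klin H.Bo T (\<lambda>z. G a z b y)" "klin A.Bo T (\<lambda>z. G a x z y)" "klin H.Bo T (\<lambda>z. G a x b z)"
proof -
  note pT = AH.presented_tensor
  show "klin A.Bo T (\<lambda>z. G z x b y)"
    unfolding G_def
    by (intro A.klin_sweedler3_param[OF pT] H.klin_sweedler3_param[OF pT] W_klin(1)[OF assms(1)] A.Bo_closed assms)
  show "klin H.Bo T (\<lambda>z. G a x b z)"
    unfolding G_def
    by (intro A.klin_sweedler3_param[OF pT] H.klin_sweedler3_param[OF pT] W_klin(2)[where y = y] H.Bo_closed assms)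
  show "klin H.Bo T (\<lambda>z. G a z b y)"
    unfolding G_def
    by (intro A.klin_sweedler3_param[OF pT] H.klin_sweedler3[OF pT] ktri_W H.Bo_closed assms)
  show "klin A.Bo T (\<lambda>z. G a x z y)"
    unfolding G_def by (intro A.klin_sweedler3[OF pT] ktri_W2 assms)
qed

lemma W_word: "W (A.bB a) (H.bB y) (A.bB b1) (A.bB b2) (A.bB b3) (H.bB x1) (H.bB x2) (H.bB x3)
    = AH.\<tau> (Poly_Mapping.single (a @ b2, x2 @ y) (P b1 x1 * Pm b3 x3))"
proof -
  have "\<phi> (antipode A.Bo (A.bB b3)) (H.bB x3) = Pm b3 x3"
    using klinD(3)[OF \<phi>_klin(1)[of "H.bB x3"], of "A.bB (A.awrd b3)" "A.asgn b3"]
    by (simp add: A.antipode_word Pm_def P_def ground_field_simps)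
  moreover have "pt (A.bB (a @ b2)) (H.bB (x2 @ y)) = AH.\<tau> (D1 (a @ b2) (x2 @ y))"
    by (simp add: AH.pure_tensor_\<tau>)
  ultimately show ?thesis
    by (simp add: W_def P_def A.Bo_mult_word H.Bo_mult_word flip: AH.T.\<pi>_scale)
qed

lemma G_word: "G (A.bB a) (H.bB x) (A.bB b) (H.bB y) = AH.\<tau> (m4 a x b y)"
proof -
  note pT = AH.presented_tensor
  have "sweedler3 H.Bo T (W (A.bB a) (H.bB y) (A.bB b1) (A.bB b2) (A.bB b3)) (H.bB x)
     = AH.\<tau> (sw3 \<delta>H (\<lambda>x1 x2 x3. Poly_Mapping.single (a @ b2, x2 @ y) (P b1 x1 * Pm b3 x3)) x)" for b1 b2 b3
    by (rule H.sweedler3_word[OF pT ktri_W]) (simp_all add: W_word)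
  then show ?thesis
    unfolding G_def m4_def by (intro A.sweedler3_word[OF pT ktri_W2]) simp_all
qed

lemma D_mult: "AH.\<tau> s \<otimes>\<^bsub>D\<^esub> AH.\<tau> t = AH.\<tau> (s \<star> t)"
proof -
  note pT = AH.presented_tensor
  have kG: "kbil A.Bo H.Bo T (G a x)" if "a \<in> carrier A.Bo" "x \<in> carrier H.Bo" for a x
    using that by (simp add: kbil_def G_klin)
  have 1: "tensor_lift T (G (A.bB a) (H.bB x)) (AH.\<tau> t) = AH.\<tau> (lin psc (\<lambda>(b, y). m4 a x b y) t)" for a x
    by (rule AH.tensor_lift_\<tau>[OF pT kG]) (simp_all add: G_word)
  have k2: "kbil A.Bo H.Bo T (\<lambda>a x. tensor_lift T (G a x) (AH.\<tau> t))"
    unfolding kbil_def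
    by (intro conjI ballI AH.klin_tensor_lift[OF pT] G_klin A.Bo_closed H.Bo_closed AH.T.\<pi>_closed)
  have "AH.\<tau> s \<otimes>\<^bsub>D\<^esub> AH.\<tau> t = tensor_lift T (\<lambda>a x. tensor_lift T (G a x) (AH.\<tau> t)) (AH.\<tau> s)"
    by (simp add: double_crossproduct_def Let_def G_def[abs_def] W_def[abs_def])
  also have "\<dots> = AH.\<tau> (s \<star> t)"
    unfolding mul_def by (rule AH.tensor_lift_\<tau>[OF pT k2 1])
  finally show ?thesis .
qed

lemma D_simps: "carrier D = carrier T" "x \<oplus>\<^bsub>D\<^esub> y = x \<oplus>\<^bsub>T\<^esub> y" "\<zero>\<^bsub>D\<^esub> = \<zero>\<^bsub>T\<^esub>" "\<one>\<^bsub>D\<^esub> = AH.\<tau> (D1 [] [])"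
proof -
  show "carrier D = carrier T" "x \<oplus>\<^bsub>D\<^esub> y = x \<oplus>\<^bsub>T\<^esub> y" "\<zero>\<^bsub>D\<^esub> = \<zero>\<^bsub>T\<^esub>" by (simp_all add: double_crossproduct_def Let_def)
  have "\<one>\<^bsub>D\<^esub> = pt (A.bB []) (H.bB [])"
    by (simp add: double_crossproduct_def Let_def tensor_def A.Bo_one H.Bo_one)
  then show "\<one>\<^bsub>D\<^esub> = AH.\<tau> (D1 [] [])" by (simp add: AH.pure_tensor_\<tau>)
qed

lemma ring_D: "ring D"
proof (rule ringI)
  show "abelian_group D"
    by (rule abelian_groupI)
      (use AH.T.C.l_neg AH.T.C.a_inv_closed in \<open>auto simp: D_simps AH.T.C.a_ac\<close>)
  show "Group.monoid D"
    by (rule Group.monoidI) (auto simp: D_simps AH.T.\<pi>_surj D_mult mul_assoc mul_one)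
qed (auto simp: D_simps AH.T.\<pi>_surj D_mult mul_linear simp flip: AH.T.\<pi>_add)

end

section \<open>Commutation rules in the double crossproduct\<close>

context pairing_setup
begin

lemma letter_gens: "u_gen l q (gE i) = A.bB [X i]" "u_gen l q (gF i) = H.bB [X i]"
  "u_gen l q (gK i) = A.bB [L i]" "u_gen l q (gK i) = H.bB [L i]" "u_gen l q (gK' i) = H.bB [L' i]"
  by (simp_all add: u_gen_eq A.\<pi>B_word H.\<pi>B_word wm_simps)

lemma monomial_words: "u_monomial l q (map eE v) = A.bB v" "u_monomial l q (map eF v) = H.bB v"
proof -
  show "u_monomial l q (map eE v) = A.bB v"
    by (induction v) (simp_all add: A.\<pi>B_word wm_simps A.u.\<alpha>_one A.u.\<alpha>_mult u_gen_eq)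
  show "u_monomial l q (map eF v) = H.bB v"
    by (induction v) (simp_all add: H.\<pi>B_word wm_simps A.u.\<alpha>_one A.u.\<alpha>_mult u_gen_eq)
qed

lemma count_letters:
  "monomial_degree (map eE v) i = int (count_list v (X i))" "monomial_degree (map eF v) i = int (count_list v (X i))"
proof -
  have e: "count_list (map eE v) (gE i) = count_list v (X i)" "count_list (map eE v) (gF i) = 0"
    "count_list (map eF v) (gF i) = count_list v (X i)" "count_list (map eF v) (gE i) = 0"
    by (induction v) (simp_all, (case_tac a; simp)+)
  show "monomial_degree (map eE v) i = int (count_list v (X i))" "monomial_degree (map eF v) i = int (count_list v (X i))"
    by (simp_all add: monomial_degree_def e)
qed

lemma P_degree: "count_list v (X i) \<noteq> count_list w (X i) \<Longrightarrow> P v w = 0"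
proof -
  assume ne: "count_list v (X i) \<noteq> count_list w (X i)"
  have s: "set (map eE v) \<subseteq> range gE \<union> range gK \<union> range gK'" "set (map eF w) \<subseteq> range gF \<union> range gK \<union> range gK'"
  proof -
    have "eE g \<in> range gE \<union> range gK \<union> range gK'" "eF g \<in> range gF \<union> range gK \<union> range gK'" for g by (cases g; simp)+
    then show "set (map eE v) \<subseteq> range gE \<union> range gK \<union> range gK'" "set (map eF w) \<subseteq> range gF \<union> range gK \<union> range gK'" by auto
  qed
  have "monomial_degree (map eE v) i \<noteq> monomial_degree (map eF w) i" using ne by (simp add: count_letters)
  then have "monomial_degree (map eE v) \<noteq> monomial_degree (map eF w)" by metis
  then have "\<phi> (u_monomial l q (map eE v)) (u_monomial l q (map eF w)) = 0"
    using pairing s unfolding is_borel_pairing_def by blast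
  then show ?thesis by (simp add: P_def monomial_words)
qed

text \<open>The value \<open>\<phi>(E\<^sub>1, F\<^sub>1)\<close>.\<close>

definition p11 :: 'k where "p11 = 1 / (q\<^sup>2 - 1)"

text \<open>The values that are not prescribed vanish for reasons of degree, or follow from
  \<open>K\<^sub>i\<^sup>-\<^sup>1 K\<^sub>i = 1\<close>.\<close>

lemma P_letters:
  "P [X i] [X j] = (if i = j \<and> i = I1 then p11 else 0)"
  "P [X i] [L j] = 0" "P [X i] [L' j] = 0" "P [L i] [X j] = 0" "P [L' i] [X j] = 0"
  "P [L i] [L j] = q powi cartan i j" "P [L i] [L' j] = inverse (q powi cartan i j)"
  "P [L' i] [L j] = inverse (q powi cartan i j)" "P [L' i] [L' j] = q powi cartan i j"
proof -
  note b = pairing[unfolded is_borel_pairing_def letter_gens]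
  show "P [X i] [X j] = (if i = j \<and> i = I1 then p11 else 0)"
    unfolding P_def p11_def using pairing[unfolded is_borel_pairing_def] by (simp add: letter_gens)
  show "P [X i] [L j] = 0" "P [X i] [L' j] = 0" by (rule P_degree[of _ i]; simp)+
  show "P [L i] [X j] = 0" "P [L' i] [X j] = 0" by (rule P_degree[of _ j]; simp)+
  have "P [L i] [L j] = q powi cartan i j \<and> P [L i] [L' j] = q powi (- cartan i j)" for i j
    using pairing[unfolded is_borel_pairing_def] unfolding P_def letter_gens(3,5)[symmetric] letter_gens(4)[symmetric] by blast
  then have LL: "P [L i] [L j] = q powi cartan i j" "P [L i] [L' j] = inverse (q powi cartan i j)" for i j
    by (simp_all add: power_int_minus)
  show "P [L i] [L j] = q powi cartan i j" "P [L i] [L' j] = inverse (q powi cartan i j)" by (rule LL)+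
  have "P [L' i, L i] [x] = eps [x]" for x by (simp add: P_def A_KK flip: P_Nil(1))
  then have "P [L' i] [L j] * P [L i] [L j] = 1" "P [L' i] [L' j] * P [L i] [L' j] = 1"
    using P_left[of "[L' i]" "[L i]" "[L j]"] P_left[of "[L' i]" "[L i]" "[L' j]"] by simp_all
  then show "P [L' i] [L j] = inverse (q powi cartan i j)" "P [L' i] [L' j] = q powi cartan i j"
    using q0 by (auto simp: LL field_simps)
qed

lemma Pm_letters:
  "Pm [X i] [X j] = - (if i = j \<and> i = I1 then p11 else 0)"
  "Pm [X i] [L j] = 0" "Pm [X i] [L' j] = 0" "Pm [L i] [X j] = 0" "Pm [L' i] [X j] = 0"
  "Pm [L i] [L j] = inverse (q powi cartan i j)" "Pm [L i] [L' j] = q powi cartan i j"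
  "Pm [L' i] [L j] = q powi cartan i j" "Pm [L' i] [L' j] = inverse (q powi cartan i j)"
proof -
  have X: "Pm [X i] w = - sw \<delta>H (\<lambda>x1 x2. P [L' i] x1 * P [X i] x2) w" for w
    using P_left[of "[L' i]" "[X i]"] by (simp add: Pm_def awrd_simps)
  show "Pm [X i] [X j] = - (if i = j \<and> i = I1 then p11 else 0)"
    "Pm [X i] [L j] = 0" "Pm [X i] [L' j] = 0" "Pm [L i] [X j] = 0" "Pm [L' i] [X j] = 0"
    "Pm [L i] [L j] = inverse (q powi cartan i j)" "Pm [L i] [L' j] = q powi cartan i j"
    "Pm [L' i] [L j] = q powi cartan i j" "Pm [L' i] [L' j] = inverse (q powi cartan i j)"
    by (simp_all add: X P_letters P_Nil) (simp_all add: Pm_def awrd_simps P_letters)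
qed

text \<open>Only the last rule is not a mere rescaling: the two correction terms come from pairing
  \<open>E\<^sub>1\<close> with \<open>F\<^sub>1\<close> through \<open>\<phi>\<close> on one side and through its
  inverse on the other.\<close>

lemma letters_commute:
  "D1 [] [L i] \<star> D1 [X j] [] = psc (q powi cartan j i) (D1 [X j] [L i])"
  "D1 [] [L' i] \<star> D1 [X j] [] = psc (inverse (q powi cartan j i)) (D1 [X j] [L' i])"
  "D1 [] [X i] \<star> D1 [L j] [] = psc (q powi cartan j i) (D1 [L j] [X i])"
  "D1 [] [X i] \<star> D1 [L' j] [] = psc (inverse (q powi cartan j i)) (D1 [L' j] [X i])"
  "D1 [] [L i] \<star> D1 [L j] [] = D1 [L j] [L i]" "D1 [] [L' i] \<star> D1 [L j] [] = D1 [L j] [L' i]"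
  "D1 [] [L i] \<star> D1 [L' j] [] = D1 [L' j] [L i]" "D1 [] [L' i] \<star> D1 [L' j] [] = D1 [L' j] [L' i]"
  "D1 [] [X i] \<star> D1 [X j] [] = D1 [X j] [X i] + (if i = j \<and> i = I1 then psc p11 (D1 [] [L' I1] - D1 [L I1] []) else 0)"
  using q0
  by (auto simp: mul_single m4_def sw3_def P_letters Pm_letters P_Nil Pm_Nil single_uminus psc.scale_right_diff_distrib)

end

section \<open>Rescaling the Borel subalgebras\<close>

subsection \<open>A module of baby Verma type\<close>

text \<open>The module has the basis \<open>v\<^sub>0, v\<^sub>1, \<dots>\<close> with \<open>v\<^sub>n =
  F\<^sub>1\<^sup>n v\<^sub>0\<close> below \<open>l\<close>, continued periodically; \<open>wt i n\<close> is the
  eigenvalue of \<open>K\<^sub>i\<close> on \<open>v\<^sub>n\<close> and \<open>E\<^sub>1 v\<^sub>n\<^sub>+\<^sub>1 =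
  raise (n + 1) v\<^sub>n\<close>.  Setting \<open>E\<^sub>2 = F\<^sub>2 = 0\<close> is consistent because these two
  commute with each other.\<close>

locale verma =
  fixes l :: nat and q :: "'k::field" and \<eta> :: "idx \<Rightarrow> 'k"
  assumes q0: "q \<noteq> 0" and ql: "q ^ l = 1" and prim: "prim_root l (q * q)" and l1: "l > 1" and \<eta>l: "\<eta> i ^ l = 1"
begin

declare single_one [simp del]

definition wt :: "idx \<Rightarrow> nat \<Rightarrow> 'k" where "wt i n = \<eta> i * inverse (q powi cartan i I1) ^ n"
definition raise :: "nat \<Rightarrow> 'k" where
  "raise n = (\<Sum>j<n. wt I1 j - inverse (wt I1 j)) / (q - inverse q)"

text \<open>As \<open>raise 0 = 0\<close>, the truncated index \<open>n - 1\<close> does no harm at \<open>n =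
  0\<close>.\<close>

fun act :: "gen \<Rightarrow> nat \<Rightarrow> (nat \<Rightarrow>\<^sub>0 'k)" where
  "act (gE i) n = (if i = I1 then Poly_Mapping.single (n - 1) (raise n) else 0)"
| "act (gF i) n = (if i = I1 \<and> \<not> l dvd Suc n then Poly_Mapping.single (Suc n) 1 else 0)"
| "act (gK i) n = Poly_Mapping.single n (wt i n)"
| "act (gK' i) n = Poly_Mapping.single n (inverse (wt i n))"

definition \<rho> :: "(gen, 'k) free_algebra \<Rightarrow> (nat \<Rightarrow>\<^sub>0 'k) \<Rightarrow> (nat \<Rightarrow>\<^sub>0 'k)" where
  "\<rho> p v = lin psc (\<lambda>w. foldr (\<lambda>g. lin psc (act g)) (letters w) v) p"

lemma \<eta>0: "\<eta> i \<noteq> 0" using \<eta>l[of i] l1 by (auto simp: power_0_left)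

lemma wt0: "wt i n \<noteq> 0" using \<eta>0 q0 by (simp add: wt_def)

lemma foldr_linear:
  "foldr (\<lambda>g. lin psc (act g)) w (v + v') = foldr (\<lambda>g. lin psc (act g)) w v + foldr (\<lambda>g. lin psc (act g)) w v'"
  "foldr (\<lambda>g. lin psc (act g)) w (psc c v) = psc c (foldr (\<lambda>g. lin psc (act g)) w v)"
  "foldr (\<lambda>g. lin psc (act g)) w 0 = 0"
  by (induction w) (simp_all add: psc.lin_add psc.lin_psc)

lemma \<rho>_linear:
  "\<rho> (p + r) v = \<rho> p v + \<rho> r v" "\<rho> (p - r) v = \<rho> p v - \<rho> r v" "\<rho> (psc c p) v = psc c (\<rho> p v)" "\<rho> 0 v = 0"
  "\<rho> p (v + v') = \<rho> p v + \<rho> p v'" "\<rho> p (psc c v) = psc c (\<rho> p v)" "\<rho> p 0 = 0"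
  by (simp_all add: \<rho>_def psc.lin_add psc.lin_diff psc.lin_psc foldr_linear psc.lin_fun_add psc.lin_fun_scale)

lemma \<rho>_wm: "\<rho> (wm w) v = foldr (\<lambda>g. lin psc (act g)) w v"
  by (simp add: \<rho>_def wm_def psc.lin_single)

lemma \<rho>_mult: "\<rho> (p * r) v = \<rho> p (\<rho> r v)"
proof (induction p rule: free_algebra_induct)
  case (word w)
  show ?case
    by (induction r rule: free_algebra_induct)
      (simp_all add: \<rho>_linear distrib_left psc_mult_right \<rho>_wm flip: wm_simps(2))
qed (simp_all add: \<rho>_linear distrib_right psc_mult_left)

lemma \<rho>_gen: "\<rho> (var g) (Poly_Mapping.single n c) = psc c (act g n)" "\<rho> 1 v = v"
  using \<rho>_wm[of "[g]"] \<rho>_wm[of "[]"] by (simp_all add: wm_simps psc.lin_single)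

lemma \<rho>_zeroI: "(\<And>n. \<rho> p (Poly_Mapping.single n 1) = 0) \<Longrightarrow> \<rho> p v = 0"
  by (induction v rule: poly_mapping_linear_induct) (simp_all add: \<rho>_linear)

lemma tideal_\<rho>: "tideal {p. \<forall>v. \<rho> p v = 0}"
  by unfold_locales (simp_all add: \<rho>_linear \<rho>_mult)

lemma wt_step: "wt i n = q powi cartan i I1 * wt i (Suc n)"
  using q0 by (simp add: wt_def field_simps)

lemma power_period: "x ^ l = 1 \<Longrightarrow> inverse x ^ l = (1::'k)"
  by (simp add: power_inverse)

lemma powi_l: "(q powi c) ^ l = 1"
  by (metis ql power_int_1_left power_int_mult power_int_of_nat mult.commute)

lemma wt_power: "wt i n ^ l = 1"
proof -
  have "wt i n ^ l = \<eta> i ^ l * (inverse (q powi cartan i I1) ^ l) ^ n"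
    by (simp add: wt_def power_mult_distrib mult.commute flip: power_mult)
  then show ?thesis by (simp add: power_inverse powi_l \<eta>l)
qed

lemma raise_Suc: "raise (Suc n) = raise n + (wt I1 n - inverse (wt I1 n)) / (q - inverse q)"
  by (simp add: raise_def add_divide_distrib)

text \<open>The sums \<open>\<Sum>\<^sub>j q\<^sup>\<plusminus>\<^sup>2\<^sup>j\<close> over a full period vanish.
  This makes it consistent that \<open>F\<^sub>1\<close> kills \<open>v\<^sub>l\<^sub>-\<^sub>1\<close>.\<close>

lemma raise_l: "raise l = 0"
proof -
  have g: "(\<Sum>j<l. x ^ j) = 0" if "x ^ l = 1" "x \<noteq> 1" for x :: 'k
    using that geometric_sum[of x l] by simp
  have qq: "q * q \<noteq> 1" using prim l1 unfolding prim_root_def by (metis power_one_right zero_less_one)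
  have i: "inverse (q * q) \<noteq> 1" using qq by (metis inverse_eq_1_iff)
  have p: "(q * q) ^ l = 1" by (simp add: power_mult_distrib ql)
  have w: "wt I1 j = \<eta> I1 * inverse (q * q) ^ j" for j
    by (simp add: wt_def cartan_def power2_eq_square)
  have w': "inverse (wt I1 j) = inverse (\<eta> I1) * (q * q) ^ j" for j
    by (simp add: w power_inverse power_mult_distrib)
  have "(\<Sum>j<l. wt I1 j) = 0"
    unfolding w sum_distrib_left[symmetric] using g[OF power_period[OF p] i] by simp
  moreover have "(\<Sum>j<l. inverse (wt I1 j)) = 0"
    unfolding w' sum_distrib_left[symmetric] using g[OF p qq] by simp
  ultimately show ?thesis by (simp add: raise_def sum_subtractf)
qed

lemma raise_period: "raise (n + l) = raise n"
proof (induction n)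
  case 0 show ?case by (simp add: raise_l) (simp add: raise_def)
next
  case (Suc n)
  have "wt I1 (n + l) = wt I1 n"
    by (simp add: wt_def power_add power_inverse powi_l)
  then show ?case using Suc by (simp add: raise_Suc)
qed

lemma raise_multiple: "l dvd n \<Longrightarrow> raise n = 0"
proof (elim dvdE)
  fix k assume "n = l * k"
  moreover have "raise (l * k) = 0" for k
    by (induction k) (simp_all add: raise_period add.commute[of l], simp add: raise_def)
  ultimately show ?thesis by simp
qed

lemma EF_act: "\<rho> (E I1 * F I1) (Poly_Mapping.single n 1) = Poly_Mapping.single n (raise (Suc n))"
  "\<rho> (F I1 * E I1) (Poly_Mapping.single n 1) = Poly_Mapping.single n (raise n)"
proof -
  show "\<rho> (E I1 * F I1) (Poly_Mapping.single n 1) = Poly_Mapping.single n (raise (Suc n))"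
    by (simp add: \<rho>_mult \<rho>_gen \<rho>_linear raise_multiple)
  show "\<rho> (F I1 * E I1) (Poly_Mapping.single n 1) = Poly_Mapping.single n (raise n)"
    using raise_multiple[of n] by (cases n) (auto simp: \<rho>_mult \<rho>_gen \<rho>_linear raise_def)
qed

lemma \<rho>_I2: "\<rho> (E I2) v = 0" "\<rho> (F I2) v = 0"
  by (rule \<rho>_zeroI; simp add: \<rho>_gen)+

lemma \<rho>_K: "\<rho> (K i) (Poly_Mapping.single n c) = Poly_Mapping.single n (c * wt i n)"
  "\<rho> (K' i) (Poly_Mapping.single n c) = Poly_Mapping.single n (c * inverse (wt i n))"
  by (simp_all add: \<rho>_gen)

lemma \<rho>_KEK: "\<rho> (K i * E j * K' i) (Poly_Mapping.single n 1) = psc (q powi cartan j i) (\<rho> (E j) (Poly_Mapping.single n 1))"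
proof (cases "j = I1 \<and> n > 0")
  case True
  then obtain m where m: "n = Suc m" "j = I1" by (cases n) auto
  have "wt i m * inverse (wt i (Suc m)) = q powi cartan I1 i"
    using wt_step[of i m] wt0[of i "Suc m"] by (simp add: cartan_sym[of I1 i])
  then show ?thesis by (simp add: m \<rho>_mult \<rho>_K \<rho>_gen \<rho>_linear mult_ac)
next
  case False
  then show ?thesis by (cases j) (auto simp: \<rho>_mult \<rho>_K \<rho>_gen \<rho>_linear raise_def \<rho>_I2)
qed

lemma \<rho>_KFK: "\<rho> (K i * F j * K' i) (Poly_Mapping.single n 1) = psc (q powi (- cartan j i)) (\<rho> (F j) (Poly_Mapping.single n 1))"
proof (cases j)
  case I1
  have "inverse (wt i n) * wt i (Suc n) = q powi (- cartan I1 i)"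
    using wt_step[of i n] wt0[of i "Suc n"] q0 by (simp add: cartan_sym[of I1 i] power_int_minus)
  then show ?thesis by (simp add: I1 \<rho>_mult \<rho>_K \<rho>_gen \<rho>_linear)
next
  case I2
  then show ?thesis by (auto simp: \<rho>_mult \<rho>_K \<rho>_gen \<rho>_linear \<rho>_I2)
qed

lemma \<rho>_EF1: "\<rho> (E I1 * F I1 - F I1 * E I1 - psc (1 / (q - inverse q)) (K I1 - K' I1)) (Poly_Mapping.single n 1) = 0"
proof -
  have "\<rho> (E I1 * F I1 - F I1 * E I1 - psc (1 / (q - inverse q)) (K I1 - K' I1)) (Poly_Mapping.single n 1)
      = Poly_Mapping.single n (raise (Suc n) - raise n - 1 / (q - inverse q) * (wt I1 n - inverse (wt I1 n)))"
    by (simp add: \<rho>_linear EF_act \<rho>_K psc.scale_right_diff_distrib single_diff right_diff_distrib)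
  then show ?thesis by (simp add: raise_Suc)
qed

lemma \<rho>_U_relations:
  assumes "p \<in> U_relations q"
  shows "\<rho> p v = 0"
proof (rule \<rho>_zeroI)
  fix n
  show "\<rho> p (Poly_Mapping.single n 1) = 0"
    using assms
  proof (cases rule: U_relationsE)
    case (EF i j)
    then show ?thesis by (cases i; cases j) (simp_all add: \<rho>_linear \<rho>_mult \<rho>_I2)
  next
    case (sE i j)
    then show ?thesis by (cases i; cases j) (simp_all add: serre_def \<rho>_linear \<rho>_mult \<rho>_I2)
  next
    case (sF i j)
    then show ?thesis by (cases i; cases j) (simp_all add: serre_def \<rho>_linear \<rho>_mult \<rho>_I2)
  next
    case EF1
    then show ?thesis by (simp only: \<rho>_EF1)
  qed (simp_all add: \<rho>_linear \<rho>_KEK \<rho>_KFK, simp_all add: \<rho>_mult \<rho>_K \<rho>_gen(2) wt0 mult.commute)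
qed

lemma E_nilpotent: "n mod l < k \<Longrightarrow> \<rho> (E I1 ^ k) (Poly_Mapping.single n c) = 0"
proof (induction k arbitrary: n c)
  case (Suc k)
  show ?case
  proof (cases "l dvd n")
    case True
    then show ?thesis by (simp add: power_Suc2 \<rho>_mult \<rho>_gen \<rho>_linear raise_multiple del: power_Suc)
  next
    case False
    then obtain m where m: "n = Suc m" by (cases n) auto
    then have "m mod l < k" using Suc.prems False by (simp add: mod_Suc dvd_eq_mod_eq_0 split: if_splits)
    then show ?thesis by (simp add: m power_Suc2 \<rho>_mult \<rho>_gen \<rho>_linear Suc.IH del: power_Suc)
  qed
qed simp

lemma F_nilpotent: "l \<le> k + n mod l \<Longrightarrow> \<rho> (F I1 ^ k) (Poly_Mapping.single n c) = 0"
proof (induction k arbitrary: n c)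
  case 0
  then have False using l1 mod_less_divisor[of l n] by linarith
  then show ?case ..
next
  case (Suc k)
  show ?case
  proof (cases "l dvd Suc n")
    case True
    then show ?thesis by (simp add: power_Suc2 \<rho>_mult \<rho>_gen \<rho>_linear del: power_Suc)
  next
    case False
    then have "l \<le> k + Suc n mod l" using Suc.prems by (simp add: mod_Suc dvd_eq_mod_eq_0 split: if_splits)
    then show ?thesis using False by (simp add: power_Suc2 \<rho>_mult \<rho>_gen \<rho>_linear Suc.IH del: power_Suc)
  qed
qed

lemma \<rho>_power_0: "(\<And>v. \<rho> p v = 0) \<Longrightarrow> \<rho> (p ^ l) v = 0"
  using l1 by (simp add: power_eq_if \<rho>_mult)

lemma \<rho>_small_relations: "p \<in> small_relations l q \<Longrightarrow> \<rho> p v = 0"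
proof (rule \<rho>_zeroI)
  fix n assume p: "p \<in> small_relations l q"
  have "\<rho> (fE12 q) v = 0" "\<rho> (fF12 q) v = 0" for v
    by (simp_all add: fE12_def fF12_def \<rho>_linear \<rho>_mult \<rho>_I2)
  then have z: "\<rho> (fE12 q ^ l) v = 0" "\<rho> (fF12 q ^ l) v = 0" "\<rho> (E I2 ^ l) v = 0" "\<rho> (F I2 ^ l) v = 0" for v
    by (simp_all add: \<rho>_power_0 \<rho>_I2)
  have "\<rho> (K i ^ m) (Poly_Mapping.single n 1) = Poly_Mapping.single n (wt i n ^ m)" for i m
    by (induction m) (simp_all add: \<rho>_mult \<rho>_gen(2) \<rho>_K mult.commute)
  then have k: "\<rho> (K i ^ l) (Poly_Mapping.single n 1) = Poly_Mapping.single n 1" for i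
    by (simp add: wt_power)
  have "n mod l < l" using l1 by simp
  then show "\<rho> p (Poly_Mapping.single n 1) = 0"
    using p unfolding small_relations_def
    by (auto simp: z k \<rho>_linear \<rho>_gen(2) E_nilpotent F_nilpotent)
qed

lemma \<rho>_u_ideal: "p \<in> u_ideal l q \<Longrightarrow> \<rho> p v = 0"
  using u_ideal_minimal[OF tideal_\<rho>, of q l p] \<rho>_U_relations \<rho>_small_relations by blast

text \<open>The coefficient of the highest weight vector \<open>v\<^sub>0\<close> in \<open>p
  v\<^sub>0\<close>.\<close>

definition \<chi> :: "(gen, 'k) free_algebra \<Rightarrow> 'k" where
  "\<chi> p = Poly_Mapping.lookup (\<rho> p (Poly_Mapping.single 0 1)) 0"

lemma \<chi>_linear: "\<chi> (p + r) = \<chi> p + \<chi> r" "\<chi> (psc c p) = c * \<chi> p"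
  by (simp_all add: \<chi>_def \<rho>_linear lookup_add)

lemma \<chi>_u_ideal: "p \<in> u_ideal l q \<Longrightarrow> \<chi> p = 0"
  by (simp add: \<chi>_def \<rho>_u_ideal)

fun chr :: "bgen \<Rightarrow> 'k" where "chr (X i) = 0" | "chr (L i) = \<eta> i" | "chr (L' i) = inverse (\<eta> i)"

text \<open>On the upper Borel part \<open>v\<^sub>0\<close> is a common eigenvector.\<close>

lemma \<chi>_E_word: "\<chi> (wm (map eE w)) = prod_list (map chr w)"
proof -
  have wt: "wt i 0 = \<eta> i" for i by (simp add: wt_def)
  have "\<rho> (wm (map eE w)) (Poly_Mapping.single 0 1) = Poly_Mapping.single 0 (prod_list (map chr w))"
  proof (induction w)
    case (Cons g w)
    then show ?case by (cases g) (auto simp: wm_simps(3) \<rho>_mult \<rho>_gen wt raise_def mult.commute)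
  qed (simp add: wm_simps \<rho>_gen)
  then show ?thesis by (simp add: \<chi>_def)
qed

text \<open>On the lower Borel part the span of the \<open>v\<^sub>n\<close> with \<open>n > 0\<close> contributes
  nothing to the coefficient of \<open>v\<^sub>0\<close>, as \<open>F\<^sub>1\<close> never reaches
  \<open>v\<^sub>0\<close>.\<close>

lemma \<chi>_F_word: "\<chi> (wm (map eF w)) = prod_list (map chr w)"
proof -
  have wt: "wt i 0 = \<eta> i" for i by (simp add: wt_def)
  have "Poly_Mapping.lookup (\<rho> (var (eF g)) v) 0 = chr g * Poly_Mapping.lookup v 0" for g v
  proof (induction v rule: poly_mapping_linear_induct)
    case (single n)
    then show ?case by (cases g) (auto simp: \<rho>_gen wt lookup_single when_def)
  qed (simp_all add: \<rho>_linear lookup_add algebra_simps)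
  then have "Poly_Mapping.lookup (\<rho> (wm (map eF w)) v) 0 = prod_list (map chr w) * Poly_Mapping.lookup v 0" for v
    by (induction w) (simp_all add: wm_simps \<rho>_gen \<rho>_mult mult.assoc)
  then show ?thesis by (simp add: \<chi>_def)
qed

subsection \<open>Winding by a character\<close>

definition windR :: "(gen word \<times> gen word \<Rightarrow>\<^sub>0 'k) \<Rightarrow> (gen, 'k) free_algebra" where
  "windR t = lin psc (\<lambda>(v, w). psc (\<chi> (wm (letters w))) (wm (letters v))) t"
definition windL :: "(gen word \<times> gen word \<Rightarrow>\<^sub>0 'k) \<Rightarrow> (gen, 'k) free_algebra" where
  "windL t = lin psc (\<lambda>(v, w). psc (\<chi> (wm (letters v))) (wm (letters w))) t"

lemma wind_linear:
  "windR (s + t) = windR s + windR t" "windR (psc c s) = psc c (windR s)" "windR (- s) = - windR s" "windR 0 = 0"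
  "windL (s + t) = windL s + windL t" "windL (psc c s) = psc c (windL s)" "windL (- s) = - windL s" "windL 0 = 0"
  using psc.lin_diff[of "\<lambda>(v, w). psc (\<chi> (wm (letters w))) (wm (letters v))" 0 s]
    psc.lin_diff[of "\<lambda>(v, w). psc (\<chi> (wm (letters v))) (wm (letters w))" 0 s]
  by (simp_all add: windR_def windL_def psc.lin_add psc.lin_psc)

lemma wind_bt: "windR (bt p r) = psc (\<chi> r) p" "windL (bt p r) = psc (\<chi> p) r"
proof -
  have \<chi>0: "\<chi> 0 = 0" using \<chi>_linear(2)[of 0] by simp
  have w: "bt (wm v) (wm w) = (Poly_Mapping.single (Word v, Word w) 1 :: gen word \<times> gen word \<Rightarrow>\<^sub>0 'k)" for v w
    by (simp add: wm_def)
  show "windR (bt p r) = psc (\<chi> r) p"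
  proof (induction p rule: free_algebra_induct)
    case (word v)
    show ?case
      by (induction r rule: free_algebra_induct)
        (simp_all add: w windR_def psc.lin_single, simp_all add: \<chi>0 bt_linear \<chi>_linear psc.lin_add psc.lin_psc psc.scale_left_distrib)
  qed (simp_all add: bt_linear wind_linear psc.scale_right_distrib mult.commute)
  show "windL (bt p r) = psc (\<chi> p) r"
  proof (induction p rule: free_algebra_induct)
    case (word v)
    show ?case
      by (induction r rule: free_algebra_induct)
        (simp_all add: w windL_def psc.lin_single, simp_all add: bt_linear psc.lin_add psc.lin_psc psc.scale_right_distrib mult.commute)
  qed (simp_all add: bt_linear wind_linear \<chi>_linear psc.scale_left_distrib \<chi>0)
qed

text \<open>The coproduct of the ideal lies in \<open>J \<otimes> 1 + 1 \<otimes> J\<close>, and the linear form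
  vanishes on \<open>J\<close>.\<close>

lemma wind_u_ideal:
  assumes "p \<in> u_ideal l q"
  shows "windR (\<Delta>0 p) \<in> u_ideal l q" "windL (\<Delta>0 p) \<in> u_ideal l q"
proof -
  interpret uu: presented_alg_pair "su l q" "pi_u l q" "su l q" "pi_u l q" by (rule u_pair)
  interpret tideal "u_ideal l q" by (rule tideal_u_ideal)
  have z: "pi_u l q p = \<zero>\<^bsub>su l q\<^esub> \<longleftrightarrow> p \<in> u_ideal l q" for p
    using pi_u_zero_iff[of l q p] by (simp add: small_u_def hopf_quot_def module.defs)
  have t: "uu.\<tau> (\<Delta>0 p) = \<zero>\<^bsub>tensor (su l q) (su l q)\<^esub>"
    using \<Delta>0_u_ideal[OF q0 prim ql assms] by (simp add: tu_def)
  note ps = tideal_psc[OF tideal_u_ideal]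
  show "windR (\<Delta>0 p) \<in> u_ideal l q"
    using t by (rule uu.kernel_induct)
      (simp_all add: wind_linear wind_bt z \<chi>_u_ideal ps zero add uminus)
  show "windL (\<Delta>0 p) \<in> u_ideal l q"
    using t by (rule uu.kernel_induct)
      (simp_all add: wind_linear wind_bt z \<chi>_u_ideal ps zero add uminus)
qed

end

subsection \<open>Rescaling the letters\<close>

text \<open>The rescaling \<open>X\<^sub>i \<mapsto> x\<^sub>i X\<^sub>i\<close>, \<open>K\<^sub>i \<mapsto> y\<^sub>i
  K\<^sub>i\<close> of the letters.\<close>

primrec scal :: "(idx \<Rightarrow> 'k) \<Rightarrow> (idx \<Rightarrow> 'k) \<Rightarrow> bgen \<Rightarrow> 'k::field" where
  "scal x y (X i) = x i" | "scal x y (L i) = y i" | "scal x y (L' i) = inverse (y i)"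

definition rescale :: "(idx \<Rightarrow> 'k) \<Rightarrow> (idx \<Rightarrow> 'k) \<Rightarrow> (bgen list \<Rightarrow>\<^sub>0 'k) \<Rightarrow> (bgen list \<Rightarrow>\<^sub>0 'k::field)" where
  "rescale x y p = lin psc (\<lambda>w. Poly_Mapping.single w (prod_list (map (scal x y) w))) p"

lemma rescale_linear:
  "rescale x y (p + r) = rescale x y p + rescale x y r" "rescale x y (psc c p) = psc c (rescale x y p)" "rescale x y 0 = 0"
  "rescale x y (Poly_Mapping.single w c) = Poly_Mapping.single w (c * prod_list (map (scal x y) w))"
  by (simp_all add: rescale_def psc.lin_add psc.lin_psc psc.lin_single)

lemma rescale_rescale: "rescale x y (rescale x' y' p) = rescale (\<lambda>i. x i * x' i) (\<lambda>i. y i * y' i) p"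
proof -
  have s: "scal x y g * scal x' y' g = scal (\<lambda>i. x i * x' i) (\<lambda>i. y i * y' i) g" for g
    by (cases g) simp_all
  have w: "prod_list (map (scal x y) w) * prod_list (map (scal x' y') w) = prod_list (map (scal (\<lambda>i. x i * x' i) (\<lambda>i. y i * y' i)) w)" for w
    by (induction w) (simp_all add: mult_ac flip: s)
  show ?thesis
    by (induction p rule: poly_mapping_linear_induct) (simp_all add: rescale_linear mult.commute flip: w)
qed

context borel
begin

lemma windR_\<iota>:
  assumes V: "verma l q \<eta>" and s: "\<And>(F :: _ \<Rightarrow> (gen, 'k) free_algebra) w. sw \<delta> (\<lambda>a b. psc (prod_list (map (verma.chr \<eta>) b)) (F a)) w = psc (prod_list (map (scal x y) w)) (F w)"
    and \<chi>: "\<And>w. verma.\<chi> l q \<eta> (wm (map e w)) = prod_list (map (verma.chr \<eta>) w)"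
    and p: "\<iota> p \<in> u_ideal l q"
  shows "\<iota> (rescale x y p) \<in> u_ideal l q"
proof -
  interpret V: verma l q \<eta> by (rule V)
  have "V.windR (\<Delta>0 (\<iota> p)) = \<iota> (rescale x y p)"
  proof (induction p rule: poly_mapping_linear_induct)
    case (single w)
    have "V.windR (\<Delta>0 (wm (map e w))) = sw \<delta> (\<lambda>a b. V.windR (bt (wm (map e a)) (wm (map e b)))) w"
      unfolding \<Delta>0_word by (rule sw_hom) (simp_all add: V.wind_linear)
    then show ?case by (simp add: \<iota>_simps rescale_linear V.wind_bt \<chi> s[of "\<lambda>w. wm (map e w)"])
  qed (simp_all add: \<iota>_simps rescale_linear \<Delta>0_simps V.wind_linear)
  then show ?thesis using V.wind_u_ideal(1)[OF p] by simp
qed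

lemma windL_\<iota>:
  assumes V: "verma l q \<eta>" and s: "\<And>(F :: _ \<Rightarrow> (gen, 'k) free_algebra) w. sw \<delta> (\<lambda>a b. psc (prod_list (map (verma.chr \<eta>) a)) (F b)) w = psc (prod_list (map (scal x y) w)) (F w)"
    and \<chi>: "\<And>w. verma.\<chi> l q \<eta> (wm (map e w)) = prod_list (map (verma.chr \<eta>) w)"
    and p: "\<iota> p \<in> u_ideal l q"
  shows "\<iota> (rescale x y p) \<in> u_ideal l q"
proof -
  interpret V: verma l q \<eta> by (rule V)
  have "V.windL (\<Delta>0 (\<iota> p)) = \<iota> (rescale x y p)"
  proof (induction p rule: poly_mapping_linear_induct)
    case (single w)
    have "V.windL (\<Delta>0 (wm (map e w))) = sw \<delta> (\<lambda>a b. V.windL (bt (wm (map e a)) (wm (map e b)))) w"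
      unfolding \<Delta>0_word by (rule sw_hom) (simp_all add: V.wind_linear)
    then show ?case by (simp add: \<iota>_simps rescale_linear V.wind_bt \<chi> s[of "\<lambda>w. wm (map e w)"])
  qed (simp_all add: \<iota>_simps rescale_linear \<Delta>0_simps V.wind_linear)
  then show ?thesis using V.wind_u_ideal(2)[OF p] by simp
qed

end

context pairing_setup
begin

lemma verma_q: "(\<And>i. \<eta> i ^ l = 1) \<Longrightarrow> verma l q \<eta>"
  using l3 by unfold_locales (simp_all add: q0 ql prim_q2)

text \<open>As \<open>\<Delta>(E\<^sub>i) = K\<^sub>i \<otimes> E\<^sub>i + E\<^sub>i \<otimes> 1\<close> and
  \<open>\<chi>(E\<^sub>i) = 0\<close>, the map \<open>(id \<otimes> \<chi>) \<Delta>\<close> fixes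
  \<open>E\<^sub>i\<close> and multiplies \<open>K\<^sub>i\<close> by \<open>\<chi>(K\<^sub>i)\<close>.\<close>

lemma A_rescale:
  assumes y: "\<And>i. y i ^ l = 1" and p: "A.\<iota> p \<in> u_ideal l q"
  shows "A.\<iota> (rescale (\<lambda>_. 1) y p) \<in> u_ideal l q"
proof -
  interpret V: verma l q y by (rule verma_q[OF y])
  show ?thesis
  proof (rule A.windR_\<iota>[OF V.verma_axioms _ V.\<chi>_E_word p])
    fix F :: "_ \<Rightarrow> (gen, 'k) free_algebra" and w
    show "sw \<delta>A (\<lambda>a b. psc (prod_list (map V.chr b)) (F a)) w = psc (prod_list (map (scal (\<lambda>_. 1) y) w)) (F w)"
    proof (induction w arbitrary: F)
      case (Cons g w)
      show ?case
        using Cons.IH[of "\<lambda>a. psc (scal (\<lambda>_. 1) y g) (F (g # a))"]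
        by (cases g) (simp_all add: sw_0 mult.commute)
    qed simp
  qed
qed

text \<open>As \<open>\<Delta>(F\<^sub>i) = 1 \<otimes> F\<^sub>i + F\<^sub>i \<otimes>
  K\<^sub>i\<^sup>-\<^sup>1\<close>, winding on the right multiplies \<open>F\<^sub>i\<close> by
  \<open>\<chi>(K\<^sub>i\<^sup>-\<^sup>1)\<close> and \<open>K\<^sub>i\<close> by \<open>\<chi>(K\<^sub>i)\<close>,
  and winding on the left fixes \<open>F\<^sub>i\<close>.  A suitable composite of both gives arbitrary
  factors.\<close>

lemma H_rescale:
  assumes x: "\<And>i. x i ^ l = 1" and y: "\<And>i. y i ^ l = 1" and p: "H.\<iota> p \<in> u_ideal l q"
  shows "H.\<iota> (rescale x y p) \<in> u_ideal l q"
proof -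
  have y1: "(y i * x i) ^ l = 1" "inverse (x i) ^ l = 1" for i by (simp_all add: power_mult_distrib x y power_inverse)
  interpret VR: verma l q "\<lambda>i. inverse (x i)" by (rule verma_q) (rule y1)
  define z where "z = (\<lambda>i. y i * x i)"
  interpret VL: verma l q z by (rule verma_q) (simp add: z_def y1)
  have "H.\<iota> (rescale x (\<lambda>i. inverse (x i)) p) \<in> u_ideal l q"
  proof (rule H.windR_\<iota>[OF VR.verma_axioms _ VR.\<chi>_F_word p])
    fix F :: "_ \<Rightarrow> (gen, 'k) free_algebra" and w
    show "sw \<delta>H (\<lambda>a b. psc (prod_list (map VR.chr b)) (F a)) w = psc (prod_list (map (scal x (\<lambda>i. inverse (x i))) w)) (F w)"
    proof (induction w arbitrary: F)
      case (Cons g w)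
      show ?case
        using Cons.IH[of "\<lambda>a. psc (scal x (\<lambda>i. inverse (x i)) g) (F (g # a))"]
        by (cases g) (simp_all add: sw_0 mult.commute)
    qed simp
  qed
  then have "H.\<iota> (rescale (\<lambda>_. 1) z (rescale x (\<lambda>i. inverse (x i)) p)) \<in> u_ideal l q"
  proof (rule H.windL_\<iota>[OF VL.verma_axioms _ VL.\<chi>_F_word, rotated])
    fix F :: "_ \<Rightarrow> (gen, 'k) free_algebra" and w
    show "sw \<delta>H (\<lambda>a b. psc (prod_list (map VL.chr a)) (F b)) w = psc (prod_list (map (scal (\<lambda>_. 1) z) w)) (F w)"
    proof (induction w arbitrary: F)
      case (Cons g w)
      show ?case
        using Cons.IH[of "\<lambda>a. psc (scal (\<lambda>_. 1) z g) (F (g # a))"]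
        by (cases g) (simp_all add: sw_0 mult.commute)
    qed simp
  qed
  moreover have "x i \<noteq> 0" for i using x[of i] l3 by (auto simp: power_0_left)
  ultimately show ?thesis by (simp add: rescale_rescale z_def mult.assoc)
qed

end

section \<open>The projections from the double crossproduct to the small quantum group\<close>

context pairing_setup
begin

sublocale U: \<Delta>_quotient "u_ideal l q" q "keru l q" by (rule \<Delta>_quotient_u[OF q0 prim_q2 ql])

notation U.eqv (infix \<open>\<approx>\<close> 50)

definition roots :: "(idx \<Rightarrow> 'k) \<Rightarrow> bool" where "roots \<eta> \<longleftrightarrow> (\<forall>i. \<eta> i ^ l = 1)"

lemma rootsD: "roots \<eta> \<Longrightarrow> \<eta> i ^ l = 1" "roots \<eta> \<Longrightarrow> \<eta> i \<noteq> 0"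
  using l3 by (auto simp: roots_def power_0_left dest: spec[of _ i])

text \<open>The factor of \<open>F\<^sub>i\<close> under \<open>\<Phi>\<^sub>\<eta>\<close>.  For
  \<open>F\<^sub>1\<close> it matches the coefficient \<open>1/(q\<^sup>2 - 1)\<close> of the commutator in
  \<open>D\<close> with the coefficient \<open>1/(q - q\<^sup>-\<^sup>1)\<close> in \<open>\<uu>\<close>.\<close>

definition sF :: "(idx \<Rightarrow> 'k) \<Rightarrow> idx \<Rightarrow> 'k" where "sF \<eta> i = (if i = I1 then \<eta> I1 * inverse q else 1)"

lemma sF_root: "roots \<eta> \<Longrightarrow> sF \<eta> i ^ l = 1" "roots \<eta> \<Longrightarrow> sF \<eta> i \<noteq> 0"
  using q0 by (auto simp: sF_def power_mult_distrib power_inverse ql rootsD)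

text \<open>The factors by which \<open>\<Phi>\<^sub>\<eta>\<close> rescales the letters of
  \<open>\<uu>\<^sup>\<ge>\<^sup>0\<close> and \<open>\<uu>\<^sup>\<le>\<^sup>0\<close>.\<close>

definition cA :: "(idx \<Rightarrow> 'k) \<Rightarrow> bgen \<Rightarrow> 'k" where "cA \<eta> = scal (\<lambda>_. 1) \<eta>"
definition cH :: "(idx \<Rightarrow> 'k) \<Rightarrow> bgen \<Rightarrow> 'k" where "cH \<eta> = scal (sF \<eta>) (\<lambda>i. inverse (\<eta> i))"

text \<open>The map \<open>\<Phi>\<^sub>\<eta>\<close> on representatives.\<close>

definition \<Phi>0 :: "(idx \<Rightarrow> 'k) \<Rightarrow> (bgen list \<times> bgen list \<Rightarrow>\<^sub>0 'k) \<Rightarrow> (gen, 'k) free_algebra" where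
  "\<Phi>0 \<eta> s = lin psc (\<lambda>(a, x). psc (prod_list (map (cA \<eta>) a) * prod_list (map (cH \<eta>) x))
      (wm (map eE a) * wm (map eF x))) s"

lemma \<Phi>0_linear: "\<Phi>0 \<eta> (s + t) = \<Phi>0 \<eta> s + \<Phi>0 \<eta> t" "\<Phi>0 \<eta> (s - t) = \<Phi>0 \<eta> s - \<Phi>0 \<eta> t"
  "\<Phi>0 \<eta> (psc c s) = psc c (\<Phi>0 \<eta> s)" "\<Phi>0 \<eta> 0 = 0"
  "\<Phi>0 \<eta> (\<Sum>i\<in>I. f i) = (\<Sum>i\<in>I. \<Phi>0 \<eta> (f i))"
proof -
  show 1: "\<Phi>0 \<eta> (s + t) = \<Phi>0 \<eta> s + \<Phi>0 \<eta> t" "\<Phi>0 \<eta> (s - t) = \<Phi>0 \<eta> s - \<Phi>0 \<eta> t"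
    "\<Phi>0 \<eta> (psc c s) = psc c (\<Phi>0 \<eta> s)" "\<Phi>0 \<eta> 0 = 0" for s t
    by (simp_all add: \<Phi>0_def psc.lin_add psc.lin_diff psc.lin_psc)
  show "\<Phi>0 \<eta> (\<Sum>i\<in>I. f i) = (\<Sum>i\<in>I. \<Phi>0 \<eta> (f i))"
    by (induction I rule: infinite_finite_induct) (simp_all add: 1)
qed

lemma \<Phi>0_word: "\<Phi>0 \<eta> (D1 a x) = psc (prod_list (map (cA \<eta>) a) * prod_list (map (cH \<eta>) x)) (wm (map eE a) * wm (map eF x))"
  by (simp add: \<Phi>0_def psc.lin_single)

lemma \<Phi>0_bt: "\<Phi>0 \<eta> (bt p r) = A.\<iota> (rescale (\<lambda>_. 1) \<eta> p) * H.\<iota> (rescale (sF \<eta>) (\<lambda>i. inverse (\<eta> i)) r)"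
proof (induction p rule: poly_mapping_linear_induct)
  case (single a)
  show ?case
    by (induction r rule: poly_mapping_linear_induct)
      (simp_all add: \<Phi>0_linear bt_linear rescale_linear A.\<iota>_simps H.\<iota>_simps distrib_left psc_mult_left psc_mult_right
        \<Phi>0_word cA_def cH_def)
qed (simp_all add: \<Phi>0_linear bt_linear rescale_linear A.\<iota>_simps distrib_right psc_mult_left)

text \<open>The kernel of \<open>\<tau>\<close> is spanned by tensors with one factor in the ideal, and the rescalings
  preserve these relations.\<close>

lemma \<Phi>0_kernel:
  assumes \<eta>: "roots \<eta>" and s: "AH.\<tau> s = \<zero>\<^bsub>T\<^esub>"
  shows "\<Phi>0 \<eta> s \<in> u_ideal l q"
proof -
  have i: "inverse (\<eta> i) ^ l = 1" for i by (simp add: power_inverse rootsD[OF \<eta>])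
  show ?thesis
    using s
  proof (rule AH.kernel_induct)
    show "\<Phi>0 \<eta> (- p) \<in> u_ideal l q" if "\<Phi>0 \<eta> p \<in> u_ideal l q" for p
      using that U.uminus \<Phi>0_linear(2)[of \<eta> 0 p] by (simp add: \<Phi>0_linear)
    show "\<Phi>0 \<eta> (bt p r) \<in> u_ideal l q" if "A.\<pi>B p = \<zero>\<^bsub>A.Bo\<^esub>" for p r
      using that unfolding A.\<pi>B_zero_iff \<Phi>0_bt by (intro U.right A_rescale rootsD[OF \<eta>])
    show "\<Phi>0 \<eta> (bt p r) \<in> u_ideal l q" if "H.\<pi>B r = \<zero>\<^bsub>H.Bo\<^esub>" for p r
      using that unfolding H.\<pi>B_zero_iff \<Phi>0_bt by (intro U.left H_rescale sF_root[OF \<eta>] i)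
  qed (simp_all add: \<Phi>0_linear U.add U.zero)
qed

lemma \<Phi>0_left: "\<Phi>0 \<eta> (D1 a [] \<star> s) = \<Phi>0 \<eta> (D1 a []) * \<Phi>0 \<eta> s"
proof (induction s rule: poly_mapping_linear_induct)
  case (single s)
  show ?case
  proof -
    obtain b y where s: "s = (b, y)" by (cases s)
    show ?thesis by (simp add: s mul_single m4_left \<Phi>0_word wm_simps psc_mult_left psc_mult_right mult.assoc)
  qed
qed (simp_all add: mul_linear \<Phi>0_linear distrib_left psc_mult_right)

lemma \<Phi>0_right: "\<Phi>0 \<eta> (s \<star> D1 [] y) = \<Phi>0 \<eta> s * \<Phi>0 \<eta> (D1 [] y)"
proof (induction s rule: poly_mapping_linear_induct)
  case (single s)
  show ?case
  proof -
    obtain b x where s: "s = (b, x)" by (cases s)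
    show ?thesis by (simp add: s mul_single m4_right \<Phi>0_word wm_simps psc_mult_left psc_mult_right mult_ac)
  qed
qed (simp_all add: mul_linear \<Phi>0_linear distrib_right psc_mult_left)

lemma \<Phi>0_one: "\<Phi>0 \<eta> (D1 [] []) = 1"
  by (simp add: \<Phi>0_word wm_simps)

lemma \<Phi>0_letters: "\<Phi>0 \<eta> (D1 [h] []) = psc (cA \<eta> h) (var (eE h))" "\<Phi>0 \<eta> (D1 [] [g]) = psc (cH \<eta> g) (var (eF g))"
  "\<Phi>0 \<eta> (D1 [h] [g]) = psc (cA \<eta> h * cH \<eta> g) (var (eE h) * var (eF g))"
  by (simp_all add: \<Phi>0_word wm_simps)

lemma \<Phi>0_letter_step:
  assumes c: "D1 [] [g] \<star> D1 [h] [] = psc c (D1 [h] [g])" and qc: "U.qc (var (eF g)) (var (eE h)) c"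
  shows "\<Phi>0 \<eta> (D1 [] [g] \<star> D1 [h] []) \<approx> \<Phi>0 \<eta> (D1 [] [g]) * \<Phi>0 \<eta> (D1 [h] [])"
proof -
  have "psc (cA \<eta> h * cH \<eta> g) (psc c (var (eE h) * var (eF g))) \<approx> psc (cA \<eta> h * cH \<eta> g) (var (eF g) * var (eE h))"
    by (rule U.psc_eqv[OF U.eqv_sym[OF qc[unfolded U.qc_def]]])
  moreover have "\<Phi>0 \<eta> (D1 [] [g] \<star> D1 [h] []) = psc (cA \<eta> h * cH \<eta> g) (psc c (var (eE h) * var (eF g)))"
    unfolding c \<Phi>0_linear \<Phi>0_letters by (simp add: mult.commute)
  moreover have "\<Phi>0 \<eta> (D1 [] [g]) * \<Phi>0 \<eta> (D1 [h] []) = psc (cA \<eta> h * cH \<eta> g) (var (eF g) * var (eE h))"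
    unfolding \<Phi>0_letters by (simp add: psc_mult_left psc_mult_right mult.commute)
  ultimately show ?thesis by simp
qed

lemma p11_eq: "p11 * q = 1 / (q - inverse q)"
  using q0 by (simp add: p11_def field_simps power2_eq_square)

lemma \<Phi>0_letter_mult:
  assumes \<eta>: "roots \<eta>"
  shows "\<Phi>0 \<eta> (D1 [] [g] \<star> D1 [h] []) \<approx> \<Phi>0 \<eta> (D1 [] [g]) * \<Phi>0 \<eta> (D1 [h] [])"
proof -
  have n: "q powi cartan i j \<noteq> 0" for i j using q0 by simp
  note step = letters_commute(1-8) U.qcKE U.qcK'E U.qcKK
  have F: "U.qc (var (gF i)) (var (gK j)) (q powi cartan j i)" "U.qc (var (gF i)) (var (gK' j)) (inverse (q powi cartan j i))" for i j
    using U.qc_swap[OF U.qcKF[of j i]] U.qc_swap[OF U.qcK'F[of j i]] n by simp_all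
  show ?thesis
  proof (cases g)
    case g: (L i)
    show ?thesis
    proof (cases h)
      case (X j) then show ?thesis using U.qcKE[of i j] g
        by (intro \<Phi>0_letter_step[where c = "q powi cartan j i"]) (simp_all add: letters_commute cartan_sym[of i j])
    next
      case (L j) then show ?thesis using g
        by (intro \<Phi>0_letter_step[where c = 1]) (simp_all add: letters_commute U.qcKK)
    next
      case (L' j) then show ?thesis using g
        by (intro \<Phi>0_letter_step[where c = 1]) (simp_all add: letters_commute U.qcKK)
    qed
  next
    case g: (L' i)
    show ?thesis
    proof (cases h)
      case (X j) then show ?thesis using U.qcK'E[of i j] g
        by (intro \<Phi>0_letter_step[where c = "inverse (q powi cartan j i)"]) (simp_all add: letters_commute cartan_sym[of i j])
    next
      case (L j) then show ?thesis using g
        by (intro \<Phi>0_letter_step[where c = 1]) (simp_all add: letters_commute U.qcKK)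
    next
      case (L' j) then show ?thesis using g
        by (intro \<Phi>0_letter_step[where c = 1]) (simp_all add: letters_commute U.qcKK)
    qed
  next
    case (X i)
    show ?thesis
    proof (cases h)
      case (L j) then show ?thesis using F(1)[of i j] X
        by (intro \<Phi>0_letter_step[where c = "q powi cartan j i"]) (simp_all add: letters_commute)
    next
      case (L' j) then show ?thesis using F(2)[of i j] X
        by (intro \<Phi>0_letter_step[where c = "inverse (q powi cartan j i)"]) (simp_all add: letters_commute)
    next
      case h: (X j)
      show ?thesis
      proof (cases "i = I1 \<and> j = I1")
        case False
        then have "var (gE j) * var (gF i) \<approx> var (gF i) * var (gE j)" by (intro U.EF) auto
        then show ?thesis using False X h
          by (intro \<Phi>0_letter_step[where c = 1]) (auto simp: letters_commute U.qc_def intro: U.eqv_sym)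
      next
        case True
        have e: "\<eta> I1 \<noteq> 0" using rootsD[OF \<eta>] by blast
        have "var (gE I1) * var (gF I1) - var (gF I1) * var (gE I1) - psc (p11 * q) (var (gK I1) - var (gK' I1)) \<in> u_ideal l q"
          using U.EF1 by (simp add: U.eqv_def p11_eq)
        from U.psc_mem[OF this, of "\<eta> I1 * inverse q"]
        have "psc (\<eta> I1 * inverse q) (var (gE I1) * var (gF I1)) + psc p11 (psc (\<eta> I1) (var (gK' I1)) - psc (\<eta> I1) (var (gK I1)))
           - psc (\<eta> I1 * inverse q) (var (gF I1) * var (gE I1)) \<in> u_ideal l q"
          using mult.assoc[of q "inverse q", symmetric] q0 by (simp add: psc.scale_right_diff_distrib algebra_simps)
        then show ?thesis
          using True X h e
          by (simp add: letters_commute \<Phi>0_linear \<Phi>0_letters cA_def cH_def sF_def U.eqv_def psc_mult_left psc_mult_right)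
      qed
    qed
  qed
qed

text \<open>Induction on the word \<open>b\<close>, moving \<open>g\<close> past its first letter.  Commuting
  \<open>F\<^sub>1\<close> with \<open>E\<^sub>1\<close> produces torus letters, so the result for these is assumed
  when \<open>g\<close> is some \<open>F\<^sub>i\<close>.\<close>

lemma \<Phi>0_mult_letter:
  assumes \<eta>: "roots \<eta>" and g: "\<And>g' h. (\<exists>i. g = X i) \<Longrightarrow> \<not> (\<exists>i. g' = X i) \<Longrightarrow> \<Phi>0 \<eta> (D1 [] [g'] \<star> D1 h []) \<approx> \<Phi>0 \<eta> (D1 [] [g']) * \<Phi>0 \<eta> (D1 h [])"
  shows "\<Phi>0 \<eta> (D1 [] [g] \<star> D1 b []) \<approx> \<Phi>0 \<eta> (D1 [] [g]) * \<Phi>0 \<eta> (D1 b [])"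
proof (induction b)
  case Nil
  show ?case by (simp add: mul_one \<Phi>0_one)
next
  case (Cons h b)
  define good where "good t \<longleftrightarrow> \<Phi>0 \<eta> (t \<star> D1 b []) \<approx> \<Phi>0 \<eta> t * \<Phi>0 \<eta> (D1 b [])" for t
  have add: "good (s + t)" if "good s" "good t" for s t
    using U.eqv_add[OF that[unfolded good_def]] by (simp add: good_def mul_linear \<Phi>0_linear distrib_right)
  have dif: "good (s - t)" if "good s" "good t" for s t
    using U.eqv_diff[OF that[unfolded good_def]] by (simp add: good_def mul_linear \<Phi>0_linear left_diff_distrib)
  have sc: "good (psc c t)" if "good t" for c t
    using U.psc_eqv[OF that[unfolded good_def]] by (simp add: good_def mul_linear \<Phi>0_linear psc_mult_left)
  have "good (D1 [h] [g])"
  proof -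
    have "\<Phi>0 \<eta> (D1 [h] [g] \<star> D1 b []) = \<Phi>0 \<eta> (D1 [h] []) * \<Phi>0 \<eta> (D1 [] [g] \<star> D1 b [])"
      by (simp add: mul_words(3)[of "[h]" "[g]"] mul_assoc \<Phi>0_left)
    also have "\<dots> \<approx> \<Phi>0 \<eta> (D1 [h] []) * (\<Phi>0 \<eta> (D1 [] [g]) * \<Phi>0 \<eta> (D1 b []))"
      by (rule U.eqv_left[OF Cons.IH])
    also have "\<dots> = \<Phi>0 \<eta> (D1 [h] [g]) * \<Phi>0 \<eta> (D1 b [])"
      by (simp add: mul_words(3)[of "[h]" "[g]"] \<Phi>0_left mult.assoc)
    finally show ?thesis by (simp add: good_def)
  qed
  moreover have "good (psc p11 (D1 [] [L' I1] - D1 [L I1] []))" if "\<exists>i. g = X i"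
    using g[OF that, of "L' I1"] by (intro sc dif) (auto simp: good_def \<Phi>0_left)
  ultimately have "good (D1 [] [g] \<star> D1 [h] [])"
    by (cases g; cases h) (auto simp: letters_commute simp del: psc_single intro!: sc add)
  then have "\<Phi>0 \<eta> (D1 [] [g] \<star> D1 [h] [] \<star> D1 b []) \<approx> \<Phi>0 \<eta> (D1 [] [g] \<star> D1 [h] []) * \<Phi>0 \<eta> (D1 b [])"
    by (simp add: good_def)
  also have "\<dots> \<approx> \<Phi>0 \<eta> (D1 [] [g]) * \<Phi>0 \<eta> (D1 [h] []) * \<Phi>0 \<eta> (D1 b [])"
    by (rule U.eqv_right[OF \<Phi>0_letter_mult[OF \<eta>]])
  finally show ?case
    using mul_words(2)[of "[h]" b "[]"] \<Phi>0_left[of \<eta> "[h]" "D1 b []"] by (simp add: mul_assoc mult.assoc)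
qed

lemma \<Phi>0_mult:
  assumes \<eta>: "roots \<eta>"
  shows "\<Phi>0 \<eta> (s \<star> t) \<approx> \<Phi>0 \<eta> s * \<Phi>0 \<eta> t"
proof -
  have L: "\<Phi>0 \<eta> (D1 [] [g] \<star> D1 b []) \<approx> \<Phi>0 \<eta> (D1 [] [g]) * \<Phi>0 \<eta> (D1 b [])" if "\<not> (\<exists>i. g = X i)" for g b
    by (rule \<Phi>0_mult_letter[OF \<eta>]) (use that in auto)
  have G: "\<Phi>0 \<eta> (D1 [] [g] \<star> D1 b []) \<approx> \<Phi>0 \<eta> (D1 [] [g]) * \<Phi>0 \<eta> (D1 b [])" for g b
    by (rule \<Phi>0_mult_letter[OF \<eta>]) (rule L)
  define good where "good s t \<longleftrightarrow> \<Phi>0 \<eta> (s \<star> t) \<approx> \<Phi>0 \<eta> s * \<Phi>0 \<eta> t" for s t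
  have addl: "good (s + s') t" if "good s t" "good s' t" for s s' t
    using U.eqv_add[OF that[unfolded good_def]] by (simp add: good_def mul_linear \<Phi>0_linear distrib_right)
  have scl: "good (psc c s) t" if "good s t" for c s t
    using U.psc_eqv[OF that[unfolded good_def]] by (simp add: good_def mul_linear \<Phi>0_linear psc_mult_left)
  have addr: "good s (t + t')" if "good s t" "good s t'" for s t t'
    using U.eqv_add[OF that[unfolded good_def]] by (simp add: good_def mul_linear \<Phi>0_linear distrib_left)
  have scr: "good s (psc c t)" if "good s t" for c s t
    using U.psc_eqv[OF that[unfolded good_def]] by (simp add: good_def mul_linear \<Phi>0_linear psc_mult_right)
  have z: "good 0 t" "good s 0" for s t by (simp_all add: good_def mul_linear \<Phi>0_linear)
  have letter: "good (D1 [] [g]) t" for g t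
  proof (induction t rule: poly_mapping_linear_induct)
    case (single t)
    obtain b y where t: "t = (b, y)" by (cases t)
    have "\<Phi>0 \<eta> (D1 [] [g] \<star> D1 b y) = \<Phi>0 \<eta> (D1 [] [g] \<star> D1 b []) * \<Phi>0 \<eta> (D1 [] y)"
      by (simp add: mul_words(3)[of b y] \<Phi>0_right flip: mul_assoc)
    also have "\<dots> \<approx> \<Phi>0 \<eta> (D1 [] [g]) * \<Phi>0 \<eta> (D1 b []) * \<Phi>0 \<eta> (D1 [] y)"
      by (rule U.eqv_right[OF G])
    also have "\<dots> = \<Phi>0 \<eta> (D1 [] [g]) * \<Phi>0 \<eta> (D1 b y)"
      by (simp add: mul_words(3)[of b y] \<Phi>0_right mult.assoc)
    finally show ?case by (simp add: good_def t)
  qed (rule addr scr z; assumption?)+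
  have word: "good (D1 [] x) t" for x t
  proof (induction x arbitrary: t)
    case Nil show ?case by (simp add: good_def mul_one \<Phi>0_one)
  next
    case (Cons g x)
    have gx: "D1 [] (g # x) = D1 [] [g] \<star> D1 [] x" using mul_words(1)[of "[]" "[g]" x] by simp
    have "\<Phi>0 \<eta> (D1 [] [g] \<star> (D1 [] x \<star> t)) \<approx> \<Phi>0 \<eta> (D1 [] [g]) * \<Phi>0 \<eta> (D1 [] x \<star> t)"
      using letter by (simp add: good_def)
    also have "\<dots> \<approx> \<Phi>0 \<eta> (D1 [] [g]) * (\<Phi>0 \<eta> (D1 [] x) * \<Phi>0 \<eta> t)"
      using Cons by (intro U.eqv_left) (simp add: good_def)
    also have "\<dots> = \<Phi>0 \<eta> (D1 [] (g # x)) * \<Phi>0 \<eta> t"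
      by (simp add: gx \<Phi>0_right mult.assoc)
    finally show ?case by (simp add: good_def gx mul_assoc)
  qed
  have "good s t"
  proof (induction s rule: poly_mapping_linear_induct)
    case (single s)
    obtain a x where s: "s = (a, x)" by (cases s)
    have "\<Phi>0 \<eta> (D1 a x \<star> t) = \<Phi>0 \<eta> (D1 a []) * \<Phi>0 \<eta> (D1 [] x \<star> t)"
      by (simp add: mul_words(3)[of a x] \<Phi>0_left mul_assoc)
    also have "\<dots> \<approx> \<Phi>0 \<eta> (D1 a []) * (\<Phi>0 \<eta> (D1 [] x) * \<Phi>0 \<eta> t)"
      using word by (intro U.eqv_left) (simp add: good_def)
    also have "\<dots> = \<Phi>0 \<eta> (D1 a x) * \<Phi>0 \<eta> t"
      by (simp add: mul_words(3)[of a x] \<Phi>0_left mult.assoc)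
    finally show ?case by (simp add: good_def s)
  qed (rule addl scl z; assumption?)+
  then show ?thesis by (simp add: good_def)
qed

definition \<Phi> :: "(idx \<Rightarrow> 'k) \<Rightarrow> _ \<Rightarrow> 'k u_elem" where
  "\<Phi> \<eta> d = pi_u l q (\<Phi>0 \<eta> (SOME s. AH.\<tau> s = d))"

lemma \<Phi>_\<tau>:
  assumes \<eta>: "roots \<eta>"
  shows "\<Phi> \<eta> (AH.\<tau> s) = pi_u l q (\<Phi>0 \<eta> s)"
proof -
  define s' where "s' = (SOME s'. AH.\<tau> s' = AH.\<tau> s)"
  have "AH.\<tau> s' = AH.\<tau> s" unfolding s'_def by (rule someI[of "\<lambda>s'. AH.\<tau> s' = AH.\<tau> s"]) simp
  then have "AH.\<tau> (s' - s) = \<zero>\<^bsub>T\<^esub>" by (simp add: AH.T.\<pi>_eq_iff)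
  then have "\<Phi>0 \<eta> (s' - s) \<in> u_ideal l q" by (rule \<Phi>0_kernel[OF \<eta>])
  then show ?thesis unfolding \<Phi>_def s'_def[symmetric] by (simp add: pi_u_eq_iff \<Phi>0_linear)
qed

lemma \<Phi>_ring_hom:
  assumes \<eta>: "roots \<eta>"
  shows "\<Phi> \<eta> \<in> ring_hom D (small_u l q)"
proof (rule ring_hom_memI)
  note p = \<Phi>_\<tau>[OF \<eta>]
  show "\<Phi> \<eta> x \<in> carrier (small_u l q)" for x by (simp add: \<Phi>_def)
  show "\<Phi> \<eta> \<one>\<^bsub>D\<^esub> = \<one>\<^bsub>small_u l q\<^esub>"
    by (simp add: D_simps p \<Phi>0_one A.u.\<alpha>_one)
  fix x y assume "x \<in> carrier D" "y \<in> carrier D"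
  then obtain s t where xy: "x = AH.\<tau> s" "y = AH.\<tau> t" by (auto simp: D_simps elim!: AH.T.\<pi>_E)
  show "\<Phi> \<eta> (x \<otimes>\<^bsub>D\<^esub> y) = \<Phi> \<eta> x \<otimes>\<^bsub>small_u l q\<^esub> \<Phi> \<eta> y"
    using \<Phi>0_mult[OF \<eta>, of s t] by (simp add: xy D_mult p pi_u_eq_iff U.eqv_def flip: A.u.\<alpha>_mult)
  show "\<Phi> \<eta> (x \<oplus>\<^bsub>D\<^esub> y) = \<Phi> \<eta> x \<oplus>\<^bsub>small_u l q\<^esub> \<Phi> \<eta> y"
    by (simp add: xy D_simps p \<Phi>0_linear flip: AH.T.\<pi>_add A.u.\<pi>_add)
qed

end

section \<open>Central idempotents\<close>

context borel
begin

lemma range_\<iota>: "p \<in> range \<iota> \<Longrightarrow> r \<in> range \<iota> \<Longrightarrow> p * r \<in> range \<iota>" "p \<in> range \<iota> \<Longrightarrow> r \<in> range \<iota> \<Longrightarrow> p + r \<in> range \<iota>"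
  "p \<in> range \<iota> \<Longrightarrow> r \<in> range \<iota> \<Longrightarrow> p - r \<in> range \<iota>" "p \<in> range \<iota> \<Longrightarrow> psc c p \<in> range \<iota>" "1 \<in> range \<iota>"
  "var (e g) \<in> range \<iota>" "p \<in> range \<iota> \<Longrightarrow> p ^ n \<in> range \<iota>"
proof -
  show m: "p \<in> range \<iota> \<Longrightarrow> r \<in> range \<iota> \<Longrightarrow> p * r \<in> range \<iota>" for p r using \<iota>_mult by blast
  show "p \<in> range \<iota> \<Longrightarrow> r \<in> range \<iota> \<Longrightarrow> p + r \<in> range \<iota>" "p \<in> range \<iota> \<Longrightarrow> r \<in> range \<iota> \<Longrightarrow> p - r \<in> range \<iota>"
    "p \<in> range \<iota> \<Longrightarrow> psc c p \<in> range \<iota>"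
    by (auto simp flip: \<iota>_simps)
  show one: "1 \<in> range \<iota>"
    by (rule image_eqI[of _ _ "Poly_Mapping.single [] 1"]) (simp_all add: \<iota>_simps wm_simps)
  show "var (e g) \<in> range \<iota>"
    by (rule image_eqI[of _ _ "Poly_Mapping.single [g] 1"]) (simp_all add: \<iota>_simps wm_simps)
  show "p \<in> range \<iota> \<Longrightarrow> p ^ n \<in> range \<iota>" by (induction n) (simp_all add: one m)
qed

end

context pairing_setup
begin

text \<open>Equality of the elements of \<open>D\<close> that are represented.\<close>

definition eqD (infix \<open>\<doteq>\<close> 50) where "s \<doteq> t \<longleftrightarrow> AH.\<tau> s = AH.\<tau> t"

lemma eqD_refl [simp]: "s \<doteq> s" and eqD_sym: "s \<doteq> t \<Longrightarrow> t \<doteq> s" and eqD_trans [trans]: "s \<doteq> t \<Longrightarrow> t \<doteq> u \<Longrightarrow> s \<doteq> u"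
  by (simp_all add: eqD_def)

lemma eqD_eq_trans [trans]: "s \<doteq> t \<Longrightarrow> t = u \<Longrightarrow> s \<doteq> u" "s = t \<Longrightarrow> t \<doteq> u \<Longrightarrow> s \<doteq> u" by auto

lemma eqD_diff0: "s \<doteq> t \<longleftrightarrow> s - t \<doteq> 0"
  by (simp add: eqD_def AH.T.\<pi>_zero AH.T.\<pi>_eq_iff)

lemma eqD_add: "s \<doteq> s' \<Longrightarrow> t \<doteq> t' \<Longrightarrow> s + t \<doteq> s' + t'"
  by (simp add: eqD_def AH.T.\<pi>_add)
lemma eqD_psc: "s \<doteq> s' \<Longrightarrow> psc c s \<doteq> psc c s'"
  by (simp add: eqD_def AH.T.\<pi>_scale)
lemma eqD_diff: "s \<doteq> s' \<Longrightarrow> t \<doteq> t' \<Longrightarrow> s - t \<doteq> s' - t'"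
  using eqD_add[of s s' "psc (- 1) t" "psc (- 1) t'"] eqD_psc[of t t' "- 1"] by simp
lemma eqD_mul: "s \<doteq> s' \<Longrightarrow> t \<doteq> t' \<Longrightarrow> s \<star> t \<doteq> s' \<star> t'"
  by (simp add: eqD_def flip: D_mult)
lemma eqD_sum: "(\<And>i. i \<in> I \<Longrightarrow> f i \<doteq> g i) \<Longrightarrow> (\<Sum>i\<in>I. f i) \<doteq> (\<Sum>i\<in>I. g i)"
  by (induction I rule: infinite_finite_induct) (simp_all add: eqD_add)

lemma eqD_bt: "A.\<iota> p - A.\<iota> p' \<in> u_ideal l q \<Longrightarrow> H.\<iota> r - H.\<iota> r' \<in> u_ideal l q \<Longrightarrow> bt p r \<doteq> bt p' r'"
  by (simp add: eqD_def flip: pi_u_eq_iff AH.pure_tensor_\<tau>) (simp add: A.\<pi>B_def H.\<pi>B_def)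

lemma eqD_left: "wm (map eE a) \<approx> psc c (wm (map eE a')) \<Longrightarrow> D1 a x \<doteq> psc c (D1 a' x)"
  using eqD_bt[of "Poly_Mapping.single a 1" "Poly_Mapping.single a' c" "Poly_Mapping.single x 1" "Poly_Mapping.single x 1"]
  by (simp add: U.eqv_def A.\<iota>_simps U.zero)

lemma eqD_right: "wm (map eF x) \<approx> psc c (wm (map eF x')) \<Longrightarrow> D1 a x \<doteq> psc c (D1 a x')"
  using eqD_bt[of "Poly_Mapping.single a 1" "Poly_Mapping.single a 1" "Poly_Mapping.single x 1" "Poly_Mapping.single x' c"]
  by (simp add: U.eqv_def H.\<iota>_simps U.zero)

subsection \<open>The central group-likes\<close>

definition z :: "idx \<Rightarrow> (bgen list \<times> bgen list \<Rightarrow>\<^sub>0 'k)" where "z i = D1 [L i] [L' i]"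

primrec zp :: "idx \<Rightarrow> nat \<Rightarrow> (bgen list \<times> bgen list \<Rightarrow>\<^sub>0 'k)" where
  "zp i 0 = D1 [] []" | "zp i (Suc m) = z i \<star> zp i m"

definition central where "central c \<longleftrightarrow> (\<forall>s. c \<star> s \<doteq> s \<star> c)"

lemma centralD: "central c \<Longrightarrow> c \<star> s \<doteq> s \<star> c" by (simp add: central_def)

lemma central_simps: "central (D1 [] [])" "central s \<Longrightarrow> central t \<Longrightarrow> central (s \<star> t)"
  "central s \<Longrightarrow> central t \<Longrightarrow> central (s + t)" "central s \<Longrightarrow> central (psc c s)" "central 0"
proof -
  show "central (D1 [] [])" "central 0" by (simp_all add: central_def mul_one mul_linear)
  show "central s \<Longrightarrow> central (psc c s)" using eqD_psc by (simp add: central_def mul_linear)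
  show "central s \<Longrightarrow> central t \<Longrightarrow> central (s + t)" using eqD_add by (simp add: central_def mul_linear)
  assume st: "central s" "central t"
  show "central (s \<star> t)"
    unfolding central_def
  proof
    fix u
    have "s \<star> t \<star> u \<doteq> s \<star> (u \<star> t)" unfolding mul_assoc by (intro eqD_mul centralD[OF st(2)] eqD_refl)
    also have "\<dots> \<doteq> u \<star> s \<star> t" unfolding mul_assoc[symmetric] by (intro eqD_mul centralD[OF st(1)] eqD_refl)
    finally show "s \<star> t \<star> u \<doteq> u \<star> (s \<star> t)" by (simp add: mul_assoc)
  qed
qed

lemma central_sum: "(\<And>i. i \<in> I \<Longrightarrow> central (f i)) \<Longrightarrow> central (\<Sum>i\<in>I. f i)"
  by (induction I rule: infinite_finite_induct) (simp_all add: central_simps)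

text \<open>Commuting with \<open>c\<close> is preserved by products and linear combinations.\<close>

lemma centralI:
  assumes "\<And>h. c \<star> D1 [h] [] \<doteq> D1 [h] [] \<star> c" "\<And>g. c \<star> D1 [] [g] \<doteq> D1 [] [g] \<star> c"
  shows "central c"
  unfolding central_def
proof
  have m: "c \<star> (s \<star> t) \<doteq> s \<star> t \<star> c" if "c \<star> s \<doteq> s \<star> c" "c \<star> t \<doteq> t \<star> c" for s t
  proof -
    have "c \<star> (s \<star> t) \<doteq> s \<star> c \<star> t" unfolding mul_assoc[symmetric] by (intro eqD_mul that eqD_refl)
    also have "\<dots> \<doteq> s \<star> (t \<star> c)" unfolding mul_assoc by (intro eqD_mul that eqD_refl)
    finally show ?thesis by (simp add: mul_assoc)
  qed
  fix s
  show "c \<star> s \<doteq> s \<star> c"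
  proof (induction s rule: poly_mapping_linear_induct)
    case (single s)
    obtain a x where s: "s = (a, x)" by (cases s)
    have "c \<star> D1 a [] \<doteq> D1 a [] \<star> c"
    proof (induction a)
      case (Cons h a)
      then show ?case using m[OF assms(1)[of h] Cons.IH] mul_words(2)[of "[h]" a "[]"] by simp
    qed (simp add: mul_one)
    moreover have "c \<star> D1 [] x \<doteq> D1 [] x \<star> c"
    proof (induction x)
      case (Cons h x)
      then show ?case using m[OF assms(2)[of h] Cons.IH] mul_words(1)[of "[]" "[h]" x] by simp
    qed (simp add: mul_one)
    ultimately have "c \<star> (D1 a [] \<star> D1 [] x) \<doteq> D1 a [] \<star> D1 [] x \<star> c" by (rule m)
    then show ?case by (simp add: s flip: mul_words(3)[of a x])
  qed (simp_all add: mul_linear eqD_add eqD_psc)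
qed

text \<open>The factors from moving a letter past the left and past the right component of \<open>z\<^sub>i\<close>
  are inverse to each other.\<close>

lemma central_z: "central (z i)"
proof (rule centralI)
  have n: "q powi cartan i j \<noteq> 0" for i j using q0 by simp
  have zl: "z i \<star> s = D1 [L i] [] \<star> (D1 [] [L' i] \<star> s)" for s by (simp add: z_def mul_words(3)[of "[L i]" "[L' i]"] mul_assoc)
  fix h
  show "z i \<star> D1 [h] [] \<doteq> D1 [h] [] \<star> z i"
  proof -
    obtain c where c: "D1 [] [L' i] \<star> D1 [h] [] = psc c (D1 [h] [L' i])" and lc: "var (gK i) * var (eE h) \<approx> psc (inverse c) (var (eE h) * var (gK i))" "c \<noteq> 0"
    proof (cases h)
      case (X j) then show ?thesis using that[of "inverse (q powi cartan j i)"] U.qcKE[of i j] n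
        by (simp add: letters_commute U.qc_def cartan_sym[of i j])
    qed (use that[of 1] U.qcKK in \<open>auto simp: letters_commute U.qc_def\<close>)
    have "z i \<star> D1 [h] [] = psc c (D1 [L i, h] [L' i])"
      using mul_words(2)[of "[L i]" "[h]" "[L' i]"] by (simp add: zl c mul_linear del: psc_single)
    also have "\<dots> \<doteq> psc c (psc (inverse c) (D1 [h, L i] [L' i]))"
      using lc by (intro eqD_psc eqD_left) (simp add: wm_simps)
    also have "\<dots> = D1 [h] [] \<star> z i"
      using lc(2) mul_words(2)[of "[h]" "[L i]" "[L' i]"] by (simp add: z_def)
    finally show ?thesis .
  qed
  fix g
  show "z i \<star> D1 [] [g] \<doteq> D1 [] [g] \<star> z i"
  proof -
    obtain c where c: "D1 [] [g] \<star> D1 [L i] [] = psc c (D1 [L i] [g])" and lc: "var (gK' i) * var (eF g) \<approx> psc c (var (eF g) * var (gK' i))"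
    proof (cases g)
      case (X j) then show ?thesis using that[of "q powi cartan i j"] U.qcK'F[of i j] n
        by (simp add: letters_commute U.qc_def)
    qed (use that[of 1] U.qcKK in \<open>auto simp: letters_commute U.qc_def\<close>)
    have "D1 [] [g] \<star> z i = D1 [] [g] \<star> D1 [L i] [] \<star> D1 [] [L' i]"
      by (simp add: z_def mul_words(3)[of "[L i]" "[L' i]"] mul_assoc)
    also have "\<dots> = psc c (D1 [L i] [g, L' i])"
      using mul_words(1)[of "[L i]" "[g]" "[L' i]"] by (simp add: c mul_linear del: psc_single)
    finally have 1: "D1 [] [g] \<star> z i = psc c (D1 [L i] [g, L' i])" .
    have "z i \<star> D1 [] [g] = D1 [L i] [L' i, g]" using mul_words(1)[of "[L i]" "[L' i]" "[g]"] by (simp add: z_def)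
    also have "\<dots> \<doteq> psc c (D1 [L i] [g, L' i])" using lc by (intro eqD_right) (simp add: wm_simps)
    finally show ?thesis unfolding 1 .
  qed
qed

lemma central_zp: "central (zp i m)"
  by (induction m) (simp_all add: central_simps central_z)

lemma zp_word: "zp i m = D1 (replicate m (L i)) (replicate m (L' i))"
proof (induction m)
  case (Suc m)
  have c: "D1 [] [L' i] \<star> D1 (replicate m (L i)) [] = D1 (replicate m (L i)) [L' i]" for m
  proof (induction m)
    case (Suc m)
    have "D1 [] [L' i] \<star> D1 (L i # replicate m (L i)) [] = D1 [] [L' i] \<star> D1 [L i] [] \<star> D1 (replicate m (L i)) []"
      using mul_words(2)[of "[L i]" "replicate m (L i)" "[]"] by (simp add: mul_assoc)
    also have "\<dots> = D1 [L i] [] \<star> (D1 [] [L' i] \<star> D1 (replicate m (L i)) [])"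
      by (simp add: letters_commute mul_words(3)[of "[L i]" "[L' i]"] mul_assoc)
    also have "\<dots> = D1 (replicate (Suc m) (L i)) [L' i]"
      using mul_words(2)[of "[L i]" "replicate m (L i)" "[L' i]"] by (simp add: Suc.IH)
    finally show ?case by simp
  qed (simp add: mul_one)
  have "zp i (Suc m) = D1 [L i] [] \<star> (D1 [] [L' i] \<star> D1 (replicate m (L i)) []) \<star> D1 [] (replicate m (L' i))"
    by (simp add: Suc z_def mul_words(3)[of "[L i]" "[L' i]"] mul_words(3)[of "replicate m (L i)" "replicate m (L' i)"] mul_assoc)
  also have "\<dots> = D1 (replicate (Suc m) (L i)) (replicate (Suc m) (L' i))"
    using mul_words(2)[of "[L i]" "replicate m (L i)" "[L' i]"] mul_words(1)[of "L i # replicate m (L i)" "[L' i]" "replicate m (L' i)"]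
    by (simp add: c)
  finally show ?case .
qed simp

lemma zp_l: "zp i l \<doteq> D1 [] []"
proof -
  have w: "wm (replicate m g) = var g ^ m" for m and g :: gen by (induction m) (simp_all add: wm_simps)
  have "small_relations l q \<subseteq> u_ideal l q" using small_relations_in_ideal by blast
  note K_l = U.small_relationsD(5,6)[OF this]
  have "D1 (replicate l (L i)) (replicate l (L' i)) \<doteq> psc 1 (D1 [] (replicate l (L' i)))"
    using K_l(1)[of i] by (intro eqD_left) (simp add: w wm_simps map_replicate_const)
  also have "\<dots> \<doteq> psc 1 (psc 1 (D1 [] []))"
    using K_l(2)[of i] by (intro eqD_psc eqD_right) (simp add: w wm_simps map_replicate_const)
  finally show ?thesis by (simp add: zp_word)
qed

text \<open>For \<open>c\<^sup>l = 1\<close>, the projection to the eigenspace of \<open>z\<^sub>i\<close> with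
  eigenvalue \<open>c\<^sup>-\<^sup>1\<close>.\<close>

definition ei :: "idx \<Rightarrow> 'k \<Rightarrow> (bgen list \<times> bgen list \<Rightarrow>\<^sub>0 'k)" where
  "ei i c = psc (1 / of_nat l) (\<Sum>m<l. psc (c ^ m) (zp i m))"

lemma central_ei: "central (ei i c)"
  unfolding ei_def by (intro central_simps central_sum central_zp)

text \<open>Multiplication by \<open>c z\<^sub>i\<close> shifts the summands cyclically.\<close>

lemma z_ei: "c ^ l = 1 \<Longrightarrow> psc c (z i \<star> ei i c) \<doteq> ei i c"
proof -
  assume c: "c ^ l = 1"
  have "psc c (z i \<star> ei i c) - ei i c
     = psc (1 / of_nat l) ((\<Sum>m<l. psc (c ^ Suc m) (zp i (Suc m))) - (\<Sum>m<l. psc (c ^ m) (zp i m)))"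
    by (simp add: ei_def mul_linear mul_sum psc.scale_right_diff_distrib psc.scale_sum_right mult_ac)
  also have "\<dots> = psc (1 / of_nat l) (psc (c ^ l) (zp i l) - psc (c ^ 0) (zp i 0))"
    unfolding sum_subtractf[symmetric] using sum_lessThan_telescope[of "\<lambda>m. psc (c ^ m) (zp i m)" l] by simp
  also have "\<dots> \<doteq> psc (1 / of_nat l) (psc 1 (D1 [] []) - psc 1 (D1 [] []))"
    unfolding c by (intro eqD_psc eqD_diff zp_l) simp
  finally show ?thesis by (subst eqD_diff0) simp
qed

text \<open>The idempotent of the block on which \<open>z\<^sub>i\<close> acts as
  \<open>\<eta>\<^sub>i\<^sup>2\<close>.\<close>

definition ee :: "(idx \<Rightarrow> 'k) \<Rightarrow> (bgen list \<times> bgen list \<Rightarrow>\<^sub>0 'k)" where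
  "ee \<eta> = ei I1 (inverse (\<eta> I1) ^ 2) \<star> ei I2 (inverse (\<eta> I2) ^ 2)"

lemma central_ee: "central (ee \<eta>)"
  unfolding ee_def by (intro central_simps central_ei)

lemma z_ee:
  assumes \<eta>: "roots \<eta>"
  shows "z i \<star> ee \<eta> \<doteq> psc (\<eta> i ^ 2) (ee \<eta>)"
proof -
  have n: "\<eta> j ^ 2 * inverse (\<eta> j) ^ 2 = 1" for j
    using rootsD(2)[OF \<eta>, of j] by (simp flip: power_mult_distrib)
  have r: "(inverse (\<eta> j) ^ 2) ^ l = 1" for j
    using rootsD(1)[OF \<eta>, of j] by (simp add: power_inverse power_mult[symmetric] mult.commute[of 2]) (simp add: power_mult)
  have e: "z j \<star> ei j (inverse (\<eta> j) ^ 2) \<doteq> psc (\<eta> j ^ 2) (ei j (inverse (\<eta> j) ^ 2))" for j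
    using eqD_psc[OF z_ei[OF r[of j], of j], of "\<eta> j ^ 2"] n[of j] by simp
  show ?thesis
  proof (cases i)
    case I1
    then show ?thesis using eqD_mul[OF e[of I1] eqD_refl] by (simp add: ee_def mul_assoc mul_linear)
  next
    case I2
    have "z I2 \<star> ee \<eta> \<doteq> ei I1 (inverse (\<eta> I1) ^ 2) \<star> z I2 \<star> ei I2 (inverse (\<eta> I2) ^ 2)"
      unfolding ee_def mul_assoc[symmetric] by (intro eqD_mul centralD central_z eqD_refl)
    also have "\<dots> \<doteq> ei I1 (inverse (\<eta> I1) ^ 2) \<star> psc (\<eta> I2 ^ 2) (ei I2 (inverse (\<eta> I2) ^ 2))"
      unfolding mul_assoc by (intro eqD_mul e eqD_refl)
    finally show ?thesis using I2 by (simp add: ee_def mul_linear)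
  qed
qed

end

section \<open>The double crossproduct as a product of copies of the small quantum group\<close>

subsection \<open>Lifting elements of the small quantum group\<close>

context pairing_setup
begin

text \<open>The values on generators of the inverse of \<open>\<Phi>\<^sub>\<eta>\<close> on the block of
  \<open>\<eta>\<close>.  The torus is lifted through its left copy, which on that block is as good as the right one
  (lemma \<open>K_ee\<close>).\<close>

fun \<theta>g :: "(idx \<Rightarrow> 'k) \<Rightarrow> gen \<Rightarrow> (bgen list \<times> bgen list \<Rightarrow>\<^sub>0 'k)" where
  "\<theta>g \<eta> (gE i) = D1 [X i] []"
| "\<theta>g \<eta> (gF i) = psc (inverse (sF \<eta> i)) (D1 [] [X i])"
| "\<theta>g \<eta> (gK i) = psc (inverse (\<eta> i)) (D1 [L i] [])"
| "\<theta>g \<eta> (gK' i) = psc (\<eta> i) (D1 [L' i] [])"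

definition \<theta> :: "(idx \<Rightarrow> 'k) \<Rightarrow> (gen, 'k) free_algebra \<Rightarrow> (bgen list \<times> bgen list \<Rightarrow>\<^sub>0 'k)" where
  "\<theta> \<eta> p = lin psc (\<lambda>w. foldr (\<lambda>g t. \<theta>g \<eta> g \<star> t) (letters w) (D1 [] [])) p"

lemma \<theta>_linear: "\<theta> \<eta> (p + r) = \<theta> \<eta> p + \<theta> \<eta> r" "\<theta> \<eta> (p - r) = \<theta> \<eta> p - \<theta> \<eta> r" "\<theta> \<eta> (psc c p) = psc c (\<theta> \<eta> p)" "\<theta> \<eta> 0 = 0"
  by (simp_all add: \<theta>_def psc.lin_add psc.lin_diff psc.lin_psc)

lemma \<theta>_wm: "\<theta> \<eta> (wm w) = foldr (\<lambda>g t. \<theta>g \<eta> g \<star> t) w (D1 [] [])"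
  by (simp add: \<theta>_def wm_def psc.lin_single)

lemma \<theta>_mult: "\<theta> \<eta> (p * r) = \<theta> \<eta> p \<star> \<theta> \<eta> r"
proof (induction p rule: free_algebra_induct)
  case (word v)
  show ?case
  proof (induction r rule: free_algebra_induct)
    case (word w)
    have "foldr (\<lambda>g t. \<theta>g \<eta> g \<star> t) v s = foldr (\<lambda>g t. \<theta>g \<eta> g \<star> t) v (D1 [] []) \<star> s" for s
      by (induction v) (simp_all add: mul_one mul_assoc)
    from this[of "\<theta> \<eta> (wm w)"] show ?case by (simp add: \<theta>_wm flip: wm_simps(2))
  qed (simp_all add: \<theta>_linear distrib_left psc_mult_right mul_linear)
qed (simp_all add: \<theta>_linear distrib_right psc_mult_left mul_linear)

lemma \<theta>_gen: "\<theta> \<eta> (var g) = \<theta>g \<eta> g" "\<theta> \<eta> 1 = D1 [] []"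
  using \<theta>_wm[of \<eta> "[g]"] \<theta>_wm[of \<eta> "[]"] by (simp_all add: wm_simps mul_one)

lemma \<Phi>0_\<theta>:
  assumes \<eta>: "roots \<eta>"
  shows "\<Phi>0 \<eta> (\<theta> \<eta> p) \<approx> p"
proof (induction p rule: free_algebra_induct)
  case (word w)
  show ?case
  proof (induction w)
    case Nil show ?case by (simp add: wm_simps \<theta>_gen \<Phi>0_one)
  next
    case (Cons g w)
    have g: "\<Phi>0 \<eta> (\<theta>g \<eta> g) = var g"
      using rootsD(2)[OF \<eta>] sF_root(2)[OF \<eta>]
      by (cases g) (simp_all add: \<Phi>0_linear \<Phi>0_letters cA_def cH_def del: psc_single)
    have "\<Phi>0 \<eta> (\<theta>g \<eta> g \<star> \<theta> \<eta> (wm w)) \<approx> \<Phi>0 \<eta> (\<theta>g \<eta> g) * \<Phi>0 \<eta> (\<theta> \<eta> (wm w))" by (rule \<Phi>0_mult[OF \<eta>])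
    also have "\<dots> \<approx> var g * wm w" unfolding g by (rule U.eqv_left[OF Cons.IH])
    finally show ?case by (simp add: wm_simps(3) \<theta>_mult \<theta>_gen)
  qed
qed (simp_all add: \<theta>_linear \<Phi>0_linear U.eqv_add U.psc_eqv)

lemma \<theta>_E_word: "\<theta> \<eta> (wm (map eE w)) = psc (prod_list (map (scal (\<lambda>_. 1) (\<lambda>i. inverse (\<eta> i))) w)) (D1 w [])"
proof (induction w)
  case (Cons h w)
  have "\<theta>g \<eta> (eE h) = psc (scal (\<lambda>_. 1) (\<lambda>i. inverse (\<eta> i)) h) (D1 [h] [])" by (cases h) simp_all
  then show ?case
    using mul_words(2)[of "[h]" w "[]"] by (simp add: wm_simps(3) \<theta>_mult \<theta>_gen Cons mul_linear mult.commute del: psc_single)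
qed (simp add: wm_simps \<theta>_gen)

lemma \<theta>_A: "\<theta> \<eta> (A.\<iota> p) = bt (rescale (\<lambda>_. 1) (\<lambda>i. inverse (\<eta> i)) p) (Poly_Mapping.single [] 1)"
  by (induction p rule: poly_mapping_linear_induct)
    (simp_all add: \<theta>_linear A.\<iota>_simps bt_linear rescale_linear \<theta>_E_word)

text \<open>On the block of \<open>\<eta>\<close> the two copies of \<open>K\<^sub>i\<close> are proportional.\<close>

lemma K_ee:
  assumes \<eta>: "roots \<eta>"
  shows "D1 [L i] [] \<star> ee \<eta> \<doteq> psc (\<eta> i ^ 2) (D1 [] [L i] \<star> ee \<eta>)"
    and "D1 [] [L' i] \<star> ee \<eta> \<doteq> psc (\<eta> i ^ 2) (D1 [L' i] [] \<star> ee \<eta>)"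
proof -
  have "D1 [L i] [L' i, L i] \<doteq> psc 1 (D1 [L i] [])"
    by (rule eqD_right) (simp add: wm_simps U.K'K)
  then have k: "D1 [L i] [] \<doteq> z i \<star> D1 [] [L i]"
    using mul_words(1)[of "[L i]" "[L' i]" "[L i]"] eqD_sym by (simp add: z_def)
  have "D1 [L i] [] \<star> ee \<eta> \<doteq> z i \<star> D1 [] [L i] \<star> ee \<eta>" by (intro eqD_mul k eqD_refl)
  also have "\<dots> \<doteq> D1 [] [L i] \<star> z i \<star> ee \<eta>" by (intro eqD_mul centralD central_z eqD_refl)
  also have "\<dots> \<doteq> D1 [] [L i] \<star> psc (\<eta> i ^ 2) (ee \<eta>)" unfolding mul_assoc by (intro eqD_mul z_ee \<eta> eqD_refl)
  finally show "D1 [L i] [] \<star> ee \<eta> \<doteq> psc (\<eta> i ^ 2) (D1 [] [L i] \<star> ee \<eta>)" by (simp add: mul_linear)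
  have "D1 [L' i, L i] [L' i] \<doteq> psc 1 (D1 [] [L' i])"
    by (rule eqD_left) (simp add: wm_simps U.K'K)
  then have k: "D1 [] [L' i] \<doteq> D1 [L' i] [] \<star> z i"
    using mul_words(2)[of "[L' i]" "[L i]" "[L' i]"] eqD_sym by (simp add: z_def)
  have "D1 [] [L' i] \<star> ee \<eta> \<doteq> D1 [L' i] [] \<star> z i \<star> ee \<eta>" by (intro eqD_mul k eqD_refl)
  also have "\<dots> \<doteq> D1 [L' i] [] \<star> psc (\<eta> i ^ 2) (ee \<eta>)" unfolding mul_assoc by (intro eqD_mul z_ee \<eta> eqD_refl)
  finally show "D1 [] [L' i] \<star> ee \<eta> \<doteq> psc (\<eta> i ^ 2) (D1 [L' i] [] \<star> ee \<eta>)" by (simp add: mul_linear)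
qed

text \<open>The factors inverse to \<open>cH \<eta>\<close>.\<close>

definition dH :: "(idx \<Rightarrow> 'k) \<Rightarrow> bgen \<Rightarrow> 'k" where "dH \<eta> = scal (\<lambda>i. inverse (sF \<eta> i)) \<eta>"

lemma \<theta>_F_letter:
  assumes \<eta>: "roots \<eta>"
  shows "\<theta>g \<eta> (eF g) \<star> ee \<eta> \<doteq> psc (dH \<eta> g) (D1 [] [g] \<star> ee \<eta>)"
proof (cases g)
  case (X i) then show ?thesis by (simp add: dH_def mul_linear del: psc_single)
next
  case (L i)
  have "inverse (\<eta> i) * \<eta> i ^ 2 = \<eta> i" using rootsD(2)[OF \<eta>, of i] by (simp add: power2_eq_square)
  then show ?thesis using eqD_psc[OF K_ee(1)[OF \<eta>, of i], of "inverse (\<eta> i)"] L by (simp add: dH_def mul_linear del: psc_single)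
next
  case (L' i)
  have "inverse (\<eta> i) * \<eta> i ^ 2 = \<eta> i" using rootsD(2)[OF \<eta>, of i] by (simp add: power2_eq_square)
  then show ?thesis using eqD_psc[OF eqD_sym[OF K_ee(2)[OF \<eta>, of i]], of "inverse (\<eta> i)"] L' by (simp add: dH_def mul_linear del: psc_single)
qed

text \<open>Next to \<open>e\<^sub>\<eta>\<close> the letters \<open>K\<^sub>i\<close> may be taken from the right
  copy of the torus, so the lift of a word in \<open>F\<^sub>i, K\<^sub>i\<close> becomes a rescaled word of
  \<open>\<uu>\<^sup>\<le>\<^sup>0\<close>.\<close>

lemma \<theta>_F_word:
  assumes \<eta>: "roots \<eta>"
  shows "\<theta> \<eta> (wm (map eF w)) \<star> ee \<eta> \<doteq> psc (prod_list (map (dH \<eta>) w)) (D1 [] w \<star> ee \<eta>)"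
proof (induction w)
  case (Cons g w)
  let ?c = "prod_list (map (dH \<eta>) w)"
  have "\<theta> \<eta> (wm (map eF (g # w))) \<star> ee \<eta> = \<theta>g \<eta> (eF g) \<star> (\<theta> \<eta> (wm (map eF w)) \<star> ee \<eta>)"
    by (simp add: wm_simps(3) \<theta>_mult \<theta>_gen mul_assoc)
  also have "\<dots> \<doteq> \<theta>g \<eta> (eF g) \<star> psc ?c (D1 [] w \<star> ee \<eta>)" by (intro eqD_mul Cons.IH eqD_refl)
  also have "\<dots> = psc ?c (\<theta>g \<eta> (eF g) \<star> (D1 [] w \<star> ee \<eta>))" by (simp add: mul_linear)
  also have "\<dots> \<doteq> psc ?c (\<theta>g \<eta> (eF g) \<star> (ee \<eta> \<star> D1 [] w))"
    by (intro eqD_psc eqD_mul eqD_refl eqD_sym[OF centralD[OF central_ee]])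
  also have "\<dots> \<doteq> psc ?c (psc (dH \<eta> g) (D1 [] [g] \<star> ee \<eta>) \<star> D1 [] w)"
    unfolding mul_assoc[symmetric] by (intro eqD_psc eqD_mul eqD_refl \<theta>_F_letter \<eta>)
  also have "\<dots> = psc (?c * dH \<eta> g) (D1 [] [g] \<star> (ee \<eta> \<star> D1 [] w))" by (simp add: mul_linear mul_assoc)
  also have "\<dots> \<doteq> psc (?c * dH \<eta> g) (D1 [] [g] \<star> (D1 [] w \<star> ee \<eta>))"
    by (intro eqD_psc eqD_mul eqD_refl centralD[OF central_ee])
  also have "\<dots> = psc (prod_list (map (dH \<eta>) (g # w))) (D1 [] (g # w) \<star> ee \<eta>)"
    using mul_words(1)[of "[]" "[g]" w] by (simp add: mult.commute flip: mul_assoc)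
  finally show ?case .
qed (simp add: wm_simps \<theta>_gen)

lemma \<theta>_H:
  assumes \<eta>: "roots \<eta>"
  shows "\<theta> \<eta> (H.\<iota> p) \<star> ee \<eta> \<doteq> bt (Poly_Mapping.single [] 1) (rescale (\<lambda>i. inverse (sF \<eta> i)) \<eta> p) \<star> ee \<eta>"
proof (induction p rule: poly_mapping_linear_induct)
  case (single w)
  have "psc (prod_list (map (dH \<eta>) w)) (D1 [] w \<star> ee \<eta>) = psc (prod_list (map (dH \<eta>) w)) (D1 [] w) \<star> ee \<eta>"
    by (simp only: mul_linear)
  then show ?case using \<theta>_F_word[OF \<eta>, of w] by (simp add: H.\<iota>_simps rescale_linear dH_def)
qed (simp_all add: \<theta>_linear H.\<iota>_simps rescale_linear bt_linear mul_linear eqD_add eqD_psc)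

text \<open>All relations except those between \<open>E\<^sub>i\<close> and \<open>F\<^sub>j\<close> involve letters
  of one Borel part only.  They hold after lifting because rescaling preserves the relations of that Borel part; the
  remaining ones are the commutation rules of \<open>D\<close>.\<close>

lemma \<theta>_u_ideal:
  assumes \<eta>: "roots \<eta>" and p: "p \<in> u_ideal l q"
  shows "\<theta> \<eta> p \<star> ee \<eta> \<doteq> 0"
proof -
  let ?N = "{p. \<theta> \<eta> p \<star> ee \<eta> \<doteq> 0}"
  have ti: "tideal ?N"
  proof (unfold_locales, goal_cases)
    case 1 show ?case by (simp add: \<theta>_linear mul_linear)
  next
    case (2 a b) then show ?case using eqD_add[of "\<theta> \<eta> a \<star> ee \<eta>" 0 "\<theta> \<eta> b \<star> ee \<eta>" 0] by (simp add: \<theta>_linear mul_linear)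
  next
    case (3 a x)
    have "\<theta> \<eta> x \<star> (\<theta> \<eta> a \<star> ee \<eta>) \<doteq> \<theta> \<eta> x \<star> 0" using 3 by (intro eqD_mul eqD_refl) simp
    then show ?case by (simp add: \<theta>_mult mul_assoc mul_linear)
  next
    case (4 a x)
    have "\<theta> \<eta> a \<star> (\<theta> \<eta> x \<star> ee \<eta>) \<doteq> \<theta> \<eta> a \<star> (ee \<eta> \<star> \<theta> \<eta> x)" by (intro eqD_mul eqD_refl eqD_sym[OF centralD[OF central_ee]])
    also have "\<dots> \<doteq> 0 \<star> \<theta> \<eta> x" unfolding mul_assoc[symmetric] using 4 by (intro eqD_mul eqD_refl) simp
    finally show ?case by (simp add: \<theta>_mult mul_assoc mul_linear)
  qed
  have A: "p \<in> ?N" if pr: "p \<in> u_ideal l q" "p \<in> range A.\<iota>" for p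
  proof -
    obtain r where r: "p = A.\<iota> r" using pr by blast
    have "A.\<iota> (rescale (\<lambda>_. 1) (\<lambda>i. inverse (\<eta> i)) r) \<in> u_ideal l q"
      using pr r by (intro A_rescale) (simp_all add: power_inverse rootsD[OF \<eta>])
    then have "\<theta> \<eta> p \<doteq> bt 0 (Poly_Mapping.single [] 1)"
      unfolding r \<theta>_A by (intro eqD_bt) (simp_all add: A.\<iota>_simps U.zero)
    then have "\<theta> \<eta> p \<star> ee \<eta> \<doteq> 0 \<star> ee \<eta>" by (intro eqD_mul eqD_refl) (simp add: bt_linear)
    then show ?thesis by (simp add: mul_linear)
  qed
  have H: "p \<in> ?N" if pr: "p \<in> u_ideal l q" "p \<in> range H.\<iota>" for p
  proof -
    obtain r where r: "p = H.\<iota> r" using pr by blast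
    have "H.\<iota> (rescale (\<lambda>i. inverse (sF \<eta> i)) \<eta> r) \<in> u_ideal l q"
      using pr r by (intro H_rescale) (simp_all add: power_inverse rootsD[OF \<eta>] sF_root[OF \<eta>])
    then have "bt (Poly_Mapping.single [] 1) (rescale (\<lambda>i. inverse (sF \<eta> i)) \<eta> r) \<doteq> bt (Poly_Mapping.single [] 1) 0"
      by (intro eqD_bt) (simp_all add: H.\<iota>_simps U.zero)
    then have "bt (Poly_Mapping.single [] 1) (rescale (\<lambda>i. inverse (sF \<eta> i)) \<eta> r) \<star> ee \<eta> \<doteq> 0 \<star> ee \<eta>"
      by (intro eqD_mul eqD_refl) (simp add: bt_linear)
    with \<theta>_H[OF \<eta>, of r] show ?thesis unfolding r mem_Collect_eq mul_linear(3) by (rule eqD_trans)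
  qed
  have gA: "var (gE i) \<in> range A.\<iota>" "var (gK i) \<in> range A.\<iota>" "var (gK' i) \<in> range A.\<iota>" for i
    using A.range_\<iota>(6)[of "X i"] A.range_\<iota>(6)[of "L i"] A.range_\<iota>(6)[of "L' i"] by simp_all
  have gH: "var (gF i) \<in> range H.\<iota>" "var (gK i) \<in> range H.\<iota>" "var (gK' i) \<in> range H.\<iota>" for i
    using H.range_\<iota>(6)[of "X i"] H.range_\<iota>(6)[of "L i"] H.range_\<iota>(6)[of "L' i"] by simp_all
  note rA = gA A.range_\<iota>(1-5,7) and rH = gH H.range_\<iota>(1-5,7)
  have small: "small_relations l q \<subseteq> ?N"
  proof
    fix p assume p: "p \<in> small_relations l q"
    then consider i where "p = var (gE i) ^ l" | "p = fE12 q ^ l" | i where "p = var (gF i) ^ l" | "p = fF12 q ^ l" | i where "p = var (gK i) ^ l - 1"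
      unfolding small_relations_def by blast
    then have "p \<in> range A.\<iota> \<or> p \<in> range H.\<iota>"
      unfolding fE12_def fF12_def by cases (simp_all only: rA rH simp_thms)
    then show "p \<in> ?N" using A H small_relations_in_ideal[OF p] by blast
  qed
  have EF1_N: "var (gE I1) * var (gF I1) - var (gF I1) * var (gE I1) - psc (1 / (q - inverse q)) (var (gK I1) - var (gK' I1)) \<in> ?N"
  proof -
    have e: "\<eta> I1 \<noteq> 0" using rootsD(2)[OF \<eta>] .
    define c where "c = inverse (sF \<eta> I1) * p11"
    have c1: "1 / (q - inverse q) * inverse (\<eta> I1) = c" "1 / (q - inverse q) * \<eta> I1 = c * \<eta> I1 ^ 2"
      using e q0 unfolding c_def p11_eq[symmetric] by (simp_all add: sF_def power2_eq_square field_simps)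
    have "\<theta> \<eta> (var (gE I1) * var (gF I1) - var (gF I1) * var (gE I1)) = psc c (D1 [L I1] [] - D1 [] [L' I1])"
      using mul_words(3)[of "[X I1]" "[X I1]"]
      by (simp add: \<theta>_linear \<theta>_mult \<theta>_gen mul_linear letters_commute c_def psc.scale_right_diff_distrib psc.scale_right_distrib mult_ac del: psc_single)
    moreover have "\<theta> \<eta> (psc (1 / (q - inverse q)) (var (gK I1) - var (gK' I1))) = psc c (D1 [L I1] []) - psc (c * \<eta> I1 ^ 2) (D1 [L' I1] [])"
      by (simp only: \<theta>_linear \<theta>_gen \<theta>g.simps psc.scale_right_diff_distrib psc.scale_scale c1)
    ultimately have "\<theta> \<eta> (var (gE I1) * var (gF I1) - var (gF I1) * var (gE I1) - psc (1 / (q - inverse q)) (var (gK I1) - var (gK' I1))) \<star> ee \<eta>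
        = psc c (psc (\<eta> I1 ^ 2) (D1 [L' I1] [] \<star> ee \<eta>) - D1 [] [L' I1] \<star> ee \<eta>)"
      by (simp add: \<theta>_linear(2) mul_linear psc.scale_right_diff_distrib del: psc_single)
    also have "\<dots> \<doteq> psc c (psc (\<eta> I1 ^ 2) (D1 [L' I1] [] \<star> ee \<eta>) - psc (\<eta> I1 ^ 2) (D1 [L' I1] [] \<star> ee \<eta>))"
      by (intro eqD_psc eqD_diff eqD_refl K_ee(2) \<eta>)
    finally show ?thesis by simp
  qed
  have U: "U_relations q \<subseteq> ?N"
  proof
    fix p assume p: "p \<in> U_relations q"
    then have "p \<in> range A.\<iota> \<or> p \<in> range H.\<iota> \<or> p \<in> ?N"
    proof (cases rule: U_relationsE)
      case EF1 then show ?thesis using EF1_N by blast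
    next
      case (EF i j)
      then have "\<theta> \<eta> p = 0"
        using mul_words(3)[of "[X i]" "[X j]"]
        by (auto simp: \<theta>_linear \<theta>_mult \<theta>_gen mul_linear letters_commute simp del: psc_single)
      then show ?thesis by (simp add: mul_linear)
    qed (simp_all only: serre_def rA rH simp_thms)
    then show "p \<in> ?N" using A H U.rel p by blast
  qed
  have "p \<in> ?N" using ti U small p by (rule u_ideal_minimal)
  then show ?thesis by simp
qed

lemma \<theta>_\<Phi>0:
  assumes \<eta>: "roots \<eta>"
  shows "\<theta> \<eta> (\<Phi>0 \<eta> s) \<star> ee \<eta> \<doteq> s \<star> ee \<eta>"
proof (induction s rule: poly_mapping_linear_induct)
  case (single s)
  obtain a x where s: "s = (a, x)" by (cases s)
  let ?b = "\<lambda>a. prod_list (map (scal (\<lambda>_. 1) (\<lambda>i. inverse (\<eta> i))) a)"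
  have ca: "prod_list (map (cA \<eta>) a) * ?b a = 1"
  proof (induction a)
    case (Cons h a)
    have "cA \<eta> h * scal (\<lambda>_. 1) (\<lambda>i. inverse (\<eta> i)) h = 1" using rootsD(2)[OF \<eta>] by (cases h) (simp_all add: cA_def)
    then have "(cA \<eta> h * scal (\<lambda>_. 1) (\<lambda>i. inverse (\<eta> i)) h) * (prod_list (map (cA \<eta>) a) * ?b a) = 1" using Cons by simp
    then show ?case by (simp add: mult_ac)
  qed simp
  have ch: "prod_list (map (cH \<eta>) x) * prod_list (map (dH \<eta>) x) = 1"
  proof (induction x)
    case (Cons h a)
    have "cH \<eta> h * dH \<eta> h = 1" using rootsD(2)[OF \<eta>] sF_root(2)[OF \<eta>] by (cases h) (simp_all add: cH_def dH_def)
    then have "(cH \<eta> h * dH \<eta> h) * (prod_list (map (cH \<eta>) a) * prod_list (map (dH \<eta>) a)) = 1" using Cons by simp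
    then show ?case by (simp add: mult_ac)
  qed simp
  let ?c = "prod_list (map (cA \<eta>) a) * prod_list (map (cH \<eta>) x)"
  have "\<theta> \<eta> (\<Phi>0 \<eta> (D1 a x)) \<star> ee \<eta> = psc (?c * ?b a) (D1 a [] \<star> (\<theta> \<eta> (wm (map eF x)) \<star> ee \<eta>))"
    unfolding \<Phi>0_word \<theta>_linear \<theta>_mult \<theta>_E_word by (simp add: mul_linear mul_assoc del: psc_single)
  also have "\<dots> \<doteq> psc (?c * ?b a) (D1 a [] \<star> psc (prod_list (map (dH \<eta>) x)) (D1 [] x \<star> ee \<eta>))"
    by (intro eqD_psc eqD_mul eqD_refl \<theta>_F_word \<eta>)
  also have "\<dots> = psc ((prod_list (map (cA \<eta>) a) * ?b a) * (prod_list (map (cH \<eta>) x) * prod_list (map (dH \<eta>) x))) (D1 a [] \<star> (D1 [] x \<star> ee \<eta>))"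
    by (simp add: mul_linear mult_ac del: psc_single)
  also have "\<dots> = D1 a x \<star> ee \<eta>"
    unfolding ca ch by (simp add: mul_words(3)[of a x] flip: mul_assoc)
  finally show ?case by (simp add: s)
qed (simp_all add: \<theta>_linear \<Phi>0_linear mul_linear eqD_add eqD_psc)

end

subsection \<open>The idempotents separate the blocks\<close>

context pairing_setup
begin

definition pr :: "'k \<times> 'k \<Rightarrow> idx \<Rightarrow> 'k" where "pr ab i = (if i = I1 then fst ab else snd ab)"

lemma roots_pr: "ab \<in> roots_of_unity l \<times> roots_of_unity l \<Longrightarrow> roots (pr ab)"
  by (auto simp: roots_def pr_def roots_of_unity_def)

lemma q_inj: "inj_on (\<lambda>j. q ^ j) {..<l}"
proof -
  have "q ^ m \<noteq> q ^ n" if "m < n" "n < l" for m n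
  proof
    assume "q ^ m = q ^ n"
    moreover have "q ^ n = q ^ m * q ^ (n - m)" using that by (simp flip: power_add)
    ultimately have "q ^ (n - m) = 1" using q0 by simp
    then show False using prim that by (auto simp: primitive_root_of_unity_def)
  qed
  then show ?thesis by (auto simp: inj_on_def) (metis linorder_neqE_nat)
qed

text \<open>The powers of \<open>q\<close> are \<open>l\<close> distinct roots of a polynomial of degree
  \<open>l\<close>.\<close>

lemma roots_powers: "roots_of_unity l = (\<lambda>j. q ^ j) ` {..<l}"
proof -
  let ?p = "monom 1 l - 1 :: 'k poly"
  have deg: "degree ?p \<le> l" using degree_diff_le_max[of "monom (1::'k) l" 1] by (simp add: degree_monom_eq)
  have "coeff ?p l = 1" using l3 by simp
  then have p0: "?p \<noteq> 0" by (metis coeff_0 zero_neq_one)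
  have r: "roots_of_unity l = {x. poly ?p x = 0}"
    by (simp add: roots_of_unity_def poly_monom)
  have fin: "finite (roots_of_unity l :: 'k set)" unfolding r by (rule poly_roots_finite[OF p0])
  have "card (roots_of_unity l :: 'k set) \<le> l"
    unfolding r using card_poly_roots_bound[OF p0] deg by linarith
  moreover have sub: "(\<lambda>j. q ^ j) ` {..<l} \<subseteq> roots_of_unity l"
  proof -
    have "(q ^ j) ^ l = 1" for j by (simp add: mult.commute[of j] ql flip: power_mult) (simp add: power_mult ql)
    then show ?thesis by (auto simp: roots_of_unity_def)
  qed
  moreover have "card ((\<lambda>j. q ^ j) ` {..<l}) = l" by (simp add: card_image q_inj)
  ultimately show ?thesis using card_seteq[OF fin sub] by simp
qed

lemma finite_roots: "finite (roots_of_unity l :: 'k set)"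
  by (simp add: roots_powers)

lemma sum_powers: "c ^ l = 1 \<Longrightarrow> c \<noteq> 1 \<Longrightarrow> (\<Sum>m<l. c ^ m) = (0::'k)"
  using geometric_sum[of c l] by simp

lemma sum_roots: "m < l \<Longrightarrow> (\<Sum>c\<in>roots_of_unity l. c ^ m) = (if m = 0 then of_nat l else 0 :: 'k)"
proof -
  assume m: "m < l"
  have "(\<Sum>c\<in>roots_of_unity l. c ^ m) = (\<Sum>j<l. (q ^ j) ^ m)"
    unfolding roots_powers by (simp add: sum.reindex[OF q_inj])
  also have "\<dots> = (\<Sum>j<l. (q ^ m) ^ j)" by (simp add: mult.commute flip: power_mult)
  also have "\<dots> = (if m = 0 then of_nat l else 0)"
  proof (cases "m = 0")
    case False
    then have "q ^ m \<noteq> 1" using m prim by (auto simp: primitive_root_of_unity_def)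
    moreover have "(q ^ m) ^ l = 1" using ql by (metis mult.commute power_mult power_one)
    ultimately show ?thesis using False sum_powers by simp
  qed simp
  finally show ?thesis .
qed

text \<open>Here \<open>l\<close> odd is used: with \<open>l = 2 n + 1\<close>, an \<open>l\<close>-th root of unity
  \<open>x\<close> is the inverse of \<open>(x\<^sup>2)\<^sup>n\<close>.\<close>

lemma square_root_inj: "x ^ l = 1 \<Longrightarrow> y ^ l = 1 \<Longrightarrow> x ^ 2 = y ^ 2 \<Longrightarrow> x = (y::'k)"
proof -
  assume xy: "x ^ l = 1" "y ^ l = 1" "x ^ 2 = y ^ 2"
  obtain n where n: "l = 2 * n + 1" using oddl by (elim oddE)
  have e: "t ^ l = (t ^ 2) ^ n * t" for t :: 'k by (simp only: n power_add power_mult power_one_right)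
  have "(x ^ 2) ^ n * x = (y ^ 2) ^ n * y" using xy(1,2) by (simp only: e)
  moreover have "y \<noteq> 0" using xy(2) l3 by (auto simp: power_0_left)
  ultimately show ?thesis using xy(3) by simp
qed

lemma inverse_square_bij: "bij_betw (\<lambda>x. inverse x ^ 2) (roots_of_unity l) (roots_of_unity l :: 'k set)"
proof -
  have inj: "inj_on (\<lambda>x. inverse x ^ 2) (roots_of_unity l :: 'k set)"
  proof (rule inj_onI)
    fix x y :: 'k assume "x \<in> roots_of_unity l" "y \<in> roots_of_unity l" "inverse x ^ 2 = inverse y ^ 2"
    then show "x = y" using square_root_inj[of x y] by (simp add: roots_of_unity_def power_inverse)
  qed
  moreover have sub: "(\<lambda>x. inverse x ^ 2) ` roots_of_unity l \<subseteq> (roots_of_unity l :: 'k set)"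
  proof -
    have "(inverse x ^ 2) ^ l = (inverse x ^ l) ^ 2" for x :: 'k by (metis power_mult mult.commute)
    then show ?thesis by (auto simp: roots_of_unity_def power_inverse)
  qed
  ultimately show ?thesis using endo_inj_surj[OF finite_roots sub] by (simp add: bij_betw_def)
qed

end

locale pairing_char_0 = pairing_setup l q \<phi> for l and q :: "'k::field_char_0" and \<phi>
begin

lemma l_nz: "(of_nat l :: 'k) \<noteq> 0" using l3 by simp

lemma sum_ei: "(\<Sum>c\<in>roots_of_unity l. ei i c) = D1 [] []"
proof -
  have "(\<Sum>c\<in>roots_of_unity l. ei i c) = psc (1 / of_nat l) (\<Sum>m<l. \<Sum>c\<in>roots_of_unity l. psc (c ^ m) (zp i m))"
    by (simp add: ei_def psc.scale_sum_right sum.swap[of _ "{..<l}"])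
  also have "(\<Sum>m<l. \<Sum>c\<in>roots_of_unity l. psc (c ^ m) (zp i m)) = (\<Sum>m<l. if m = 0 then psc (of_nat l) (zp i 0) else 0)"
    by (rule sum.cong) (simp_all add: sum_roots flip: psc.scale_sum_left)
  also have "\<dots> = psc (of_nat l) (D1 [] [])" using l3 by (simp add: sum.delta)
  finally show ?thesis using l_nz by simp
qed

lemma sum_ee: "(\<Sum>ab\<in>roots_of_unity l \<times> roots_of_unity l. ee (pr ab)) = D1 [] []"
proof -
  have s: "(\<Sum>a\<in>roots_of_unity l. ei i (inverse a ^ 2)) = D1 [] []" for i
    using sum.reindex_bij_betw[OF inverse_square_bij, of "ei i"] by (simp add: sum_ei)
  have "(\<Sum>ab\<in>roots_of_unity l \<times> roots_of_unity l. ee (pr ab))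
      = (\<Sum>a\<in>roots_of_unity l. \<Sum>b\<in>roots_of_unity l. ei I1 (inverse a ^ 2) \<star> ei I2 (inverse b ^ 2))"
    by (simp add: ee_def pr_def sum.cartesian_product case_prod_unfold)
  also have "\<dots> = (\<Sum>a\<in>roots_of_unity l. ei I1 (inverse a ^ 2)) \<star> (\<Sum>b\<in>roots_of_unity l. ei I2 (inverse b ^ 2))"
    by (subst mul_sum(1)) (simp only: mul_sum(2))
  also have "\<dots> = D1 [] []" unfolding s by (rule mul_one)
  finally show ?thesis .
qed

lemma \<Phi>0_zp:
  assumes \<eta>: "roots \<eta>"
  shows "\<Phi>0 \<eta> (zp i m) \<approx> psc ((\<eta> i ^ 2) ^ m) 1"
proof (induction m)
  case 0 show ?case by (simp add: \<Phi>0_one)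
next
  case (Suc m)
  have "\<Phi>0 \<eta> (z i) = psc (\<eta> i ^ 2) (var (gK i) * var (gK' i))"
    by (simp add: z_def \<Phi>0_letters cA_def cH_def power2_eq_square)
  also have "\<dots> \<approx> psc (\<eta> i ^ 2) 1" by (rule U.psc_eqv[OF U.KK'])
  finally have z: "\<Phi>0 \<eta> (z i) \<approx> psc (\<eta> i ^ 2) 1" .
  have "\<Phi>0 \<eta> (z i \<star> zp i m) \<approx> \<Phi>0 \<eta> (z i) * \<Phi>0 \<eta> (zp i m)" by (rule \<Phi>0_mult[OF \<eta>])
  also have "\<dots> \<approx> psc (\<eta> i ^ 2) 1 * psc ((\<eta> i ^ 2) ^ m) 1" by (rule U.eqv_mult[OF z Suc.IH])
  finally show ?case by (simp add: psc_mult_left)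
qed

lemma \<Phi>0_ei:
  assumes \<eta>: "roots \<eta>" and c: "c ^ l = 1"
  shows "\<Phi>0 \<eta> (ei i c) \<approx> (if c * \<eta> i ^ 2 = 1 then 1 else 0)"
proof -
  have "\<Phi>0 \<eta> (ei i c) = psc (1 / of_nat l) (\<Sum>m<l. psc (c ^ m) (\<Phi>0 \<eta> (zp i m)))"
    by (simp add: ei_def \<Phi>0_linear)
  also have "\<dots> \<approx> psc (1 / of_nat l) (\<Sum>m<l. psc (c ^ m) (psc ((\<eta> i ^ 2) ^ m) 1))"
    by (intro U.psc_eqv U.eqv_sum \<Phi>0_zp \<eta>)
  also have "\<dots> = psc (1 / of_nat l * (\<Sum>m<l. (c * \<eta> i ^ 2) ^ m)) 1"
    by (simp add: power_mult_distrib flip: psc.scale_sum_left)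
  also have "\<dots> = (if c * \<eta> i ^ 2 = 1 then 1 else 0)"
  proof (cases "c * \<eta> i ^ 2 = 1")
    case True
    then show ?thesis using l_nz by simp
  next
    case False
    have "(c * \<eta> i ^ 2) ^ l = 1"
    proof -
      have "(\<eta> i ^ 2) ^ l = (\<eta> i ^ l) ^ 2" by (metis power_mult mult.commute)
      then show ?thesis by (simp add: power_mult_distrib c rootsD(1)[OF \<eta>])
    qed
    then show ?thesis using False sum_powers by simp
  qed
  finally show ?thesis .
qed

lemma \<Phi>0_ee:
  assumes \<eta>: "roots \<eta>" and \<eta>': "roots \<eta>'"
  shows "\<Phi>0 \<eta>' (ee \<eta>) \<approx> (if \<eta>' = \<eta> then 1 else 0)"
proof -
  have c: "(inverse (\<eta> i) ^ 2) ^ l = 1" for i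
    using rootsD(1)[OF \<eta>, of i] by (metis power_inverse inverse_1 mult.commute power_mult power_one)
  have e: "inverse (\<eta> i) ^ 2 * \<eta>' i ^ 2 = 1 \<longleftrightarrow> \<eta>' i = \<eta> i" for i
  proof -
    have "inverse (\<eta> i) ^ 2 * \<eta>' i ^ 2 = 1 \<longleftrightarrow> \<eta>' i ^ 2 = \<eta> i ^ 2"
      using rootsD(2)[OF \<eta>, of i] by (auto simp: field_simps)
    also have "\<dots> \<longleftrightarrow> \<eta>' i = \<eta> i"
      using square_root_inj[of "\<eta>' i" "\<eta> i"] rootsD(1)[OF \<eta>] rootsD(1)[OF \<eta>'] by auto
    finally show ?thesis .
  qed
  have "\<Phi>0 \<eta>' (ee \<eta>) \<approx> \<Phi>0 \<eta>' (ei I1 (inverse (\<eta> I1) ^ 2)) * \<Phi>0 \<eta>' (ei I2 (inverse (\<eta> I2) ^ 2))"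
    unfolding ee_def by (rule \<Phi>0_mult[OF \<eta>'])
  also have "\<dots> \<approx> (if \<eta>' I1 = \<eta> I1 then 1 else 0) * (if \<eta>' I2 = \<eta> I2 then 1 else 0)"
    using U.eqv_mult[OF \<Phi>0_ei[OF \<eta>' c[of I1], of I1] \<Phi>0_ei[OF \<eta>' c[of I2], of I2]] unfolding e .
  also have "\<dots> = (if \<eta>' = \<eta> then 1 else 0)"
  proof -
    have "\<eta>' = \<eta> \<longleftrightarrow> \<eta>' I1 = \<eta> I1 \<and> \<eta>' I2 = \<eta> I2" by (metis (full_types) ext idx.exhaust)
    then show ?thesis by simp
  qed
  finally show ?thesis .
qed

text \<open>If all \<open>\<Phi>\<^sub>\<eta>(s)\<close> vanish, then \<open>s e\<^sub>\<eta> =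
  \<theta>\<^sub>\<eta>(\<Phi>\<^sub>\<eta>(s)) e\<^sub>\<eta> = 0\<close> for all \<open>\<eta>\<close>, and the
  \<open>e\<^sub>\<eta>\<close> sum to \<open>1\<close>.  The element \<open>\<theta>\<^sub>\<eta>(p)
  e\<^sub>\<eta>\<close> is sent to \<open>p\<close> by \<open>\<Phi>\<^sub>\<eta>\<close> and to \<open>0\<close> by
  the other projections.\<close>

lemma ring_product_D:
  assumes "infinite (UNIV :: 'v set)"
  shows "ring_product TYPE('v) D (small_u l q) (roots_of_unity l \<times> roots_of_unity l) (\<lambda>ab. \<Phi> (pr ab))"
proof (rule ring_product.intro)
  note r = roots_pr
  show "ring D" by (rule ring_D)
  show "ring (small_u l q)" by (rule A.u.ring)
  show "finite (roots_of_unity l \<times> roots_of_unity l :: ('k \<times> 'k) set)" using finite_roots by blast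
  show "\<Phi> (pr ab) \<in> ring_hom D (small_u l q)" if "ab \<in> roots_of_unity l \<times> roots_of_unity l" for ab
    using that by (intro \<Phi>_ring_hom r)
  show "infinite (UNIV :: 'v set)" by (rule assms)
  fix d assume "d \<in> carrier D" and z: "\<And>ab. ab \<in> roots_of_unity l \<times> roots_of_unity l \<Longrightarrow> \<Phi> (pr ab) d = \<zero>\<^bsub>small_u l q\<^esub>"
  then obtain s where s: "d = AH.\<tau> s" by (auto simp: D_simps elim!: AH.T.\<pi>_E)
  have block: "s \<star> ee (pr ab) \<doteq> 0" if ab: "ab \<in> roots_of_unity l \<times> roots_of_unity l" for ab
  proof -
    have "\<Phi>0 (pr ab) s \<in> u_ideal l q"
      using z[OF ab] by (simp add: s \<Phi>_\<tau>[OF r[OF ab]] pi_u_zero_iff)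
    then show ?thesis
      using eqD_trans[OF eqD_sym[OF \<theta>_\<Phi>0[OF r[OF ab]]] \<theta>_u_ideal[OF r[OF ab]]] by blast
  qed
  have "(\<Sum>ab\<in>roots_of_unity l \<times> roots_of_unity l. s \<star> ee (pr ab)) \<doteq> (\<Sum>ab\<in>(roots_of_unity l \<times> roots_of_unity l :: ('k \<times> 'k) set). 0)"
    by (rule eqD_sum) (rule block)
  then have "s \<doteq> 0" by (simp add: sum_ee mul_one flip: mul_sum)
  then show "d = \<zero>\<^bsub>D\<^esub>" by (simp add: eqD_def s D_simps AH.T.\<pi>_zero)
next
  note r = roots_pr
  fix ab :: "'k \<times> 'k" and u :: "'k u_elem" assume ab: "ab \<in> roots_of_unity l \<times> roots_of_unity l" and "u \<in> carrier (small_u l q)"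
  then obtain p where p: "u = pi_u l q p" by (auto elim!: A.u.\<pi>_E)
  let ?s = "\<theta> (pr ab) p \<star> ee (pr ab)"
  have \<Phi>s: "\<Phi>0 (pr cd) ?s \<approx> \<Phi>0 (pr cd) (\<theta> (pr ab) p) * (if cd = ab then 1 else 0)"
    if cd: "cd \<in> roots_of_unity l \<times> roots_of_unity l" for cd :: "'k \<times> 'k"
  proof -
    have eq: "pr cd = pr ab \<longleftrightarrow> cd = ab"
      by (auto simp: pr_def fun_eq_iff prod_eq_iff split: if_splits)
    have "\<Phi>0 (pr cd) ?s \<approx> \<Phi>0 (pr cd) (\<theta> (pr ab) p) * \<Phi>0 (pr cd) (ee (pr ab))" by (rule \<Phi>0_mult[OF r[OF cd]])
    also have "\<dots> \<approx> \<Phi>0 (pr cd) (\<theta> (pr ab) p) * (if cd = ab then 1 else 0)"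
      using U.eqv_left[OF \<Phi>0_ee[OF r[OF ab] r[OF cd]]] unfolding eq .
    finally show ?thesis .
  qed
  show "\<exists>d\<in>carrier D. \<Phi> (pr ab) d = u \<and> (\<forall>cd\<in>roots_of_unity l \<times> roots_of_unity l - {ab}. \<Phi> (pr cd) d = \<zero>\<^bsub>small_u l q\<^esub>)"
  proof (intro bexI[of _ "AH.\<tau> ?s"] conjI ballI)
    show "AH.\<tau> ?s \<in> carrier D" by (simp add: D_simps)
    have "\<Phi>0 (pr ab) ?s \<approx> p" using U.eqv_trans[OF \<Phi>s[OF ab]] \<Phi>0_\<theta>[OF r[OF ab], of p] by simp
    then show "\<Phi> (pr ab) (AH.\<tau> ?s) = u" by (simp add: \<Phi>_\<tau>[OF r[OF ab]] p pi_u_eq_iff U.eqv_def)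
    fix cd assume "cd \<in> roots_of_unity l \<times> roots_of_unity l - {ab}"
    then have "cd \<in> roots_of_unity l \<times> roots_of_unity l" "cd \<noteq> ab" by auto
    then show "\<Phi> (pr cd) (AH.\<tau> ?s) = \<zero>\<^bsub>small_u l q\<^esub>"
      using \<Phi>s[of cd] by (simp add: \<Phi>_\<tau>[OF r] pi_u_zero_iff U.eqv_0)
  qed
qed

end

theorem theorem3p9:
  fixes l :: nat
    and q :: "'k :: {alg_closed_field, field_char_0}"
    and \<phi> :: "'k u_elem \<Rightarrow> 'k u_elem \<Rightarrow> 'k"
  assumes "l \<ge> 3" and "odd l"
    and "primitive_root_of_unity l q"
    and "is_borel_pairing l q \<phi>"
    and "infinite (UNIV :: 'v set)"
  shows "equivalent_categories
    (left_module_category TYPE('v) (double_crossproduct (u_ge0 l q) (u_le0 l q) \<phi>))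
    (product_category (roots_of_unity l \<times> roots_of_unity l)
      (\<lambda>_ :: 'k \<times> 'k. left_module_category TYPE('v) (small_u l q)))"
proof -
  interpret pairing_char_0 l q \<phi>
    by unfold_locales (fact assms)+
  interpret ring_product D "small_u l q" "roots_of_unity l \<times> roots_of_unity l" "\<lambda>ab. \<Phi> (pr ab)" "TYPE('v)"
    by (rule ring_product_D[OF assms(5)])
  show ?thesis unfolding ge0_eq le0_eq by (rule equivalent)
qed

end
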